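(* Let $\Theta$ be a compact subset of $\Theta(2)$, let $\theta_0\in\Theta$, and let $X$ be the stationary solution to the TARCH($\infty$) equations $$X_t=\sigma_t\xi_t,\qquad \sigma_t=b_0(\theta_0)+\sum_{j=1}^\infty\Big[b_j^+(\theta_0)\max(X_{t-j},0)-b_j^-(\theta_0)\min(X_{t-j},0)\Big],\quad t\in\mathbb Z.$$ Assume that for all $\theta\in\Theta$, $H_\theta^t=H_{\theta_0}^t$ a.s. implies $\theta=\theta_0$. Assume that $\inf_{\theta\in\Theta}b_0(\theta)>0$ and $$\sup_{\theta\in\Theta}\max\big(b_j^-(\theta),b_j^+(\theta)\big)=O(j^{-\ell})\quad\text{for some }\ell>3/2.$$ Then the QMLE $\widehat\theta_n$ is strongly consistent: $\widehat\theta_n\to\theta_0$ a.s. Moreover, if $\theta_0\in\overset{\circ}{\Theta}$ with $\overset{\circ}{\Theta}\subset\Theta(4)$, assume that the functions $\theta\mapsto b_0(\theta)$, $\theta\mapsto b_j^+(\theta)$ and $\theta\mapsto b_j^-(\theta)$ are twice continuously differentiable on $\Theta$ and satisfy, for all $(k,k')\in\{1,\ldots,d\}^2$, $$\sup_{\theta\in\Theta}\max\Big(\Big|\frac{\partial b_j^+(\theta)}{\partial\theta_k}\Big|,\Big|\frac{\partial b_j^-(\theta)}{\partial\theta_k}\Big|\Big)=O(j^{-\ell'})\ \text{for some }\ell'>3/2,\qquad \sum_{j\ge1}\sup_{\theta\in\Theta}\max\Big(\Big|\frac{\partial^2b_j^+(\theta)}{\partial\theta_k\partial\theta_{k'}}\Big|,\Big|\frac{\partial^2b_j^-(\theta)}{\partial\theta_k\partial\theta_{k'}}\Big|\Big)<\infty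 .$$ If the family $(\partial H_{\theta_0}^t/\partial\theta_i)_{1\le i\le d}$ is a.e. linearly independent, then $\widehat\theta_n$ is also asymptotically normal: $$\sqrt n(\widehat\theta_n-\theta_0)\xrightarrow[n\to\infty]{\mathcal D}\mathcal N_d\big(0,F(\theta_0)^{-1}G(\theta_0)F(\theta_0)^{-1}\big).$$
   Context: $(\xi_t)_{t\in\mathbb Z}$ are i.i.d. real random variables with $E[\xi_0^2]=\mathrm{Var}(\xi_0)=1$ (hence mean zero). For $\theta\in\mathbb R^d$, $b_0(\theta)$, $b_j^+(\theta)$, $b_j^-(\theta)$ ($j\ge1$) are non-negative real numbers, continuous in $\theta$ on $\Theta$. $\overset{\circ}{\Theta}$ is the interior of $\Theta$. For $r$ with $E|\xi_0|^r<\infty$, $$\Theta(r)=\Big\{\theta\in\mathbb R^d:\ \sum_{j=1}^\infty\max\big(b_j^-(\theta),b_j^+(\theta)\big)<\big(E|\xi_0|^r\big)^{-1/r}\Big\};$$ use of $\Theta(4)$ presupposes $E\xi_0^4<\infty$. The stationary solution $X$ is the causal ($X_t$ independent of $(\xi_i)_{i>t}$), stationary ergodic solution with $E|X_0|^r<\infty$ ($r=2$ for the first part, $r=4$ for the second). For a real sequence $x=(x_j)_{j\ge1}$ put $M_\theta(x)=b_0(\theta)+\sum_{j\ge1}[b_j^+(\theta)\max(x_j,0)-b_j^-(\theta)\min(x_j,0)]$ and $H_\theta(x)=M_\theta(x)^2$. Let $H_\theta^t=H_\theta(X_{t-1},X_{t-2},\ldots)$, with derivatives $\partial H_\theta^t/\partial\theta=(\partial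 H_\theta/\partial\theta)(X_{t-1},\ldots)$, and $q_t(\theta)=X_t^2/H_\theta^t+\log H_\theta^t$. QMLE: fix a real sequence $u$ with finitely many non-zero terms, let $\widehat H_\theta^t=H_\theta(X_{t-1},\ldots,X_1,u)$, $\widehat L_n(\theta)=-\frac12\sum_{t=1}^n[X_t^2/\widehat H_\theta^t+\log\widehat H_\theta^t]$ and $\widehat\theta_n=\operatorname{Argmax}_{\theta\in\Theta}\widehat L_n(\theta)$. The $d\times d$ matrices are $F(\theta_0)_{ij}=E[\partial^2q_0(\theta_0)/\partial\theta_i\partial\theta_j]$ and $G(\theta_0)_{ij}=E[(\partial q_0(\theta_0)/\partial\theta_i)(\partial q_0(\theta_0)/\partial\theta_j)]$. *)

theory Defs
  imports "HOL-Probability.Probability" "HOL-Library.Landau_Symbols"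
begin

definition iid_process :: "'a measure \<Rightarrow> (int \<Rightarrow> 'a \<Rightarrow> real) \<Rightarrow> bool" where
  "iid_process M \<xi> \<longleftrightarrow>
     prob_space.indep_vars M (\<lambda>_. borel) \<xi> UNIV \<and>
     (\<forall>t. distr M borel (\<xi> t) = distr M borel (\<xi> 0))"

abbreviation path_space :: "(int \<Rightarrow> real) measure" where
  "path_space \<equiv> Pi\<^sub>M UNIV (\<lambda>_. borel)"

definition stationary :: "'a measure \<Rightarrow> (int \<Rightarrow> 'a \<Rightarrow> real) \<Rightarrow> bool" where
  "stationary M X \<longleftrightarrow>
     (\<forall>h. distr M path_space (\<lambda>\<omega> t. X (t + h) \<omega>) = distr M path_space (\<lambda>\<omega> t. X t \<omega>))"

definition ergodic :: "'a measure \<Rightarrow> (int \<Rightarrow> 'a \<Rightarrow> real) \<Rightarrow> bool" where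
  "ergodic M X \<longleftrightarrow>
     (\<forall>A \<in> sets path_space. {x. (\<lambda>t. x (t + 1)) \<in> A} = A \<longrightarrow>
        measure (distr M path_space (\<lambda>\<omega> t. X t \<omega>)) A \<in> {0, 1})"

text \<open>Each \<open>X t\<close> is independent of the family of all later innovations. The singleton index set
  is only there because \<^const>\<open>prob_space.indep_var\<close> wants both variables to have the same type.\<close>

definition causal :: "'a measure \<Rightarrow> (int \<Rightarrow> 'a \<Rightarrow> real) \<Rightarrow> (int \<Rightarrow> 'a \<Rightarrow> real) \<Rightarrow> bool" where
  "causal M \<xi> X \<longleftrightarrow>
     (\<forall>t. prob_space.indep_var M
            (Pi\<^sub>M {t} (\<lambda>_. borel)) (\<lambda>\<omega>. \<lambda>i\<in>{t}. X i \<omega>)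
            (Pi\<^sub>M {t<..} (\<lambda>_. borel)) (\<lambda>\<omega>. \<lambda>i\<in>{t<..}. \<xi> i \<omega>))"

text \<open>Sequences \<open>(x\<^sub>j)\<close> and coefficients \<open>b\<^sub>j\<close>, indexed by \<open>j \<ge> 1\<close>, are functions on \<^typ>\<open>nat\<close> whose
  value at \<open>0\<close> is never used.\<close>

definition tarch_M ::
  "('p \<Rightarrow> real) \<Rightarrow> (nat \<Rightarrow> 'p \<Rightarrow> real) \<Rightarrow> (nat \<Rightarrow> 'p \<Rightarrow> real) \<Rightarrow> 'p \<Rightarrow> (nat \<Rightarrow> real) \<Rightarrow> real" where
  "tarch_M b0 bp bm \<theta> x =
     b0 \<theta> + (\<Sum>j. bp (Suc j) \<theta> * max (x (Suc j)) 0 - bm (Suc j) \<theta> * min (x (Suc j)) 0)"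

definition tarch_H ::
  "('p \<Rightarrow> real) \<Rightarrow> (nat \<Rightarrow> 'p \<Rightarrow> real) \<Rightarrow> (nat \<Rightarrow> 'p \<Rightarrow> real) \<Rightarrow> 'p \<Rightarrow> (nat \<Rightarrow> real) \<Rightarrow> real" where
  "tarch_H b0 bp bm \<theta> x = (tarch_M b0 bp bm \<theta> x)\<^sup>2"

definition past :: "(int \<Rightarrow> 'a \<Rightarrow> real) \<Rightarrow> int \<Rightarrow> 'a \<Rightarrow> nat \<Rightarrow> real" where
  "past X t \<omega> = (\<lambda>j. X (t - int j) \<omega>)"

text \<open>The set \<open>\<Theta>(r)\<close>; meaningful when \<open>\<bar>\<xi>\<^sub>0\<bar>\<^sup>r\<close> is integrable.\<close>

definition Theta_r ::
  "'a measure \<Rightarrow> (int \<Rightarrow> 'a \<Rightarrow> real) \<Rightarrow> (nat \<Rightarrow> 'p \<Rightarrow> real) \<Rightarrow> (nat \<Rightarrow> 'p \<Rightarrow> real) \<Rightarrow> real \<Rightarrow> 'p set" where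
  "Theta_r M \<xi> bp bm r =
     {\<theta>. summable (\<lambda>j. max (bm (Suc j) \<theta>) (bp (Suc j) \<theta>)) \<and>
         (\<Sum>j. max (bm (Suc j) \<theta>) (bp (Suc j) \<theta>)) <
           (\<integral>\<omega>. \<bar>\<xi> 0 \<omega>\<bar> powr r \<partial>M) powr (- 1 / r)}"

definition stationary_solution ::
  "'a measure \<Rightarrow> (int \<Rightarrow> 'a \<Rightarrow> real) \<Rightarrow> ('p \<Rightarrow> real) \<Rightarrow> (nat \<Rightarrow> 'p \<Rightarrow> real) \<Rightarrow> (nat \<Rightarrow> 'p \<Rightarrow> real) \<Rightarrow>
   'p \<Rightarrow> real \<Rightarrow> (int \<Rightarrow> 'a \<Rightarrow> real) \<Rightarrow> bool" where
  "stationary_solution M \<xi> b0 bp bm \<theta>0 r X \<longleftrightarrow>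
     (\<forall>t. X t \<in> borel_measurable M) \<and>
     (\<forall>t. AE \<omega> in M. X t \<omega> = tarch_M b0 bp bm \<theta>0 (past X t \<omega>) * \<xi> t \<omega>) \<and>
     causal M \<xi> X \<and> stationary M X \<and> ergodic M X \<and>
     integrable M (\<lambda>\<omega>. \<bar>X 0 \<omega>\<bar> powr r)"

definition H_proc ::
  "('p \<Rightarrow> real) \<Rightarrow> (nat \<Rightarrow> 'p \<Rightarrow> real) \<Rightarrow> (nat \<Rightarrow> 'p \<Rightarrow> real) \<Rightarrow> (int \<Rightarrow> 'a \<Rightarrow> real) \<Rightarrow> int \<Rightarrow> 'a \<Rightarrow> 'p \<Rightarrow> real"
  where "H_proc b0 bp bm X t \<omega> \<theta> = tarch_H b0 bp bm \<theta> (past X t \<omega>)"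

definition q_proc ::
  "('p \<Rightarrow> real) \<Rightarrow> (nat \<Rightarrow> 'p \<Rightarrow> real) \<Rightarrow> (nat \<Rightarrow> 'p \<Rightarrow> real) \<Rightarrow> (int \<Rightarrow> 'a \<Rightarrow> real) \<Rightarrow> int \<Rightarrow> 'a \<Rightarrow> 'p \<Rightarrow> real"
  where "q_proc b0 bp bm X t \<omega> \<theta> =
           (X t \<omega>)\<^sup>2 / H_proc b0 bp bm X t \<omega> \<theta> + ln (H_proc b0 bp bm X t \<omega> \<theta>)"

text \<open>The sequence \<open>(X\<^sub>t\<^sub>-\<^sub>1, \<dots>, X\<^sub>1, u\<^sub>1, u\<^sub>2, \<dots>)\<close>, indexed from \<open>1\<close>.\<close>

definition past_hat :: "(nat \<Rightarrow> real) \<Rightarrow> (int \<Rightarrow> 'a \<Rightarrow> real) \<Rightarrow> nat \<Rightarrow> 'a \<Rightarrow> nat \<Rightarrow> real" where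
  "past_hat u X t \<omega> = (\<lambda>j. if j < t then X (int t - int j) \<omega> else u (j + 1 - t))"

definition H_hat ::
  "('p \<Rightarrow> real) \<Rightarrow> (nat \<Rightarrow> 'p \<Rightarrow> real) \<Rightarrow> (nat \<Rightarrow> 'p \<Rightarrow> real) \<Rightarrow> (nat \<Rightarrow> real) \<Rightarrow>
   (int \<Rightarrow> 'a \<Rightarrow> real) \<Rightarrow> nat \<Rightarrow> 'a \<Rightarrow> 'p \<Rightarrow> real"
  where "H_hat b0 bp bm u X t \<omega> \<theta> = tarch_H b0 bp bm \<theta> (past_hat u X t \<omega>)"

definition L_hat ::
  "('p \<Rightarrow> real) \<Rightarrow> (nat \<Rightarrow> 'p \<Rightarrow> real) \<Rightarrow> (nat \<Rightarrow> 'p \<Rightarrow> real) \<Rightarrow> (nat \<Rightarrow> real) \<Rightarrow>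
   (int \<Rightarrow> 'a \<Rightarrow> real) \<Rightarrow> nat \<Rightarrow> 'a \<Rightarrow> 'p \<Rightarrow> real"
  where "L_hat b0 bp bm u X n \<omega> \<theta> =
    - (1 / 2) * (\<Sum>t = 1..n. (X (int t) \<omega>)\<^sup>2 / H_hat b0 bp bm u X t \<omega> \<theta>
                             + ln (H_hat b0 bp bm u X t \<omega> \<theta>))"

text \<open>An arbitrary selection of maximisers; no measurability is imposed here.\<close>

definition is_QMLE ::
  "'a measure \<Rightarrow> ('p \<Rightarrow> real) \<Rightarrow> (nat \<Rightarrow> 'p \<Rightarrow> real) \<Rightarrow> (nat \<Rightarrow> 'p \<Rightarrow> real) \<Rightarrow> (nat \<Rightarrow> real) \<Rightarrow>
   (int \<Rightarrow> 'a \<Rightarrow> real) \<Rightarrow> 'p set \<Rightarrow> (nat \<Rightarrow> 'a \<Rightarrow> 'p) \<Rightarrow> bool"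
  where "is_QMLE M b0 bp bm u X \<Theta> \<theta>hat \<longleftrightarrow>
    (\<forall>n\<ge>1. \<forall>\<omega>\<in>space M. is_arg_max (L_hat b0 bp bm u X n \<omega>) (\<lambda>\<theta>. \<theta> \<in> \<Theta>) (\<theta>hat n \<omega>))"

definition partial_deriv :: "'d::finite \<Rightarrow> (real ^ 'd \<Rightarrow> real) \<Rightarrow> real ^ 'd \<Rightarrow> real" where
  "partial_deriv i f \<theta> = deriv (\<lambda>s. f (\<theta> + s *\<^sub>R axis i 1)) 0"

text \<open>Twice continuously differentiable on a set that need not be open: derivatives are taken
  within the set, with gradient \<open>g\<close> and Hessian \<open>h\<close> continuous up to the boundary. Every \<open>C\<^sup>2\<close> function
  on an open neighbourhood of the set qualifies, and at interior points \<open>g\<close> and \<open>h\<close> hold the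
  usual partial derivatives.\<close>

definition C2_on ::
  "(real ^ 'd::finite) set \<Rightarrow> (real ^ 'd \<Rightarrow> real) \<Rightarrow> (real ^ 'd \<Rightarrow> real ^ 'd) \<Rightarrow>
   (real ^ 'd \<Rightarrow> real ^ 'd ^ 'd) \<Rightarrow> bool" where
  "C2_on S f g h \<longleftrightarrow>
     (\<forall>\<theta>\<in>S. (f has_derivative (\<lambda>v. g \<theta> \<bullet> v)) (at \<theta> within S)) \<and>
     (\<forall>\<theta>\<in>S. (g has_derivative (\<lambda>v. h \<theta> *v v)) (at \<theta> within S)) \<and>
     continuous_on S h"

text \<open>Partial derivatives of \<open>q\<^sub>0\<close> exist only almost surely. On the exceptional null set the values of
  \<^const>\<open>deriv\<close> are arbitrary and may fail to be measurable with respect to \<open>M\<close>, in which case the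
  Bochner integral over \<open>M\<close> would be \<open>0\<close> by convention. Integrating over the completion avoids this
  and changes nothing for \<open>M\<close>-measurable integrands.\<close>

definition F_matrix ::
  "'a measure \<Rightarrow> (real ^ 'd \<Rightarrow> real) \<Rightarrow> (nat \<Rightarrow> real ^ 'd \<Rightarrow> real) \<Rightarrow> (nat \<Rightarrow> real ^ 'd \<Rightarrow> real) \<Rightarrow>
   (int \<Rightarrow> 'a \<Rightarrow> real) \<Rightarrow> real ^ 'd \<Rightarrow> real ^ 'd::finite ^ 'd" where
  "F_matrix M b0 bp bm X \<theta>0 =
     (\<chi> i j. \<integral>\<omega>. partial_deriv i (partial_deriv j (q_proc b0 bp bm X 0 \<omega>)) \<theta>0 \<partial>completion M)"

definition G_matrix ::
  "'a measure \<Rightarrow> (real ^ 'd \<Rightarrow> real) \<Rightarrow> (nat \<Rightarrow> real ^ 'd \<Rightarrow> real) \<Rightarrow> (nat \<Rightarrow> real ^ 'd \<Rightarrow> real) \<Rightarrow>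
   (int \<Rightarrow> 'a \<Rightarrow> real) \<Rightarrow> real ^ 'd \<Rightarrow> real ^ 'd::finite ^ 'd" where
  "G_matrix M b0 bp bm X \<theta>0 =
     (\<chi> i j. \<integral>\<omega>. partial_deriv i (q_proc b0 bp bm X 0 \<omega>) \<theta>0 *
                partial_deriv j (q_proc b0 bp bm X 0 \<omega>) \<theta>0 \<partial>completion M)"

text \<open>Variance \<open>0\<close> is allowed: the limiting covariance vanishes when \<open>\<bar>\<xi>\<^sub>0\<bar> = 1\<close> almost surely.\<close>

definition normal_law :: "real \<Rightarrow> real \<Rightarrow> real measure" where
  "normal_law m v =
     (if v = 0 then return borel m else density lborel (\<lambda>x. ennreal (normal_density m (sqrt v) x)))"

text \<open>A law is \<open>\<N>\<^sub>d(m, S)\<close> iff each of its linear images \<open>x \<mapsto> v \<bullet> x\<close> is normal with mean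
  \<open>v \<bullet> m\<close> and variance \<open>v \<bullet> S v\<close>.\<close>

definition mvnormal_law :: "real ^ 'd::finite \<Rightarrow> real ^ 'd ^ 'd \<Rightarrow> (real ^ 'd) measure \<Rightarrow> bool" where
  "mvnormal_law m S \<nu> \<longleftrightarrow> prob_space \<nu> \<and> sets \<nu> = sets borel \<and>
     (\<forall>v. distr \<nu> borel (\<lambda>x. v \<bullet> x) = normal_law (v \<bullet> m) (v \<bullet> (S *v v)))"

definition converges_in_law ::
  "'a measure \<Rightarrow> (nat \<Rightarrow> 'a \<Rightarrow> 'b::topological_space) \<Rightarrow> 'b measure \<Rightarrow> bool" where
  "converges_in_law M Y \<nu> \<longleftrightarrow>
     (\<forall>f::'b \<Rightarrow> real. continuous_on UNIV f \<longrightarrow> bounded (range f) \<longrightarrow>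
        (\<lambda>n. \<integral>\<omega>. f (Y n \<omega>) \<partial>M) \<longlonglongrightarrow> (\<integral>x. f x \<partial>\<nu>))"

end

theory Submission
  imports Defs
begin

text \<open>Since \<open>\<theta>0 \<in> \<Theta>(2)\<close>, the recursion contracts in \<open>L\<^sup>1\<close>, so \<open>X\<close> is almost surely a function of past
  innovations and \<open>\<xi> t\<close> is independent of the whole past of \<open>X\<close> before \<open>t\<close>.

  Consistency: the contrast satisfies \<open>E q(\<theta>) > E q(\<theta>0)\<close> for \<open>\<theta> \<noteq> \<theta>0\<close> because \<open>z - ln z \<ge> 1\<close> with
  equality only at \<open>z = 1\<close>. Birkhoff's theorem applied to local moduli of continuity makes the
  averages converge uniformly enough on the compact parameter set, and the truncation of the past is
  negligible in Cesaro mean.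

  Normality: at \<open>\<theta>0\<close> the score is \<open>(1 - \<xi>\<^sub>t\<^sup>2) D\<^sub>t\<close> with \<open>D\<^sub>t\<close> depending on the past only, a stationary
  martingale difference; this also gives \<open>F = E D D\<^sup>T\<close> and \<open>G = E (1 - \<xi>\<^sup>2)\<^sup>2 F\<close>. Expanding the score
  equation around \<open>\<theta>0\<close> yields \<open>F (sqrt n (\<theta>hat - \<theta>0)) = - T\<^sub>n + o(1)\<close>, where the truncation error is
  handled by Kronecker's lemma. Convergence in law follows from characteristic functions, by tightness and
  approximation of bounded continuous functions by trigonometric polynomials.\<close>

section \<open>Birkhoff's ergodic theorem\<close>

text \<open>Suprema over \<theta> of random functions would raise measurability questions at every
  use of the ergodic theorem. They are therefore taken over the deterministic coefficient functions
  only, and the resulting moduli multiply |X| lag by lag; such bounds are measurable and one null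
  set serves all \<theta>. Moments shape the estimates. For consistency only second moments are
  available, while the change of \<open>X^2 / H\<close> with \<theta> is of the order of
  \<open>X^2\<close> times a series in past values; so the modulus is capped at 1 where it
  multiplies \<open>X^2\<close>. For normality the score remainder is of order
  \<open>(1 + X^2) B^2\<close> with \<open>B\<close> affine in the absolute past values, which
  fourth moments control. Second derivatives are merely continuous, so the expansion is made around
  \<theta>0 alone, with a remainder that vanishes by dominated convergence and not at a rate. The
  martingale limit theorem exploits that each increment is a past-measurable factor times an
  independent innovation: conditional characteristic functions become integrals against one fixed
  law.\<close>

fun max_birkhoff_sum :: "('b \<Rightarrow> 'b) \<Rightarrow> ('b \<Rightarrow> real) \<Rightarrow> nat \<Rightarrow> 'b \<Rightarrow> real" where
  "max_birkhoff_sum T f 0 x = f x"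
| "max_birkhoff_sum T f (Suc n) x = f x + max 0 (max_birkhoff_sum T f n (T x))"

lemma max_birkhoff_sum_mono_Suc: "max_birkhoff_sum T f n x \<le> max_birkhoff_sum T f (Suc n) x"
proof (induction n arbitrary: x)
  case (Suc n)
  show ?case using Suc[of "T x"] by (simp add: max_def) 
qed simp

text \<open>\<open>max_birkhoff_sum T f n\<close> is the maximum of the Birkhoff sums with 1 to
  \<open>n + 1\<close> terms, written through its recursion along \<open>T\<close>; the longest of
  these sums is the one compared here.\<close>

lemma birkhoff_sum_le_max: "(\<Sum>i<Suc n. f ((T ^^ i) x)) \<le> max_birkhoff_sum T f n x"
proof (induction n arbitrary: x)
  case (Suc n)
  have "(\<Sum>i<Suc (Suc n). f ((T ^^ i) x)) = f x + (\<Sum>i<Suc n. f ((T ^^ i) (T x)))"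
    by (subst sum.lessThan_Suc_shift) (simp add: funpow_Suc_right del: funpow.simps)
  also have "\<dots> \<le> f x + max 0 (max_birkhoff_sum T f n (T x))"
    using Suc[of "T x"] by linarith
  finally show ?case by simp
qed simp

locale ergodic_system = prob_space N for N :: "'b measure" +
  fixes T :: "'b \<Rightarrow> 'b"
  assumes T_measurable [measurable]: "T \<in> N \<rightarrow>\<^sub>M N"
    and T_preserving: "distr N N T = N"
    and T_ergodic: "\<And>A. A \<in> sets N \<Longrightarrow> T -` A \<inter> space N = A \<Longrightarrow> measure N A \<in> {0, 1}"
begin

lemma integrable_comp_T:
  fixes f :: "'b \<Rightarrow> real"
  assumes "integrable N f"
  shows "integrable N (\<lambda>x. f (T x))" "(\<integral>x. f (T x) \<partial>N) = (\<integral>x. f x \<partial>N)"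
proof -
  have "f \<in> borel_measurable N" using assms by auto
  then show "integrable N (\<lambda>x. f (T x))" "(\<integral>x. f (T x) \<partial>N) = (\<integral>x. f x \<partial>N)"
    using integrable_distr_eq[of T N N f] integral_distr[of T N N f] assms T_preserving by auto
qed

text \<open>The set on which the maxima \<open>m n\<close> are unbounded is invariant, so it has
  measure 0 or 1. Measure 1 is impossible: then \<open>m (Suc n) x - m n (T x)\<close> would
  converge to \<open>f x\<close> under an integrable majorant, while its integrals are nonnegative
  because \<open>m\<close> increases and \<open>T\<close> preserves \<open>N\<close>. This
  contradicts the negative mean.\<close>

lemma birkhoff_sums_bounded:
  fixes f :: "'b \<Rightarrow> real"
  assumes f: "integrable N f" and neg: "(\<integral>x. f x \<partial>N) < 0"
  shows "AE x in N. \<exists>c. \<forall>n. (\<Sum>i<n. f ((T ^^ i) x)) \<le> c"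
proof -
  define m where "m = max_birkhoff_sum T f"
  have m_Suc: "m (Suc n) x = f x + max 0 (m n (T x))" for n x by (simp add: m_def)
  have m_mono: "m n x \<le> m (Suc n) x" for n x
    unfolding m_def by (rule max_birkhoff_sum_mono_Suc)
  have inc: "incseq (\<lambda>n. m n x)" for x by (rule incseq_SucI) (rule m_mono)
  have [measurable]: "f \<in> borel_measurable N" using f by auto
  have [measurable]: "m n \<in> borel_measurable N" for n
  proof (induction n)
    case (Suc n)
    have "m (Suc n) = (\<lambda>x. f x + max 0 (m n (T x)))" by (simp add: m_Suc fun_eq_iff)
    with Suc show ?case by simp
  qed (simp add: m_def)
  have int_m: "integrable N (m n)" for n
  proof (induction n)
    case (Suc n)
    have "m (Suc n) = (\<lambda>x. f x + max 0 (m n (T x)))" by (simp add: m_Suc fun_eq_iff)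
    with f integrable_comp_T(1)[OF Suc] show ?case by simp
  qed (simp add: m_def f)
  \<comment> \<open>Natural thresholds \<open>c\<close> keep \<open>A\<close> a countable
    combination of measurable sets.\<close>
  define A where "A = {x \<in> space N. \<forall>c::nat. \<exists>n. m n x > real c}"
  have A[measurable]: "A \<in> sets N" unfolding A_def by measurable
  have unb: "(\<forall>c::nat. \<exists>n. m n x > real c) \<longleftrightarrow> (\<forall>c::nat. \<exists>n. m n (T x) > real c)" for x
  proof
    assume L: "\<forall>c::nat. \<exists>n. m n x > real c"
    show "\<forall>c::nat. \<exists>n. m n (T x) > real c"
    proof
      fix c :: nat
      obtain k :: nat where k: "c + \<bar>f x\<bar> < real k" using reals_Archimedean2 by blast
      obtain n where "m n x > real k" using L by blast
      then have "m (Suc n) x > k" using m_mono[of n x] by linarith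
      then have "m n (T x) > c" using k unfolding m_Suc by linarith
      then show "\<exists>n. m n (T x) > real c" by blast
    qed
  next
    assume R: "\<forall>c::nat. \<exists>n. m n (T x) > real c"
    show "\<forall>c::nat. \<exists>n. m n x > real c"
    proof
      fix c :: nat
      obtain k :: nat where k: "c + \<bar>f x\<bar> < real k" using reals_Archimedean2 by blast
      obtain n where "m n (T x) > real k" using R by blast
      then have "m (Suc n) x > c" using k unfolding m_Suc by linarith
      then show "\<exists>n. m n x > real c" by blast
    qed
  qed
  have "T -` A \<inter> space N = A"
    using measurable_space[OF T_measurable] unb unfolding A_def by auto
  then have "measure N A \<in> {0, 1}" by (rule T_ergodic[OF A])
  moreover have "measure N A \<noteq> 1"
  proof
    assume "measure N A = 1"
    then have AE_A: "AE x in N. x \<in> A" using prob_eq_1 by simp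
    \<comment> \<open>Once \<open>m n (T x)\<close> is positive, the truncation at 0 in the
      recursion is inactive and the difference equals \<open>f x\<close> exactly.\<close>
    have "(\<lambda>n. \<integral>x. m (Suc n) x - m n (T x) \<partial>N) \<longlonglongrightarrow> (\<integral>x. f x \<partial>N)"
    proof (rule integral_dominated_convergence)
      show "integrable N (\<lambda>x. \<bar>f x\<bar> + \<bar>f (T x)\<bar>)"
        using f integrable_comp_T(1)[OF f] by auto
      show "AE x in N. (\<lambda>n. m (Suc n) x - m n (T x)) \<longlonglongrightarrow> f x"
        using AE_A
      proof eventually_elim
        case (elim x)
        then have "\<exists>n0. m n0 (T x) > real 0" using unb unfolding A_def by blast
        then obtain n0 where n0: "m n0 (T x) > 0" by auto
        have "m (Suc n) x - m n (T x) = f x" if "n \<ge> n0" for n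
        proof -
          have "m n0 (T x) \<le> m n (T x)" using inc[of "T x"] that by (auto simp: incseq_def)
          then show ?thesis using n0 by (simp add: m_Suc)
        qed
        then show ?case
          by (intro tendsto_eventually) (auto simp: eventually_sequentially)
      qed
      fix n
      show "AE x in N. norm (m (Suc n) x - m n (T x)) \<le> \<bar>f x\<bar> + \<bar>f (T x)\<bar>"
      proof (intro AE_I2)
        fix x
        have "m 0 (T x) \<le> m n (T x)" using inc[of "T x"] by (auto simp: incseq_def)
        then have "f (T x) \<le> m n (T x)" by (simp add: m_def)
        then show "norm (m (Suc n) x - m n (T x)) \<le> \<bar>f x\<bar> + \<bar>f (T x)\<bar>"
          unfolding m_Suc by (auto simp: max_def abs_if)
      qed
    qed auto
    moreover have "(\<integral>x. m (Suc n) x - m n (T x) \<partial>N) \<ge> 0" for n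
    proof -
      have "(\<integral>x. m (Suc n) x - m n (T x) \<partial>N) = (\<integral>x. m (Suc n) x \<partial>N) - (\<integral>x. m n x \<partial>N)"
        using int_m integrable_comp_T[OF int_m] by simp
      also have "\<dots> \<ge> 0" using m_mono int_m by (simp add: integral_mono)
      finally show ?thesis .
    qed
    ultimately have "(\<integral>x. f x \<partial>N) \<ge> 0" by (intro LIMSEQ_le_const) auto
    with neg show False by simp
  qed
  ultimately have "measure N A = 0" by simp
  then have "AE x in N. x \<notin> A" using prob_eq_0 by simp
  then show ?thesis
  proof (rule AE_mp, intro AE_I2 impI)
    fix x assume "x \<in> space N" "x \<notin> A"
    then obtain c :: nat where c: "\<And>n. m n x \<le> real c" unfolding A_def by (auto simp: not_less)
    have "(\<Sum>i<n. f ((T ^^ i) x)) \<le> real c" for n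
    proof (cases n)
      case (Suc k)
      show ?thesis using birkhoff_sum_le_max[of f T x k] c[of k] by (simp add: Suc m_def)
    qed simp
    then show "\<exists>c. \<forall>n. (\<Sum>i<n. f ((T ^^ i) x)) \<le> c" by blast
  qed
qed

text \<open>Both \<open>f - E - 1 / Suc k\<close> and \<open>E - f - 1 / Suc k\<close> have negative
  mean, so their sums are bounded above. After division by \<open>n\<close> these bounds vanish, and
  the averages are squeezed into every margin \<open>1 / Suc k\<close> around the mean.\<close>

theorem birkhoff_ergodic:
  fixes f :: "'b \<Rightarrow> real"
  assumes f: "integrable N f"
  shows "AE x in N. (\<lambda>n. (\<Sum>i<n. f ((T ^^ i) x)) / n) \<longlonglongrightarrow> (\<integral>x. f x \<partial>N)"
proof -
  define E where "E = (\<integral>x. f x \<partial>N)"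
  have "AE x in N. \<exists>c. \<forall>n. (\<Sum>i<n. f ((T ^^ i) x) - E - 1 / real (Suc k)) \<le> c" for k
    using f by (intro birkhoff_sums_bounded) (auto simp: E_def prob_space)
  moreover have "AE x in N. \<exists>c. \<forall>n. (\<Sum>i<n. E - f ((T ^^ i) x) - 1 / real (Suc k)) \<le> c" for k
    using f by (intro birkhoff_sums_bounded) (auto simp: E_def prob_space)
  ultimately have "AE x in N. \<forall>k. (\<exists>c. \<forall>n. (\<Sum>i<n. f ((T ^^ i) x) - E - 1 / real (Suc k)) \<le> c) \<and>
      (\<exists>c. \<forall>n. (\<Sum>i<n. E - f ((T ^^ i) x) - 1 / real (Suc k)) \<le> c)"
    by (simp add: AE_all_countable)
  then show ?thesis
  proof eventually_elim
    case (elim x)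
    show "(\<lambda>n. (\<Sum>i<n. f ((T ^^ i) x)) / n) \<longlonglongrightarrow> (\<integral>x. f x \<partial>N)"
      unfolding E_def[symmetric]
    proof (rule LIMSEQ_I)
      fix r :: real assume "0 < r"
      then obtain k where k: "1 / real (Suc k) < r / 2"
        using reals_Archimedean[of "r/2"] by (auto simp: inverse_eq_divide)
      obtain c1 c2 where
        c1: "\<And>n. (\<Sum>i<n. f ((T ^^ i) x) - E - 1 / real (Suc k)) \<le> c1" and
        c2: "\<And>n. (\<Sum>i<n. E - f ((T ^^ i) x) - 1 / real (Suc k)) \<le> c2"
        using elim[rule_format, of k] by blast
      define c where "c = \<bar>c1\<bar> + \<bar>c2\<bar> + 1"
      obtain n0 :: nat where n0: "c / (r / 2) < real n0" using reals_Archimedean2 by blast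
      have c0: "c > 0" by (simp add: c_def)
      have "norm ((\<Sum>i<n. f ((T ^^ i) x)) / n - E) < r" if "n \<ge> n0" for n
      proof -
        have n: "real n > c / (r/2)" using n0 that by linarith
        moreover have "c / (r/2) > 0" using c0 \<open>0 < r\<close> by simp
        ultimately have npos: "real n > 0" by linarith
        have nc: "c < n * (r/2)" using n \<open>0 < r\<close> by (simp add: field_simps)
        define S where "S = (\<Sum>i<n. f ((T ^^ i) x))"
        have a: "S - n * E - n * (1 / real (Suc k)) \<le> c1"
          using c1[of n] by (simp add: sum_subtractf S_def)
        have b: "n * E - S - n * (1 / real (Suc k)) \<le> c2"
          using c2[of n] by (simp add: sum_subtractf S_def)
        have "n * (1 / real (Suc k)) \<le> n * (r/2)" using k by (intro mult_left_mono) auto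
        then have "\<bar>S - n * E\<bar> < n * r" using a b nc unfolding c_def by (simp add: abs_le_iff)
        moreover have "S / n - E = (S - n * E) / n" using npos by (simp add: field_simps)
        ultimately show ?thesis using npos by (simp add: S_def[symmetric] field_simps abs_divide)
      qed
      then show "\<exists>no. \<forall>n\<ge>no. norm ((\<Sum>i<n. f ((T ^^ i) x)) / n - E) < r" by blast
    qed
  qed
qed

end

lemma measurable_path:
  assumes "\<And>t. X t \<in> borel_measurable M"
  shows "(\<lambda>\<omega> t. X (t + h) \<omega>) \<in> M \<rightarrow>\<^sub>M path_space" "(\<lambda>\<omega> t. X t \<omega>) \<in> M \<rightarrow>\<^sub>M path_space"
  using assms by (auto intro!: measurable_PiM_single' )

lemma stationary_transfer:
  fixes f :: "(int \<Rightarrow> real) \<Rightarrow> 'b::{banach, second_countable_topology}"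
  assumes st: "stationary M X" and X: "\<And>t. X t \<in> borel_measurable M"
    and f: "f \<in> borel_measurable path_space"
  shows "integrable M (\<lambda>\<omega>. f (\<lambda>t. X (t + h) \<omega>)) \<longleftrightarrow> integrable M (\<lambda>\<omega>. f (\<lambda>t. X t \<omega>))"
    and "(\<integral>\<omega>. f (\<lambda>t. X (t + h) \<omega>) \<partial>M) = (\<integral>\<omega>. f (\<lambda>t. X t \<omega>) \<partial>M)"
    and "distr M borel (\<lambda>\<omega>. f (\<lambda>t. X (t + h) \<omega>)) = distr M borel (\<lambda>\<omega>. f (\<lambda>t. X t \<omega>))"
proof -
  note m = measurable_path[of X M, OF X]
  have eq: "distr M path_space (\<lambda>\<omega> t. X (t + h) \<omega>) = distr M path_space (\<lambda>\<omega> t. X t \<omega>)"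
    using st by (auto simp: stationary_def)
  show "integrable M (\<lambda>\<omega>. f (\<lambda>t. X (t + h) \<omega>)) \<longleftrightarrow> integrable M (\<lambda>\<omega>. f (\<lambda>t. X t \<omega>))"
    using integrable_distr_eq[OF m(1)[of h] f] integrable_distr_eq[OF m(2) f] eq by simp
  show "(\<integral>\<omega>. f (\<lambda>t. X (t + h) \<omega>) \<partial>M) = (\<integral>\<omega>. f (\<lambda>t. X t \<omega>) \<partial>M)"
    using integral_distr[OF m(1)[of h] f] integral_distr[OF m(2) f] eq by simp
  show "distr M borel (\<lambda>\<omega>. f (\<lambda>t. X (t + h) \<omega>)) = distr M borel (\<lambda>\<omega>. f (\<lambda>t. X t \<omega>))"
    using distr_distr[OF f m(1)[of h]] distr_distr[OF f m(2)] eq by (simp add: comp_def)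
qed

text \<open>The law of \<open>X\<close> on path space together with the coordinate shift is an
  ergodic system. Every function on the integers is a point of that space, so the invariance
  condition in \<open>ergodic\<close> is exactly the one of the locale.\<close>

lemma ergodic_average:
  fixes X :: "int \<Rightarrow> 'a \<Rightarrow> real"
  assumes ps: "prob_space M" and st: "stationary M X" and er: "ergodic M X"
    and X: "\<And>t. X t \<in> borel_measurable M"
    and f: "f \<in> borel_measurable path_space"
    and int: "integrable M (\<lambda>\<omega>. f (\<lambda>t. X t \<omega>))"
  shows "AE \<omega> in M. (\<lambda>n. (\<Sum>t=1..n. f (\<lambda>s. X (s + int t) \<omega>)) / n) \<longlonglongrightarrow> (\<integral>\<omega>. f (\<lambda>t. X t \<omega>) \<partial>M)"
proof -
  define T :: "(int \<Rightarrow> real) \<Rightarrow> (int \<Rightarrow> real)" where "T = (\<lambda>x t. x (t + 1))"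
  define N where "N = distr M path_space (\<lambda>\<omega> t. X t \<omega>)"
  note m = measurable_path[of X M, OF X]
  have T[measurable]: "T \<in> path_space \<rightarrow>\<^sub>M path_space"
    unfolding T_def by (intro measurable_PiM_single') auto
  interpret ergodic_system N T
  proof (intro ergodic_system.intro ergodic_system_axioms.intro)
    show "prob_space N" unfolding N_def using prob_space.prob_space_distr[OF ps m(2)] .
    show "T \<in> N \<rightarrow>\<^sub>M N" using T unfolding N_def by simp
    have "distr N path_space T = distr M path_space (\<lambda>\<omega> t. X (t + 1) \<omega>)"
      unfolding N_def by (subst distr_distr[OF T m(2)]) (simp add: comp_def T_def)
    also have "\<dots> = N" using st unfolding stationary_def N_def by blast
    finally show "distr N N T = N" by (simp add: N_def cong: distr_cong)
    fix A assume A: "A \<in> sets N" "T -` A \<inter> space N = A"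
    have "{x. (\<lambda>t. x (t + 1)) \<in> A} = A" using A(2) by (auto simp: N_def T_def space_PiM)
    with er A(1) show "measure N A \<in> {0, 1}" unfolding ergodic_def N_def by simp
  qed
  have intT: "integrable N (\<lambda>x. f (T x))" "(\<integral>x. f (T x) \<partial>N) = (\<integral>x. f x \<partial>N)"
    using integrable_comp_T[of f] int f m by (auto simp: N_def integrable_distr_eq)
  have funT: "(T ^^ i) x = (\<lambda>t. x (t + int i))" for i x
    by (induction i arbitrary: x) (auto simp: T_def fun_eq_iff add_ac)
  \<comment> \<open>Birkhoff sums start at time 0 and the averages here at time 1, hence
    \<open>f\<close> composed with \<open>T\<close>.\<close>
  have "AE x in N. (\<lambda>n. (\<Sum>i<n. f (T ((T ^^ i) x))) / n) \<longlonglongrightarrow> (\<integral>x. f x \<partial>N)"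
    using birkhoff_ergodic[OF intT(1)] intT(2) by simp
  then have "AE \<omega> in M. (\<lambda>n. (\<Sum>i<n. f (T ((T ^^ i) (\<lambda>t. X t \<omega>)))) / n) \<longlonglongrightarrow> (\<integral>x. f x \<partial>N)"
    unfolding N_def by (rule AE_distrD[OF m(2)])
  moreover have "(\<Sum>i<n. f (T ((T ^^ i) (\<lambda>t. X t \<omega>)))) = (\<Sum>t=1..n. f (\<lambda>s. X (s + int t) \<omega>))" for n \<omega>
    unfolding funT by (simp add: T_def sum.atLeast1_atMost_eq add_ac)
  moreover have "(\<integral>x. f x \<partial>N) = (\<integral>\<omega>. f (\<lambda>t. X t \<omega>) \<partial>M)"
    unfolding N_def by (rule integral_distr[OF m(2) f])
  ultimately show ?thesis by simp
qed

section \<open>A central limit theorem for stationary martingale differences\<close>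

lemma measurable_larger_algebra:
  assumes "f \<in> measurable A N" "space A = space B" "sets A \<subseteq> sets B"
  shows "f \<in> measurable B N"
  using assms by (auto simp: measurable_def)

text \<open>\<^const>\<open>prob_space.indep_var\<close> forces both variables to have the same type.\<close>

definition indep_pair ::
  "'a measure \<Rightarrow> 'b measure \<Rightarrow> ('a \<Rightarrow> 'b) \<Rightarrow> 'c measure \<Rightarrow> ('a \<Rightarrow> 'c) \<Rightarrow> bool" where
  "indep_pair M S X T Y \<longleftrightarrow> X \<in> M \<rightarrow>\<^sub>M S \<and> Y \<in> M \<rightarrow>\<^sub>M T \<and>
     distr M S X \<Otimes>\<^sub>M distr M T Y = distr M (S \<Otimes>\<^sub>M T) (\<lambda>\<omega>. (X \<omega>, Y \<omega>))"

lemma (in prob_space) indep_pair_iff_indep_var: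
  "indep_pair M S X T Y \<longleftrightarrow> indep_var S X T Y"
  unfolding indep_pair_def indep_var_distribution_eq by simp

lemma (in prob_space) indep_pair_compose:
  assumes "indep_pair M S X T Y" and f[measurable]: "f \<in> S \<rightarrow>\<^sub>M S'" and g[measurable]: "g \<in> T \<rightarrow>\<^sub>M T'"
  shows "indep_pair M S' (\<lambda>\<omega>. f (X \<omega>)) T' (\<lambda>\<omega>. g (Y \<omega>))"
proof -
  have rv[measurable]: "random_variable S X" "random_variable T Y"
    and eq: "distr M S X \<Otimes>\<^sub>M distr M T Y = distr M (S \<Otimes>\<^sub>M T) (\<lambda>\<omega>. (X \<omega>, Y \<omega>))"
    using assms(1) unfolding indep_pair_def by auto
  interpret G: prob_space "distr M T' (\<lambda>\<omega>. g (Y \<omega>))" by (rule prob_space_distr) simp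
  have gd: "distr (distr M T Y) T' g = distr M T' (\<lambda>\<omega>. g (Y \<omega>))"
    and fd: "distr (distr M S X) S' f = distr M S' (\<lambda>\<omega>. f (X \<omega>))"
    by (subst distr_distr; simp add: comp_def)+
  have "distr M S' (\<lambda>\<omega>. f (X \<omega>)) \<Otimes>\<^sub>M distr M T' (\<lambda>\<omega>. g (Y \<omega>))
      = distr (distr M S X \<Otimes>\<^sub>M distr M T Y) (S' \<Otimes>\<^sub>M T') (\<lambda>(x, y). (f x, g y))"
    unfolding gd[symmetric] fd[symmetric]
    by (rule pair_measure_distr) (simp_all add: gd G.sigma_finite_measure_axioms)
  also have "\<dots> = distr M (S' \<Otimes>\<^sub>M T') (\<lambda>\<omega>. (f (X \<omega>), g (Y \<omega>)))"
    unfolding eq by (subst distr_distr) (simp_all add: comp_def)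
  finally show ?thesis unfolding indep_pair_def by simp
qed

text \<open>Passes from independence of the variable \<open>X\<close> to independence of the
  sigma-algebra that it generates, expressed by the identity map into that algebra. Its sets are
  preimages under \<open>X\<close>, so rectangles reduce to rectangles for the pair of
  variables.\<close>

lemma (in prob_space) indep_pair_vimage_algebra:
  assumes "indep_pair M S X T Y"
  shows "indep_pair M (vimage_algebra (space M) X S) (\<lambda>\<omega>. \<omega>) T Y"
proof -
  have rv[measurable]: "random_variable S X" "random_variable T Y"
    and eq: "distr M S X \<Otimes>\<^sub>M distr M T Y = distr M (S \<Otimes>\<^sub>M T) (\<lambda>\<omega>. (X \<omega>, Y \<omega>))"
    using assms(1) unfolding indep_pair_def by auto
  let ?F = "vimage_algebra (space M) X S"
  have XS: "X \<in> space M \<rightarrow> space S" using measurable_space[OF rv(1)] by auto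
  have sub: "sets ?F \<subseteq> sets M"
    using rv(1) by (auto simp: sets_vimage_algebra2[OF XS])
  then have id[measurable]: "(\<lambda>\<omega>. \<omega>) \<in> M \<rightarrow>\<^sub>M ?F" by (auto intro!: measurableI)
  interpret X: prob_space "distr M S X" by (rule prob_space_distr) fact
  interpret Y: prob_space "distr M T Y" by (rule prob_space_distr) fact
  interpret I: prob_space "distr M ?F (\<lambda>\<omega>. \<omega>)" by (rule prob_space_distr) simp
  have "distr M ?F (\<lambda>\<omega>. \<omega>) \<Otimes>\<^sub>M distr M T Y = distr M (?F \<Otimes>\<^sub>M T) (\<lambda>\<omega>. (\<omega>, Y \<omega>))"
  proof (rule pair_measure_eqI)
    show "sets (distr M ?F (\<lambda>\<omega>. \<omega>) \<Otimes>\<^sub>M distr M T Y) = sets (distr M (?F \<Otimes>\<^sub>M T) (\<lambda>\<omega>. (\<omega>, Y \<omega>)))"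
      by (simp cong: sets_pair_measure_cong)
    fix A B assume "A \<in> sets (distr M ?F (\<lambda>\<omega>. \<omega>))" and "B \<in> sets (distr M T Y)"
    then have A: "A \<in> sets ?F" and B[measurable]: "B \<in> sets T" by auto
    then obtain C where C[measurable]: "C \<in> sets S" and AC: "A = X -` C \<inter> space M"
      by (auto simp: sets_vimage_algebra2[OF XS])
    have "emeasure (distr M S X) C * emeasure (distr M T Y) B
        = emeasure (distr M S X \<Otimes>\<^sub>M distr M T Y) (C \<times> B)"
      by (rule Y.emeasure_pair_measure_Times[symmetric]) auto
    also have "\<dots> = emeasure M ((\<lambda>\<omega>. (X \<omega>, Y \<omega>)) -` (C \<times> B) \<inter> space M)"
      unfolding eq by (subst emeasure_distr) auto
    also have "(\<lambda>\<omega>. (X \<omega>, Y \<omega>)) -` (C \<times> B) \<inter> space M = (\<lambda>\<omega>. (\<omega>, Y \<omega>)) -` (A \<times> B) \<inter> space M"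
      unfolding AC by auto
    also have "emeasure M \<dots> = emeasure (distr M (?F \<Otimes>\<^sub>M T) (\<lambda>\<omega>. (\<omega>, Y \<omega>))) (A \<times> B)"
      using A B by (subst emeasure_distr) auto
    finally have *: "emeasure (distr M S X) C * emeasure (distr M T Y) B = \<dots>" .
    have "emeasure (distr M S X) C = emeasure (distr M ?F (\<lambda>\<omega>. \<omega>)) A"
      using A by (simp add: emeasure_distr AC) 
    with * show "emeasure (distr M ?F (\<lambda>\<omega>. \<omega>)) A * emeasure (distr M T Y) B =
       emeasure (distr M (?F \<Otimes>\<^sub>M T) (\<lambda>\<omega>. (\<omega>, Y \<omega>))) (A \<times> B)" by simp
  qed (simp_all add: I.sigma_finite_measure_axioms Y.sigma_finite_measure_axioms)
  then show ?thesis unfolding indep_pair_def by simp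
qed

text \<open>Fubini for the joint law. With \<open>X\<close> the identity into a sub-sigma-algebra it
  plays the role of a conditional expectation: the independent variable is integrated out while
  everything else is frozen.\<close>

lemma (in prob_space) indep_pair_integral:
  fixes k :: "'b \<times> 'c \<Rightarrow> 'd::{banach, second_countable_topology}"
  assumes ind: "indep_pair M S X T Y" and k: "k \<in> borel_measurable (S \<Otimes>\<^sub>M T)"
    and bd: "\<And>z. norm (k z) \<le> B"
  shows "(\<integral>\<omega>. k (X \<omega>, Y \<omega>) \<partial>M) = (\<integral>\<omega>. (\<integral>y. k (X \<omega>, y) \<partial>distr M T Y) \<partial>M)"
proof -
  have rv[measurable]: "random_variable S X" "random_variable T Y"
    and eq: "distr M (S \<Otimes>\<^sub>M T) (\<lambda>\<omega>. (X \<omega>, Y \<omega>)) = distr M S X \<Otimes>\<^sub>M distr M T Y"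
    using ind unfolding indep_pair_def by auto
  interpret X: prob_space "distr M S X" by (rule prob_space_distr) fact
  interpret Y: prob_space "distr M T Y" by (rule prob_space_distr) fact
  interpret XY: pair_prob_space "distr M S X" "distr M T Y" ..
  have k'[measurable]: "k \<in> borel_measurable (distr M S X \<Otimes>\<^sub>M distr M T Y)"
    using k by (simp cong: measurable_cong_sets)
  have int: "integrable (distr M S X \<Otimes>\<^sub>M distr M T Y) k"
    by (rule XY.integrable_const_bound[of _ B]) (use bd k' in auto)
  have inner: "(\<lambda>x. \<integral>y. k (x, y) \<partial>distr M T Y) \<in> borel_measurable S"
    using k by (intro Y.borel_measurable_lebesgue_integral) (simp add: split_def cong: measurable_cong_sets)
  have "(\<integral>\<omega>. k (X \<omega>, Y \<omega>) \<partial>M) = (\<integral>z. k z \<partial>distr M (S \<Otimes>\<^sub>M T) (\<lambda>\<omega>. (X \<omega>, Y \<omega>)))"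
    using k by (subst integral_distr) auto
  also have "\<dots> = (\<integral>x. (\<integral>y. k (x, y) \<partial>distr M T Y) \<partial>distr M S X)"
    unfolding eq using XY.integral_fst'[OF int] by simp
  also have "\<dots> = (\<integral>\<omega>. (\<integral>y. k (X \<omega>, y) \<partial>distr M T Y) \<partial>M)"
    by (rule integral_distr[OF rv(1) inner])
  finally show ?thesis .
qed

text \<open>At arguments of order \<open>1 / n\<close>, the linear bound supplies an integrable
  majorant and the quadratic one a limit 0 even after multiplication by \<open>n\<close>.\<close>

lemma exp_minus_approx:
  fixes u :: real assumes "0 \<le> u"
  shows "\<bar>exp (- u) - (1 - u)\<bar> \<le> u" "\<bar>exp (- u) - (1 - u)\<bar> \<le> u\<^sup>2"
proof -
  have a: "exp (- u) \<ge> 1 - u" using exp_ge_add_one_self[of "-u"] by simp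
  then show "\<bar>exp (- u) - (1 - u)\<bar> \<le> u" using assms by simp
  have "1 + u \<le> exp u" by simp
  then have "exp (- u) \<le> 1 / (1 + u)" using assms by (simp add: exp_minus field_simps)
  also have "\<dots> \<le> 1 - u + u\<^sup>2"
    using assms by (simp add: field_simps power2_eq_square)
  finally show "\<bar>exp (- u) - (1 - u)\<bar> \<le> u\<^sup>2" using a by simp
qed

text \<open>The one-step error of replacing a characteristic function by its Gaussian counterpart
  at scale \<open>y / sqrt n\<close>.\<close>

lemma (in prob_space) char_scaled_error:
  fixes \<eta> :: "'a \<Rightarrow> real"
  assumes [measurable]: "\<eta> \<in> borel_measurable M"
    and int2: "integrable M (\<lambda>\<omega>. (\<eta> \<omega>)\<^sup>2)" and mean: "expectation \<eta> = 0"
    and var: "expectation (\<lambda>\<omega>. (\<eta> \<omega>)\<^sup>2) = c"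
  defines "r \<equiv> \<lambda>n y. real n * cmod (char (distr M borel \<eta>) (y / sqrt n) - exp (- (c * y\<^sup>2 / (2 * n))))"
  shows "r n y \<le> 2 * c * y\<^sup>2" "(\<lambda>n. r n y) \<longlonglongrightarrow> 0"
proof -
  have c0: "c \<ge> 0" unfolding var[symmetric] by (intro integral_nonneg_AE) auto
  have int1: "integrable M \<eta>"
    by (rule square_integrable_imp_integrable[OF _ int2]) simp
  have vareq: "variance \<eta> = c" using mean var by simp
  \<comment> \<open>The minimum in the Taylor remainder is dominated by the second moment and tends
    to 0 pointwise as \<open>t\<close> does, so finite variance suffices.\<close>
  define \<kappa> where "\<kappa> = (\<lambda>t. expectation (\<lambda>x. min (6 * (\<eta> x)\<^sup>2) (\<bar>t\<bar> * \<bar>\<eta> x\<bar> ^ 3)))"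
  have approx: "cmod (char (distr M borel \<eta>) t - (1 - t\<^sup>2 * c / 2)) \<le> t\<^sup>2 / 6 * \<kappa> t" for t
    unfolding \<kappa>_def by (rule char_approx3') (use int1 int2 mean vareq in auto)
  have \<kappa>_le: "\<kappa> t \<le> 6 * c" for t
  proof -
    have "\<kappa> t \<le> expectation (\<lambda>x. 6 * (\<eta> x)\<^sup>2)"
      unfolding \<kappa>_def using int2
      by (intro integral_mono Bochner_Integration.integrable_bound[OF integrable_mult_right[OF int2, of 6]] AE_I2)
         (auto simp: min_def)
    then show ?thesis using var by simp
  qed
  have main: "r n y \<le> y\<^sup>2 / 6 * \<kappa> (y / sqrt n) + real n * \<bar>exp (- (c * y\<^sup>2 / (2 * n))) - (1 - c * y\<^sup>2 / (2 * n))\<bar>"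
    if n: "n > 0" for n
  proof -
    define t where "t = y / sqrt n"
    have t2: "t\<^sup>2 = y\<^sup>2 / n" using n by (simp add: t_def power_divide)
    have u: "t\<^sup>2 * c / 2 = c * y\<^sup>2 / (2 * n)" unfolding t2 by (simp add: mult.commute)
    have "cmod (char (distr M borel \<eta>) t - exp (- (c * y\<^sup>2 / (2 * n))))
      \<le> cmod (char (distr M borel \<eta>) t - (1 - t\<^sup>2 * c / 2)) + cmod ((1 - t\<^sup>2 * c / 2) - exp (- (c * y\<^sup>2 / (2 * n))))"
      using norm_triangle_ineq[of "char (distr M borel \<eta>) t - (1 - t\<^sup>2 * c / 2)" "(1 - t\<^sup>2 * c / 2) - exp (- (c * y\<^sup>2 / (2 * n)))"]
      by (simp del: exp_of_real)
    also have "cmod ((1 - t\<^sup>2 * c / 2) - exp (- (c * y\<^sup>2 / (2 * n)))) = \<bar>exp (- (c * y\<^sup>2 / (2 * n))) - (1 - c * y\<^sup>2 / (2 * n))\<bar>"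
      unfolding u[symmetric] norm_of_real[symmetric, where 'a=complex]
      by (simp add: norm_minus_commute flip: exp_of_real)
    finally have *: "cmod (char (distr M borel \<eta>) t - exp (- (c * y\<^sup>2 / (2 * n))))
      \<le> t\<^sup>2 / 6 * \<kappa> t + \<bar>exp (- (c * y\<^sup>2 / (2 * n))) - (1 - c * y\<^sup>2 / (2 * n))\<bar>"
      using approx[of t] by linarith
    have "r n y = real n * cmod (char (distr M borel \<eta>) t - exp (- (c * y\<^sup>2 / (2 * n))))"
      by (simp add: r_def t_def)
    also have "\<dots> \<le> real n * (t\<^sup>2 / 6 * \<kappa> t + \<bar>exp (- (c * y\<^sup>2 / (2 * n))) - (1 - c * y\<^sup>2 / (2 * n))\<bar>)"
      by (rule mult_left_mono[OF *]) simp
    also have "\<dots> = y\<^sup>2 / 6 * \<kappa> t + real n * \<bar>exp (- (c * y\<^sup>2 / (2 * n))) - (1 - c * y\<^sup>2 / (2 * n))\<bar>"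
      using n by (simp only: distrib_left) (simp add: t2)
    finally show ?thesis unfolding t_def .
  qed
  show "r n y \<le> 2 * c * y\<^sup>2"
  proof (cases "n > 0")
    case True
    have "real n * \<bar>exp (- (c * y\<^sup>2 / (2 * n))) - (1 - c * y\<^sup>2 / (2 * n))\<bar> \<le> real n * (c * y\<^sup>2 / (2 * n))"
      using c0 by (intro mult_left_mono exp_minus_approx) auto
    also have "\<dots> = c * y\<^sup>2 / 2" using True by simp
    finally have b: "real n * \<bar>exp (- (c * y\<^sup>2 / (2 * n))) - (1 - c * y\<^sup>2 / (2 * n))\<bar> \<le> c * y\<^sup>2 / 2" .
    have "y\<^sup>2 / 6 * \<kappa> (y / sqrt n) \<le> y\<^sup>2 / 6 * (6 * c)"
      by (intro mult_left_mono \<kappa>_le) auto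
    then have "r n y \<le> y\<^sup>2 * c + c * y\<^sup>2 / 2" using main[OF True] b by linarith
    also have "\<dots> \<le> 2 * c * y\<^sup>2" using c0 by (simp add: field_simps)
    finally show ?thesis .
  qed (use c0 in \<open>simp add: r_def\<close>)
  have k0: "(\<lambda>n. \<kappa> (y / sqrt (real n))) \<longlonglongrightarrow> expectation (\<lambda>x. 0)"
    unfolding \<kappa>_def
  proof (rule integral_dominated_convergence[where w="\<lambda>x. 6 * (\<eta> x)\<^sup>2"])
    show "AE x in M. (\<lambda>n. min (6 * (\<eta> x)\<^sup>2) (\<bar>y / sqrt (real n)\<bar> * \<bar>\<eta> x\<bar> ^ 3)) \<longlonglongrightarrow> 0"
    proof (rule AE_I2)
      fix x
      have "(\<lambda>n. \<bar>y\<bar> / sqrt (real n)) \<longlonglongrightarrow> 0"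
        by (rule real_tendsto_divide_at_top[OF tendsto_const filterlim_compose[OF sqrt_at_top filterlim_real_sequentially]])
      then have "(\<lambda>n. \<bar>y / sqrt (real n)\<bar> * \<bar>\<eta> x\<bar> ^ 3) \<longlonglongrightarrow> 0 * \<bar>\<eta> x\<bar> ^ 3"
        by (intro tendsto_mult tendsto_const) (simp add: abs_divide)
      then have "(\<lambda>n. min (6 * (\<eta> x)\<^sup>2) (\<bar>y / sqrt (real n)\<bar> * \<bar>\<eta> x\<bar> ^ 3)) \<longlonglongrightarrow> min (6 * (\<eta> x)\<^sup>2) (0 * \<bar>\<eta> x\<bar> ^ 3)"
        by (intro tendsto_min tendsto_const)
      then show "(\<lambda>n. min (6 * (\<eta> x)\<^sup>2) (\<bar>y / sqrt (real n)\<bar> * \<bar>\<eta> x\<bar> ^ 3)) \<longlonglongrightarrow> 0" by simp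
    qed
  qed (use int2 in \<open>auto simp: min_def\<close>)
  have lim: "(\<lambda>n. y\<^sup>2 / 6 * \<kappa> (y / sqrt n) + c\<^sup>2 * y ^ 4 / 4 * inverse (real n)) \<longlonglongrightarrow> y\<^sup>2 / 6 * 0 + c\<^sup>2 * y ^ 4 / 4 * 0"
    using k0 by (intro tendsto_intros lim_inverse_n) simp
  show "(\<lambda>n. r n y) \<longlonglongrightarrow> 0"
  proof (rule tendsto_sandwich[OF _ _ tendsto_const])
    show "\<forall>\<^sub>F n in sequentially. 0 \<le> r n y" by (simp add: r_def)
    show "\<forall>\<^sub>F n in sequentially. r n y \<le> y\<^sup>2 / 6 * \<kappa> (y / sqrt n) + c\<^sup>2 * y ^ 4 / 4 * inverse (real n)"
      using eventually_gt_at_top[of 0]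
    proof eventually_elim
      case (elim n)
      have "real n * \<bar>exp (- (c * y\<^sup>2 / (2 * n))) - (1 - c * y\<^sup>2 / (2 * n))\<bar> \<le> real n * (c * y\<^sup>2 / (2 * n))\<^sup>2"
        using c0 by (intro mult_left_mono exp_minus_approx) auto
      also have "\<dots> = c\<^sup>2 * y ^ 4 / 4 * inverse (real n)"
        using elim by (simp add: power2_eq_square field_simps power4_eq_xxxx)
      finally show ?case using main[OF elim] by linarith
    qed
    show "(\<lambda>n. y\<^sup>2 / 6 * \<kappa> (y / sqrt n) + c\<^sup>2 * y ^ 4 / 4 * inverse (real n)) \<longlonglongrightarrow> 0"
      using lim by simp
  qed
qed

text \<open>The increments are products of an innovation \<open>\<eta> n\<close> independent of
  \<open>F n\<close> and a factor \<open>d n\<close> measurable for \<open>F n\<close>. The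
  innovation is revealed at \<open>F (Suc n)\<close>, so the sum of the first \<open>n\<close>
  products is measurable for \<open>F n\<close>.\<close>

locale martingale_difference = prob_space M for M :: "'a measure" +
  fixes F :: "nat \<Rightarrow> 'a measure" and d \<eta> :: "nat \<Rightarrow> 'a \<Rightarrow> real" and c s :: real
  assumes space_F: "\<And>n. space (F n) = space M"
    and sets_F: "\<And>n. sets (F n) \<subseteq> sets M"
    and mono_F: "\<And>m n. m \<le> n \<Longrightarrow> sets (F m) \<subseteq> sets (F n)"
    and d_F: "\<And>n. d n \<in> borel_measurable (F n)"
    and \<eta>_F: "\<And>n. \<eta> n \<in> borel_measurable (F (Suc n))"
    and ind: "\<And>n. indep_pair M (F n) (\<lambda>\<omega>. \<omega>) borel (\<eta> n)"
    and distr_\<eta>: "\<And>n. distr M borel (\<eta> n) = distr M borel (\<eta> 0)"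
    and distr_d: "\<And>n. distr M borel (d n) = distr M borel (d 0)"
    and int_\<eta>: "integrable M (\<lambda>\<omega>. (\<eta> 0 \<omega>)\<^sup>2)" and mean_\<eta>: "expectation (\<eta> 0) = 0"
    and var_\<eta>: "expectation (\<lambda>\<omega>. (\<eta> 0 \<omega>)\<^sup>2) = c"
    and int_d: "integrable M (\<lambda>\<omega>. (d 0 \<omega>)\<^sup>2)"
    and lln: "AE \<omega> in M. (\<lambda>n. (\<Sum>t<n. (d t \<omega>)\<^sup>2) / n) \<longlonglongrightarrow> s"
begin

lemma meas_F: "f \<in> measurable (F m) N \<Longrightarrow> m \<le> n \<Longrightarrow> f \<in> measurable (F n) N"
  by (rule measurable_larger_algebra[of f "F m" N "F n"]) (simp_all only: space_F mono_F)

lemma meas_M: "f \<in> measurable (F m) N \<Longrightarrow> f \<in> measurable M N"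
  by (rule measurable_larger_algebra[of f "F m" N M]) (simp_all only: space_F sets_F)

lemma d_M[measurable]: "d n \<in> borel_measurable M" using meas_M[OF d_F] .
lemma \<eta>_M[measurable]: "\<eta> n \<in> borel_measurable M" using meas_M[OF \<eta>_F] .

definition \<phi> :: "real \<Rightarrow> complex" where "\<phi> = char (distr M borel (\<eta> 0))"

lemma prob_distr_\<eta>: "prob_space (distr M borel (\<eta> n))"
  by (rule prob_space_distr) simp

lemma \<phi>_measurable[measurable]: "\<phi> \<in> borel_measurable borel"
proof -
  interpret R: real_distribution "distr M borel (\<eta> 0)"
    by (simp add: real_distribution_def real_distribution_axioms_def prob_distr_\<eta>)
  show ?thesis unfolding \<phi>_def by (rule R.char_measurable)
qed

text \<open>Given \<open>F t\<close> the factors \<open>W\<close> and \<open>x\<close> are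
  constants, and integrating out the independent innovation replaces the exponential by the
  characteristic function at \<open>x\<close>.\<close>

lemma conditional_char:
  assumes W: "W \<in> borel_measurable (F t)" and x: "x \<in> borel_measurable (F t)"
    and bd: "\<And>\<omega>. cmod (W \<omega>) \<le> B"
  shows "(\<integral>\<omega>. W \<omega> * iexp (\<eta> t \<omega> * x \<omega>) \<partial>M) = (\<integral>\<omega>. W \<omega> * \<phi> (x \<omega>) \<partial>M)"
proof -
  define k :: "'a \<times> real \<Rightarrow> complex" where "k = (\<lambda>z. W (fst z) * iexp (snd z * x (fst z)))"
  have "k \<in> borel_measurable (F t \<Otimes>\<^sub>M borel)"
    unfolding k_def using W x by measurable
  moreover have "norm (k z) \<le> B" for z unfolding k_def using bd by (simp add: norm_mult)
  ultimately have "(\<integral>\<omega>. k (\<omega>, \<eta> t \<omega>) \<partial>M) = (\<integral>\<omega>. (\<integral>y. k (\<omega>, y) \<partial>distr M borel (\<eta> t)) \<partial>M)"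
    using indep_pair_integral[OF ind[of t], of k B] by simp
  also have "\<dots> = (\<integral>\<omega>. W \<omega> * \<phi> (x \<omega>) \<partial>M)"
    unfolding k_def \<phi>_def char_def distr_\<eta>[of t] by (simp add: mult.commute)
  finally show ?thesis by (simp add: k_def)
qed

text \<open>\<open>x\<close> is either \<open>d t\<close> or, after stopping, 0. At 0 both
  exponentials equal 1, so stopping can only lower the error, and the bound is written with
  \<open>d 0\<close> because all \<open>d t\<close> have the same law.\<close>

lemma one_step_error:
  fixes n :: nat
  assumes W: "W \<in> borel_measurable (F t)" and x: "x \<in> borel_measurable (F t)"
    and bd: "\<And>\<omega>. cmod (W \<omega>) \<le> B" and xd: "\<And>\<omega>. x \<omega> = d t \<omega> \<or> x \<omega> = 0" and n: "n > 0"
  shows "cmod (\<integral>\<omega>. W \<omega> * (iexp (\<eta> t \<omega> * x \<omega> / sqrt n) - exp (- (c * (x \<omega>)\<^sup>2 / (2 * n)))) \<partial>M)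
    \<le> B * (\<integral>\<omega>. cmod (\<phi> (d 0 \<omega> / sqrt n) - exp (- (c * (d 0 \<omega>)\<^sup>2 / (2 * n)))) \<partial>M)"
proof -
  define h where "h = (\<lambda>y::real. cmod (\<phi> (y / sqrt n) - exp (- (c * y\<^sup>2 / (2 * n)))))"
  have h[measurable]: "h \<in> borel_measurable borel" unfolding h_def by measurable
  have B: "B \<ge> 0" using bd[of undefined] norm_ge_zero order_trans by blast
  have c0: "c \<ge> 0" unfolding var_\<eta>[symmetric] by (intro integral_nonneg_AE) auto
  have [measurable]: "W \<in> borel_measurable M" "x \<in> borel_measurable M"
    using meas_M W x by auto
  interpret E: prob_space "distr M borel (\<eta> 0)" by (rule prob_distr_\<eta>)
  interpret R: real_distribution "distr M borel (\<eta> 0)"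
    by (simp add: real_distribution_def real_distribution_axioms_def prob_distr_\<eta>)
  have \<phi>1: "cmod (\<phi> y) \<le> 1" for y unfolding \<phi>_def by (rule R.cmod_char_le_1)
  have e1: "exp (- (c * y\<^sup>2 / (2 * n))) \<le> 1" for y :: real using c0 by simp
  have h2: "h y \<le> 2" for y
  proof -
    have "h y \<le> cmod (\<phi> (y / sqrt n)) + cmod (complex_of_real (exp (- (c * y\<^sup>2 / (2 * n)))))"
      unfolding h_def by (rule norm_triangle_ineq4)
    also have "\<dots> = cmod (\<phi> (y / sqrt n)) + exp (- (c * y\<^sup>2 / (2 * n)))" by (simp del: of_real_exp)
    finally show ?thesis using \<phi>1[of "y / sqrt n"] e1[of y] by linarith
  qed
  have h0: "h y \<ge> 0" for y by (simp add: h_def)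
  have inth: "integrable M (\<lambda>\<omega>. h (f \<omega>))" if [measurable]: "f \<in> borel_measurable M" for f
    by (rule integrable_const_bound[where B=2]) (auto simp: h2 h0)
  have int1: "integrable M (\<lambda>\<omega>. W \<omega> * iexp (\<eta> t \<omega> * x \<omega> / sqrt n))"
    by (rule integrable_const_bound[where B=B]) (auto simp: norm_mult bd)
  have int2: "integrable M (\<lambda>\<omega>. W \<omega> * exp (- (c * (x \<omega>)\<^sup>2 / (2 * n))))"
  proof (rule integrable_const_bound[where B="B * 1"])
    show "AE \<omega> in M. cmod (W \<omega> * exp (- (c * (x \<omega>)\<^sup>2 / (2 * n)))) \<le> B * 1"
      unfolding norm_mult using e1 bd B by (intro AE_I2 mult_mono) (auto simp del: of_real_exp)
  qed auto
  have int3: "integrable M (\<lambda>\<omega>. W \<omega> * \<phi> (x \<omega> / sqrt n))"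
  proof (rule integrable_const_bound[where B="B * 1"])
    show "AE \<omega> in M. cmod (W \<omega> * \<phi> (x \<omega> / sqrt n)) \<le> B * 1"
      unfolding norm_mult using \<phi>1 bd B by (intro AE_I2 mult_mono) auto
  qed auto
  have "(\<integral>\<omega>. W \<omega> * (iexp (\<eta> t \<omega> * x \<omega> / sqrt n) - exp (- (c * (x \<omega>)\<^sup>2 / (2 * n)))) \<partial>M)
     = (\<integral>\<omega>. W \<omega> * iexp (\<eta> t \<omega> * (x \<omega> / sqrt n)) \<partial>M) - (\<integral>\<omega>. W \<omega> * exp (- (c * (x \<omega>)\<^sup>2 / (2 * n))) \<partial>M)"
    using int1 int2 by (simp add: right_diff_distrib)
  also have "(\<integral>\<omega>. W \<omega> * iexp (\<eta> t \<omega> * (x \<omega> / sqrt n)) \<partial>M) = (\<integral>\<omega>. W \<omega> * \<phi> (x \<omega> / sqrt n) \<partial>M)"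
    by (rule conditional_char[OF W _ bd]) (use x in measurable)
  also have "\<dots> - (\<integral>\<omega>. W \<omega> * exp (- (c * (x \<omega>)\<^sup>2 / (2 * n))) \<partial>M)
     = (\<integral>\<omega>. W \<omega> * (\<phi> (x \<omega> / sqrt n) - exp (- (c * (x \<omega>)\<^sup>2 / (2 * n)))) \<partial>M)"
    using int3 int2 by (simp add: right_diff_distrib)
  finally have "cmod (\<integral>\<omega>. W \<omega> * (iexp (\<eta> t \<omega> * x \<omega> / sqrt n) - exp (- (c * (x \<omega>)\<^sup>2 / (2 * n)))) \<partial>M)
     \<le> (\<integral>\<omega>. cmod (W \<omega> * (\<phi> (x \<omega> / sqrt n) - exp (- (c * (x \<omega>)\<^sup>2 / (2 * n))))) \<partial>M)"
    by (simp only:) (rule integral_norm_bound)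
  also have "\<dots> \<le> (\<integral>\<omega>. B * h (d t \<omega>) \<partial>M)"
  proof (rule integral_mono_AE)
    show "integrable M (\<lambda>\<omega>. cmod (W \<omega> * (\<phi> (x \<omega> / sqrt n) - exp (- (c * (x \<omega>)\<^sup>2 / (2 * n))))))"
      using int3 int2 by (intro integrable_norm) (simp add: right_diff_distrib)
    show "integrable M (\<lambda>\<omega>. B * h (d t \<omega>))" using inth by simp
    have hx: "h (x \<omega>) \<le> h (d t \<omega>)" for \<omega>
    proof -
      have "\<phi> 0 = 1" unfolding \<phi>_def by (rule R.char_zero)
      then have "h 0 = 0" by (simp add: h_def)
      then show ?thesis using xd[of \<omega>] h0 by auto
    qed
    show "AE \<omega> in M. cmod (W \<omega> * (\<phi> (x \<omega> / sqrt n) - exp (- (c * (x \<omega>)\<^sup>2 / (2 * n))))) \<le> B * h (d t \<omega>)"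
    proof (rule AE_I2)
      fix \<omega>
      have "cmod (W \<omega> * (\<phi> (x \<omega> / sqrt n) - exp (- (c * (x \<omega>)\<^sup>2 / (2 * n))))) = cmod (W \<omega>) * h (x \<omega>)"
        by (simp add: norm_mult h_def)
      also have "\<dots> \<le> B * h (d t \<omega>)" using bd hx B h0 by (intro mult_mono) auto
      finally show "cmod (W \<omega> * (\<phi> (x \<omega> / sqrt n) - exp (- (c * (x \<omega>)\<^sup>2 / (2 * n))))) \<le> B * h (d t \<omega>)" .
    qed
  qed
  also have "\<dots> = B * (\<integral>\<omega>. h (d t \<omega>) \<partial>M)" by simp
  also have "(\<integral>\<omega>. h (d t \<omega>) \<partial>M) = (\<integral>\<omega>. h (d 0 \<omega>) \<partial>M)"
    using integral_distr[of "d t" M borel h] integral_distr[of "d 0" M borel h] distr_d[of t] by simp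
  finally show ?thesis unfolding h_def .
qed

text \<open>The compensated exponential \<open>Z n t\<close>, with exponent
  \<open>i S / sqrt n + V / 2\<close>, keeps its expectation near 1: each of the \<open>n\<close>
  steps costs \<open>exp (K / 2) * a n\<close>, and \<open>n * a n\<close> tends to 0. Since
  \<open>V n n\<close> converges to \<open>c * s\<close> almost surely, the compensator can finally
  be replaced by its constant limit.\<close>

theorem martingale_clt:
  "(\<lambda>n. CLINT \<omega>|M. iexp ((\<Sum>t<n. \<eta> t \<omega> * d t \<omega>) / sqrt n)) \<longlonglongrightarrow> complex_of_real (exp (- (c * s / 2)))"
proof -
  have c0: "c \<ge> 0" unfolding var_\<eta>[symmetric] by (intro integral_nonneg_AE) auto
  have "AE \<omega> in M. s \<ge> 0"
    using lln by eventually_elim (rule LIMSEQ_le_const, assumption, auto intro!: sum_nonneg divide_nonneg_nonneg)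
  then have s0: "s \<ge> 0" by simp
  \<comment> \<open>The margin 1 above the limit \<open>c * s\<close> makes the stopping eventually
    inactive on almost every path.\<close>
  define K where "K = c * s + 1"
  have K0: "K > 0" using c0 s0 by (simp add: K_def add_nonneg_pos)
  \<comment> \<open>Stopping inspects the squares up to and including time \<open>t\<close>: they
    are known to \<open>F t\<close>, and the stopped sum of squares never passes the threshold,
    which bounds \<open>Z\<close>.\<close>
  define e where "e = (\<lambda>(n::nat) t \<omega>. if c * (\<Sum>i\<le>t. (d i \<omega>)\<^sup>2) \<le> n * K then d t \<omega> else 0)"
  define S where "S = (\<lambda>n t \<omega>. \<Sum>i<t. \<eta> i \<omega> * e n i \<omega>)"
  define V where "V = (\<lambda>n t \<omega>. c / real n * (\<Sum>i<t. (e n i \<omega>)\<^sup>2))"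
  define Z where "Z = (\<lambda>n t \<omega>. iexp (S n t \<omega> / sqrt (real n)) * complex_of_real (exp (V n t \<omega> / 2)))"
  have e_F: "e n t \<in> borel_measurable (F t)" for n t
  proof -
    have [measurable]: "d i \<in> borel_measurable (F t)" if "i \<le> t" for i
      using meas_F[OF d_F that] .
    show ?thesis unfolding e_def by measurable
  qed
  have S_F: "S n t \<in> borel_measurable (F t)" for n t
    unfolding S_def by (intro borel_measurable_sum borel_measurable_times meas_F[OF \<eta>_F] meas_F[OF e_F]) auto
  have V_F: "V n (Suc t) \<in> borel_measurable (F t)" for n t
    unfolding V_def
    by (intro borel_measurable_sum borel_measurable_times borel_measurable_power borel_measurable_const meas_F[OF e_F]) auto
  have [measurable]: "e n t \<in> borel_measurable M" for n t using meas_M[OF e_F] .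
  have [measurable]: "S n t \<in> borel_measurable M" for n t using meas_M[OF S_F] .
  have [measurable]: "V n t \<in> borel_measurable M" for n t unfolding V_def by measurable
  have [measurable]: "Z n t \<in> borel_measurable M" for n t unfolding Z_def by measurable
  have e_le: "(e n t \<omega>)\<^sup>2 \<le> (d t \<omega>)\<^sup>2" for n t \<omega> unfolding e_def by auto
  have Vsum: "c * (\<Sum>i<t. (e n i \<omega>)\<^sup>2) \<le> n * K" for n t \<omega>
  proof (induction t)
    case (Suc t)
    show ?case
    proof (cases "c * (\<Sum>i\<le>t. (d i \<omega>)\<^sup>2) \<le> n * K")
      case True
      have "c * (\<Sum>i<Suc t. (e n i \<omega>)\<^sup>2) \<le> c * (\<Sum>i<Suc t. (d i \<omega>)\<^sup>2)"
        by (intro mult_left_mono sum_mono e_le c0)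
      then show ?thesis using True by (simp add: lessThan_Suc_atMost)
    next
      case False
      then show ?thesis using Suc by (simp add: e_def)
    qed
  qed (use K0 in simp)
  have V_le: "V n t \<omega> \<le> K" if "n > 0" for n t \<omega>
  proof -
    have "c * (\<Sum>i<t. (e n i \<omega>)\<^sup>2) \<le> n * K" by (rule Vsum)
    then show ?thesis using that unfolding V_def by (simp add: field_simps)
  qed
  have Z_bd: "cmod (Z n t \<omega>) \<le> exp (K / 2)" if "n > 0" for n t \<omega>
    unfolding Z_def norm_mult using V_le[OF that, of t \<omega>] by (simp del: of_real_exp)
  have int_Z: "integrable M (Z n t)" if "n > 0" for n t
    by (rule integrable_const_bound[where B="exp (K / 2)"]) (use Z_bd[OF that] in auto)
  define a where "a = (\<lambda>n. \<integral>\<omega>. cmod (\<phi> (d 0 \<omega> / sqrt (real n)) - exp (- (c * (d 0 \<omega>)\<^sup>2 / (2 * real n)))) \<partial>M)"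
  \<comment> \<open>Replacing the law of the innovation by a Gaussian one costs
    \<open>o(1 / n)\<close> for each fixed argument; the quadratic majorant allows this to be
    averaged over \<open>d 0\<close>.\<close>
  have na: "(\<lambda>n. real n * a n) \<longlonglongrightarrow> 0"
  proof -
    define r where "r = (\<lambda>n y. real n * cmod (\<phi> (y / sqrt (real n)) - exp (- (c * y\<^sup>2 / (2 * real n)))))"
    have "(\<lambda>n. \<integral>\<omega>. r n (d 0 \<omega>) \<partial>M) \<longlonglongrightarrow> (\<integral>\<omega>. 0 \<partial>M)"
    proof (rule integral_dominated_convergence[where w="\<lambda>\<omega>. 2 * c * (d 0 \<omega>)\<^sup>2"])
      show "AE \<omega> in M. (\<lambda>n. r n (d 0 \<omega>)) \<longlonglongrightarrow> 0"
        unfolding r_def \<phi>_def using char_scaled_error(2)[OF \<eta>_M int_\<eta> mean_\<eta> var_\<eta>] by (intro AE_I2) simp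
      fix n
      have "r n y \<le> 2 * c * y\<^sup>2" for y
        unfolding r_def \<phi>_def using char_scaled_error(1)[OF \<eta>_M int_\<eta> mean_\<eta> var_\<eta>] by simp
      then show "AE \<omega> in M. norm (r n (d 0 \<omega>)) \<le> 2 * c * (d 0 \<omega>)\<^sup>2"
        by (intro AE_I2) (simp add: r_def)
      show "(\<lambda>\<omega>. r n (d 0 \<omega>)) \<in> borel_measurable M" unfolding r_def by measurable
    qed (use int_d in auto)
    moreover have "(\<integral>\<omega>. r n (d 0 \<omega>) \<partial>M) = n * a n" for n unfolding r_def a_def by simp
    ultimately show ?thesis by simp
  qed
  have step: "cmod ((\<integral>\<omega>. Z n (Suc t) \<omega> \<partial>M) - (\<integral>\<omega>. Z n t \<omega> \<partial>M)) \<le> exp (K / 2) * a n" if n: "n > 0" for n t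
  proof -
    \<comment> \<open>The compensator \<open>V n (Suc t)\<close> is already known at time
      \<open>t\<close>. Both \<open>Z n t\<close> and \<open>Z n (Suc t)\<close> are multiples of
      \<open>W\<close>, which isolates the single new innovation.\<close>
    define W where "W = (\<lambda>\<omega>. iexp (S n t \<omega> / sqrt (real n)) * complex_of_real (exp (V n (Suc t) \<omega> / 2)))"
    have W: "W \<in> borel_measurable (F t)"
    proof -
      have [measurable]: "S n t \<in> borel_measurable (F t)" "V n (Suc t) \<in> borel_measurable (F t)"
        using S_F V_F by auto
      show ?thesis unfolding W_def by measurable
    qed
    have Wb: "cmod (W \<omega>) \<le> exp (K / 2)" for \<omega>
      unfolding W_def norm_mult using V_le[OF n, of "Suc t" \<omega>] by (simp del: of_real_exp)
    have diff: "Z n (Suc t) \<omega> - Z n t \<omega> =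
        W \<omega> * (iexp (\<eta> t \<omega> * e n t \<omega> / sqrt n) - exp (- (c * (e n t \<omega>)\<^sup>2 / (2 * n))))" for \<omega>
    proof -
      have Vt: "V n t \<omega> / 2 = V n (Suc t) \<omega> / 2 + - (c * (e n t \<omega>)\<^sup>2 / (2 * n))"
        unfolding V_def using n by (simp add: field_simps)
      have "Z n t \<omega> = W \<omega> * complex_of_real (exp (- (c * (e n t \<omega>)\<^sup>2 / (2 * n))))"
        unfolding Z_def W_def Vt exp_add by simp
      moreover have "Z n (Suc t) \<omega> = W \<omega> * iexp (\<eta> t \<omega> * e n t \<omega> / sqrt n)"
        unfolding Z_def W_def S_def by (simp add: add_divide_distrib distrib_left exp_add)
      ultimately show ?thesis by (simp add: right_diff_distrib)
    qed
    have "(\<integral>\<omega>. Z n (Suc t) \<omega> \<partial>M) - (\<integral>\<omega>. Z n t \<omega> \<partial>M) =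
       (\<integral>\<omega>. W \<omega> * (iexp (\<eta> t \<omega> * e n t \<omega> / sqrt n) - exp (- (c * (e n t \<omega>)\<^sup>2 / (2 * n)))) \<partial>M)"
      unfolding diff[symmetric] using int_Z[OF n] by simp
    then show ?thesis
      using one_step_error[OF W e_F Wb _ n, of n] unfolding a_def by (simp add: e_def)
  qed
  \<comment> \<open>The steps telescope from \<open>Z n 0 = 1\<close>.\<close>
  have tele: "cmod ((\<integral>\<omega>. Z n t \<omega> \<partial>M) - 1) \<le> t * (exp (K / 2) * a n)" if n: "n > 0" for n t
  proof (induction t)
    case 0
    show ?case by (simp add: Z_def S_def V_def prob_space)
  next
    case (Suc t)
    have "cmod ((\<integral>\<omega>. Z n (Suc t) \<omega> \<partial>M) - 1) \<le> cmod ((\<integral>\<omega>. Z n (Suc t) \<omega> \<partial>M) - (\<integral>\<omega>. Z n t \<omega> \<partial>M))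
       + cmod ((\<integral>\<omega>. Z n t \<omega> \<partial>M) - 1)"
      using norm_triangle_ineq[of "(\<integral>\<omega>. Z n (Suc t) \<omega> \<partial>M) - (\<integral>\<omega>. Z n t \<omega> \<partial>M)" "(\<integral>\<omega>. Z n t \<omega> \<partial>M) - 1"] by simp
    then show ?case using step[OF n, of t] Suc by (simp add: distrib_right)
  qed
  have limZ: "(\<lambda>n. \<integral>\<omega>. Z n n \<omega> \<partial>M) \<longlonglongrightarrow> 1"
  proof (rule LIM_zero_cancel, rule Lim_null_comparison)
    show "(\<lambda>n. exp (K / 2) * (real n * a n)) \<longlonglongrightarrow> 0"
      using tendsto_mult_right_zero[OF na] by simp
    show "\<forall>\<^sub>F n in sequentially. norm ((\<integral>\<omega>. Z n n \<omega> \<partial>M) - 1) \<le> exp (K / 2) * (real n * a n)"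
      using eventually_gt_at_top[of 0] by eventually_elim (use tele in \<open>simp add: mult_ac\<close>)
  qed
  define Tn where "Tn = (\<lambda>n \<omega>. (\<Sum>t<n. \<eta> t \<omega> * d t \<omega>) / sqrt (real n))"
  have [measurable]: "Tn n \<in> borel_measurable M" for n unfolding Tn_def by measurable
  have Tb: "cmod (iexp (Tn n \<omega>) * complex_of_real (exp (c * s / 2))) = exp (c * s / 2)" for n \<omega>
    by (simp add: norm_mult del: of_real_exp)
  have int_T: "integrable M (\<lambda>\<omega>. iexp (Tn n \<omega>) * complex_of_real (exp (c * s / 2)))" for n
    by (rule integrable_const_bound[where B="exp (c * s / 2)"]) (use Tb in auto)
  have "(\<lambda>n. \<integral>\<omega>. (if n = 0 then 0 else iexp (Tn n \<omega>) * complex_of_real (exp (c * s / 2)) - Z n n \<omega>) \<partial>M) \<longlonglongrightarrow> (\<integral>\<omega>. 0 \<partial>M)"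
  proof (rule integral_dominated_convergence[where w="\<lambda>_. exp (c * s / 2) + exp (K / 2)"])
    show "AE \<omega> in M. (\<lambda>n. if n = 0 then 0 else iexp (Tn n \<omega>) * complex_of_real (exp (c * s / 2)) - Z n n \<omega>) \<longlonglongrightarrow> 0"
      using lln
    proof eventually_elim
      case (elim \<omega>)
      define v where "v = (\<lambda>n. (\<Sum>t<n. (d t \<omega>)\<^sup>2) / real n)"
      have v: "(\<lambda>n. c * v n) \<longlonglongrightarrow> c * s" unfolding v_def by (intro tendsto_mult tendsto_const elim)
      then have ev: "\<forall>\<^sub>F n in sequentially. c * v n < K"
        by (rule order_tendstoD) (simp add: K_def)
      show ?case
      proof (rule Lim_null_comparison)
        have "(\<lambda>n. exp (c * s / 2) - exp (c * v n / 2)) \<longlonglongrightarrow> exp (c * s / 2) - exp (c * s / 2)"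
          by (intro tendsto_intros v) auto
        then show "(\<lambda>n. \<bar>exp (c * s / 2) - exp (c * v n / 2)\<bar>) \<longlonglongrightarrow> 0"
          by (intro tendsto_rabs_zero) simp
        show "\<forall>\<^sub>F n in sequentially. norm (if n = 0 then 0 else iexp (Tn n \<omega>) * complex_of_real (exp (c * s / 2)) - Z n n \<omega>)
            \<le> \<bar>exp (c * s / 2) - exp (c * v n / 2)\<bar>"
          using ev eventually_gt_at_top[of 0]
        proof eventually_elim
          case (elim n)
          have le: "c * (\<Sum>t<n. (d t \<omega>)\<^sup>2) \<le> n * K" using elim by (simp add: v_def field_simps)
          have ed: "e n i \<omega> = d i \<omega>" if "i < n" for i
          proof -
            have "(\<Sum>t\<le>i. (d t \<omega>)\<^sup>2) \<le> (\<Sum>t<n. (d t \<omega>)\<^sup>2)"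
              using that by (intro sum_mono2) auto
            then have "c * (\<Sum>t\<le>i. (d t \<omega>)\<^sup>2) \<le> n * K"
              using mult_left_mono[OF _ c0] le by (meson order_trans)
            then show ?thesis by (simp add: e_def)
          qed
          have Zn: "Z n n \<omega> = iexp (Tn n \<omega>) * complex_of_real (exp (c * v n / 2))"
            unfolding Z_def S_def V_def Tn_def v_def using ed by simp
          have "norm (iexp (Tn n \<omega>) * complex_of_real (exp (c * s / 2)) - Z n n \<omega>)
             = norm (iexp (Tn n \<omega>) * complex_of_real (exp (c * s / 2) - exp (c * v n / 2)))"
            unfolding Zn by (simp add: right_diff_distrib)
          also have "\<dots> = \<bar>exp (c * s / 2) - exp (c * v n / 2)\<bar>"
            unfolding norm_mult norm_of_real by simp
          finally show ?case using elim by simp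
        qed
      qed
    qed
    fix n
    show "AE \<omega> in M. norm (if n = 0 then 0 else iexp (Tn n \<omega>) * complex_of_real (exp (c * s / 2)) - Z n n \<omega>) \<le> exp (c * s / 2) + exp (K / 2)"
    proof (rule AE_I2)
      fix \<omega>
      show "norm (if n = 0 then 0 else iexp (Tn n \<omega>) * complex_of_real (exp (c * s / 2)) - Z n n \<omega>) \<le> exp (c * s / 2) + exp (K / 2)"
      proof (cases "n = 0")
        case False
        have "norm (iexp (Tn n \<omega>) * complex_of_real (exp (c * s / 2)) - Z n n \<omega>)
           \<le> norm (iexp (Tn n \<omega>) * complex_of_real (exp (c * s / 2))) + norm (Z n n \<omega>)"
          by (rule norm_triangle_ineq4)
        then show ?thesis using Tb[of n \<omega>] Z_bd[of n n \<omega>] False by simp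
      qed (simp add: add_nonneg_nonneg)
    qed
  qed auto
  then have "(\<lambda>n. (\<integral>\<omega>. (if n = 0 then 0 else iexp (Tn n \<omega>) * complex_of_real (exp (c * s / 2)) - Z n n \<omega>) \<partial>M) + (\<integral>\<omega>. Z n n \<omega> \<partial>M)) \<longlonglongrightarrow> 0 + 1"
    using limZ by (intro tendsto_add) simp_all
  note this[unfolded add_0]
  then have "(\<lambda>n. (\<integral>\<omega>. iexp (Tn n \<omega>) \<partial>M) * complex_of_real (exp (c * s / 2))) \<longlonglongrightarrow> 1"
  proof (rule Lim_transform_eventually)
    show "\<forall>\<^sub>F n in sequentially. (\<integral>\<omega>. (if n = 0 then 0 else iexp (Tn n \<omega>) * complex_of_real (exp (c * s / 2)) - Z n n \<omega>) \<partial>M) + (\<integral>\<omega>. Z n n \<omega> \<partial>M)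
      = (\<integral>\<omega>. iexp (Tn n \<omega>) \<partial>M) * complex_of_real (exp (c * s / 2))"
      using eventually_gt_at_top[of 0]
    proof eventually_elim
      case (elim n)
      then have "(\<integral>\<omega>. (if n = 0 then 0 else iexp (Tn n \<omega>) * complex_of_real (exp (c * s / 2)) - Z n n \<omega>) \<partial>M)
         = (\<integral>\<omega>. iexp (Tn n \<omega>) * complex_of_real (exp (c * s / 2)) \<partial>M) - (\<integral>\<omega>. Z n n \<omega> \<partial>M)"
        using int_T int_Z by (simp del: of_real_exp)
      then show ?case by (simp del: of_real_exp)
    qed
  qed
  then have "(\<lambda>n. (\<integral>\<omega>. iexp (Tn n \<omega>) \<partial>M) * complex_of_real (exp (c * s / 2)) * complex_of_real (exp (- (c * s / 2)))) \<longlonglongrightarrow> 1 * complex_of_real (exp (- (c * s / 2)))"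
    by (intro tendsto_mult tendsto_const)
  moreover have "z * complex_of_real (exp (c * s / 2)) * complex_of_real (exp (- (c * s / 2))) = z" for z
  proof -
    have "complex_of_real (exp (c * s / 2)) * complex_of_real (exp (- (c * s / 2))) = 1"
      unfolding of_real_mult[symmetric] exp_add[symmetric] by simp
    then show ?thesis by (simp add: mult.assoc)
  qed
  ultimately show ?thesis by (simp add: Tn_def)
qed


section \<open>Orthogonality of the increments and second moments\<close>

lemma F_indep_integral:
  fixes f :: "'a \<Rightarrow> real" and k :: "real \<Rightarrow> real"
  assumes f: "f \<in> borel_measurable (F t)" and k: "k \<in> borel_measurable borel"
    and i: "integrable M f" "integrable M (\<lambda>\<omega>. k (\<eta> t \<omega>))"
  shows "expectation (\<lambda>\<omega>. f \<omega> * k (\<eta> t \<omega>)) = expectation f * expectation (\<lambda>\<omega>. k (\<eta> t \<omega>))"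
    "integrable M (\<lambda>\<omega>. f \<omega> * k (\<eta> t \<omega>))"
proof -
  have "indep_pair M borel (\<lambda>\<omega>. f \<omega>) borel (\<lambda>\<omega>. k (\<eta> t \<omega>))" by (rule indep_pair_compose[OF ind f k])
  then have iv: "indep_var borel f borel (\<lambda>\<omega>. k (\<eta> t \<omega>))" by (simp add: indep_pair_iff_indep_var)
  show "expectation (\<lambda>\<omega>. f \<omega> * k (\<eta> t \<omega>)) = expectation f * expectation (\<lambda>\<omega>. k (\<eta> t \<omega>))"
    by (rule indep_var_lebesgue_integral[OF iv i])
  show "integrable M (\<lambda>\<omega>. f \<omega> * k (\<eta> t \<omega>))" by (rule indep_var_integrable[OF iv i])
qed

lemma \<eta>_moments: "integrable M (\<eta> t)" "expectation (\<eta> t) = 0"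
  "integrable M (\<lambda>\<omega>. (\<eta> t \<omega>)\<^sup>2)" "expectation (\<lambda>\<omega>. (\<eta> t \<omega>)\<^sup>2) = c"
proof -
  have i: "integrable M (\<lambda>\<omega>. k (\<eta> t \<omega>)) \<longleftrightarrow> integrable M (\<lambda>\<omega>. k (\<eta> 0 \<omega>))"
    and e: "expectation (\<lambda>\<omega>. k (\<eta> t \<omega>)) = expectation (\<lambda>\<omega>. k (\<eta> 0 \<omega>))"
    if "k \<in> borel_measurable borel" for k :: "real \<Rightarrow> real"
    using integrable_distr_eq[OF \<eta>_M that, of t] integrable_distr_eq[OF \<eta>_M that, of 0]
      integral_distr[OF \<eta>_M that, of t] integral_distr[OF \<eta>_M that, of 0] distr_\<eta>[of t] by auto
  show 2: "integrable M (\<lambda>\<omega>. (\<eta> t \<omega>)\<^sup>2)" "expectation (\<lambda>\<omega>. (\<eta> t \<omega>)\<^sup>2) = c"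
    using i[of "\<lambda>x. x\<^sup>2"] e[of "\<lambda>x. x\<^sup>2"] int_\<eta> var_\<eta> by auto
  show "integrable M (\<eta> t)" by (rule square_integrable_imp_integrable[OF \<eta>_M 2(1)])
  show "expectation (\<eta> t) = 0" using e[of "\<lambda>x. x"] mean_\<eta> by simp
qed

lemma d_moments: "integrable M (\<lambda>\<omega>. (d t \<omega>)\<^sup>2)" "expectation (\<lambda>\<omega>. (d t \<omega>)\<^sup>2) = expectation (\<lambda>\<omega>. (d 0 \<omega>)\<^sup>2)"
proof -
  have k: "(\<lambda>x::real. x\<^sup>2) \<in> borel_measurable borel" by measurable
  show "integrable M (\<lambda>\<omega>. (d t \<omega>)\<^sup>2)" "expectation (\<lambda>\<omega>. (d t \<omega>)\<^sup>2) = expectation (\<lambda>\<omega>. (d 0 \<omega>)\<^sup>2)"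
    using integrable_distr_eq[OF d_M k, of t] integrable_distr_eq[OF d_M k, of 0]
      integral_distr[OF d_M k, of t] integral_distr[OF d_M k, of 0] distr_d[of t] int_d by auto
qed

text \<open>The cross term is \<open>2 * S * d n\<close>, known to \<open>F n\<close>, times the
  centred \<open>\<eta> n\<close>, so increments are orthogonal. This later bounds the second
  moments of the normalised score and gives tightness.\<close>

lemma martingale_second_moment:
  "integrable M (\<lambda>\<omega>. (\<Sum>t<n. \<eta> t \<omega> * d t \<omega>)\<^sup>2)"
  "expectation (\<lambda>\<omega>. (\<Sum>t<n. \<eta> t \<omega> * d t \<omega>)\<^sup>2) = n * (c * expectation (\<lambda>\<omega>. (d 0 \<omega>)\<^sup>2))"
proof (induction n)
  case (Suc n)
  define S where "S = (\<lambda>\<omega>. \<Sum>t<n. \<eta> t \<omega> * d t \<omega>)"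
  have SF: "S \<in> borel_measurable (F n)"
    unfolding S_def by (intro borel_measurable_sum borel_measurable_times meas_F[OF \<eta>_F] meas_F[OF d_F]) auto
  have [measurable]: "S \<in> borel_measurable M" by (rule meas_M[OF SF])
  have S2: "integrable M (\<lambda>\<omega>. (S \<omega>)\<^sup>2)" using Suc by (simp add: S_def)
  have Sd: "integrable M (\<lambda>\<omega>. 2 * (S \<omega> * d n \<omega>))"
  proof (rule Bochner_Integration.integrable_bound)
    show "integrable M (\<lambda>\<omega>. (S \<omega>)\<^sup>2 + (d n \<omega>)\<^sup>2)" using S2 d_moments(1) by simp
    show "AE \<omega> in M. norm (2 * (S \<omega> * d n \<omega>)) \<le> norm ((S \<omega>)\<^sup>2 + (d n \<omega>)\<^sup>2)"
    proof (rule AE_I2)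
      fix \<omega>
      have "2 * \<bar>S \<omega>\<bar> * \<bar>d n \<omega>\<bar> \<le> \<bar>S \<omega>\<bar>\<^sup>2 + \<bar>d n \<omega>\<bar>\<^sup>2" by (rule sum_squares_bound)
      then show "norm (2 * (S \<omega> * d n \<omega>)) \<le> norm ((S \<omega>)\<^sup>2 + (d n \<omega>)\<^sup>2)" by (simp add: abs_mult mult.assoc)
    qed
  qed measurable
  have f1: "(\<lambda>\<omega>. 2 * (S \<omega> * d n \<omega>)) \<in> borel_measurable (F n)" using SF d_F[of n] by measurable
  have f2: "(\<lambda>\<omega>. (d n \<omega>)\<^sup>2) \<in> borel_measurable (F n)" using d_F[of n] by measurable
  note A = F_indep_integral[where k="\<lambda>x. x", OF f1 _ Sd \<eta>_moments(1)]
  note C = F_indep_integral[where k="\<lambda>x. x\<^sup>2", OF f2 _ d_moments(1) \<eta>_moments(3)]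
  have eq: "(\<Sum>t<Suc n. \<eta> t \<omega> * d t \<omega>)\<^sup>2 = (S \<omega>)\<^sup>2 + 2 * (S \<omega> * d n \<omega>) * \<eta> n \<omega> + (d n \<omega>)\<^sup>2 * (\<eta> n \<omega>)\<^sup>2" for \<omega>
    by (simp add: S_def power2_sum power_mult_distrib mult_ac)
  show "integrable M (\<lambda>\<omega>. (\<Sum>t<Suc n. \<eta> t \<omega> * d t \<omega>)\<^sup>2)" unfolding eq using S2 A C by simp
  have "expectation (\<lambda>\<omega>. (\<Sum>t<Suc n. \<eta> t \<omega> * d t \<omega>)\<^sup>2) = expectation (\<lambda>\<omega>. (S \<omega>)\<^sup>2) + 0 + expectation (\<lambda>\<omega>. (d 0 \<omega>)\<^sup>2) * c"
    unfolding eq using S2 A C \<eta>_moments(2,4)[of n] d_moments(2)[of n] by simp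
  then show "expectation (\<lambda>\<omega>. (\<Sum>t<Suc n. \<eta> t \<omega> * d t \<omega>)\<^sup>2) = Suc n * (c * expectation (\<lambda>\<omega>. (d 0 \<omega>)\<^sup>2))"
    using Suc(2) by (simp add: S_def algebra_simps)
qed simp_all

end

section \<open>Convergence in law and Gaussian vectors\<close>

text \<open>By linearity, convergence of characteristic functions is convergence of expectations on
  this class; closure under products makes it large enough for approximation.\<close>

inductive trig_poly :: "(real ^ 'd::finite \<Rightarrow> complex) \<Rightarrow> bool" where
  trig_poly_base: "trig_poly (\<lambda>x. c * iexp (v \<bullet> x))"
| trig_poly_add: "trig_poly f \<Longrightarrow> trig_poly g \<Longrightarrow> trig_poly (\<lambda>x. f x + g x)"

lemma trig_poly_const: "trig_poly (\<lambda>x. c)"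
  using trig_poly_base[of c 0] by simp

lemma trig_poly_mult:
  assumes "trig_poly f" "trig_poly g"
  shows "trig_poly (\<lambda>x. f x * g x)"
  using assms(1)
proof induction
  case (trig_poly_base c v)
  show ?case using assms(2)
  proof induction
    case (trig_poly_base c' v')
    have "(\<lambda>x. c * iexp (v \<bullet> x) * (c' * iexp (v' \<bullet> x))) = (\<lambda>x. (c * c') * iexp ((v + v') \<bullet> x))"
      by (simp add: inner_add_left distrib_left exp_add mult_ac)
    then show ?case using trig_poly.trig_poly_base[of "c * c'" "v + v'"] by simp
  next
    case (trig_poly_add f g)
    then show ?case using trig_poly.trig_poly_add by (simp add: distrib_left)
  qed
next
  case (trig_poly_add f1 f2)
  then show ?case using trig_poly.trig_poly_add by (simp add: distrib_right)
qed

lemma trig_poly_sum: "finite I \<Longrightarrow> (\<And>i. i \<in> I \<Longrightarrow> trig_poly (f i)) \<Longrightarrow> trig_poly (\<lambda>x. \<Sum>i\<in>I. f i x)"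
  by (induction I rule: finite_induct) (auto intro: trig_poly_const trig_poly_add)

lemma trig_poly_sin: "trig_poly (\<lambda>x. complex_of_real (sin (x $ i / L)))"
proof -
  have "complex_of_real (sin t) = (- \<i> / 2) * iexp t + (\<i> / 2) * iexp (- t)" for t
    by (simp add: sin_of_real[symmetric] sin_exp_eq field_simps)
  then have "(\<lambda>x. complex_of_real (sin (x $ i / L))) =
    (\<lambda>x. (- \<i> / 2) * iexp (axis i (1 / L) \<bullet> x) + (\<i> / 2) * iexp (axis i (- 1 / L) \<bullet> x))"
    by (simp add: inner_axis' fun_eq_iff)
  then show ?thesis by (simp only:) (rule trig_poly_add[OF trig_poly_base trig_poly_base])
qed

text \<open>A bounded substitute for the identity, uniformly close to it on any fixed ball once
  \<open>L\<close> is large. Its coordinates are trigonometric polynomials, so every polynomial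
  composed with it is a trigonometric polynomial; this links Weierstrass approximation to
  characteristic functions.\<close>

definition sin_cutoff :: "real \<Rightarrow> real ^ 'd::finite \<Rightarrow> real ^ 'd" where
  "sin_cutoff L x = (\<chi> i. L * sin (x $ i / L))"

lemma trig_poly_real_polynomial:
  fixes g :: "real ^ 'd::finite \<Rightarrow> real"
  assumes "real_polynomial_function g"
  shows "trig_poly (\<lambda>x. complex_of_real (g (sin_cutoff L x)))"
  using assms
proof induction
  case (linear f)
  interpret f: bounded_linear f by fact
  have f_eq: "f y = (\<Sum>i\<in>UNIV. y $ i * f (axis i 1))" for y :: "real ^ 'd"
  proof -
    have "f y = f (\<Sum>i\<in>UNIV. y $ i *\<^sub>R axis i 1)"
      using basis_expansion[of y] by (simp add: scalar_mult_eq_scaleR)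
    then show ?thesis by (simp add: f.sum f.scaleR)
  qed
  have "(\<lambda>x. complex_of_real (f (sin_cutoff L x))) =
     (\<lambda>x. \<Sum>i\<in>UNIV. complex_of_real (L * f (axis i 1)) * complex_of_real (sin (x $ i / L)))"
    by (rule ext, subst f_eq) (simp add: sin_cutoff_def mult_ac)
  then show ?case
    by (simp only:) (intro trig_poly_sum trig_poly_mult trig_poly_const trig_poly_sin finite)
next
  case (mult f g) then show ?case using trig_poly_mult[OF mult.IH] by simp
qed (auto intro: trig_poly_const trig_poly_add)

lemma norm_sin_cutoff: "L \<ge> 0 \<Longrightarrow> norm (sin_cutoff L (x :: real ^ 'd::finite)) \<le> real CARD('d) * L"
proof -
  assume L: "L \<ge> 0"
  have "norm (sin_cutoff L x) \<le> (\<Sum>i\<in>UNIV. \<bar>sin_cutoff L x $ i\<bar>)" by (rule norm_le_l1_cart)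
  also have "\<dots> \<le> (\<Sum>i\<in>(UNIV::'d set). L)"
    using L by (intro sum_mono) (simp add: sin_cutoff_def abs_mult mult_left_le)
  finally show ?thesis by simp
qed

text \<open>Imaginary part of the first-order Taylor bound for \<open>exp (i u)\<close>.\<close>

lemma abs_sin_minus_self: "\<bar>sin u - u\<bar> \<le> u\<^sup>2 / 2" for u :: real
proof -
  have "\<bar>Im (iexp u - (\<Sum>k\<le>1. (\<i> * u) ^ k / fact k))\<bar> \<le> \<bar>u\<bar> ^ (Suc 1) / fact (Suc 1)"
    by (rule order_trans[OF abs_Im_le_cmod iexp_approx1])
  moreover have "Im (iexp u) = sin u" by (simp add: Im_exp)
  ultimately show ?thesis by (simp add: fact_2 power2_eq_square)
qed

lemma norm_sin_cutoff_diff: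
  fixes x :: "real ^ 'd::finite"
  assumes L: "L > 0" and x: "norm x \<le> K"
  shows "norm (sin_cutoff L x - x) \<le> real CARD('d) * (K\<^sup>2 / (2 * L))"
proof -
  have "norm (sin_cutoff L x - x) \<le> (\<Sum>i\<in>UNIV. \<bar>(sin_cutoff L x - x) $ i\<bar>)" by (rule norm_le_l1_cart)
  also have "\<dots> \<le> (\<Sum>i\<in>(UNIV::'d set). K\<^sup>2 / (2 * L))"
  proof (rule sum_mono)
    fix i :: 'd
    have xi: "\<bar>x $ i\<bar> \<le> K" using component_le_norm_cart[of x i] x by linarith
    have "(sin_cutoff L x - x) $ i = L * (sin (x $ i / L) - x $ i / L)"
      using L by (simp add: sin_cutoff_def right_diff_distrib)
    then have "\<bar>(sin_cutoff L x - x) $ i\<bar> \<le> L * ((x $ i / L)\<^sup>2 / 2)"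
      using L abs_sin_minus_self[of "x $ i / L"] by (simp add: abs_mult)
    also have "\<dots> = (x $ i)\<^sup>2 / (2 * L)" using L by (simp add: power2_eq_square field_simps)
    also have "\<dots> \<le> K\<^sup>2 / (2 * L)"
      using L abs_le_square_iff[of "x $ i" K] xi by (intro divide_right_mono) auto
    finally show "\<bar>(sin_cutoff L x - x) $ i\<bar> \<le> K\<^sup>2 / (2 * L)" .
  qed
  finally show ?thesis by simp
qed

lemma continuous_on_sin_cutoff: "continuous_on S (sin_cutoff L)"
  unfolding sin_cutoff_def divide_inverse by (intro continuous_intros)

lemma abs_integral_diff_le_split:
  fixes f g :: "'a \<Rightarrow> real"
  assumes "prob_space M" and [measurable]: "f \<in> borel_measurable M" "g \<in> borel_measurable M" "A \<in> sets M"
    and f: "\<And>\<omega>. \<bar>f \<omega>\<bar> \<le> B" and g: "\<And>\<omega>. \<bar>g \<omega>\<bar> \<le> B"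
    and close: "\<And>\<omega>. \<omega> \<in> space M \<Longrightarrow> \<omega> \<notin> A \<Longrightarrow> \<bar>f \<omega> - g \<omega>\<bar> \<le> e" and e: "e \<ge> 0"
  shows "\<bar>(\<integral>\<omega>. f \<omega> \<partial>M) - (\<integral>\<omega>. g \<omega> \<partial>M)\<bar> \<le> e + 2 * B * measure M A"
proof -
  interpret prob_space M by fact
  have B: "B \<ge> 0" using f[of undefined] by linarith
  have int: "integrable M f" "integrable M g"
    using f g by (auto intro!: integrable_const_bound[where B=B])
  have "\<bar>(\<integral>\<omega>. f \<omega> \<partial>M) - (\<integral>\<omega>. g \<omega> \<partial>M)\<bar> = \<bar>\<integral>\<omega>. f \<omega> - g \<omega> \<partial>M\<bar>" using int by simp
  also have "\<dots> \<le> (\<integral>\<omega>. \<bar>f \<omega> - g \<omega>\<bar> \<partial>M)" by (rule integral_abs_bound)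
  also have "\<dots> \<le> (\<integral>\<omega>. e + 2 * B * indicator A \<omega> \<partial>M)"
  proof (rule integral_mono)
    fix \<omega> assume "\<omega> \<in> space M"
    then show "\<bar>f \<omega> - g \<omega>\<bar> \<le> e + 2 * B * indicator A \<omega>"
      using close[of \<omega>] f[of \<omega>] g[of \<omega>] e by (cases "\<omega> \<in> A") auto
  qed (use int in \<open>auto simp: less_top[symmetric]\<close>)
  also have "\<dots> = e + 2 * B * measure M A" by (simp add: prob_space less_top[symmetric])
  finally show ?thesis .
qed

section \<open>Tightness and convergence in law\<close>

definition uniformly_tight :: "'a measure \<Rightarrow> (nat \<Rightarrow> 'a \<Rightarrow> 'b::real_normed_vector) \<Rightarrow> bool" where
  "uniformly_tight M Y \<longleftrightarrow> (\<forall>e>0. \<exists>K>0. \<forall>n. measure M {\<omega> \<in> space M. norm (Y n \<omega>) > K} \<le> e)"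

lemma uniformly_tight_const:
  assumes "prob_space \<nu>" "sets \<nu> = sets (borel :: (real ^ 'd::finite) measure)"
  shows "uniformly_tight \<nu> (\<lambda>_::nat. \<lambda>x. x)"
proof -
  interpret prob_space \<nu> by fact
  have [measurable]: "(\<lambda>x. x) \<in> borel_measurable \<nu>" using assms(2) by (simp cong: measurable_cong_sets)
  let ?A = "\<lambda>k::nat. {x \<in> space \<nu>. norm x > real k}"
  have "(\<lambda>k. measure \<nu> (?A k)) \<longlonglongrightarrow> measure \<nu> (\<Inter>k. ?A k)"
    by (intro finite_Lim_measure_decseq) (auto simp: decseq_def intro: le_less_trans[rotated])
  moreover have "(\<Inter>k. ?A k) = {}"
  proof -
    have "\<exists>k::nat. \<not> norm x > real k" for x :: "real ^ 'd"
      using reals_Archimedean2[of "norm x"] by (auto simp: not_less intro: less_imp_le)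
    then show ?thesis by blast
  qed
  ultimately have lim: "(\<lambda>k. measure \<nu> (?A k)) \<longlonglongrightarrow> 0" by simp
  show ?thesis unfolding uniformly_tight_def
  proof (intro allI impI)
    fix e :: real assume "e > 0"
    then have "\<forall>\<^sub>F k in sequentially. measure \<nu> (?A k) < e" using lim by (simp add: order_tendsto_iff)
    then obtain k0 where "\<And>k. k \<ge> k0 \<Longrightarrow> measure \<nu> (?A k) < e"
      unfolding eventually_sequentially by blast
    then obtain k where k: "k > 0" "measure \<nu> (?A k) < e" by (metis le_SucI order_refl zero_less_Suc)
    then show "\<exists>K>0. \<forall>n. measure \<nu> {x \<in> space \<nu>. norm x > K} \<le> e"
      by (intro exI[of _ "real k"]) auto
  qed
qed

text \<open>Three approximations are chained: \<open>f\<close> by \<open>f\<close> after the cutoff,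
  which tightness controls; this by a polynomial after the cutoff, by Stone-Weierstrass on a ball
  containing all cutoff values; and the expectations of the resulting trigonometric polynomial
  converge by assumption.\<close>

theorem char_convergence_imp_law:
  fixes Y :: "nat \<Rightarrow> 'a \<Rightarrow> real ^ 'd::finite"
  assumes M: "prob_space M" and Y[measurable]: "\<And>n. Y n \<in> borel_measurable M"
    and \<nu>: "prob_space \<nu>" "sets \<nu> = sets borel"
    and ch: "\<And>v. (\<lambda>n. CLINT \<omega>|M. iexp (v \<bullet> Y n \<omega>)) \<longlonglongrightarrow> (CLINT x|\<nu>. iexp (v \<bullet> x))"
    and tight: "uniformly_tight M Y"
  shows "converges_in_law M Y \<nu>"
  unfolding converges_in_law_def
proof (intro allI impI)
  fix f :: "real ^ 'd \<Rightarrow> real"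
  assume cont: "continuous_on UNIV f" and "bounded (range f)"
  then obtain B where B: "\<And>x. \<bar>f x\<bar> \<le> B" unfolding bounded_iff by auto
  have B0: "B \<ge> 0" using B[of 0] by linarith
  interpret M: prob_space M by fact
  interpret N: prob_space \<nu> by fact
  have id[measurable]: "(\<lambda>x. x) \<in> borel_measurable \<nu>" using \<nu>(2) by (simp cong: measurable_cong_sets)
  have f[measurable]: "f \<in> borel_measurable borel" using cont by (rule borel_measurable_continuous_onI)
  have sc[measurable]: "sin_cutoff L \<in> borel_measurable borel" for L :: real
    using continuous_on_sin_cutoff by (rule borel_measurable_continuous_onI)
  have borel_\<nu>: "g \<in> borel_measurable borel \<Longrightarrow> g \<in> borel_measurable \<nu>" for g :: "real ^ 'd \<Rightarrow> 'z::topological_space"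
    using \<nu>(2) by (simp cong: measurable_cong_sets)
  have trig: "integrable \<nu> h \<and> (\<forall>n. integrable M (\<lambda>\<omega>. h (Y n \<omega>))) \<and>
      (\<lambda>n. \<integral>\<omega>. h (Y n \<omega>) \<partial>M) \<longlonglongrightarrow> (\<integral>x. h x \<partial>\<nu>)" if "trig_poly h" for h
    using that
  proof induction
    case (trig_poly_base c v)
    have 1: "integrable \<nu> (\<lambda>x. iexp (v \<bullet> x))"
      by (rule N.integrable_const_bound[where B=1]) auto
    have 2: "integrable M (\<lambda>\<omega>. iexp (v \<bullet> Y n \<omega>))" for n
      by (rule M.integrable_const_bound[where B=1]) auto
    show ?case using 1 2 by (auto intro!: tendsto_mult ch)
  next
    case (trig_poly_add f g)
    then show ?case by (auto intro!: tendsto_add)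
  qed
  \<comment> \<open>For fixed \<open>L\<close> the cutoff takes values in a fixed ball, so one
    polynomial approximates \<open>f\<close> along all \<open>Y n\<close> and under
    \<open>\<nu>\<close> at once, without a tail estimate.\<close>
  have cutoff: "(\<lambda>n. \<integral>\<omega>. f (sin_cutoff L (Y n \<omega>)) \<partial>M) \<longlonglongrightarrow> (\<integral>x. f (sin_cutoff L x) \<partial>\<nu>)" if L: "L > 0" for L
  proof (rule LIMSEQ_I)
    fix r :: real assume r: "0 < r"
    obtain g where g: "real_polynomial_function g"
      "\<And>x. x \<in> cball 0 (real CARD('d) * L) \<Longrightarrow> \<bar>f x - g x\<bar> < r / 4"
      using Stone_Weierstrass_real_polynomial_function[of "cball 0 (real CARD('d) * L)" f "r / 4"]
        continuous_on_subset[OF cont] r by auto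
    have gc: "continuous_on UNIV g"
      using g(1) continuous_on_polymonial_function real_polynomial_function_eq by blast
    have [measurable]: "g \<in> borel_measurable borel" using gc by (rule borel_measurable_continuous_onI)
    have fg: "\<bar>f (sin_cutoff L x) - g (sin_cutoff L x)\<bar> \<le> r / 4" for x
      using g(2)[of "sin_cutoff L x"] norm_sin_cutoff[of L x] L by (simp add: less_imp_le)
    have gB: "\<bar>g (sin_cutoff L x)\<bar> \<le> B + r / 4" for x using fg[of x] B[of "sin_cutoff L x"] by linarith
    note T = trig[OF trig_poly_real_polynomial[OF g(1), of L]]
    have "(\<lambda>n. complex_of_real (\<integral>\<omega>. g (sin_cutoff L (Y n \<omega>)) \<partial>M)) \<longlonglongrightarrow> complex_of_real (\<integral>x. g (sin_cutoff L x) \<partial>\<nu>)"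
      using T by simp
    then have "(\<lambda>n. (\<integral>\<omega>. g (sin_cutoff L (Y n \<omega>)) \<partial>M)) \<longlonglongrightarrow> (\<integral>x. g (sin_cutoff L x) \<partial>\<nu>)"
      by (rule iffD1[OF tendsto_of_real_iff])
    then obtain n0 where n0: "\<And>n. n \<ge> n0 \<Longrightarrow> norm ((\<integral>\<omega>. g (sin_cutoff L (Y n \<omega>)) \<partial>M) - (\<integral>x. g (sin_cutoff L x) \<partial>\<nu>)) < r / 4"
      using LIMSEQ_D[of _ _ "r / 4"] r by (metis zero_less_divide_iff zero_less_numeral)
    \<comment> \<open>The exceptional set is empty, as this approximation holds everywhere.\<close>
    have e1: "\<bar>(\<integral>\<omega>. f (sin_cutoff L (Y n \<omega>)) \<partial>M) - (\<integral>\<omega>. g (sin_cutoff L (Y n \<omega>)) \<partial>M)\<bar> \<le> r / 4 + 2 * (B + r/4) * measure M {}" for n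
      by (rule abs_integral_diff_le_split[OF M]) (use fg r gB B in \<open>auto intro: order_trans[OF B]\<close>)
    have e2: "\<bar>(\<integral>x. f (sin_cutoff L x) \<partial>\<nu>) - (\<integral>x. g (sin_cutoff L x) \<partial>\<nu>)\<bar> \<le> r / 4 + 2 * (B + r/4) * measure \<nu> {}"
      by (rule abs_integral_diff_le_split[OF \<nu>(1)]) (use fg r gB B in \<open>auto intro: order_trans[OF B]\<close>)
    show "\<exists>no. \<forall>n\<ge>no. norm ((\<integral>\<omega>. f (sin_cutoff L (Y n \<omega>)) \<partial>M) - (\<integral>x. f (sin_cutoff L x) \<partial>\<nu>)) < r"
    proof (intro exI[of _ n0] allI impI)
      fix n assume "n0 \<le> n"
      from n0[OF this] e1[of n] e2 r
      show "norm ((\<integral>\<omega>. f (sin_cutoff L (Y n \<omega>)) \<partial>M) - (\<integral>x. f (sin_cutoff L x) \<partial>\<nu>)) < r"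
        by (simp add: abs_if split: if_splits)
    qed
  qed
  show "(\<lambda>n. \<integral>\<omega>. f (Y n \<omega>) \<partial>M) \<longlonglongrightarrow> (\<integral>x. f x \<partial>\<nu>)"
  proof (rule LIMSEQ_I)
    fix r :: real assume r: "0 < r"
    \<comment> \<open>A tail of mass \<open>e\<close> with oscillation \<open>2 * B\<close>
      contributes at most \<open>r / 8\<close>; \<open>B + 1\<close> avoids division by 0.\<close>
    define e where "e = r / (16 * (B + 1))"
    have e0: "e > 0" using r B0 by (simp add: e_def)
    have eB: "2 * B * e \<le> r / 8"
    proof -
      have "e * (16 * (B + 1)) = r" using B0 by (simp add: e_def)
      then show ?thesis using e0 by (simp add: algebra_simps)
    qed
    obtain K1 where K1: "K1 > 0" "\<And>n. measure M {\<omega> \<in> space M. norm (Y n \<omega>) > K1} \<le> e"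
      using tight e0 unfolding uniformly_tight_def by blast
    obtain K2 where K2: "K2 > 0" "measure \<nu> {x \<in> space \<nu>. norm x > K2} \<le> e"
      using uniformly_tight_const[OF \<nu>] e0 unfolding uniformly_tight_def by blast
    define K where "K = max K1 K2"
    have K: "K > 0" using K1 by (simp add: K_def)
    have MK: "measure M {\<omega> \<in> space M. norm (Y n \<omega>) > K} \<le> e" for n
      by (rule order_trans[OF M.finite_measure_mono K1(2)[of n]]) (auto simp: K_def)
    have NK: "measure \<nu> {x \<in> space \<nu>. norm x > K} \<le> e"
      by (rule order_trans[OF N.finite_measure_mono K2(2)]) (auto simp: K_def)
    have "uniformly_continuous_on (cball 0 (K + 1)) f"
      by (rule compact_uniformly_continuous[OF continuous_on_subset[OF cont]]) auto
    then obtain \<delta> where \<delta>: "\<delta> > 0" "\<And>x y. x \<in> cball 0 (K + 1) \<Longrightarrow> y \<in> cball 0 (K + 1) \<Longrightarrow> dist y x < \<delta> \<Longrightarrow> dist (f y) (f x) < r / 8"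
      unfolding uniformly_continuous_on_def using r by (metis zero_less_divide_iff zero_less_numeral)
    \<comment> \<open>With this \<open>L\<close> the cutoff moves points of norm at most
      \<open>K\<close> by at most \<open>min \<delta> 1 / 2\<close>: less than
      \<open>\<delta>\<close>, and not out of the ball of radius \<open>K + 1\<close> on which
      \<open>f\<close> is uniformly continuous.\<close>
    define L where "L = real CARD('d) * K\<^sup>2 / min \<delta> 1"
    have L: "L > 0" using K \<delta> by (simp add: L_def)
    have near: "\<bar>f (sin_cutoff L x) - f x\<bar> \<le> r / 8" if x: "norm x \<le> K" for x
    proof -
      have "norm (sin_cutoff L x - x) \<le> real CARD('d) * (K\<^sup>2 / (2 * L))"
        by (rule norm_sin_cutoff_diff[OF L x])
      also have "\<dots> = min \<delta> 1 / 2" using K \<delta> by (simp add: L_def)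
      finally have c: "norm (sin_cutoff L x - x) \<le> min \<delta> 1 / 2" .
      have "norm (sin_cutoff L x) \<le> norm x + norm (sin_cutoff L x - x)" by (rule norm_triangle_sub)
      then have "norm (sin_cutoff L x) \<le> K + 1" using c x by (simp add: min_def split: if_splits)
      moreover have "dist (sin_cutoff L x) x < \<delta>" using c \<delta>(1) by (simp add: dist_norm min_def split: if_splits)
      ultimately have "dist (f (sin_cutoff L x)) (f x) < r / 8" using x by (intro \<delta>(2)) auto
      then show ?thesis by (simp add: dist_real_def)
    qed
    have e1: "\<bar>(\<integral>\<omega>. f (sin_cutoff L (Y n \<omega>)) \<partial>M) - (\<integral>\<omega>. f (Y n \<omega>) \<partial>M)\<bar> \<le> r / 8 + 2 * B * measure M {\<omega> \<in> space M. norm (Y n \<omega>) > K}" for n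
      by (rule abs_integral_diff_le_split[OF M]) (use B near r in auto)
    have e2: "\<bar>(\<integral>x. f (sin_cutoff L x) \<partial>\<nu>) - (\<integral>x. f x \<partial>\<nu>)\<bar> \<le> r / 8 + 2 * B * measure \<nu> {x \<in> space \<nu>. norm x > K}"
      by (rule abs_integral_diff_le_split[OF \<nu>(1)]) (use B near r in auto)
    have m1: "2 * B * measure M {\<omega> \<in> space M. norm (Y n \<omega>) > K} \<le> r / 8" for n
      using mult_left_mono[OF MK[of n], of "2 * B"] B0 eB by linarith
    have m2: "2 * B * measure \<nu> {x \<in> space \<nu>. norm x > K} \<le> r / 8"
      using mult_left_mono[OF NK, of "2 * B"] B0 eB by linarith
    obtain n0 where n0: "\<And>n. n \<ge> n0 \<Longrightarrow> norm ((\<integral>\<omega>. f (sin_cutoff L (Y n \<omega>)) \<partial>M) - (\<integral>x. f (sin_cutoff L x) \<partial>\<nu>)) < r / 4"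
      using LIMSEQ_D[OF cutoff[OF L], of "r / 4"] r by auto
    show "\<exists>no. \<forall>n\<ge>no. norm ((\<integral>\<omega>. f (Y n \<omega>) \<partial>M) - (\<integral>x. f x \<partial>\<nu>)) < r"
    proof (intro exI[of _ n0] allI impI)
      fix n assume "n0 \<le> n"
      from n0[OF this] e1[of n] e2 m1[of n] m2 r
      show "norm ((\<integral>\<omega>. f (Y n \<omega>) \<partial>M) - (\<integral>x. f x \<partial>\<nu>)) < r"
        by (simp add: abs_if split: if_splits)
    qed
  qed
qed

text \<open>A Slutsky argument in which closeness is demanded only at those \<open>n\<close> where
  \<open>W n\<close> is bounded by \<open>K\<close>. For the other \<open>n\<close> the hybrid
  \<open>g n\<close> copies \<open>f (W n)\<close>; hence \<open>g n - f (W n)\<close> tends to 0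
  pathwise, and \<open>g n\<close> differs from \<open>f (Y n)\<close> only on an event that
  tightness makes small.\<close>

lemma converges_in_law_perturbation:
  fixes W Y :: "nat \<Rightarrow> 'a \<Rightarrow> real ^ 'd::finite"
  assumes M: "prob_space M"
    and W[measurable]: "\<And>n. W n \<in> borel_measurable M" and Y[measurable]: "\<And>n. Y n \<in> borel_measurable M"
    and law: "converges_in_law M W \<nu>" and tight: "uniformly_tight M W"
    and close: "AE \<omega> in M. \<forall>K>0. (\<lambda>n. if norm (W n \<omega>) \<le> K then norm (Y n \<omega> - W n \<omega>) else 0) \<longlonglongrightarrow> 0"
  shows "converges_in_law M Y \<nu>"
  unfolding converges_in_law_def
proof (intro allI impI)
  fix f :: "real ^ 'd \<Rightarrow> real"
  assume cont: "continuous_on UNIV f" and bdd: "bounded (range f)"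
  then obtain B where B: "\<And>x. \<bar>f x\<bar> \<le> B" unfolding bounded_iff by auto
  have B0: "B \<ge> 0" using B[of 0] by linarith
  interpret M: prob_space M by fact
  have f[measurable]: "f \<in> borel_measurable borel" using cont by (rule borel_measurable_continuous_onI)
  have limW: "(\<lambda>n. \<integral>\<omega>. f (W n \<omega>) \<partial>M) \<longlonglongrightarrow> (\<integral>x. f x \<partial>\<nu>)"
    using law cont bdd unfolding converges_in_law_def by blast
  show "(\<lambda>n. \<integral>\<omega>. f (Y n \<omega>) \<partial>M) \<longlonglongrightarrow> (\<integral>x. f x \<partial>\<nu>)"
  proof (rule LIMSEQ_I)
    fix r :: real assume r: "0 < r"
    define e where "e = r / (8 * (B + 1))"
    have e0: "e > 0" using r B0 by (simp add: e_def)
    have eB: "2 * B * e \<le> r / 4"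
    proof -
      have "e * (8 * (B + 1)) = r" using B0 by (simp add: e_def)
      then show ?thesis using e0 by (simp add: algebra_simps)
    qed
    obtain K where K: "K > 0" "\<And>n. measure M {\<omega> \<in> space M. norm (W n \<omega>) > K} \<le> e"
      using tight e0 unfolding uniformly_tight_def by blast
    define g where "g = (\<lambda>n \<omega>. if norm (W n \<omega>) \<le> K then f (Y n \<omega>) else f (W n \<omega>))"
    have [measurable]: "g n \<in> borel_measurable M" for n unfolding g_def by measurable
    have gB: "\<bar>g n \<omega>\<bar> \<le> B" for n \<omega> using B by (simp add: g_def)
    have "uniformly_continuous_on (cball 0 (K + 1)) f"
      by (rule compact_uniformly_continuous[OF continuous_on_subset[OF cont]]) auto
    note uc = this[unfolded uniformly_continuous_on_def]
    have "(\<lambda>n. \<integral>\<omega>. g n \<omega> - f (W n \<omega>) \<partial>M) \<longlonglongrightarrow> (\<integral>\<omega>. 0 \<partial>M)"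
    proof (rule integral_dominated_convergence[where w="\<lambda>_. 2 * B"])
      show "AE \<omega> in M. (\<lambda>n. g n \<omega> - f (W n \<omega>)) \<longlonglongrightarrow> 0"
        using close
      proof eventually_elim
        case (elim \<omega>)
        then have lim: "(\<lambda>n. if norm (W n \<omega>) \<le> K then norm (Y n \<omega> - W n \<omega>) else 0) \<longlonglongrightarrow> 0" using K by blast
        show ?case
        proof (rule LIMSEQ_I)
          fix s :: real assume "0 < s"
          then obtain \<delta> where \<delta>: "\<delta> > 0" "\<And>x y. x \<in> cball 0 (K + 1) \<Longrightarrow> y \<in> cball 0 (K + 1) \<Longrightarrow> dist y x < \<delta> \<Longrightarrow> dist (f y) (f x) < s"
            using uc by metis
          have "\<forall>\<^sub>F n in sequentially. (if norm (W n \<omega>) \<le> K then norm (Y n \<omega> - W n \<omega>) else 0) < min \<delta> 1"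
            by (rule order_tendstoD(2)[OF lim]) (use \<delta>(1) in simp)
          then obtain n0 where n0: "\<And>n. n \<ge> n0 \<Longrightarrow> (if norm (W n \<omega>) \<le> K then norm (Y n \<omega> - W n \<omega>) else 0) < min \<delta> 1"
            unfolding eventually_sequentially by blast
          have "norm (g n \<omega> - f (W n \<omega>) - 0) < s" if "n \<ge> n0" for n
          proof (cases "norm (W n \<omega>) \<le> K")
            case True
            have d: "norm (Y n \<omega> - W n \<omega>) < min \<delta> 1" using n0[OF that] True by simp
            moreover have "norm (Y n \<omega>) \<le> norm (W n \<omega>) + norm (Y n \<omega> - W n \<omega>)" by (rule norm_triangle_sub)
            ultimately have "dist (f (Y n \<omega>)) (f (W n \<omega>)) < s"
              using True by (intro \<delta>(2)) (auto simp: dist_norm)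
            then show ?thesis using True by (simp add: g_def dist_real_def)
          next
            case False then show ?thesis using \<open>0 < s\<close> by (simp add: g_def)
          qed
          then show "\<exists>no. \<forall>n\<ge>no. norm (g n \<omega> - f (W n \<omega>) - 0) < s" by blast
        qed
      qed
      fix n
      show "AE \<omega> in M. norm (g n \<omega> - f (W n \<omega>)) \<le> 2 * B"
        using gB[of n] B by (intro AE_I2) (metis abs_triangle_ineq4 add_mono mult_2 order_trans real_norm_def)
    qed auto
    moreover have "(\<integral>\<omega>. g n \<omega> - f (W n \<omega>) \<partial>M) = (\<integral>\<omega>. g n \<omega> \<partial>M) - (\<integral>\<omega>. f (W n \<omega>) \<partial>M)" for n
      by (rule Bochner_Integration.integral_diff) (auto intro!: M.integrable_const_bound[where B=B] simp: gB B)
    ultimately have "(\<lambda>n. ((\<integral>\<omega>. g n \<omega> \<partial>M) - (\<integral>\<omega>. f (W n \<omega>) \<partial>M)) + (\<integral>\<omega>. f (W n \<omega>) \<partial>M)) \<longlonglongrightarrow> 0 + (\<integral>x. f x \<partial>\<nu>)"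
      using limW by (intro tendsto_add) simp_all
    then have limg: "(\<lambda>n. \<integral>\<omega>. g n \<omega> \<partial>M) \<longlonglongrightarrow> (\<integral>x. f x \<partial>\<nu>)" by simp
    obtain n0 where n0: "\<And>n. n \<ge> n0 \<Longrightarrow> norm ((\<integral>\<omega>. g n \<omega> \<partial>M) - (\<integral>x. f x \<partial>\<nu>)) < r / 2"
      using LIMSEQ_D[OF limg, of "r / 2"] r by auto
    have e1: "\<bar>(\<integral>\<omega>. g n \<omega> \<partial>M) - (\<integral>\<omega>. f (Y n \<omega>) \<partial>M)\<bar> \<le> 0 + 2 * B * measure M {\<omega> \<in> space M. norm (W n \<omega>) > K}" for n
      by (rule abs_integral_diff_le_split[OF M]) (use B gB in \<open>auto simp: g_def\<close>)
    have m1: "2 * B * measure M {\<omega> \<in> space M. norm (W n \<omega>) > K} \<le> r / 4" for n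
      using mult_left_mono[OF K(2)[of n], of "2 * B"] B0 eB by linarith
    show "\<exists>no. \<forall>n\<ge>no. norm ((\<integral>\<omega>. f (Y n \<omega>) \<partial>M) - (\<integral>x. f x \<partial>\<nu>)) < r"
    proof (intro exI[of _ n0] allI impI)
      fix n assume "n0 \<le> n"
      from n0[OF this] e1[of n] m1[of n] r
      show "norm ((\<integral>\<omega>. f (Y n \<omega>) \<partial>M) - (\<integral>x. f x \<partial>\<nu>)) < r"
        by (simp add: abs_if split: if_splits)
    qed
  qed
qed

text \<open>Chebyshev's inequality for the squared Euclidean norm, whose expectation is bounded
  coordinate by coordinate.\<close>

lemma uniformly_tight_second_moment:
  fixes Y :: "nat \<Rightarrow> 'a \<Rightarrow> real ^ 'd::finite"
  assumes ps: "prob_space M" and Y[measurable]: "\<And>n. Y n \<in> borel_measurable M"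
    and int: "\<And>n i. integrable M (\<lambda>\<omega>. (Y n \<omega> $ i)\<^sup>2)" and le: "\<And>n i. (\<integral>\<omega>. (Y n \<omega> $ i)\<^sup>2 \<partial>M) \<le> C i"
  shows "uniformly_tight M Y"
  unfolding uniformly_tight_def
proof (intro allI impI)
  fix e :: real assume e: "e > 0"
  interpret prob_space M by fact
  define S where "S = (\<Sum>i\<in>UNIV. C i)"
  have C0: "C i \<ge> 0" for i
    by (rule order_trans[OF integral_nonneg_AE le[of 0 i]]) auto
  have S0: "S \<ge> 0" unfolding S_def by (intro sum_nonneg C0)
  \<comment> \<open>\<open>K^2\<close> dominates \<open>S / e\<close>, as Chebyshev requires, and
    the summand 1 keeps \<open>K\<close> positive when \<open>S = 0\<close>.\<close>
  define K where "K = sqrt (S / e) + 1"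
  have K: "K > 0" "K\<^sup>2 \<ge> S / e"
  proof -
    have s: "sqrt (S / e) \<ge> 0" using S0 e by simp
    then show "K > 0" unfolding K_def using s by linarith
    have "(sqrt (S / e))\<^sup>2 \<le> K\<^sup>2" using s by (intro power_mono) (auto simp: K_def)
    then show "K\<^sup>2 \<ge> S / e" using S0 e by simp
  qed
  have "measure M {\<omega> \<in> space M. norm (Y n \<omega>) > K} \<le> e" for n
  proof -
    let ?A = "{\<omega> \<in> space M. norm (Y n \<omega>) > K}"
    have n2: "(norm (Y n \<omega>))\<^sup>2 = (\<Sum>i\<in>UNIV. (Y n \<omega> $ i)\<^sup>2)" for \<omega>
      unfolding power2_norm_eq_inner inner_vec_def by (simp add: power2_eq_square)
    have "K\<^sup>2 * measure M ?A = expectation (\<lambda>\<omega>. K\<^sup>2 * indicator ?A \<omega>)" by simp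
    also have "\<dots> \<le> expectation (\<lambda>\<omega>. \<Sum>i\<in>UNIV. (Y n \<omega> $ i)\<^sup>2)"
    proof (rule integral_mono)
      show "integrable M (\<lambda>\<omega>. K\<^sup>2 * indicator ?A \<omega>)" by (simp add: less_top[symmetric])
      show "integrable M (\<lambda>\<omega>. \<Sum>i\<in>UNIV. (Y n \<omega> $ i)\<^sup>2)" using int by simp
      fix \<omega> assume "\<omega> \<in> space M"
      show "K\<^sup>2 * indicator ?A \<omega> \<le> (\<Sum>i\<in>UNIV. (Y n \<omega> $ i)\<^sup>2)"
        unfolding n2[symmetric] using K(1) by (auto simp: indicator_def intro!: power_mono)
    qed
    also have "\<dots> = (\<Sum>i\<in>UNIV. expectation (\<lambda>\<omega>. (Y n \<omega> $ i)\<^sup>2))" using int by simp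
    also have "\<dots> \<le> S" unfolding S_def by (intro sum_mono le)
    also have "\<dots> \<le> K\<^sup>2 * e" using K(2) e by (simp add: field_simps)
    finally show ?thesis using K(1) by simp
  qed
  then show "\<exists>K>0. \<forall>n. measure M {\<omega> \<in> space M. norm (Y n \<omega>) > K} \<le> e" using K(1) by blast
qed

text \<open>Symmetric elimination. Subtracting the rank-one matrix of
  \<open>w0 = A e / sqrt a\<close> leaves a positive semidefinite matrix whose \<open>i\<close>-th
  diagonal entry is 0 and whose other zero diagonal entries stay 0, so the number of nonzero
  diagonal entries drops. With zero diagonal the matrix itself is 0.\<close>

lemma psd_matrix_decomposition:
  fixes A :: "real ^ 'd::finite ^ 'd"
  assumes "\<And>x y. x \<bullet> (A *v y) = (A *v x) \<bullet> y" and "\<And>x. x \<bullet> (A *v x) \<ge> 0"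
  shows "\<exists>(m::nat) w. \<forall>x. A *v x = (\<Sum>k<m. (w k \<bullet> x) *\<^sub>R w k)"
  using assms
proof (induction "card {i. A $ i $ i \<noteq> 0}" arbitrary: A rule: less_induct)
  case less
  note sym = less.prems(1) and psd = less.prems(2)
  have Aij: "axis i 1 \<bullet> (A *v axis j 1) = A $ i $ j" for i j
    by (simp add: inner_axis' matrix_vector_mul_component) (simp add: inner_axis)
  have Asym: "A $ i $ j = A $ j $ i" for i j
    using sym[of "axis i 1" "axis j 1"] Aij[of i j] Aij[of j i] by (simp add: inner_commute)
  show ?case
  proof (cases "\<exists>i. A $ i $ i \<noteq> 0")
    case False
    then have diag: "A $ i $ i = 0" for i by simp
    have "A $ i $ j = 0" for i j
    proof -
      define z where "z = A $ i $ j"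
      \<comment> \<open>With zero diagonal the quadratic form is linear in \<open>t\<close> along
        this line; \<open>t = - z\<close> would make it \<open>- 2 * z^2\<close>, so
        semidefiniteness forces \<open>z = 0\<close>.\<close>
      have "(axis i 1 + t *\<^sub>R axis j 1) \<bullet> (A *v (axis i 1 + t *\<^sub>R axis j 1)) = 2 * t * z" for t :: real
        using Aij Asym[of i j] diag
        by (simp add: matrix_vector_right_distrib matrix_vector_mult_scaleR inner_add_left inner_add_right z_def)
      from this[of "- z"] psd[of "axis i 1 + (- z) *\<^sub>R axis j 1"] have "z * z \<le> 0" by simp
      then show ?thesis using zero_le_square[of z] by (simp add: z_def[symmetric])
    qed
    then have "A = 0" by (simp add: vec_eq_iff)
    then show ?thesis by (intro exI[of _ "0::nat"]) simp
  next
    case True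
    then obtain i where i: "A $ i $ i \<noteq> 0" by blast
    define a where "a = A $ i $ i"
    define e :: "real ^ 'd" where "e = axis i 1"
    have ae: "e \<bullet> (A *v e) = a" unfolding e_def a_def by (rule Aij)
    have a: "a > 0" using psd[of e] i ae by (simp add: a_def)
    define w0 where "w0 = (1 / sqrt a) *\<^sub>R (A *v e)"
    define A' where "A' = A - (\<chi> k l. w0 $ k * w0 $ l)"
    have A'v: "A' *v x = A *v x - (w0 \<bullet> x) *\<^sub>R w0" for x
      by (simp add: A'_def vec_eq_iff matrix_vector_mult_def inner_vec_def left_diff_distrib sum_subtractf
          sum_distrib_left sum_distrib_right right_diff_distrib mult_ac)
    have w0x: "(w0 \<bullet> x)\<^sup>2 = (x \<bullet> (A *v e))\<^sup>2 / a" for x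
      using a by (simp add: w0_def power_mult_distrib power_divide inner_commute)
    have sym': "x \<bullet> (A' *v y) = (A' *v x) \<bullet> y" for x y
      unfolding A'v using sym[of x y] by (simp add: inner_diff_left inner_diff_right inner_commute)
    have psd': "x \<bullet> (A' *v x) \<ge> 0" for x
    proof -
      \<comment> \<open>This \<open>t\<close> minimises the quadratic form of \<open>A\<close> over
        \<open>x - t e\<close>; the minimum is the quadratic form of \<open>A'\<close> at
        \<open>x\<close>.\<close>
      define t where "t = (x \<bullet> (A *v e)) / a"
      have xe: "e \<bullet> (A *v x) = x \<bullet> (A *v e)" using sym[of e x] by (simp add: inner_commute)
      have "(x - t *\<^sub>R e) \<bullet> (A *v (x - t *\<^sub>R e)) = x \<bullet> (A *v x) - 2 * t * (x \<bullet> (A *v e)) + t * t * a"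
        by (simp add: matrix_vector_mult_diff_distrib matrix_vector_mult_scaleR inner_diff_left inner_diff_right xe ae algebra_simps)
      also have "\<dots> = x \<bullet> (A *v x) - (x \<bullet> (A *v e))\<^sup>2 / a"
        using a by (simp add: t_def power2_eq_square field_simps)
      also have "\<dots> = x \<bullet> (A' *v x)" unfolding A'v using w0x[of x]
        by (simp add: inner_diff_right power2_eq_square inner_commute)
      finally show ?thesis using psd[of "x - t *\<^sub>R e"] by simp
    qed
    have A'd: "A' $ k $ k = A $ k $ k - (w0 $ k)\<^sup>2" for k by (simp add: A'_def power2_eq_square)
    have A'ge: "A' $ k $ k \<ge> 0" for k
    proof -
      have "axis k 1 \<bullet> (A' *v axis k 1) = A' $ k $ k"
        by (simp add: inner_axis' matrix_vector_mul_component) (simp add: inner_axis)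
      then show ?thesis using psd'[of "axis k 1"] by simp
    qed
    have w0i: "(w0 $ i)\<^sup>2 = a"
      using w0x[of e] ae a by (simp add: e_def inner_axis' inner_axis inner_commute power2_eq_square)
    have "{k. A' $ k $ k \<noteq> 0} \<subset> {k. A $ k $ k \<noteq> 0}"
    proof
      show "{k. A' $ k $ k \<noteq> 0} \<subseteq> {k. A $ k $ k \<noteq> 0}"
      proof (clarify)
        fix k assume k: "A' $ k $ k \<noteq> 0" and "A $ k $ k = 0"
        then have "A' $ k $ k \<le> 0" using A'd[of k] by simp
        then show False using A'ge[of k] k by simp
      qed
      have "A' $ i $ i = 0" using A'd[of i] w0i by (simp add: a_def)
      then show "{k. A' $ k $ k \<noteq> 0} \<noteq> {k. A $ k $ k \<noteq> 0}" using i by blast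
    qed
    then have "card {k. A' $ k $ k \<noteq> 0} < card {k. A $ k $ k \<noteq> 0}" by (intro psubset_card_mono) auto
    from less.hyps[OF this sym' psd'] obtain m :: nat and w where
      w: "\<And>x. A' *v x = (\<Sum>k<m. (w k \<bullet> x) *\<^sub>R w k)" by blast
    have "A *v x = (\<Sum>k<Suc m. ((w(m := w0)) k \<bullet> x) *\<^sub>R (w(m := w0)) k)" for x
      using w[of x] A'v[of x] by (simp add: algebra_simps)
    then show ?thesis by blast
  qed
qed

lemma char_std_normal_scaled:
  "char (distr std_normal_distribution borel (\<lambda>x. a * x)) t = complex_of_real (exp (- (a * t)\<^sup>2 / 2))"
proof -
  have "char (distr std_normal_distribution borel (\<lambda>x. a * x)) t = char std_normal_distribution (a * t)"
    unfolding char_def by (subst integral_distr) (simp_all add: mult_ac)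
  then show ?thesis by (simp add: char_std_normal_distribution)
qed

text \<open>Scaling a standard normal variable puts the degenerate variance 0 on the same footing as
  positive variances, so later arguments need no case distinction.\<close>

lemma normal_law_eq_distr:
  assumes "v \<ge> 0"
  shows "normal_law 0 v = distr std_normal_distribution borel (\<lambda>x. sqrt v * x)"
proof (cases "v = 0")
  case True
  have [simp]: "prob_space std_normal_distribution" by (rule prob_space_normal_density) simp
  have "distr std_normal_distribution borel (\<lambda>x. 0 :: real) = return borel 0"
    by (rule prob_space.distr_const) auto
  then show ?thesis using True by (simp add: normal_law_def)
next
  case False
  interpret prob_space std_normal_distribution by (rule prob_space_normal_density) simp
  have "distributed std_normal_distribution lborel (\<lambda>x. x) std_normal_density"
    unfolding distributed_def by (auto simp: distr_id2)
  then have "distributed std_normal_distribution lborel (\<lambda>x. 0 + sqrt v * x) (normal_density (0 + sqrt v * 0) (\<bar>sqrt v\<bar> * 1))"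
    by (rule normal_density_affine) (use assms False in auto)
  then have "distr std_normal_distribution lborel (\<lambda>x. sqrt v * x) = density lborel (normal_density 0 (sqrt v))"
    using assms by (simp add: distributed_def)
  moreover have "distr std_normal_distribution lborel (\<lambda>x. sqrt v * x) = distr std_normal_distribution borel (\<lambda>x. sqrt v * x)"
    by (rule distr_cong) auto
  ultimately show ?thesis using False by (simp add: normal_law_def)
qed

lemma prob_space_normal_law: "v \<ge> 0 \<Longrightarrow> prob_space (normal_law 0 v)"
  unfolding normal_law_eq_distr
  by (intro prob_space.prob_space_distr prob_space_normal_density) auto

lemma sets_normal_law: "sets (normal_law m v) = sets borel"
  by (simp add: normal_law_def)

lemma char_normal_law: "v \<ge> 0 \<Longrightarrow> char (normal_law 0 v) t = complex_of_real (exp (- (v * t\<^sup>2) / 2))"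
  unfolding normal_law_eq_distr char_std_normal_scaled by (simp add: power_mult_distrib)

text \<open>The law is realised as a sum of vectors \<open>w k\<close> weighted by independent
  standard normals, where \<open>A\<close> is the sum of the rank-one matrices of the
  \<open>w k\<close>; singular \<open>A\<close> is thereby included. Linear images are identified
  through their characteristic functions.\<close>

lemma ex_mvnormal_law:
  fixes A :: "real ^ 'd::finite ^ 'd"
  assumes sym: "\<And>x y. x \<bullet> (A *v y) = (A *v x) \<bullet> y" and psd: "\<And>x. x \<bullet> (A *v x) \<ge> 0"
  shows "\<exists>\<nu>. mvnormal_law 0 A \<nu>"
proof -
  obtain m :: nat and w where w: "\<And>x. A *v x = (\<Sum>k<m. (w k \<bullet> x) *\<^sub>R w k)"
    using psd_matrix_decomposition[OF sym psd] by blast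
  let ?P = "PiM {..<m} (\<lambda>_. std_normal_distribution)"
  have ps1: "prob_space std_normal_distribution" by (rule prob_space_normal_density) simp
  interpret prob_space ?P by (rule prob_space_PiM) (rule ps1)
  have comp: "distr ?P std_normal_distribution (\<lambda>z. z k) = std_normal_distribution" if "k < m" for k
    by (rule distr_PiM_component) (use ps1 that in auto)
  have indep: "indep_vars (\<lambda>_. std_normal_distribution) (\<lambda>k z. z k) {..<m}"
  \<comment> \<open>The characterisation of independence by a product law is applied to a nonempty
    index set; for \<open>m = 0\<close> independence is vacuous.\<close>
  proof (cases "m = 0")
    case True then show ?thesis unfolding indep_vars_def indep_sets_def by auto
  next
    case False
    show ?thesis
    proof (subst indep_vars_iff_distr_eq_PiM')
      have "distr ?P ?P (\<lambda>x. \<lambda>i\<in>{..<m}. x i) = distr ?P ?P (\<lambda>x. x)"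
        by (rule distr_cong) (auto simp: space_PiM PiE_def extensional_def fun_eq_iff)
      also have "\<dots> = ?P" by (rule distr_id)
      also have "\<dots> = PiM {..<m} (\<lambda>i. distr ?P std_normal_distribution (\<lambda>z. z i))"
        by (rule PiM_cong) (use comp in auto)
      finally show "distr ?P ?P (\<lambda>x. \<lambda>i\<in>{..<m}. x i) = PiM {..<m} (\<lambda>i. distr ?P std_normal_distribution (\<lambda>z. z i))" .
    qed (use False in auto)
  qed
  define f where "f = (\<lambda>z. \<Sum>k<m. z k *\<^sub>R w k)"
  have f[measurable]: "f \<in> borel_measurable ?P" unfolding f_def by measurable
  define \<nu> where "\<nu> = distr ?P borel f"
  have "distr \<nu> borel (\<lambda>x. v \<bullet> x) = normal_law (v \<bullet> 0) (v \<bullet> (A *v v))" for v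
  proof -
    define a where "a = (\<lambda>k. v \<bullet> w k)"
    have "distr \<nu> borel (\<lambda>x. v \<bullet> x) = distr ?P borel (\<lambda>z. v \<bullet> f z)"
      unfolding \<nu>_def by (subst distr_distr) (auto simp: comp_def)
    also have "(\<lambda>z. v \<bullet> f z) = (\<lambda>z. \<Sum>k<m. a k * z k)"
      by (simp add: f_def a_def inner_sum_right mult.commute)
    finally have eq: "distr \<nu> borel (\<lambda>x. v \<bullet> x) = distr ?P borel (\<lambda>z. \<Sum>k<m. a k * z k)" .
    have ind: "indep_vars (\<lambda>_. borel) (\<lambda>k z. a k * z k) {..<m}"
      using indep_vars_compose2[OF indep, of "\<lambda>k x. a k * x" "\<lambda>_. borel"] by simp
    have q: "v \<bullet> (A *v v) = (\<Sum>k<m. (a k)\<^sup>2)"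
      unfolding w by (simp add: inner_sum_right a_def power2_eq_square inner_commute)
    have q0: "v \<bullet> (A *v v) \<ge> 0" by (rule psd)
    have "char (distr ?P borel (\<lambda>z. \<Sum>k<m. a k * z k)) t = char (normal_law 0 (v \<bullet> (A *v v))) t" for t
    proof -
      have "char (distr ?P borel (\<lambda>z. \<Sum>k<m. a k * z k)) t = (\<Prod>k<m. char (distr ?P borel (\<lambda>z. a k * z k)) t)"
        by (rule char_distr_sum[OF ind])
      also have "\<dots> = (\<Prod>k<m. complex_of_real (exp (- (a k * t)\<^sup>2 / 2)))"
      proof (rule prod.cong[OF refl])
        fix k assume "k \<in> {..<m}"
        then have k: "k < m" by simp
        have "distr ?P borel (\<lambda>z. a k * z k) = distr (distr ?P std_normal_distribution (\<lambda>z. z k)) borel (\<lambda>x. a k * x)"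
          by (subst distr_distr) (use k in \<open>auto simp: comp_def\<close>)
        then show "char (distr ?P borel (\<lambda>z. a k * z k)) t = complex_of_real (exp (- (a k * t)\<^sup>2 / 2))"
          using comp[OF k] char_std_normal_scaled[of "a k" t] by simp
      qed
      also have "\<dots> = complex_of_real (exp (\<Sum>k<m. - (a k * t)\<^sup>2 / 2))"
        by (simp only: exp_sum[OF finite_lessThan] of_real_prod)
      also have "(\<Sum>k<m. - (a k * t)\<^sup>2 / 2) = - (v \<bullet> (A *v v) * t\<^sup>2) / 2"
        unfolding q by (simp add: sum_distrib_right sum_divide_distrib sum_negf power_mult_distrib)
      finally show ?thesis using char_normal_law[OF q0, of t] by simp
    qed
    then have "char (distr ?P borel (\<lambda>z. \<Sum>k<m. a k * z k)) = char (normal_law 0 (v \<bullet> (A *v v)))" by (rule ext)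
    moreover have "real_distribution (distr ?P borel (\<lambda>z. \<Sum>k<m. a k * z k))"
      by (intro real_distribution_distr borel_measurable_sum) measurable
    moreover have "real_distribution (normal_law 0 (v \<bullet> (A *v v)))"
      using prob_space_normal_law[OF q0] sets_normal_law sets_eq_imp_space_eq[OF sets_normal_law[of 0 "v \<bullet> (A *v v)"]]
      by (simp add: real_distribution_def real_distribution_axioms_def)
    ultimately show ?thesis unfolding eq by (simp add: Levy_uniqueness)
  qed
  moreover have "prob_space \<nu>" unfolding \<nu>_def by (rule prob_space_distr) simp
  ultimately have "mvnormal_law 0 A \<nu>" unfolding mvnormal_law_def by (simp add: \<nu>_def)
  then show ?thesis by blast
qed

lemma mvnormal_law_char:
  assumes \<nu>: "mvnormal_law 0 A \<nu>" and "v \<bullet> (A *v v) \<ge> 0"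
  shows "(CLINT x|\<nu>. iexp (v \<bullet> x)) = complex_of_real (exp (- (v \<bullet> (A *v v)) / 2))"
proof -
  have sets: "sets \<nu> = sets borel" and d: "distr \<nu> borel (\<lambda>x. v \<bullet> x) = normal_law 0 (v \<bullet> (A *v v))"
    using \<nu> by (auto simp: mvnormal_law_def)
  have [measurable]: "(\<lambda>x. v \<bullet> x) \<in> borel_measurable \<nu>" using sets by (simp cong: measurable_cong_sets)
  have "(CLINT x|\<nu>. iexp (v \<bullet> x)) = char (distr \<nu> borel (\<lambda>x. v \<bullet> x)) 1"
    unfolding char_def by (subst integral_distr) auto
  then show ?thesis unfolding d using char_normal_law[OF assms(2), of 1] by simp
qed

section \<open>Asymmetric linear series\<close>

text \<open>Coefficients are vectors so that the volatility, its gradient and its Hessian in a fixed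
  direction are instances of one and the same series.\<close>

definition tterm :: "'v::real_normed_vector \<Rightarrow> 'v \<Rightarrow> real \<Rightarrow> 'v" where
  "tterm p m x = max x 0 *\<^sub>R p - min x 0 *\<^sub>R m"

text \<open>Sequences of lags are indexed from \<open>0\<close> here: \<open>y j\<close> is the value at lag \<open>j + 1\<close>.\<close>

definition tser :: "(nat \<Rightarrow> 'v::real_normed_vector) \<Rightarrow> (nat \<Rightarrow> 'v) \<Rightarrow> (nat \<Rightarrow> real) \<Rightarrow> 'v" where
  "tser p m y = (\<Sum>j. tterm (p j) (m j) (y j))"

definition lag :: "(int \<Rightarrow> 'a \<Rightarrow> real) \<Rightarrow> int \<Rightarrow> 'a \<Rightarrow> nat \<Rightarrow> real" where
  "lag X t \<omega> = (\<lambda>j. X (t - int (Suc j)) \<omega>)"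

lemma tarch_M_eq_tser:
  "tarch_M b0 bp bm \<theta> x = b0 \<theta> + tser (\<lambda>j. bp (Suc j) \<theta>) (\<lambda>j. bm (Suc j) \<theta>) (\<lambda>j. x (Suc j))"
  by (simp add: tarch_M_def tser_def tterm_def mult.commute)

lemma past_Suc: "past X t \<omega> (Suc j) = lag X t \<omega> j"
  by (simp add: past_def lag_def)

text \<open>The increments of positive and negative part add up to exactly \<open>|x - y|\<close>,
  so a common bound \<open>w\<close> of both coefficients is a Lipschitz constant without a factor
  2.\<close>

lemma norm_tterm_diff:
  assumes "norm p \<le> w" "norm m \<le> w"
  shows "norm (tterm p m x - tterm p m y) \<le> w * \<bar>x - y\<bar>"
proof -
  have "tterm p m x - tterm p m y = (max x 0 - max y 0) *\<^sub>R p - (min x 0 - min y 0) *\<^sub>R m"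
    by (simp add: tterm_def scaleR_left_diff_distrib)
  then have "norm (tterm p m x - tterm p m y) \<le> \<bar>max x 0 - max y 0\<bar> * norm p + \<bar>min x 0 - min y 0\<bar> * norm m"
    using norm_triangle_ineq4[of "(max x 0 - max y 0) *\<^sub>R p" "(min x 0 - min y 0) *\<^sub>R m"] by simp
  also have "\<dots> \<le> \<bar>max x 0 - max y 0\<bar> * w + \<bar>min x 0 - min y 0\<bar> * w"
    using assms by (intro add_mono mult_left_mono) auto
  also have "\<dots> = w * (\<bar>max x 0 - max y 0\<bar> + \<bar>min x 0 - min y 0\<bar>)" by (simp add: algebra_simps)
  also have "\<bar>max x 0 - max y 0\<bar> + \<bar>min x 0 - min y 0\<bar> = \<bar>x - y\<bar>" by (auto simp: max_def min_def)
  finally show ?thesis .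
qed

lemma tterm_0 [simp]: "tterm p m 0 = 0" by (simp add: tterm_def)

lemma norm_tterm: "norm p \<le> w \<Longrightarrow> norm m \<le> w \<Longrightarrow> norm (tterm p m x) \<le> w * \<bar>x\<bar>"
  using norm_tterm_diff[of p w m x 0] by simp

lemma tterm_diff: "tterm (p - p') (m - m') x = tterm p m x - tterm p' m' x"
  by (simp add: tterm_def algebra_simps)

lemma tser_bound:
  fixes p m :: "nat \<Rightarrow> 'v::banach"
  assumes w: "\<And>j. norm (p j) \<le> w j" "\<And>j. norm (m j) \<le> w j" and s: "summable (\<lambda>j. w j * \<bar>y j\<bar>)"
  shows "summable (\<lambda>j. tterm (p j) (m j) (y j))" "norm (tser p m y) \<le> (\<Sum>j. w j * \<bar>y j\<bar>)"
proof -
  have b: "norm (tterm (p j) (m j) (y j)) \<le> w j * \<bar>y j\<bar>" for j by (rule norm_tterm[OF w])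
  have sn: "summable (\<lambda>j. norm (tterm (p j) (m j) (y j)))"
    by (rule summable_comparison_test'[OF s, of 0]) (use b in auto)
  then show "summable (\<lambda>j. tterm (p j) (m j) (y j))" by (rule summable_norm_cancel)
  have "norm (tser p m y) \<le> (\<Sum>j. norm (tterm (p j) (m j) (y j)))"
    unfolding tser_def by (rule summable_norm[OF sn])
  also have "\<dots> \<le> (\<Sum>j. w j * \<bar>y j\<bar>)" by (rule suminf_le[OF b sn s])
  finally show "norm (tser p m y) \<le> (\<Sum>j. w j * \<bar>y j\<bar>)" .
qed

lemma summable_weighted_diff:
  fixes x y w :: "nat \<Rightarrow> real"
  assumes "\<And>j. w j \<ge> 0" "summable (\<lambda>j. w j * \<bar>x j\<bar>)" "summable (\<lambda>j. w j * \<bar>y j\<bar>)"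
  shows "summable (\<lambda>j. w j * \<bar>x j - y j\<bar>)"
proof (rule summable_comparison_test'[of "\<lambda>j. w j * \<bar>x j\<bar> + w j * \<bar>y j\<bar>" 0])
  fix j
  have "w j * \<bar>x j - y j\<bar> \<le> w j * (\<bar>x j\<bar> + \<bar>y j\<bar>)" using assms(1) by (intro mult_left_mono) auto
  then show "norm (w j * \<bar>x j - y j\<bar>) \<le> w j * \<bar>x j\<bar> + w j * \<bar>y j\<bar>"
    using assms(1) by (simp add: distrib_left abs_mult)
qed (use assms in \<open>auto intro: summable_add\<close>)

lemma tser_diff_seq:
  fixes p m :: "nat \<Rightarrow> 'v::banach"
  assumes w: "\<And>j. norm (p j) \<le> w j" "\<And>j. norm (m j) \<le> w j"
    and s: "summable (\<lambda>j. w j * \<bar>x j\<bar>)" "summable (\<lambda>j. w j * \<bar>y j\<bar>)"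
  shows "norm (tser p m x - tser p m y) \<le> (\<Sum>j. w j * \<bar>x j - y j\<bar>)"
proof -
  have w0: "w j \<ge> 0" for j using w(1)[of j] norm_ge_zero order_trans by blast
  have sd: "summable (\<lambda>j. w j * \<bar>x j - y j\<bar>)" by (rule summable_weighted_diff[OF w0 s])
  have b: "norm (tterm (p j) (m j) (x j) - tterm (p j) (m j) (y j)) \<le> w j * \<bar>x j - y j\<bar>" for j
    by (rule norm_tterm_diff[OF w])
  have sn: "summable (\<lambda>j. norm (tterm (p j) (m j) (x j) - tterm (p j) (m j) (y j)))"
    by (rule summable_comparison_test'[OF sd, of 0]) (use b in auto)
  have "tser p m x - tser p m y = (\<Sum>j. tterm (p j) (m j) (x j) - tterm (p j) (m j) (y j))"
    unfolding tser_def by (rule suminf_diff[OF tser_bound(1)[OF w s(1)] tser_bound(1)[OF w s(2)]])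
  also have "norm \<dots> \<le> (\<Sum>j. norm (tterm (p j) (m j) (x j) - tterm (p j) (m j) (y j)))"
    by (rule summable_norm[OF sn])
  also have "\<dots> \<le> (\<Sum>j. w j * \<bar>x j - y j\<bar>)" by (rule suminf_le[OF b sn sd])
  finally show ?thesis .
qed

lemma tser_diff_coeff:
  fixes p m p' m' :: "nat \<Rightarrow> 'v::banach"
  assumes "summable (\<lambda>j. tterm (p j) (m j) (y j))" "summable (\<lambda>j. tterm (p' j) (m' j) (y j))"
  shows "tser p m y - tser p' m' y = tser (\<lambda>j. p j - p' j) (\<lambda>j. m j - m' j) y"
  unfolding tser_def using suminf_diff[OF assms] by (simp add: tterm_diff)

lemma borel_measurable_tterm [measurable]:
  fixes p m :: "'v::{real_normed_vector, second_countable_topology}"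
  assumes [measurable]: "f \<in> borel_measurable N"
  shows "(\<lambda>\<omega>. tterm p m (f \<omega>)) \<in> borel_measurable N"
  unfolding tterm_def by measurable

lemma borel_measurable_tser [measurable]:
  fixes p m :: "nat \<Rightarrow> 'v::{banach, second_countable_topology}"
  assumes [measurable]: "\<And>j. (\<lambda>\<omega>. f \<omega> j) \<in> borel_measurable N"
  shows "(\<lambda>\<omega>. tser p m (f \<omega>)) \<in> borel_measurable N"
  unfolding tser_def by measurable

section \<open>The stationary solution is a function of past innovations\<close>

lemma (in prob_space) indep_pair_nn_integral:
  assumes ind: "indep_pair M S X T Y" and f[measurable]: "f \<in> borel_measurable S" and g[measurable]: "g \<in> borel_measurable T"
  shows "(\<integral>\<^sup>+\<omega>. f (X \<omega>) * g (Y \<omega>) \<partial>M) = (\<integral>\<^sup>+\<omega>. f (X \<omega>) \<partial>M) * (\<integral>\<^sup>+\<omega>. g (Y \<omega>) \<partial>M)"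
proof -
  have rv[measurable]: "random_variable S X" "random_variable T Y"
    and eq: "distr M (S \<Otimes>\<^sub>M T) (\<lambda>\<omega>. (X \<omega>, Y \<omega>)) = distr M S X \<Otimes>\<^sub>M distr M T Y"
    using ind unfolding indep_pair_def by auto
  interpret Y: prob_space "distr M T Y" by (rule prob_space_distr) fact
  have "(\<integral>\<^sup>+\<omega>. f (X \<omega>) * g (Y \<omega>) \<partial>M) = (\<integral>\<^sup>+z. f (fst z) * g (snd z) \<partial>distr M (S \<Otimes>\<^sub>M T) (\<lambda>\<omega>. (X \<omega>, Y \<omega>)))"
    by (subst nn_integral_distr) auto
  also have "\<dots> = (\<integral>\<^sup>+x. \<integral>\<^sup>+y. f x * g y \<partial>distr M T Y \<partial>distr M S X)"
    unfolding eq by (subst Y.nn_integral_fst[symmetric]) auto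
  also have "\<dots> = (\<integral>\<^sup>+x. f x * (\<integral>\<^sup>+y. g y \<partial>distr M T Y) \<partial>distr M S X)"
    by (intro nn_integral_cong nn_integral_cmult) simp
  also have "\<dots> = (\<integral>\<^sup>+x. f x \<partial>distr M S X) * (\<integral>\<^sup>+y. g y \<partial>distr M T Y)"
    by (rule nn_integral_multc) simp
  finally show ?thesis by (simp add: nn_integral_distr)
qed

lemma AE_summable_weighted:
  fixes Z :: "nat \<Rightarrow> 'a \<Rightarrow> real"
  assumes [measurable]: "\<And>j. Z j \<in> borel_measurable M" and w: "\<And>j. w j \<ge> 0" "summable w"
    and C: "\<And>j. (\<integral>\<^sup>+\<omega>. ennreal \<bar>Z j \<omega>\<bar> \<partial>M) \<le> C" "C < \<infinity>"
  shows "AE \<omega> in M. summable (\<lambda>j. w j * \<bar>Z j \<omega>\<bar>)"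
proof -
  have "(\<integral>\<^sup>+\<omega>. (\<Sum>j. ennreal (w j * \<bar>Z j \<omega>\<bar>)) \<partial>M) = (\<Sum>j. \<integral>\<^sup>+\<omega>. ennreal (w j * \<bar>Z j \<omega>\<bar>) \<partial>M)"
    by (rule nn_integral_suminf) simp
  also have "\<dots> = (\<Sum>j. ennreal (w j) * (\<integral>\<^sup>+\<omega>. ennreal \<bar>Z j \<omega>\<bar> \<partial>M))"
    using w by (simp add: ennreal_mult nn_integral_cmult)
  also have "\<dots> \<le> (\<Sum>j. ennreal (w j) * C)"
    by (intro suminf_le mult_left_mono C) auto
  also have "\<dots> = ennreal (\<Sum>j. w j) * C"
    using w by (simp add: suminf_ennreal2)
  also have "\<dots> < \<infinity>" using C(2) by (simp add: ennreal_mult_less_top)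
  finally have "(\<integral>\<^sup>+\<omega>. (\<Sum>j. ennreal (w j * \<bar>Z j \<omega>\<bar>)) \<partial>M) \<noteq> \<infinity>" by simp
  then have "AE \<omega> in M. (\<Sum>j. ennreal (w j * \<bar>Z j \<omega>\<bar>)) \<noteq> \<infinity>"
    by (intro nn_integral_noteq_infinite) auto
  then show ?thesis
    by eventually_elim (rule summable_suminf_not_top, use w in auto)
qed

locale tarch_setting = prob_space M for M :: "'a measure" +
  fixes \<xi> X :: "int \<Rightarrow> 'a \<Rightarrow> real"
    and b0 :: "real ^ 'd::finite \<Rightarrow> real"
    and bp bm :: "nat \<Rightarrow> real ^ 'd \<Rightarrow> real"
    and \<Theta> :: "(real ^ 'd) set"
    and \<theta>0 :: "real ^ 'd"
    and u :: "nat \<Rightarrow> real"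
  assumes iid: "iid_process M \<xi>"
    and int_\<xi>2: "integrable M (\<lambda>\<omega>. (\<xi> 0 \<omega>)\<^sup>2)"
    and mean_\<xi>2: "expectation (\<lambda>\<omega>. (\<xi> 0 \<omega>)\<^sup>2) = 1"
    and bp_nonneg: "\<And>j \<theta>. j \<ge> 1 \<Longrightarrow> bp j \<theta> \<ge> 0"
    and bm_nonneg: "\<And>j \<theta>. j \<ge> 1 \<Longrightarrow> bm j \<theta> \<ge> 0"
    and cont_b0: "continuous_on \<Theta> b0"
    and cont_bp: "\<And>j. j \<ge> 1 \<Longrightarrow> continuous_on \<Theta> (bp j)"
    and cont_bm: "\<And>j. j \<ge> 1 \<Longrightarrow> continuous_on \<Theta> (bm j)"
    and compact_\<Theta>: "compact \<Theta>"
    and \<Theta>_subset: "\<Theta> \<subseteq> Theta_r M \<xi> bp bm 2"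
    and \<theta>0: "\<theta>0 \<in> \<Theta>"
    and solution: "stationary_solution M \<xi> b0 bp bm \<theta>0 2 X"
    and identifiable: "\<And>\<theta> t. \<theta> \<in> \<Theta> \<Longrightarrow>
           (AE \<omega> in M. H_proc b0 bp bm X t \<omega> \<theta> = H_proc b0 bp bm X t \<omega> \<theta>0) \<Longrightarrow> \<theta> = \<theta>0"
    and b0_pos: "(INF \<theta>\<in>\<Theta>. b0 \<theta>) > 0"
    and coeff_decay: "\<exists>l>3/2. (\<lambda>j. SUP \<theta>\<in>\<Theta>. max (bm j \<theta>) (bp j \<theta>)) \<in> O(\<lambda>j. real j powr (- l))"
    and u_finite: "finite {j. u j \<noteq> 0}"
begin

lemma \<xi>_indep: "indep_vars (\<lambda>_. borel) \<xi> UNIV" using iid by (simp add: iid_process_def)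

lemma \<xi>_measurable [measurable]: "\<xi> t \<in> borel_measurable M"
  using \<xi>_indep by (auto simp: indep_vars_def)

lemma X_measurable [measurable]: "X t \<in> borel_measurable M"
  using solution by (simp add: stationary_solution_def)

lemma X_stationary: "stationary M X" and X_ergodic: "ergodic M X" and X_causal: "causal M \<xi> X"
  using solution by (auto simp: stationary_solution_def)

lemma X_eq: "AE \<omega> in M. X t \<omega> = tarch_M b0 bp bm \<theta>0 (past X t \<omega>) * \<xi> t \<omega>"
  using solution by (simp add: stationary_solution_def)

lemma distr_\<xi>: "distr M borel (\<xi> t) = distr M borel (\<xi> 0)"
  using iid by (simp add: iid_process_def)

lemma int_X2: "integrable M (\<lambda>\<omega>. (X t \<omega>)\<^sup>2)"
proof -
  have "integrable M (\<lambda>\<omega>. (X 0 \<omega>)\<^sup>2)"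
    using solution by (simp add: stationary_solution_def powr_numeral cong: integrable_cong)
  then show ?thesis
    using stationary_transfer(1)[OF X_stationary X_measurable, of "\<lambda>x. (x 0)\<^sup>2" t] by simp
qed

lemma int_X: "integrable M (X t)"
  by (rule square_integrable_imp_integrable[OF _ int_X2]) simp

lemma nn_X: "(\<integral>\<^sup>+\<omega>. ennreal \<bar>X t \<omega>\<bar> \<partial>M) = ennreal (expectation (\<lambda>\<omega>. \<bar>X 0 \<omega>\<bar>))"
proof -
  have "expectation (\<lambda>\<omega>. \<bar>X t \<omega>\<bar>) = expectation (\<lambda>\<omega>. \<bar>X 0 \<omega>\<bar>)"
    using stationary_transfer(2)[OF X_stationary X_measurable, of "\<lambda>x. \<bar>x 0\<bar>" t] by simp
  then show ?thesis using int_X[of t] by (subst nn_integral_eq_integral) auto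
qed

lemma AE_summable_lag:
  assumes "\<And>j. w j \<ge> 0" "summable w"
  shows "AE \<omega> in M. summable (\<lambda>j. w j * \<bar>lag X t \<omega> j\<bar>)"
  unfolding lag_def by (rule AE_summable_weighted[OF _ assms]) (use nn_X in auto)

text \<open>Since \<open>|x| \<le> (1 + x^2) / 2\<close>, a unit second moment forces a first moment
  of at most 1. This turns the condition defining \<open>\<Theta>(2)\<close> into a contraction in
  mean.\<close>

lemma nn_\<xi>_le_1: "(\<integral>\<^sup>+\<omega>. ennreal \<bar>\<xi> t \<omega>\<bar> \<partial>M) \<le> 1"
proof -
  have int: "integrable M (\<xi> 0)" by (rule square_integrable_imp_integrable[OF _ int_\<xi>2]) simp
  have "expectation (\<lambda>\<omega>. \<bar>\<xi> 0 \<omega>\<bar>) \<le> expectation (\<lambda>\<omega>. (1 + (\<xi> 0 \<omega>)\<^sup>2) / 2)"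
  proof (rule integral_mono)
    fix \<omega>
    have "0 \<le> (\<bar>\<xi> 0 \<omega>\<bar> - 1)\<^sup>2" by simp
    then show "\<bar>\<xi> 0 \<omega>\<bar> \<le> (1 + (\<xi> 0 \<omega>)\<^sup>2) / 2" by (simp add: power2_eq_square algebra_simps)
  qed (use int int_\<xi>2 in auto)
  also have "\<dots> = 1" using mean_\<xi>2 int_\<xi>2 by (simp add: prob_space)
  finally have "(\<integral>\<^sup>+\<omega>. ennreal \<bar>\<xi> 0 \<omega>\<bar> \<partial>M) \<le> 1"
    using int by (subst nn_integral_eq_integral) (auto simp: ennreal_le_1)
  moreover have "(\<integral>\<^sup>+\<omega>. ennreal \<bar>\<xi> t \<omega>\<bar> \<partial>M) = (\<integral>\<^sup>+\<omega>. ennreal \<bar>\<xi> 0 \<omega>\<bar> \<partial>M)" for t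
    using nn_integral_distr[of "\<xi> t" M borel "\<lambda>x. ennreal \<bar>x\<bar>"] nn_integral_distr[of "\<xi> 0" M borel "\<lambda>x. ennreal \<bar>x\<bar>"] distr_\<xi>[of t] by simp
  ultimately show ?thesis by metis
qed

definition w0 :: "nat \<Rightarrow> real" where "w0 j = max (bm (Suc j) \<theta>0) (bp (Suc j) \<theta>0)"

lemma w0_nonneg: "w0 j \<ge> 0" using bp_nonneg[of "Suc j" \<theta>0] by (simp add: w0_def)

text \<open>The second moment of the innovations is 1, so the threshold in \<open>Theta_r\<close>
  for \<open>r = 2\<close> is a power of 1.\<close>

lemma w0_summable: "summable w0" and w0_sum: "(\<Sum>j. w0 j) < 1"
proof -
  have *: "(\<integral>\<omega>. \<bar>\<xi> 0 \<omega>\<bar> powr 2 \<partial>M) = 1" using mean_\<xi>2 by (simp add: powr_numeral)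
  have "\<theta>0 \<in> Theta_r M \<xi> bp bm 2" using \<theta>0 \<Theta>_subset by blast
  then show "summable w0" "(\<Sum>j. w0 j) < 1"
    unfolding Theta_r_def w0_def[abs_def] by (auto simp: * mean_\<xi>2)
qed

lemma norm_b_le_w0: "norm (bp (Suc j) \<theta>0) \<le> w0 j" "norm (bm (Suc j) \<theta>0) \<le> w0 j"
  using bp_nonneg[of "Suc j" \<theta>0] bm_nonneg[of "Suc j" \<theta>0] by (auto simp: w0_def)

text \<open>Stated in \<open>ennreal\<close>, so that an infinite right-hand side is harmless; when
  it is finite, \<open>y\<close> inherits weighted summability from \<open>x\<close>.\<close>

lemma tarch_M_contraction:
  assumes s: "summable (\<lambda>j. w0 j * \<bar>x (Suc j)\<bar>)"
  shows "ennreal \<bar>tarch_M b0 bp bm \<theta>0 x - tarch_M b0 bp bm \<theta>0 y\<bar> \<le> (\<Sum>j. ennreal (w0 j * \<bar>x (Suc j) - y (Suc j)\<bar>))"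
proof (cases "(\<Sum>j. ennreal (w0 j * \<bar>x (Suc j) - y (Suc j)\<bar>)) = \<infinity>")
  case False
  then have sd: "summable (\<lambda>j. w0 j * \<bar>x (Suc j) - y (Suc j)\<bar>)"
    by (intro summable_suminf_not_top) (use w0_nonneg in auto)
  have "summable (\<lambda>j. w0 j * \<bar>x (Suc j) - (x (Suc j) - y (Suc j))\<bar>)"
    by (rule summable_weighted_diff[OF w0_nonneg s sd])
  then have sy: "summable (\<lambda>j. w0 j * \<bar>y (Suc j)\<bar>)" by simp
  have "\<bar>tarch_M b0 bp bm \<theta>0 x - tarch_M b0 bp bm \<theta>0 y\<bar> \<le> (\<Sum>j. w0 j * \<bar>x (Suc j) - y (Suc j)\<bar>)"
    unfolding tarch_M_eq_tser using tser_diff_seq[OF norm_b_le_w0 s sy] by simp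
  then have "ennreal \<bar>tarch_M b0 bp bm \<theta>0 x - tarch_M b0 bp bm \<theta>0 y\<bar> \<le> ennreal (\<Sum>j. w0 j * \<bar>x (Suc j) - y (Suc j)\<bar>)"
    by (rule ennreal_leI)
  also have "\<dots> = (\<Sum>j. ennreal (w0 j * \<bar>x (Suc j) - y (Suc j)\<bar>))"
    using sd w0_nonneg by (intro suminf_ennreal2[symmetric]) auto
  finally show ?thesis .
qed simp

text \<open>Successive approximation started from 0, as a function of a deterministic innovation
  path. Only values of \<open>z\<close> up to time \<open>t\<close> enter, which makes the limit
  causal.\<close>

fun picard :: "nat \<Rightarrow> (int \<Rightarrow> real) \<Rightarrow> int \<Rightarrow> real" where
  "picard 0 z t = 0"
| "picard (Suc k) z t = tarch_M b0 bp bm \<theta>0 (\<lambda>j. picard k z (t - int j)) * z t"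

lemma picard_measurable [measurable]: "(\<lambda>z. picard k z t) \<in> borel_measurable path_space"
proof (induction k arbitrary: t)
  case (Suc k)
  note [measurable] = Suc
  show ?case unfolding picard.simps tarch_M_eq_tser by measurable
qed simp

lemma picard_measurable_M [measurable]: "(\<lambda>\<omega>. picard k (\<lambda>s. \<xi> s \<omega>) t) \<in> borel_measurable M"
  using measurable_compose[OF measurable_path(2)[of \<xi> M] picard_measurable] by simp

lemma picard_cong: "(\<And>s. s \<le> t \<Longrightarrow> z s = z' s) \<Longrightarrow> picard k z t = picard k z' t"
proof (induction k arbitrary: t)
  case (Suc k)
  have "(\<lambda>j. picard k z (t - int j)) = (\<lambda>j. picard k z' (t - int j))"
    using Suc.prems by (intro ext Suc.IH) auto
  then show ?case using Suc.prems[of t] by simp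
qed simp

text \<open>Causality only gives independence of each single \<open>X t\<close> from later innovations. It suffices
  because the weight \<open>\<psi>\<close> collects the innovations met along a branch of the iterated recursion.\<close>

lemma picard_error:
  assumes "\<psi> \<in> borel_measurable (PiM {t<..} (\<lambda>_. borel))"
  shows "(\<integral>\<^sup>+\<omega>. ennreal \<bar>X t \<omega> - picard k (\<lambda>s. \<xi> s \<omega>) t\<bar> * \<psi> (\<lambda>i\<in>{t<..}. \<xi> i \<omega>) \<partial>M)
    \<le> ennreal ((\<Sum>j. w0 j) ^ k * expectation (\<lambda>\<omega>. \<bar>X 0 \<omega>\<bar>)) * (\<integral>\<^sup>+\<omega>. \<psi> (\<lambda>i\<in>{t<..}. \<xi> i \<omega>) \<partial>M)"
  using assms
proof (induction k arbitrary: t \<psi>)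
  case 0
  note \<psi>[measurable] = "0.prems"
  have "indep_pair M (Pi\<^sub>M {t} (\<lambda>_. borel)) (\<lambda>\<omega>. \<lambda>i\<in>{t}. X i \<omega>) (Pi\<^sub>M {t<..} (\<lambda>_. borel)) (\<lambda>\<omega>. \<lambda>i\<in>{t<..}. \<xi> i \<omega>)"
    using X_causal unfolding causal_def indep_pair_iff_indep_var by blast
  from indep_pair_nn_integral[OF this, of "\<lambda>z. ennreal \<bar>z t\<bar>" \<psi>]
  have "(\<integral>\<^sup>+\<omega>. ennreal \<bar>X t \<omega>\<bar> * \<psi> (\<lambda>i\<in>{t<..}. \<xi> i \<omega>) \<partial>M) = ennreal (expectation (\<lambda>\<omega>. \<bar>X 0 \<omega>\<bar>)) * (\<integral>\<^sup>+\<omega>. \<psi> (\<lambda>i\<in>{t<..}. \<xi> i \<omega>) \<partial>M)"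
    using nn_X[of t] by simp
  then show ?case by (simp only: picard.simps diff_0_right power_0 mult_1_left order_refl)
next
  case (Suc k)
  note \<psi>[measurable] = Suc.prems
  let ?R = "\<lambda>t \<omega>. \<lambda>i\<in>{t<..}. \<xi> i \<omega>" and ?C = "ennreal ((\<Sum>j. w0 j) ^ k * expectation (\<lambda>\<omega>. \<bar>X 0 \<omega>\<bar>))"
  let ?D = "\<lambda>j \<omega>. ennreal \<bar>X (t - int (Suc j)) \<omega> - picard k (\<lambda>s. \<xi> s \<omega>) (t - int (Suc j))\<bar>"
  have R[measurable]: "?R s \<in> M \<rightarrow>\<^sub>M PiM {s<..} (\<lambda>_. borel)" for s
    by (intro measurable_restrict) simp
  have S0: "(\<Sum>j. w0 j) \<ge> 0" using w0_nonneg w0_summable by (intro suminf_nonneg)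
  have "AE \<omega> in M. ennreal \<bar>X t \<omega> - picard (Suc k) (\<lambda>s. \<xi> s \<omega>) t\<bar> * \<psi> (?R t \<omega>)
     \<le> (\<Sum>j. ennreal (w0 j) * (?D j \<omega> * (ennreal \<bar>\<xi> t \<omega>\<bar> * \<psi> (?R t \<omega>))))"
    using X_eq[of t] AE_summable_lag[OF w0_nonneg w0_summable, of t]
  proof eventually_elim
    case (elim \<omega>)
    have "ennreal \<bar>X t \<omega> - picard (Suc k) (\<lambda>s. \<xi> s \<omega>) t\<bar> =
       ennreal \<bar>tarch_M b0 bp bm \<theta>0 (past X t \<omega>) - tarch_M b0 bp bm \<theta>0 (\<lambda>j. picard k (\<lambda>s. \<xi> s \<omega>) (t - int j))\<bar> * ennreal \<bar>\<xi> t \<omega>\<bar>"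
      unfolding elim(1) picard.simps left_diff_distrib[symmetric] abs_mult by (simp add: ennreal_mult)
    also have "\<dots> \<le> (\<Sum>j. ennreal (w0 j * \<bar>past X t \<omega> (Suc j) - picard k (\<lambda>s. \<xi> s \<omega>) (t - int (Suc j))\<bar>)) * ennreal \<bar>\<xi> t \<omega>\<bar>"
      by (intro mult_right_mono tarch_M_contraction) (use elim(2) in \<open>simp_all add: past_Suc\<close>)
    also have "\<dots> = (\<Sum>j. ennreal (w0 j) * ?D j \<omega>) * ennreal \<bar>\<xi> t \<omega>\<bar>"
      using w0_nonneg by (simp add: past_def ennreal_mult)
    finally have "ennreal \<bar>X t \<omega> - picard (Suc k) (\<lambda>s. \<xi> s \<omega>) t\<bar> * \<psi> (?R t \<omega>)
       \<le> (\<Sum>j. ennreal (w0 j) * ?D j \<omega>) * ennreal \<bar>\<xi> t \<omega>\<bar> * \<psi> (?R t \<omega>)"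
      by (intro mult_right_mono) auto
    also have "\<dots> = (\<Sum>j. ennreal (w0 j) * (?D j \<omega> * (ennreal \<bar>\<xi> t \<omega>\<bar> * \<psi> (?R t \<omega>))))"
      by (simp add: mult.assoc flip: ennreal_suminf_multc)
    finally show ?case .
  qed
  then have "(\<integral>\<^sup>+\<omega>. ennreal \<bar>X t \<omega> - picard (Suc k) (\<lambda>s. \<xi> s \<omega>) t\<bar> * \<psi> (?R t \<omega>) \<partial>M)
     \<le> (\<integral>\<^sup>+\<omega>. (\<Sum>j. ennreal (w0 j) * (?D j \<omega> * (ennreal \<bar>\<xi> t \<omega>\<bar> * \<psi> (?R t \<omega>)))) \<partial>M)"
    by (rule nn_integral_mono_AE)
  also have "\<dots> = (\<Sum>j. ennreal (w0 j) * (\<integral>\<^sup>+\<omega>. ?D j \<omega> * (ennreal \<bar>\<xi> t \<omega>\<bar> * \<psi> (?R t \<omega>)) \<partial>M))"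
    by (simp add: nn_integral_suminf nn_integral_cmult)
  also have "\<dots> \<le> (\<Sum>j. ennreal (w0 j) * (?C * (\<integral>\<^sup>+\<omega>. \<psi> (?R t \<omega>) \<partial>M)))"
  proof (intro suminf_le mult_left_mono)
    fix j
    define s where "s = t - int (Suc j)"
    have st: "s < t" by (simp add: s_def)
    \<comment> \<open>Seen from the earlier time \<open>s\<close>, the factor
      \<open>|\<xi> t|\<close> produced by the recursion is one more later innovation. Absorbed into
      the weight, it leaves the induction hypothesis concerned with the single variable
      \<open>X s\<close>.\<close>
    define \<psi>' where "\<psi>' = (\<lambda>z::int \<Rightarrow> real. ennreal \<bar>z t\<bar> * \<psi> (restrict z {t<..}))"
    have [measurable]: "(\<lambda>z. restrict z {t<..}) \<in> PiM {s<..} (\<lambda>_. borel) \<rightarrow>\<^sub>M PiM {t<..} (\<lambda>_. borel :: real measure)"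
      by (rule measurable_restrict_subset) (use st in auto)
    have [measurable]: "(\<lambda>z. z t) \<in> PiM {s<..} (\<lambda>_. borel) \<rightarrow>\<^sub>M (borel :: real measure)"
      by (rule measurable_component_singleton) (use st in auto)
    have \<psi>': "\<psi>' \<in> borel_measurable (PiM {s<..} (\<lambda>_. borel))" unfolding \<psi>'_def by measurable
    have \<psi>'_eq: "\<psi>' (?R s \<omega>) = ennreal \<bar>\<xi> t \<omega>\<bar> * \<psi> (?R t \<omega>)" for \<omega>
    proof -
      have "restrict (?R s \<omega>) {t<..} = ?R t \<omega>" using st by (auto simp: fun_eq_iff restrict_def)
      then show ?thesis using st by (simp add: \<psi>'_def)
    qed
    \<comment> \<open>Integrating out \<open>\<xi> t\<close>, independent of the innovations after
      \<open>t\<close>, costs a factor of at most 1; each level of the recursion then contributes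
      only the sum of the \<open>w0 j\<close>.\<close>
    have "indep_pair M (Pi\<^sub>M {t} (\<lambda>_. borel)) (\<lambda>\<omega>. \<lambda>i\<in>{t}. \<xi> i \<omega>) (Pi\<^sub>M {t<..} (\<lambda>_. borel)) (?R t)"
      unfolding indep_pair_iff_indep_var by (rule indep_var_restrict[OF \<xi>_indep]) auto
    from indep_pair_nn_integral[OF this, of "\<lambda>z. ennreal \<bar>z t\<bar>" \<psi>]
    have "(\<integral>\<^sup>+\<omega>. ennreal \<bar>\<xi> t \<omega>\<bar> * \<psi> (?R t \<omega>) \<partial>M) = (\<integral>\<^sup>+\<omega>. ennreal \<bar>\<xi> t \<omega>\<bar> \<partial>M) * (\<integral>\<^sup>+\<omega>. \<psi> (?R t \<omega>) \<partial>M)"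
      by simp
    also have "\<dots> \<le> 1 * (\<integral>\<^sup>+\<omega>. \<psi> (?R t \<omega>) \<partial>M)" by (intro mult_right_mono nn_\<xi>_le_1) simp
    finally have le: "(\<integral>\<^sup>+\<omega>. ennreal \<bar>\<xi> t \<omega>\<bar> * \<psi> (?R t \<omega>) \<partial>M) \<le> (\<integral>\<^sup>+\<omega>. \<psi> (?R t \<omega>) \<partial>M)" by simp
    have "(\<integral>\<^sup>+\<omega>. ?D j \<omega> * (ennreal \<bar>\<xi> t \<omega>\<bar> * \<psi> (?R t \<omega>)) \<partial>M) \<le> ?C * (\<integral>\<^sup>+\<omega>. ennreal \<bar>\<xi> t \<omega>\<bar> * \<psi> (?R t \<omega>) \<partial>M)"
      using Suc.IH[OF \<psi>'] unfolding \<psi>'_eq unfolding s_def .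
    also have "\<dots> \<le> ?C * (\<integral>\<^sup>+\<omega>. \<psi> (?R t \<omega>) \<partial>M)" by (intro mult_left_mono le) simp
    finally show "(\<integral>\<^sup>+\<omega>. ?D j \<omega> * (ennreal \<bar>\<xi> t \<omega>\<bar> * \<psi> (?R t \<omega>)) \<partial>M) \<le> ?C * (\<integral>\<^sup>+\<omega>. \<psi> (?R t \<omega>) \<partial>M)" .
  qed auto
  also have "\<dots> = ennreal (\<Sum>j. w0 j) * (?C * (\<integral>\<^sup>+\<omega>. \<psi> (?R t \<omega>) \<partial>M))"
    using w0_nonneg w0_summable by (simp add: suminf_ennreal2)
  also have "\<dots> = ennreal ((\<Sum>j. w0 j) ^ Suc k * expectation (\<lambda>\<omega>. \<bar>X 0 \<omega>\<bar>)) * (\<integral>\<^sup>+\<omega>. \<psi> (?R t \<omega>) \<partial>M)"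
    using S0 by (simp add: mult.assoc[symmetric] ennreal_mult[symmetric])
  finally show ?case .
qed

text \<open>The mean errors decay geometrically. Their sum is thus finite in expectation, and the
  terms of an almost surely finite series tend to 0.\<close>

lemma picard_converges: "AE \<omega> in M. \<forall>t. (\<lambda>k. picard k (\<lambda>s. \<xi> s \<omega>) t) \<longlonglongrightarrow> X t \<omega>"
proof -
  have "AE \<omega> in M. (\<lambda>k. picard k (\<lambda>s. \<xi> s \<omega>) t) \<longlonglongrightarrow> X t \<omega>" for t
  proof -
    let ?S = "\<Sum>j. w0 j" and ?C = "expectation (\<lambda>\<omega>. \<bar>X 0 \<omega>\<bar>)"
    have S0: "?S \<ge> 0" using w0_nonneg w0_summable by (intro suminf_nonneg)
    have le: "(\<integral>\<^sup>+\<omega>. ennreal \<bar>X t \<omega> - picard k (\<lambda>s. \<xi> s \<omega>) t\<bar> \<partial>M) \<le> ennreal (?S ^ k * ?C)" for k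
      using picard_error[of "\<lambda>_. 1" t k] by (simp add: emeasure_space_1)
    have "(\<integral>\<^sup>+\<omega>. (\<Sum>k. ennreal \<bar>X t \<omega> - picard k (\<lambda>s. \<xi> s \<omega>) t\<bar>) \<partial>M)
       = (\<Sum>k. \<integral>\<^sup>+\<omega>. ennreal \<bar>X t \<omega> - picard k (\<lambda>s. \<xi> s \<omega>) t\<bar> \<partial>M)"
      by (rule nn_integral_suminf) simp
    also have "\<dots> \<le> (\<Sum>k. ennreal (?S ^ k * ?C))" by (intro suminf_le le) auto
    also have "\<dots> = ennreal (\<Sum>k. ?S ^ k * ?C)"
      using S0 w0_sum by (intro suminf_ennreal2 summable_mult2 summable_geometric) auto
    also have "\<dots> < \<infinity>" by simp
    finally have "AE \<omega> in M. (\<Sum>k. ennreal \<bar>X t \<omega> - picard k (\<lambda>s. \<xi> s \<omega>) t\<bar>) \<noteq> \<infinity>"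
      by (intro nn_integral_noteq_infinite) auto
    then show ?thesis
    proof eventually_elim
      case (elim \<omega>)
      then have "summable (\<lambda>k. \<bar>X t \<omega> - picard k (\<lambda>s. \<xi> s \<omega>) t\<bar>)"
        by (intro summable_suminf_not_top) auto
      then have "(\<lambda>k. \<bar>X t \<omega> - picard k (\<lambda>s. \<xi> s \<omega>) t\<bar>) \<longlonglongrightarrow> 0" by (rule summable_LIMSEQ_zero)
      then have "(\<lambda>k. X t \<omega> - picard k (\<lambda>s. \<xi> s \<omega>) t) \<longlonglongrightarrow> 0" by (simp only: tendsto_rabs_zero_iff)
      then have "(\<lambda>k. X t \<omega> - (X t \<omega> - picard k (\<lambda>s. \<xi> s \<omega>) t)) \<longlonglongrightarrow> X t \<omega> - 0" by (intro tendsto_diff tendsto_const)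
      then show ?case by simp
    qed
  qed
  then show ?thesis by (simp add: AE_all_countable)
qed

definition sol :: "(int \<Rightarrow> real) \<Rightarrow> int \<Rightarrow> real" where "sol z t = lim (\<lambda>k. picard k z t)"

text \<open>\<open>X\<close> equals this process only almost everywhere, and a change on a null set
  can destroy measurability for a sub-sigma-algebra of \<open>M\<close>; \<open>X'\<close> is
  adapted to the past innovations everywhere.\<close>

definition X' :: "int \<Rightarrow> 'a \<Rightarrow> real" where "X' t \<omega> = sol (\<lambda>s. \<xi> s \<omega>) t"

lemma sol_measurable [measurable]: "(\<lambda>z. sol z t) \<in> borel_measurable path_space"
  unfolding sol_def by (rule borel_measurable_lim_metric) simp

lemma sol_cong: "(\<And>s. s \<le> t \<Longrightarrow> z s = z' s) \<Longrightarrow> sol z t = sol z' t"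
  unfolding sol_def using picard_cong[of t z z'] by simp

lemma X_eq_X': "AE \<omega> in M. \<forall>t. X t \<omega> = X' t \<omega>"
  using picard_converges
proof eventually_elim
  case (elim \<omega>)
  then show ?case unfolding X'_def sol_def by (intro allI limI[symmetric]) blast
qed

definition past_algebra :: "int \<Rightarrow> 'a measure" where
  "past_algebra t = vimage_algebra (space M) (\<lambda>\<omega>. \<lambda>i\<in>{..<t}. \<xi> i \<omega>) (PiM {..<t} (\<lambda>_. borel))"

lemma past_innovations_measurable: "(\<lambda>\<omega>. \<lambda>i\<in>{..<t}. \<xi> i \<omega>) \<in> M \<rightarrow>\<^sub>M PiM {..<t} (\<lambda>_. borel)"
  by (intro measurable_restrict) simp

lemma space_past_algebra: "space (past_algebra t) = space M"
  by (simp add: past_algebra_def)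

lemma measurable_past_algebra_restrict:
  "(\<lambda>\<omega>. \<lambda>i\<in>{..<t}. \<xi> i \<omega>) \<in> past_algebra t \<rightarrow>\<^sub>M PiM {..<t} (\<lambda>_. borel)"
  unfolding past_algebra_def
  by (rule measurable_vimage_algebra1) (use measurable_space[OF past_innovations_measurable] in auto)

lemma sets_past_algebra: "sets (past_algebra t) \<subseteq> sets M"
  unfolding past_algebra_def
  by (subst sets_vimage_algebra2)
    (use measurable_space[OF past_innovations_measurable] measurable_sets[OF past_innovations_measurable] in auto)

lemma \<xi>_past_algebra: "s < t \<Longrightarrow> \<xi> s \<in> borel_measurable (past_algebra t)"
  using measurable_compose[OF measurable_past_algebra_restrict measurable_component_singleton[of s "{..<t}"]]
  by simp

lemma X'_past_algebra: 
  assumes "s < t" shows "X' s \<in> borel_measurable (past_algebra t)"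
proof -
  \<comment> \<open>Filling the innovations from time \<open>t\<close> on with 0 leaves
    \<open>sol\<close> at the earlier time \<open>s\<close> unchanged.\<close>
  define ext where "ext = (\<lambda>z::int \<Rightarrow> real. \<lambda>i. if i < t then z i else 0)"
  have 1: "ext \<in> PiM {..<t} (\<lambda>_. borel) \<rightarrow>\<^sub>M path_space"
  proof (rule measurable_PiM_single')
    fix i
    show "(\<lambda>z. ext z i) \<in> borel_measurable (PiM {..<t} (\<lambda>_. borel))"
      by (cases "i < t") (auto simp: ext_def)
  qed auto
  have "X' s = (\<lambda>\<omega>. sol (ext (\<lambda>i\<in>{..<t}. \<xi> i \<omega>)) s)"
    unfolding X'_def using assms by (intro ext sol_cong) (auto simp: ext_def)
  then show ?thesis
    using measurable_compose[OF measurable_past_algebra_restrict measurable_compose[OF 1 sol_measurable[of s]]] by simp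
qed

lemma past_algebra_mono: "s \<le> t \<Longrightarrow> sets (past_algebra s) \<subseteq> sets (past_algebra t)"
proof -
  assume st: "s \<le> t"
  have m: "(\<lambda>\<omega>. \<lambda>i\<in>{..<s}. \<xi> i \<omega>) \<in> past_algebra t \<rightarrow>\<^sub>M PiM {..<s} (\<lambda>_. borel)"
    by (intro measurable_restrict \<xi>_past_algebra) (use st in auto)
  show "sets (past_algebra s) \<subseteq> sets (past_algebra t)"
    unfolding past_algebra_def[of s]
    by (subst sets_vimage_algebra2) (use measurable_space[OF past_innovations_measurable] m in
        \<open>auto dest!: measurable_sets simp: space_past_algebra\<close>)
qed

lemma past_algebra_indep: "indep_pair M (past_algebra t) (\<lambda>\<omega>. \<omega>) borel (\<xi> t)"
proof -
  have "indep_pair M (Pi\<^sub>M {..<t} (\<lambda>_. borel)) (\<lambda>\<omega>. \<lambda>i\<in>{..<t}. \<xi> i \<omega>) (Pi\<^sub>M {t} (\<lambda>_. borel)) (\<lambda>\<omega>. \<lambda>i\<in>{t}. \<xi> i \<omega>)"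
    unfolding indep_pair_iff_indep_var by (rule indep_var_restrict[OF \<xi>_indep]) auto
  from indep_pair_compose[OF this, of "\<lambda>x. x" _ "\<lambda>z. z t" borel]
  have "indep_pair M (Pi\<^sub>M {..<t} (\<lambda>_. borel)) (\<lambda>\<omega>. \<lambda>i\<in>{..<t}. \<xi> i \<omega>) borel (\<xi> t)" by simp
  then show ?thesis unfolding past_algebra_def by (rule indep_pair_vimage_algebra)
qed

abbreviation lag_space :: "(nat \<Rightarrow> real) measure" where "lag_space \<equiv> PiM UNIV (\<lambda>_. borel)"

lemma lag_X'_past_algebra: "lag X' t \<in> past_algebra t \<rightarrow>\<^sub>M lag_space"
  unfolding lag_def[abs_def] by (intro measurable_PiM_single' X'_past_algebra) auto

lemma lag_X_measurable: "lag X t \<in> M \<rightarrow>\<^sub>M lag_space"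
  unfolding lag_def[abs_def] by (intro measurable_PiM_single') auto

text \<open>Once \<open>X\<close> is replaced by its adapted version \<open>X'\<close>, the past
  becomes measurable for the innovations before \<open>t\<close>, hence independent of
  \<open>\<xi> t\<close>. The formulas for the limiting contrast and for the matrices
  \<open>F\<close> and \<open>G\<close> rest on this factorisation.\<close>

lemma lag_independent:
  fixes g :: "(nat \<Rightarrow> real) \<Rightarrow> real" and k :: "real \<Rightarrow> real"
  assumes g: "g \<in> borel_measurable lag_space" and k: "k \<in> borel_measurable borel"
    and ig: "integrable M (\<lambda>\<omega>. g (lag X t \<omega>))" and ik: "integrable M (\<lambda>\<omega>. k (\<xi> t \<omega>))"
  shows "expectation (\<lambda>\<omega>. g (lag X t \<omega>) * k (\<xi> t \<omega>)) = expectation (\<lambda>\<omega>. g (lag X t \<omega>)) * expectation (\<lambda>\<omega>. k (\<xi> t \<omega>))"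
    and "integrable M (\<lambda>\<omega>. g (lag X t \<omega>) * k (\<xi> t \<omega>))"
proof -
  have eq: "AE \<omega> in M. g (lag X t \<omega>) = g (lag X' t \<omega>)"
    using X_eq_X' by eventually_elim (simp add: lag_def)
  have gF: "(\<lambda>\<omega>. g (lag X' t \<omega>)) \<in> borel_measurable (past_algebra t)"
    by (rule measurable_compose[OF lag_X'_past_algebra g])
  have gM[measurable]: "(\<lambda>\<omega>. g (lag X' t \<omega>)) \<in> borel_measurable M"
    using measurable_larger_algebra[OF gF] space_past_algebra sets_past_algebra by blast
  have gM2[measurable]: "(\<lambda>\<omega>. g (lag X t \<omega>)) \<in> borel_measurable M" using ig by auto
  note k[measurable]
  have ig': "integrable M (\<lambda>\<omega>. g (lag X' t \<omega>))"
    using ig eq integrable_cong_AE[OF gM2 gM] by simp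
  have "indep_pair M borel (\<lambda>\<omega>. g (lag X' t \<omega>)) borel (\<lambda>\<omega>. k (\<xi> t \<omega>))"
    by (rule indep_pair_compose[OF past_algebra_indep gF k])
  then have ind: "indep_var borel (\<lambda>\<omega>. g (lag X' t \<omega>)) borel (\<lambda>\<omega>. k (\<xi> t \<omega>))"
    by (simp add: indep_pair_iff_indep_var)
  have eq2: "AE \<omega> in M. g (lag X t \<omega>) * k (\<xi> t \<omega>) = g (lag X' t \<omega>) * k (\<xi> t \<omega>)"
    using eq by eventually_elim simp
  have "expectation (\<lambda>\<omega>. g (lag X t \<omega>) * k (\<xi> t \<omega>)) = expectation (\<lambda>\<omega>. g (lag X' t \<omega>) * k (\<xi> t \<omega>))"
    by (rule integral_cong_AE) (use eq2 in auto)
  also have "\<dots> = expectation (\<lambda>\<omega>. g (lag X' t \<omega>)) * expectation (\<lambda>\<omega>. k (\<xi> t \<omega>))"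
    by (rule indep_var_lebesgue_integral[OF ind ig' ik])
  also have "expectation (\<lambda>\<omega>. g (lag X' t \<omega>)) = expectation (\<lambda>\<omega>. g (lag X t \<omega>))"
    by (rule integral_cong_AE) (use eq in auto)
  finally show "expectation (\<lambda>\<omega>. g (lag X t \<omega>) * k (\<xi> t \<omega>)) = expectation (\<lambda>\<omega>. g (lag X t \<omega>)) * expectation (\<lambda>\<omega>. k (\<xi> t \<omega>))" .
  have "integrable M (\<lambda>\<omega>. g (lag X' t \<omega>) * k (\<xi> t \<omega>))"
    by (rule indep_var_integrable[OF ind ig' ik])
  then show "integrable M (\<lambda>\<omega>. g (lag X t \<omega>) * k (\<xi> t \<omega>))"
    by (subst integrable_cong_AE[OF _ _ eq2]) auto
qed

end

section \<open>Elementary estimates\<close>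

text \<open>The eventual constant is enlarged by finitely many ratios. Index 0 stays out because
  \<open>0 powr (- l)\<close> is 0.\<close>

lemma bigo_powr_bound:
  fixes f :: "nat \<Rightarrow> real"
  assumes "f \<in> O(\<lambda>j. real j powr (- l))"
  shows "\<exists>C\<ge>0. \<forall>j\<ge>1. \<bar>f j\<bar> \<le> C * real j powr (- l)"
proof -
  obtain c where c: "c > 0" "\<forall>\<^sub>F j in sequentially. norm (f j) \<le> c * norm (real j powr (- l))"
    using landau_o.bigE[OF assms] by blast
  then obtain N where N: "\<And>j. j \<ge> N \<Longrightarrow> \<bar>f j\<bar> \<le> c * real j powr (- l)"
    unfolding eventually_sequentially by auto
  define C where "C = c + (\<Sum>j<N. \<bar>f j\<bar> / real j powr (- l))"
  have C: "C \<ge> c" unfolding C_def by (simp add: sum_nonneg)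
  have "\<bar>f j\<bar> \<le> C * real j powr (- l)" if j: "j \<ge> 1" for j
  proof (cases "j \<ge> N")
    case True
    then show ?thesis using N[OF True] C by (meson mult_right_mono order_trans powr_ge_zero)
  next
    case False
    have "\<bar>f j\<bar> / real j powr (- l) \<le> (\<Sum>j<N. \<bar>f j\<bar> / real j powr (- l))"
      using False by (intro member_le_sum) auto
    also have "\<dots> \<le> C" using c by (simp add: C_def)
    finally show ?thesis using j by (simp add: field_simps)
  qed
  then show ?thesis using C c by (intro exI[of _ C]) auto
qed

text \<open>\<open>sqrt j * j powr (- l)\<close> equals \<open>j powr (1 / 2 - l)\<close>, which is
  summable exactly when \<open>l > 3 / 2\<close>.\<close>

lemma summable_powr_decay:
  fixes \<beta> :: "nat \<Rightarrow> real"
  assumes nonneg: "\<And>j. \<beta> j \<ge> 0" and le: "\<And>j. \<beta> j \<le> C * real (Suc j) powr (- l)" and l: "l > 3 / 2"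
  shows "summable \<beta>" "summable (\<lambda>j. sqrt (real (Suc j)) * \<beta> j)"
proof -
  have s: "summable (\<lambda>j. real (Suc j) powr (1 / 2 - l))"
    using l summable_real_powr_iff[of "1 / 2 - l"] summable_Suc_iff[of "\<lambda>j. real j powr (1 / 2 - l)"] by simp
  have le2: "sqrt (real (Suc j)) * \<beta> j \<le> C * real (Suc j) powr (1 / 2 - l)" for j
  proof -
    have "sqrt (real (Suc j)) * \<beta> j \<le> sqrt (real (Suc j)) * (C * real (Suc j) powr (- l))"
      by (intro mult_left_mono le) simp
    also have "\<dots> = C * (real (Suc j) powr (1 / 2) * real (Suc j) powr (- l))"
      by (simp add: powr_half_sqrt)
    also have "\<dots> = C * real (Suc j) powr (1 / 2 - l)"
      unfolding powr_add[symmetric] by simp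
    finally show ?thesis .
  qed
  show s2: "summable (\<lambda>j. sqrt (real (Suc j)) * \<beta> j)"
    by (rule summable_comparison_test'[OF summable_mult[OF s, of C], of 0]) (use le2 nonneg in auto)
  show "summable \<beta>"
  proof (rule summable_comparison_test'[OF s2, of 0])
    fix j
    have "1 * \<beta> j \<le> sqrt (real (Suc j)) * \<beta> j" by (intro mult_right_mono nonneg) simp
    then show "norm (\<beta> j) \<le> sqrt (real (Suc j)) * \<beta> j" using nonneg by simp
  qed
qed

text \<open>Nonnegativity of the weighted variance about the weighted mean
  \<open>m = A / S\<close>.\<close>

lemma weighted_cauchy_schwarz:
  fixes w z :: "nat \<Rightarrow> real"
  assumes w: "\<And>j. w j \<ge> 0" and s: "summable w" "summable (\<lambda>j. w j * z j)" "summable (\<lambda>j. w j * (z j)\<^sup>2)"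
  shows "(\<Sum>j. w j * z j)\<^sup>2 \<le> (\<Sum>j. w j) * (\<Sum>j. w j * (z j)\<^sup>2)"
proof (cases "(\<Sum>j. w j) = 0")
  case True
  then have "w j = 0" for j using suminf_eq_zero_iff[OF s(1)] w by auto
  then show ?thesis by simp
next
  case False
  define S where "S = (\<Sum>j. w j)"
  define A where "A = (\<Sum>j. w j * z j)"
  define B where "B = (\<Sum>j. w j * (z j)\<^sup>2)"
  have S: "S > 0" using False suminf_nonneg[OF s(1)] w by (simp add: S_def order_less_le)
  define m where "m = A / S"
  have eq: "w j * (z j - m)\<^sup>2 = (w j * (z j)\<^sup>2 - (2 * m) * (w j * z j)) + m\<^sup>2 * w j" for j
    by (simp add: power2_eq_square algebra_simps)
  have "(\<lambda>j. w j * (z j - m)\<^sup>2) sums ((B - (2 * m) * A) + m\<^sup>2 * S)"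
    unfolding eq A_def B_def S_def using s
    by (intro sums_add sums_diff sums_mult summable_sums)
  then have "0 \<le> (B - (2 * m) * A) + m\<^sup>2 * S"
    by (rule sums_le[OF _ sums_zero, rotated]) (use w in auto)
  then have "A\<^sup>2 / S \<le> B" using S by (simp add: m_def power2_eq_square field_simps)
  then show ?thesis using S unfolding A_def[symmetric] B_def[symmetric] S_def[symmetric] by (simp add: field_simps)
qed

text \<open>A local modulus at \<open>x\<close>, of continuity or of differentiability according to
  \<open>f\<close>. Radii \<open>1 / (k + 1)\<close> turn the limit at \<open>x\<close> into a limit
  of sequences, to which dominated convergence applies.\<close>

definition lsup :: "('p::metric_space \<Rightarrow> real) \<Rightarrow> 'p set \<Rightarrow> 'p \<Rightarrow> nat \<Rightarrow> real" where
  "lsup f S x k = (SUP y\<in>S \<inter> cball x (inverse (real (Suc k))). f y)"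

lemma lsup_props:
  fixes f :: "'p::metric_space \<Rightarrow> real"
  assumes x: "x \<in> S" and f0: "f x = 0" and B: "\<And>y. y \<in> S \<Longrightarrow> f y \<le> B" and nonneg: "\<And>y. f y \<ge> 0"
  shows "\<And>y k. y \<in> S \<Longrightarrow> dist x y \<le> inverse (real (Suc k)) \<Longrightarrow> f y \<le> lsup f S x k"
    and "\<And>k. lsup f S x k \<ge> 0" and "\<And>k. lsup f S x k \<le> B"
    and "(f \<longlongrightarrow> 0) (at x within S) \<Longrightarrow> (\<lambda>k. lsup f S x k) \<longlonglongrightarrow> 0"
proof -
  have bdd: "bdd_above (f ` (S \<inter> cball x r))" for r using B by (intro bdd_aboveI2[of _ _ B]) auto
  have ne: "x \<in> S \<inter> cball x (inverse (real (Suc k)))" for k using x by simp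
  show up: "f y \<le> lsup f S x k" if "y \<in> S" "dist x y \<le> inverse (real (Suc k))" for y k
    unfolding lsup_def by (rule cSUP_upper[OF _ bdd]) (use that in auto)
  show nn: "lsup f S x k \<ge> 0" for k using up[OF x, of k] f0 by simp
  show "lsup f S x k \<le> B" for k
    unfolding lsup_def by (rule cSUP_least) (use ne B in auto)
  assume lim: "(f \<longlongrightarrow> 0) (at x within S)"
  show "(\<lambda>k. lsup f S x k) \<longlonglongrightarrow> 0"
  proof (rule LIMSEQ_I)
    fix r :: real assume r: "0 < r"
    then obtain d where d: "d > 0" "\<And>y. y \<in> S \<Longrightarrow> 0 < dist y x \<Longrightarrow> dist y x < d \<Longrightarrow> dist (f y) 0 < r / 2"
      using lim unfolding Lim_within by (metis half_gt_zero)
    obtain k0 where k0: "inverse (real (Suc k0)) < d" using reals_Archimedean[OF d(1)] by blast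
    have "norm (lsup f S x k - 0) < r" if k: "k \<ge> k0" for k
    proof -
      have "inverse (real (Suc k)) \<le> inverse (real (Suc k0))" using k by simp
      then have kd: "inverse (real (Suc k)) < d" using k0 by linarith
      have "lsup f S x k \<le> r / 2"
        unfolding lsup_def
      proof (rule cSUP_least)
        show "S \<inter> cball x (inverse (real (Suc k))) \<noteq> {}" using ne[of k] by blast
        fix y assume y: "y \<in> S \<inter> cball x (inverse (real (Suc k)))"
        show "f y \<le> r / 2"
        proof (cases "y = x")
          case False
          then show ?thesis using d(2)[of y] y kd by (auto simp: dist_commute dist_real_def)
        qed (use f0 r in simp)
      qed
      then show ?thesis using nn[of k] r by simp
    qed
    then show "\<exists>no. \<forall>k\<ge>no. norm (lsup f S x k - 0) < r" by blast
  qed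
qed

text \<open>Beyond some \<open>N\<close> the factors \<open>e t\<close> are small against the
  bounded averages of \<open>a\<close>; the finitely many earlier terms form a constant
  \<open>A\<close>, which division by \<open>n\<close> removes.\<close>

lemma cesaro_weighted_null:
  fixes a e :: "nat \<Rightarrow> real"
  assumes a: "\<And>t. a t \<ge> 0" and avg: "(\<lambda>n. (\<Sum>t=1..n. a t) / n) \<longlonglongrightarrow> L"
    and e: "e \<longlonglongrightarrow> 0"
  shows "(\<lambda>n. (\<Sum>t=1..n. a t * e t) / n) \<longlonglongrightarrow> 0"
proof -
  have "Bseq (\<lambda>n. (\<Sum>t=1..n. a t) / n)" using avg by (intro convergent_imp_Bseq convergentI)
  then obtain K where K: "K > 0" "\<And>n. norm ((\<Sum>t=1..n. a t) / real n) \<le> K" unfolding Bseq_def by blast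
  show ?thesis
  proof (rule LIMSEQ_I)
    fix r :: real assume r: "0 < r"
    then have "r / (2 * K) > 0" using K by simp
    then obtain N where N: "\<And>t. t \<ge> N \<Longrightarrow> \<bar>e t\<bar> < r / (2 * K)" using LIMSEQ_D[OF e] by auto
    define A where "A = (\<Sum>t=1..N. a t * \<bar>e t\<bar>)"
    have A: "A \<ge> 0" unfolding A_def using a by (intro sum_nonneg) auto
    obtain n0 :: nat where n0: "2 * A / r < real n0" using reals_Archimedean2 by blast
    have "norm ((\<Sum>t=1..n. a t * e t) / real n - 0) < r" if n: "n \<ge> Suc n0" for n
    proof -
      have np: "real n > 0" using n by simp
      have "\<bar>\<Sum>t=1..n. a t * e t\<bar> \<le> (\<Sum>t=1..n. a t * \<bar>e t\<bar>)"
        using a by (intro order_trans[OF sum_abs]) (simp add: abs_mult)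
      also have "\<dots> \<le> (\<Sum>t=1..n. (if t \<le> N then a t * \<bar>e t\<bar> else 0) + a t * (r / (2 * K)))"
      proof (rule sum_mono)
        fix t
        show "a t * \<bar>e t\<bar> \<le> (if t \<le> N then a t * \<bar>e t\<bar> else 0) + a t * (r / (2 * K))"
        proof (cases "t \<le> N")
          case True
          have "0 \<le> a t * (r / (2 * K))" using a[of t] r K by (intro mult_nonneg_nonneg) auto
          then show ?thesis using True by simp
        next
          case False
          then have "\<bar>e t\<bar> \<le> r / (2 * K)" using N[of t] by simp
          from mult_left_mono[OF this a[of t]] show ?thesis using False by simp
        qed
      qed
      also have "\<dots> = (\<Sum>t\<in>{1..n}. if t \<le> N then a t * \<bar>e t\<bar> else 0) + (\<Sum>t=1..n. a t) * (r / (2 * K))"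
        by (simp only: sum.distrib sum_distrib_right)
      also have "(\<Sum>t\<in>{1..n}. if t \<le> N then a t * \<bar>e t\<bar> else 0) = (\<Sum>t\<in>{1..n} \<inter> {t. t \<le> N}. a t * \<bar>e t\<bar>)"
        by (simp add: sum.inter_filter sum.If_cases)
      also have "\<dots> \<le> A" unfolding A_def using a by (intro sum_mono2) auto
      also have "(\<Sum>t=1..n. a t) * (r / (2 * K)) \<le> (n * K) * (r / (2 * K))"
      proof (rule mult_right_mono)
        have "\<bar>\<Sum>t=1..n. a t\<bar> / real n \<le> K" using K(2)[of n] by simp
        then have "\<bar>\<Sum>t=1..n. a t\<bar> \<le> K * n" using np by (simp only: pos_divide_le_eq)
        then show "(\<Sum>t=1..n. a t) \<le> n * K" by (simp add: mult.commute)
      qed (use r K in simp)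
      also have "(n * K) * (r / (2 * K)) = n * (r / 2)" using K by simp
      finally have le: "\<bar>\<Sum>t=1..n. a t * e t\<bar> \<le> A + n * (r / 2)" by simp
      have "A < real n * (r / 2)"
      proof -
        have "2 * A / r < real n" using n0 n by linarith
        then show ?thesis using r by (simp add: field_simps)
      qed
      then have "\<bar>\<Sum>t=1..n. a t * e t\<bar> < n * r" using le by linarith
      then show ?thesis using np by (simp add: field_simps)
    qed
    then show "\<exists>no. \<forall>n\<ge>no. norm ((\<Sum>t=1..n. a t * e t) / real n - 0) < r" by blast
  qed
qed

lemma tannery_null:
  fixes a :: "nat \<Rightarrow> nat \<Rightarrow> real"
  assumes "\<And>i. (\<lambda>k. a i k) \<longlonglongrightarrow> 0" "\<And>i k. \<bar>a i k\<bar> \<le> B i" "summable B"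
  shows "(\<lambda>k. \<Sum>i. a i k) \<longlonglongrightarrow> 0"
proof -
  have "((\<lambda>k. \<Sum>i. a i k) \<longlongrightarrow> (\<Sum>i. 0)) sequentially"
    by (rule tannerys_theorem[where M=B, THEN conjunct2, THEN conjunct2])
       (use assms in \<open>auto intro!: always_eventually\<close>)
  then show ?thesis by simp
qed

lemma (in prob_space) integrable_weighted_sum:
  fixes Z :: "nat \<Rightarrow> 'a \<Rightarrow> real"
  assumes Z: "\<And>j. integrable M (Z j)" "\<And>j \<omega>. Z j \<omega> \<ge> 0" "\<And>j. expectation (Z j) \<le> K"
    and w: "\<And>j. w j \<ge> 0" "summable w"
  shows "AE \<omega> in M. summable (\<lambda>j. w j * Z j \<omega>)" "integrable M (\<lambda>\<omega>. \<Sum>j. w j * Z j \<omega>)"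
    "expectation (\<lambda>\<omega>. \<Sum>j. w j * Z j \<omega>) = (\<Sum>j. w j * expectation (Z j))"
proof -
  have [measurable]: "Z j \<in> borel_measurable M" for j using Z(1)[of j] by auto
  have nn: "(\<integral>\<^sup>+\<omega>. ennreal \<bar>Z j \<omega>\<bar> \<partial>M) \<le> ennreal K" for j
    using Z by (subst nn_integral_eq_integral) (auto intro!: ennreal_leI)
  have "AE \<omega> in M. summable (\<lambda>j. w j * \<bar>Z j \<omega>\<bar>)"
    by (rule AE_summable_weighted[OF _ w nn]) auto
  then show s: "AE \<omega> in M. summable (\<lambda>j. w j * Z j \<omega>)" using Z(2) by simp
  have E0: "expectation (Z j) \<ge> 0" for j using Z(2) by (intro integral_nonneg_AE) auto
  have s2: "summable (\<lambda>j. \<integral>\<omega>. norm (w j * Z j \<omega>) \<partial>M)"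
  proof (rule summable_comparison_test'[OF summable_mult[OF w(2), of K], of 0])
    fix j
    show "norm (\<integral>\<omega>. norm (w j * Z j \<omega>) \<partial>M) \<le> K * w j"
      using w(1)[of j] Z E0[of j] mult_left_mono[OF Z(3)[of j] w(1)[of j]] by (simp add: abs_mult mult.commute)
  qed
  have s3: "AE \<omega> in M. summable (\<lambda>j. norm (w j * Z j \<omega>))" using s w(1) Z(2) by simp
  have i: "integrable M (\<lambda>\<omega>. w j * Z j \<omega>)" for j using Z by simp
  show "integrable M (\<lambda>\<omega>. \<Sum>j. w j * Z j \<omega>)" by (rule integrable_suminf[OF i s3 s2])
  show "expectation (\<lambda>\<omega>. \<Sum>j. w j * Z j \<omega>) = (\<Sum>j. w j * expectation (Z j))"
    using integral_suminf[OF i s3 s2] by simp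
qed

text \<open>Cauchy-Schwarz moves the square inside the weighted series, where integrability is
  checked term by term.\<close>

lemma (in prob_space) integrable_weighted_sum_square:
  fixes Z :: "nat \<Rightarrow> 'a \<Rightarrow> real"
  assumes [measurable]: "\<And>j. Z j \<in> borel_measurable M"
    and Z: "\<And>j. integrable M (\<lambda>\<omega>. (Z j \<omega>)\<^sup>2)" "\<And>j \<omega>. Z j \<omega> \<ge> 0" "\<And>j. expectation (\<lambda>\<omega>. (Z j \<omega>)\<^sup>2) \<le> K"
    and w: "\<And>j. w j \<ge> 0" "summable w"
  shows "AE \<omega> in M. (\<Sum>j. w j * Z j \<omega>)\<^sup>2 \<le> (\<Sum>j. w j) * (\<Sum>j. w j * (Z j \<omega>)\<^sup>2)"
    and "integrable M (\<lambda>\<omega>. (\<Sum>j. w j * Z j \<omega>)\<^sup>2)"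
proof -
  have Z1: "integrable M (Z j)" for j by (rule square_integrable_imp_integrable[OF _ Z(1)]) simp
  have K1: "expectation (Z j) \<le> 1 + K" for j
  proof -
    have "expectation (Z j) \<le> expectation (\<lambda>\<omega>. 1 + (Z j \<omega>)\<^sup>2)"
    proof (rule integral_mono)
      fix \<omega>
      have "0 \<le> (Z j \<omega> - 1)\<^sup>2" by simp
      then show "Z j \<omega> \<le> 1 + (Z j \<omega>)\<^sup>2" using Z(2)[of j \<omega>] by (simp add: power2_eq_square algebra_simps)
    qed (use Z1 Z in auto)
    also have "\<dots> = 1 + expectation (\<lambda>\<omega>. (Z j \<omega>)\<^sup>2)" using Z by (simp add: prob_space)
    finally show ?thesis using Z(3)[of j] by linarith
  qed
  note a = integrable_weighted_sum[of Z, OF Z1 Z(2) K1 w]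
  note b = integrable_weighted_sum[of "\<lambda>j \<omega>. (Z j \<omega>)\<^sup>2", OF Z(1) _ Z(3) w]
  show le: "AE \<omega> in M. (\<Sum>j. w j * Z j \<omega>)\<^sup>2 \<le> (\<Sum>j. w j) * (\<Sum>j. w j * (Z j \<omega>)\<^sup>2)"
    using a(1) b(1)[simplified] by eventually_elim (rule weighted_cauchy_schwarz[OF w])
  show "integrable M (\<lambda>\<omega>. (\<Sum>j. w j * Z j \<omega>)\<^sup>2)"
  proof (rule Bochner_Integration.integrable_bound)
    show "integrable M (\<lambda>\<omega>. (\<Sum>j. w j) * (\<Sum>j. w j * (Z j \<omega>)\<^sup>2))" using b(2) by simp
    show "AE \<omega> in M. norm ((\<Sum>j. w j * Z j \<omega>)\<^sup>2) \<le> norm ((\<Sum>j. w j) * (\<Sum>j. w j * (Z j \<omega>)\<^sup>2))"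
      using le by eventually_elim auto
  qed measurable
qed

text \<open>The contrast \<open>x\<^sup>2 / H + ln H\<close> with \<open>H = m\<^sup>2\<close>.\<close>

definition qf :: "real \<Rightarrow> real \<Rightarrow> real" where "qf x m = x\<^sup>2 / m\<^sup>2 + 2 * ln m"

lemma inverse_square_diff:
  fixes m m' b :: real
  assumes "b > 0" "m \<ge> b" "m' \<ge> b"
  shows "\<bar>1 / m\<^sup>2 - 1 / m'\<^sup>2\<bar> \<le> 2 / b ^ 3 * \<bar>m - m'\<bar>" "\<bar>1 / m\<^sup>2 - 1 / m'\<^sup>2\<bar> \<le> 1 / b\<^sup>2"
proof -
  have p: "m > 0" "m' > 0" using assms by auto
  have i: "1 / m \<le> 1 / b" "1 / m' \<le> 1 / b" "0 < 1 / m" "0 < 1 / m'" using assms p by (auto simp: frac_le)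
  have e: "1 / m\<^sup>2 - 1 / m'\<^sup>2 = (m' - m) * ((1 / m) * (1 / m') * (1 / m + 1 / m'))"
    using p by (simp add: field_simps power2_eq_square)
  have "(1 / m) * (1 / m') * (1 / m + 1 / m') \<le> (1 / b) * (1 / b) * (1 / b + 1 / b)"
    using i assms by (intro mult_mono add_mono) auto
  also have "\<dots> = 2 / b ^ 3" by (simp add: power3_eq_cube)
  finally have "(1 / m) * (1 / m') * (1 / m + 1 / m') \<le> 2 / b ^ 3" .
  then show "\<bar>1 / m\<^sup>2 - 1 / m'\<^sup>2\<bar> \<le> 2 / b ^ 3 * \<bar>m - m'\<bar>"
    unfolding e abs_mult using i by (subst mult.commute) (intro mult_mono, auto)
  have "1 / m\<^sup>2 \<le> 1 / b\<^sup>2" "1 / m'\<^sup>2 \<le> 1 / b\<^sup>2" "0 \<le> 1 / m\<^sup>2" "0 \<le> 1 / m'\<^sup>2"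
    using assms p by (auto simp: frac_le power_mono)
  then show "\<bar>1 / m\<^sup>2 - 1 / m'\<^sup>2\<bar> \<le> 1 / b\<^sup>2" by linarith
qed

lemma ln_diff_abs:
  fixes m m' b :: real
  assumes "b > 0" "m \<ge> b" "m' \<ge> b"
  shows "\<bar>ln m - ln m'\<bar> \<le> 1 / b * \<bar>m - m'\<bar>"
proof -
  have *: "ln y - ln x \<le> 1 / b * \<bar>y - x\<bar>" if "x \<ge> b" "y \<ge> b" for x y :: real
  proof -
    have p: "x > 0" "y > 0" using assms that by auto
    have "ln y - ln x = ln (y / x)" using p by (simp add: ln_div)
    also have "\<dots> \<le> y / x - 1" using p by (intro ln_le_minus_one) simp
    also have "\<dots> = (y - x) / x" using p by (simp add: field_simps)
    also have "\<dots> \<le> \<bar>y - x\<bar> / x" using p by (intro divide_right_mono) auto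
    also have "\<dots> \<le> \<bar>y - x\<bar> / b" using that assms by (intro divide_left_mono) auto
    finally show ?thesis by simp
  qed
  show ?thesis using *[of m m'] *[of m' m] assms by (simp add: abs_le_iff abs_minus_commute)
qed

text \<open>The first bound serves truncation, where the volatility difference vanishes along each
  path. The second caps the factor of \<open>x^2\<close> at 1, so it is integrable with second
  moments only although \<open>e\<close> itself is a random series in the past.\<close>

lemma qf_diff:
  assumes b: "b > 0" "m \<ge> b" "m' \<ge> b"
  shows "\<bar>qf x m - qf x m'\<bar> \<le> (2 / b ^ 3 + 2 / b) * ((1 + x\<^sup>2) * \<bar>m - m'\<bar>)"
    and "\<bar>m - m'\<bar> \<le> e \<Longrightarrow> \<bar>qf x m - qf x m'\<bar> \<le> (2 / b ^ 3 + 1 / b\<^sup>2) * (x\<^sup>2 * min 1 e) + 2 / b * e"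
proof -
  have e: "qf x m - qf x m' = x\<^sup>2 * (1 / m\<^sup>2 - 1 / m'\<^sup>2) + 2 * (ln m - ln m')"
    by (simp add: qf_def algebra_simps)
  have t: "\<bar>qf x m - qf x m'\<bar> \<le> x\<^sup>2 * \<bar>1 / m\<^sup>2 - 1 / m'\<^sup>2\<bar> + 2 * \<bar>ln m - ln m'\<bar>"
    unfolding e by (rule order_trans[OF abs_triangle_ineq]) (simp only: abs_mult abs_power2 abs_numeral order_refl)
  have "x\<^sup>2 * \<bar>1 / m\<^sup>2 - 1 / m'\<^sup>2\<bar> + 2 * \<bar>ln m - ln m'\<bar> \<le> x\<^sup>2 * (2 / b ^ 3 * \<bar>m - m'\<bar>) + 2 * (1 / b * \<bar>m - m'\<bar>)"
    by (intro add_mono mult_left_mono inverse_square_diff ln_diff_abs b) auto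
  also have "\<dots> \<le> (2 / b ^ 3 + 2 / b) * ((1 + x\<^sup>2) * \<bar>m - m'\<bar>)"
  proof -
    have "0 \<le> (2 / b ^ 3 + 2 / b * x\<^sup>2) * \<bar>m - m'\<bar>" using b by (intro mult_nonneg_nonneg add_nonneg_nonneg) auto
    then show ?thesis by (simp add: algebra_simps)
  qed
  finally show "\<bar>qf x m - qf x m'\<bar> \<le> (2 / b ^ 3 + 2 / b) * ((1 + x\<^sup>2) * \<bar>m - m'\<bar>)" using t by linarith
  assume me: "\<bar>m - m'\<bar> \<le> e"
  have K: "2 / b ^ 3 \<ge> 0" "1 / b\<^sup>2 \<ge> 0" using b by auto
  have 1: "\<bar>1 / m\<^sup>2 - 1 / m'\<^sup>2\<bar> \<le> (2 / b ^ 3 + 1 / b\<^sup>2) * min 1 e"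
  proof (cases "e \<le> 1")
    case True
    have "\<bar>1 / m\<^sup>2 - 1 / m'\<^sup>2\<bar> \<le> 2 / b ^ 3 * \<bar>m - m'\<bar>" by (rule inverse_square_diff(1)[OF b])
    also have "\<dots> \<le> (2 / b ^ 3 + 1 / b\<^sup>2) * e" using me K by (intro mult_mono) auto
    finally show ?thesis using True by simp
  next
    case False
    then have "min 1 e = 1" by simp
    then show ?thesis using inverse_square_diff(2)[OF b] K by (simp only: mult_1_right)
  qed
  have 2: "\<bar>ln m - ln m'\<bar> \<le> 1 / b * e"
    by (rule order_trans[OF ln_diff_abs[OF b]]) (use b me in \<open>intro mult_left_mono, auto\<close>)
  have "x\<^sup>2 * \<bar>1 / m\<^sup>2 - 1 / m'\<^sup>2\<bar> + 2 * \<bar>ln m - ln m'\<bar> \<le> x\<^sup>2 * ((2 / b ^ 3 + 1 / b\<^sup>2) * min 1 e) + 2 * (1 / b * e)"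
    by (intro add_mono mult_left_mono 1 2) auto
  then show "\<bar>qf x m - qf x m'\<bar> \<le> (2 / b ^ 3 + 1 / b\<^sup>2) * (x\<^sup>2 * min 1 e) + 2 / b * e"
    using t by (simp add: mult_ac)
qed

lemma sum_inverse_sqrt_le: "(\<Sum>n\<le>j. 1 / sqrt (real (Suc n))) \<le> 2 * sqrt (real (Suc j))"
proof (induction j)
  case (Suc j)
  define s where "s = sqrt (real (Suc j))" define r where "r = sqrt (real (Suc (Suc j)))"
  have sr: "s \<ge> 0" "r > 0" "r\<^sup>2 = s\<^sup>2 + 1" by (auto simp: s_def r_def)
  have "0 \<le> (r - s)\<^sup>2" by simp
  then have "2 * s * r + 1 \<le> 2 * r\<^sup>2" using sr(3) by (simp add: power2_diff mult_ac)
  then have "2 * s + 1 / r \<le> 2 * r" using sr(2) by (simp add: field_simps power2_eq_square)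
  then show ?case using Suc by (simp add: s_def r_def)
qed simp

lemma suminf_ennreal_swap:
  fixes f :: "nat \<Rightarrow> nat \<Rightarrow> ennreal"
  shows "(\<Sum>n. \<Sum>j. f n j) = (\<Sum>j. \<Sum>n. f n j)"
  using nn_integral_suminf[of "\<lambda>j n. f n j" "count_space UNIV"]
  by (simp add: nn_integral_count_space_nat)

text \<open>Interchanging the sums, \<open>w j\<close> is multiplied by the sum of
  \<open>1 / sqrt (n + 1)\<close> over \<open>n \<le> j\<close>, which is at most
  \<open>2 * sqrt (j + 1)\<close>.\<close>

lemma tail_sums_weighted:
  fixes w :: "nat \<Rightarrow> real"
  assumes w: "\<And>j. w j \<ge> 0" "summable w" and s: "summable (\<lambda>j. sqrt (real (Suc j)) * w j)"
  shows "(\<Sum>n. ennreal ((\<Sum>i. w (i + n)) / sqrt (real (Suc n)))) < \<infinity>"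
proof -
  have tail: "(\<Sum>i. w (i + n)) = (\<Sum>j. if n \<le> j then w j else 0)"
    and tail_s: "summable (\<lambda>j. if n \<le> j then w j else 0)" for n
  proof -
    show sm: "summable (\<lambda>j. if n \<le> j then w j else 0)"
      by (rule summable_comparison_test'[OF w(2), of 0]) (use w in auto)
    show "(\<Sum>i. w (i + n)) = (\<Sum>j. if n \<le> j then w j else 0)"
      using suminf_split_initial_segment[OF sm, of n] by simp
  qed
  have "(\<Sum>n. ennreal ((\<Sum>i. w (i + n)) / sqrt (real (Suc n))))
     = (\<Sum>n. \<Sum>j. ennreal ((if n \<le> j then w j else 0) / sqrt (real (Suc n))))"
  proof (rule suminf_cong)
    fix n
    have "ennreal ((\<Sum>i. w (i + n)) / sqrt (real (Suc n))) = ennreal (\<Sum>j. (if n \<le> j then w j else 0) / sqrt (real (Suc n)))"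
      unfolding tail using suminf_divide[OF tail_s, of n "sqrt (real (Suc n))"] by simp
    also have "\<dots> = (\<Sum>j. ennreal ((if n \<le> j then w j else 0) / sqrt (real (Suc n))))"
      by (rule suminf_ennreal2[symmetric]) (use w tail_s in \<open>auto intro: summable_divide\<close>)
    finally show "ennreal ((\<Sum>i. w (i + n)) / sqrt (real (Suc n))) = (\<Sum>j. ennreal ((if n \<le> j then w j else 0) / sqrt (real (Suc n))))" .
  qed
  also have "\<dots> = (\<Sum>j. \<Sum>n. ennreal ((if n \<le> j then w j else 0) / sqrt (real (Suc n))))"
    by (rule suminf_ennreal_swap)
  also have "\<dots> \<le> (\<Sum>j. ennreal (2 * (sqrt (real (Suc j)) * w j)))"
  proof (intro suminf_le)
    fix j
    have "(\<Sum>n. ennreal ((if n \<le> j then w j else 0) / sqrt (real (Suc n)))) = (\<Sum>n\<in>{..j}. ennreal ((if n \<le> j then w j else 0) / sqrt (real (Suc n))))"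
      by (rule suminf_finite) auto
    also have "\<dots> = (\<Sum>n\<le>j. ennreal (w j * (1 / sqrt (real (Suc n)))))"
      by (rule sum.cong) auto
    also have "\<dots> = ennreal (w j * (\<Sum>n\<le>j. 1 / sqrt (real (Suc n))))"
      unfolding sum_distrib_left by (rule sum_ennreal) (use w in auto)
    also have "\<dots> \<le> ennreal (w j * (2 * sqrt (real (Suc j))))"
      by (intro ennreal_leI mult_left_mono sum_inverse_sqrt_le w)
    finally show "(\<Sum>n. ennreal ((if n \<le> j then w j else 0) / sqrt (real (Suc n)))) \<le> ennreal (2 * (sqrt (real (Suc j)) * w j))"
      by (simp add: mult_ac)
  qed auto
  also have "\<dots> = ennreal (\<Sum>j. 2 * (sqrt (real (Suc j)) * w j))"
    by (rule suminf_ennreal2) (use w s in \<open>auto intro: summable_mult\<close>)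
  also have "\<dots> < \<infinity>" by simp
  finally show ?thesis .
qed

text \<open>For nonnegative terms each \<open>a i / sqrt N\<close> with \<open>i < N\<close> is at
  most \<open>a i / sqrt (i + 1)\<close> and tends to 0 as \<open>N\<close> grows, so dominated
  convergence of series gives the claim directly.\<close>

lemma kronecker_sqrt:
  fixes a :: "nat \<Rightarrow> real"
  assumes a: "\<And>n. a n \<ge> 0" and s: "summable (\<lambda>n. a n / sqrt (real (Suc n)))"
  shows "(\<lambda>N. (\<Sum>n<N. a n) / sqrt (real N)) \<longlonglongrightarrow> 0"
proof -
  have "(\<lambda>N. \<Sum>n. if n < N then a n / sqrt (real N) else 0) \<longlonglongrightarrow> 0"
  proof (rule tannery_null[OF _ _ s])
    fix i
    have "(\<lambda>N. a i / sqrt (real N)) \<longlonglongrightarrow> 0"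
      by (rule real_tendsto_divide_at_top[OF tendsto_const filterlim_compose[OF sqrt_at_top filterlim_real_sequentially]])
    then show "(\<lambda>N. if i < N then a i / sqrt (real N) else 0) \<longlonglongrightarrow> 0"
      by (rule Lim_transform_eventually) (rule eventually_mono[OF eventually_gt_at_top[of i]], simp)
    fix N
    show "\<bar>if i < N then a i / sqrt (real N) else 0\<bar> \<le> a i / sqrt (real (Suc i))"
      using a[of i] by (auto intro!: divide_left_mono)
  qed
  moreover have "(\<Sum>n. if n < N then a n / sqrt (real N) else 0) = (\<Sum>n<N. a n) / sqrt (real N)" for N
  proof -
    have "(\<Sum>n. if n < N then a n / sqrt (real N) else 0) = (\<Sum>n\<in>{..<N}. if n < N then a n / sqrt (real N) else 0)"
      by (rule suminf_finite) auto
    also have "\<dots> = (\<Sum>n<N. a n / sqrt (real N))" by (rule sum.cong) auto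
    finally show ?thesis by (simp add: sum_divide_distrib)
  qed
  ultimately show ?thesis by simp
qed

section \<open>Strong consistency\<close>

definition wsum :: "(nat \<Rightarrow> real) \<Rightarrow> (nat \<Rightarrow> real) \<Rightarrow> real" where
  "wsum w y = (\<Sum>j. w j * \<bar>y j\<bar>)"

lemma borel_measurable_wsum [measurable]:
  assumes [measurable]: "\<And>j. (\<lambda>\<omega>. f \<omega> j) \<in> borel_measurable N"
  shows "(\<lambda>\<omega>. wsum w (f \<omega>)) \<in> borel_measurable N"
  unfolding wsum_def by measurable

lemma wsum_nonneg: "(\<And>j. w j \<ge> 0) \<Longrightarrow> summable (\<lambda>j. w j * \<bar>y j\<bar>) \<Longrightarrow> wsum w y \<ge> 0"
  unfolding wsum_def by (intro suminf_nonneg) auto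

lemma continuous_on_compact_bdd:
  fixes f :: "'b::topological_space \<Rightarrow> real"
  assumes "compact S" "continuous_on S f"
  shows "bdd_above (f ` S)" "bdd_below (f ` S)"
  using compact_imp_bounded[OF compact_continuous_image[OF assms(2,1)]]
  by (auto intro: bounded_imp_bdd_above bounded_imp_bdd_below)

context tarch_setting
begin

section \<open>Uniform coefficient bounds and the volatility as a function of the parameter\<close>

definition \<beta> :: "nat \<Rightarrow> real" where "\<beta> j = (SUP \<theta>\<in>\<Theta>. max (bm (Suc j) \<theta>) (bp (Suc j) \<theta>))"

definition b :: real where "b = (INF \<theta>\<in>\<Theta>. b0 \<theta>)"

definition vol :: "real ^ 'd \<Rightarrow> (nat \<Rightarrow> real) \<Rightarrow> real" where
  "vol \<theta> y = b0 \<theta> + tser (\<lambda>j. bp (Suc j) \<theta>) (\<lambda>j. bm (Suc j) \<theta>) y"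

lemma b_pos: "b > 0" using b0_pos by (simp add: b_def)

lemma b_le: "\<theta> \<in> \<Theta> \<Longrightarrow> b \<le> b0 \<theta>"
  unfolding b_def by (rule cINF_lower[OF continuous_on_compact_bdd(2)[OF compact_\<Theta> cont_b0]])

lemma b_le_\<beta>:
  assumes "\<theta> \<in> \<Theta>"
  shows "norm (bp (Suc j) \<theta>) \<le> \<beta> j" "norm (bm (Suc j) \<theta>) \<le> \<beta> j"
proof -
  have "bdd_above ((\<lambda>\<theta>. max (bm (Suc j) \<theta>) (bp (Suc j) \<theta>)) ` \<Theta>)"
    by (rule continuous_on_compact_bdd[OF compact_\<Theta>]) (intro continuous_on_max cont_bm cont_bp, auto)
  then have "max (bm (Suc j) \<theta>) (bp (Suc j) \<theta>) \<le> \<beta> j"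
    unfolding \<beta>_def by (rule cSUP_upper[OF assms])
  then show "norm (bp (Suc j) \<theta>) \<le> \<beta> j" "norm (bm (Suc j) \<theta>) \<le> \<beta> j"
    using bp_nonneg[of "Suc j" \<theta>] bm_nonneg[of "Suc j" \<theta>] by auto
qed

lemma \<beta>_nonneg: "\<beta> j \<ge> 0"
  using b_le_\<beta>(1)[OF \<theta>0, of j] norm_ge_zero order_trans by blast

lemma \<beta>_decay: "\<exists>C l. l > 3 / 2 \<and> C \<ge> 0 \<and> (\<forall>j. \<beta> j \<le> C * real (Suc j) powr (- l))"
proof -
  obtain l where l: "l > 3 / 2" "(\<lambda>j. SUP \<theta>\<in>\<Theta>. max (bm j \<theta>) (bp j \<theta>)) \<in> O(\<lambda>j. real j powr (- l))"
    using coeff_decay by blast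
  from bigo_powr_bound[OF this(2)] obtain C where C: "C \<ge> 0"
    "\<And>j. j \<ge> 1 \<Longrightarrow> \<bar>SUP \<theta>\<in>\<Theta>. max (bm j \<theta>) (bp j \<theta>)\<bar> \<le> C * real j powr (- l)" by blast
  have "\<beta> j \<le> C * real (Suc j) powr (- l)" for j
    using C(2)[of "Suc j"] unfolding \<beta>_def by simp
  then show ?thesis using l C by blast
qed

lemma \<beta>_summable: "summable \<beta>" and \<beta>_sqrt_summable: "summable (\<lambda>j. sqrt (real (Suc j)) * \<beta> j)"
proof -
  obtain C l where "l > 3 / 2" "\<And>j. \<beta> j \<le> C * real (Suc j) powr (- l)" using \<beta>_decay by blast
  then show "summable \<beta>" "summable (\<lambda>j. sqrt (real (Suc j)) * \<beta> j)"
    using summable_powr_decay[of \<beta> C l] \<beta>_nonneg by blast+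
qed

lemma tarch_M_eq_vol: "tarch_M b0 bp bm \<theta> x = vol \<theta> (\<lambda>j. x (Suc j))"
  by (simp add: tarch_M_eq_tser vol_def)

lemma H_proc_eq_vol: "H_proc b0 bp bm X t \<omega> \<theta> = (vol \<theta> (lag X t \<omega>))\<^sup>2"
  by (simp add: H_proc_def tarch_H_def tarch_M_eq_vol past_Suc)

definition laghat :: "nat \<Rightarrow> 'a \<Rightarrow> nat \<Rightarrow> real" where
  "laghat t \<omega> j = past_hat u X t \<omega> (Suc j)"

lemma H_hat_eq_vol: "H_hat b0 bp bm u X t \<omega> \<theta> = (vol \<theta> (laghat t \<omega>))\<^sup>2"
  unfolding H_hat_def tarch_H_def tarch_M_eq_vol laghat_def[abs_def] ..

lemma vol_measurable [measurable]:
  assumes [measurable]: "\<And>j. (\<lambda>\<omega>. f \<omega> j) \<in> borel_measurable N"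
  shows "(\<lambda>\<omega>. vol \<theta> (f \<omega>)) \<in> borel_measurable N"
  unfolding vol_def by measurable

lemma vol_bounds:
  assumes \<theta>: "\<theta> \<in> \<Theta>" and s: "summable (\<lambda>j. \<beta> j * \<bar>y j\<bar>)"
  shows "vol \<theta> y \<ge> b" "vol \<theta> y \<le> b0 \<theta> + wsum \<beta> y"
proof -
  note t = tser_bound[OF b_le_\<beta>[OF \<theta>] s]
  have "tser (\<lambda>j. bp (Suc j) \<theta>) (\<lambda>j. bm (Suc j) \<theta>) y \<ge> 0"
    unfolding tser_def by (rule suminf_nonneg[OF t(1)])
      (use bp_nonneg bm_nonneg in \<open>auto simp: tterm_def min_def max_def mult_nonneg_nonneg mult_nonpos_nonneg\<close>)
  then show "vol \<theta> y \<ge> b" using b_le[OF \<theta>] by (simp add: vol_def)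
  show "vol \<theta> y \<le> b0 \<theta> + wsum \<beta> y" using t(2) by (simp add: vol_def wsum_def)
qed

lemma vol_diff_seq:
  assumes \<theta>: "\<theta> \<in> \<Theta>" and s: "summable (\<lambda>j. \<beta> j * \<bar>y j\<bar>)" "summable (\<lambda>j. \<beta> j * \<bar>y' j\<bar>)"
  shows "\<bar>vol \<theta> y - vol \<theta> y'\<bar> \<le> wsum \<beta> (\<lambda>j. y j - y' j)"
  using tser_diff_seq[OF b_le_\<beta>[OF \<theta>] s] by (simp add: vol_def wsum_def)

text \<open>The pair of \<open>X t\<close> and its lags is one fixed measurable function of the path
  shifted by \<open>t\<close>, so stationarity of the path law passes to it.\<close>

lemma lag_stationary:
  fixes g :: "real \<times> (nat \<Rightarrow> real) \<Rightarrow> 'c::{banach, second_countable_topology}"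
  assumes g: "g \<in> borel_measurable (borel \<Otimes>\<^sub>M lag_space)"
  shows "integrable M (\<lambda>\<omega>. g (X t \<omega>, lag X t \<omega>)) \<longleftrightarrow> integrable M (\<lambda>\<omega>. g (X 0 \<omega>, lag X 0 \<omega>))"
    and "expectation (\<lambda>\<omega>. g (X t \<omega>, lag X t \<omega>)) = expectation (\<lambda>\<omega>. g (X 0 \<omega>, lag X 0 \<omega>))"
    and "distr M borel (\<lambda>\<omega>. g (X t \<omega>, lag X t \<omega>)) = distr M borel (\<lambda>\<omega>. g (X 0 \<omega>, lag X 0 \<omega>))"
proof -
  define f where "f = (\<lambda>x::int \<Rightarrow> real. g (x 0, \<lambda>j. x (- int (Suc j))))"
  have m: "(\<lambda>x. (x 0, \<lambda>j. x (- int (Suc j)))) \<in> path_space \<rightarrow>\<^sub>M borel \<Otimes>\<^sub>M lag_space"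
    by (intro measurable_Pair measurable_PiM_single') auto
  have f: "f \<in> borel_measurable path_space" unfolding f_def by (rule measurable_compose[OF m g])
  have f_eq: "f (\<lambda>s. X (s + t) \<omega>) = g (X t \<omega>, lag X t \<omega>)" for t \<omega>
  proof -
    have "(\<lambda>j. X (- int (Suc j) + t) \<omega>) = lag X t \<omega>" by (simp add: lag_def algebra_simps)
    then show ?thesis unfolding f_def by simp
  qed
  have f_eq0: "f (\<lambda>s. X s \<omega>) = g (X 0 \<omega>, lag X 0 \<omega>)" for \<omega> using f_eq[of 0 \<omega>] by simp
  note st = stationary_transfer[OF X_stationary X_measurable f, of t, unfolded f_eq f_eq0]
  show "integrable M (\<lambda>\<omega>. g (X t \<omega>, lag X t \<omega>)) \<longleftrightarrow> integrable M (\<lambda>\<omega>. g (X 0 \<omega>, lag X 0 \<omega>))"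
    "expectation (\<lambda>\<omega>. g (X t \<omega>, lag X t \<omega>)) = expectation (\<lambda>\<omega>. g (X 0 \<omega>, lag X 0 \<omega>))"
    "distr M borel (\<lambda>\<omega>. g (X t \<omega>, lag X t \<omega>)) = distr M borel (\<lambda>\<omega>. g (X 0 \<omega>, lag X 0 \<omega>))"
    using st by auto
qed

lemma ergodic_lag:
  fixes g :: "real \<times> (nat \<Rightarrow> real) \<Rightarrow> real"
  assumes g: "g \<in> borel_measurable (borel \<Otimes>\<^sub>M lag_space)"
    and int: "integrable M (\<lambda>\<omega>. g (X 0 \<omega>, lag X 0 \<omega>))"
  shows "AE \<omega> in M. (\<lambda>n. (\<Sum>t=1..n. g (X (int t) \<omega>, lag X (int t) \<omega>)) / n) \<longlonglongrightarrow> expectation (\<lambda>\<omega>. g (X 0 \<omega>, lag X 0 \<omega>))"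
proof -
  define f where "f = (\<lambda>x::int \<Rightarrow> real. g (x 0, \<lambda>j. x (- int (Suc j))))"
  have m: "(\<lambda>x. (x 0, \<lambda>j. x (- int (Suc j)))) \<in> path_space \<rightarrow>\<^sub>M borel \<Otimes>\<^sub>M lag_space"
    by (intro measurable_Pair measurable_PiM_single') auto
  have f: "f \<in> borel_measurable path_space" unfolding f_def by (rule measurable_compose[OF m g])
  have f_eq: "f (\<lambda>s. X (s + t) \<omega>) = g (X t \<omega>, lag X t \<omega>)" for t \<omega>
  proof -
    have "(\<lambda>j. X (- int (Suc j) + t) \<omega>) = lag X t \<omega>" by (simp add: lag_def algebra_simps)
    then show ?thesis unfolding f_def by simp
  qed
  have f_eq0: "f (\<lambda>s. X s \<omega>) = g (X 0 \<omega>, lag X 0 \<omega>)" for \<omega> using f_eq[of 0 \<omega>] by simp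
  show ?thesis
    using ergodic_average[OF prob_space_axioms X_stationary X_ergodic X_measurable f] int
    unfolding f_eq f_eq0 by blast
qed

lemma wsum_lag_props:
  assumes w: "\<And>j. w j \<ge> 0" "summable w"
  shows "AE \<omega> in M. \<forall>t. summable (\<lambda>j. w j * \<bar>lag X t \<omega> j\<bar>)"
    and "integrable M (\<lambda>\<omega>. wsum w (lag X t \<omega>))"
    and "integrable M (\<lambda>\<omega>. (wsum w (lag X t \<omega>))\<^sup>2)"
proof -
  show "AE \<omega> in M. \<forall>t. summable (\<lambda>j. w j * \<bar>lag X t \<omega> j\<bar>)"
    using AE_summable_lag[OF w] by (simp add: AE_all_countable)
  have e1: "expectation (\<lambda>\<omega>. (X s \<omega>)\<^sup>2) \<le> expectation (\<lambda>\<omega>. (X 0 \<omega>)\<^sup>2)" for s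
    using lag_stationary(2)[of "\<lambda>z. (fst z)\<^sup>2" s] by simp
  have e2: "expectation (\<lambda>\<omega>. \<bar>X s \<omega>\<bar>) \<le> expectation (\<lambda>\<omega>. \<bar>X 0 \<omega>\<bar>)" for s
    using lag_stationary(2)[of "\<lambda>z. \<bar>fst z\<bar>" s] by simp
  show "integrable M (\<lambda>\<omega>. wsum w (lag X t \<omega>))"
    unfolding wsum_def lag_def
    by (rule integrable_weighted_sum(2)[where K="expectation (\<lambda>\<omega>. \<bar>X 0 \<omega>\<bar>)"]) (use w int_X e2 in auto)
  show "integrable M (\<lambda>\<omega>. (wsum w (lag X t \<omega>))\<^sup>2)"
    unfolding wsum_def lag_def
    by (rule integrable_weighted_sum_square(2)[where K="expectation (\<lambda>\<omega>. (X 0 \<omega>)\<^sup>2)"]) (use w int_X2 e1 in auto)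
qed

text \<open>Beyond the observed values \<open>laghat\<close> continues with \<open>u\<close>, so it
  has finitely many nonzero terms and is summable against any weight.\<close>

lemma laghat_summable: "t \<ge> 1 \<Longrightarrow> summable (\<lambda>j. w j * \<bar>laghat t \<omega> j\<bar>)"
proof -
  assume t: "t \<ge> 1"
  \<comment> \<open>Outside the observed range position \<open>j\<close> holds
    \<open>u (j + 2 - t)\<close>, hence the inverse shift \<open>k + t - 2\<close>.\<close>
  have sub: "{j. laghat t \<omega> j \<noteq> 0} \<subseteq> {..<t} \<union> (\<lambda>k. k + t - 2) ` {k. u k \<noteq> 0}"
  proof
    fix j assume j: "j \<in> {j. laghat t \<omega> j \<noteq> 0}"
    show "j \<in> {..<t} \<union> (\<lambda>k. k + t - 2) ` {k. u k \<noteq> 0}"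
    proof (cases "Suc j < t")
      case False
      then have "u (Suc j + 1 - t) \<noteq> 0" using j by (simp add: laghat_def past_hat_def)
      moreover have "j = (Suc j + 1 - t) + t - 2" using False t by simp
      ultimately show ?thesis by blast
    qed auto
  qed
  have fin: "finite {j. laghat t \<omega> j \<noteq> 0}"
    by (rule finite_subset[OF sub]) (use u_finite in auto)
  show ?thesis by (rule summable_finite[OF fin]) auto
qed

section \<open>Effect of replacing the unobserved past by \<open>u\<close>\<close>

definition dev :: "nat \<Rightarrow> 'a \<Rightarrow> real" where "dev i \<omega> = \<bar>X (- int i) \<omega> - u (Suc i)\<bar>"

definition \<Delta> :: "(nat \<Rightarrow> real) \<Rightarrow> nat \<Rightarrow> 'a \<Rightarrow> real" where
  "\<Delta> w t \<omega> = wsum w (\<lambda>j. lag X (int t) \<omega> j - laghat t \<omega> j)"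

text \<open>At time \<open>n + 1\<close> the first \<open>n\<close> lags are observed and agree.
  From position \<open>n\<close> on, \<open>X\<close> at time \<open>- i\<close> is compared with
  \<open>u (i + 1)\<close>, so only the weights shift with \<open>n\<close>.\<close>

lemma \<Delta>_eq:
  assumes "summable (\<lambda>i. w (i + n) * dev i \<omega>)"
  shows "\<Delta> w (Suc n) \<omega> = (\<Sum>i. w (i + n) * dev i \<omega>)"
proof -
  let ?f = "\<lambda>j. w j * \<bar>lag X (int (Suc n)) \<omega> j - laghat (Suc n) \<omega> j\<bar>"
  have shift: "?f (i + n) = w (i + n) * dev i \<omega>" for i
    by (simp add: lag_def laghat_def past_hat_def dev_def)
  have zero: "?f j = 0" if "j < n" for j
    using that by (simp add: lag_def laghat_def past_hat_def of_nat_diff)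
  have s: "summable ?f" using assms unfolding shift[symmetric] by (rule summable_iff_shift[THEN iffD1])
  have "(\<Sum>j. ?f j) = (\<Sum>i. ?f (i + n)) + (\<Sum>j<n. ?f j)" by (rule suminf_split_initial_segment[OF s])
  also have "(\<Sum>j<n. ?f j) = 0" by (intro sum.neutral ballI zero) auto
  finally show ?thesis unfolding \<Delta>_def wsum_def shift by simp
qed

lemma u_bounded: "\<exists>U\<ge>0. \<forall>i. \<bar>u i\<bar> \<le> U"
proof -
  have "\<bar>u i\<bar> \<le> (\<Sum>k\<in>{k. u k \<noteq> 0}. \<bar>u k\<bar>)" for i
  proof (cases "u i = 0")
    case False
    then show ?thesis using u_finite by (intro member_le_sum[of i _ "\<lambda>k. \<bar>u k\<bar>"]) auto
  qed (simp add: sum_nonneg)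
  then show ?thesis by (intro exI[of _ "\<Sum>k\<in>{k. u k \<noteq> 0}. \<bar>u k\<bar>"]) (auto simp: sum_nonneg)
qed

lemma dev_measurable [measurable]: "dev i \<in> borel_measurable M"
  unfolding dev_def by measurable

lemma AE_summable_dev:
  assumes w: "\<And>j. w j \<ge> 0" "summable w"
  shows "AE \<omega> in M. summable (\<lambda>i. w i * dev i \<omega>)"
proof -
  obtain U where U: "U \<ge> 0" "\<And>i. \<bar>u i\<bar> \<le> U" using u_bounded by blast
  have e2: "expectation (\<lambda>\<omega>. \<bar>X s \<omega>\<bar>) = expectation (\<lambda>\<omega>. \<bar>X 0 \<omega>\<bar>)" for s
    using lag_stationary(2)[of "\<lambda>z. \<bar>fst z\<bar>" s] by simp
  have i: "integrable M (dev j)" for j unfolding dev_def using int_X by simp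
  have le: "expectation (dev j) \<le> expectation (\<lambda>\<omega>. \<bar>X 0 \<omega>\<bar>) + U" for j
  proof -
    have "expectation (dev j) \<le> expectation (\<lambda>\<omega>. \<bar>X (- int j) \<omega>\<bar> + U)"
    proof (rule integral_mono)
      show "dev j \<omega> \<le> \<bar>X (- int j) \<omega>\<bar> + U" for \<omega> using U(2)[of "Suc j"] by (simp add: dev_def)
    qed (use i int_X in auto)
    also have "\<dots> = expectation (\<lambda>\<omega>. \<bar>X (- int j) \<omega>\<bar>) + U" using int_X by (simp add: prob_space)
    finally show ?thesis unfolding e2[of "- int j"] .
  qed
  show ?thesis
    by (rule integrable_weighted_sum(1)[of dev, OF i _ le w]) (simp add: dev_def)
qed

text \<open>The sequence \<open>\<beta>\<close> may fail to be monotone, so its shifts are dominated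
  through the decreasing bound \<open>C * (i + 1) powr (- l)\<close>, uniformly in the shift; then
  dominated convergence of series applies.\<close>

lemma \<Delta>_\<beta>_tendsto_0: "AE \<omega> in M. (\<lambda>t. \<Delta> \<beta> t \<omega>) \<longlonglongrightarrow> 0"
proof -
  obtain C l where C: "l > 3 / 2" "C \<ge> 0" "\<And>j. \<beta> j \<le> C * real (Suc j) powr (- l)" using \<beta>_decay by blast
  have "summable (\<lambda>j. C * real (Suc j) powr (- l))"
    by (rule summable_powr_decay(1)[of _ C l]) (use C in auto)
  from AE_summable_dev[OF _ this]
  have "AE \<omega> in M. summable (\<lambda>i. C * real (Suc i) powr (- l) * dev i \<omega>)" using C by simp
  then show ?thesis
  proof eventually_elim
    case (elim \<omega>)
    have d0: "dev i \<omega> \<ge> 0" for i by (simp add: dev_def)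
    have le: "\<bar>\<beta> (i + n) * dev i \<omega>\<bar> \<le> C * real (Suc i) powr (- l) * dev i \<omega>" for i n
    proof -
      have "\<beta> (i + n) \<le> C * real (Suc (i + n)) powr (- l)" by (rule C(3))
      also have "\<dots> \<le> C * real (Suc i) powr (- l)"
        using C by (intro mult_left_mono powr_mono2') auto
      finally show ?thesis using \<beta>_nonneg[of "i + n"] d0[of i] by (simp add: abs_mult mult_right_mono)
    qed
    have s: "summable (\<lambda>i. \<beta> (i + n) * dev i \<omega>)" for n
      by (rule summable_comparison_test'[OF elim, of 0]) (use le in auto)
    have "(\<lambda>n. \<Sum>i. \<beta> (i + n) * dev i \<omega>) \<longlonglongrightarrow> 0"
    proof (rule tannery_null[OF _ le elim])
      fix i
      have "(\<lambda>n. \<beta> (n + i)) \<longlonglongrightarrow> 0"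
        by (rule LIMSEQ_ignore_initial_segment[OF summable_LIMSEQ_zero[OF \<beta>_summable]])
      then show "(\<lambda>n. \<beta> (i + n) * dev i \<omega>) \<longlonglongrightarrow> 0"
        by (intro tendsto_mult_left_zero) (simp add: add.commute)
    qed
    then have "(\<lambda>n. \<Delta> \<beta> (Suc n) \<omega>) \<longlonglongrightarrow> 0" unfolding \<Delta>_eq[OF s] .
    then show ?case by (rule LIMSEQ_imp_Suc)
  qed
qed

section \<open>The contrast and its truncated version\<close>

definition Qn :: "nat \<Rightarrow> 'a \<Rightarrow> real ^ 'd \<Rightarrow> real" where
  "Qn n \<omega> \<theta> = (\<Sum>t=1..n. qf (X (int t) \<omega>) (vol \<theta> (lag X (int t) \<omega>)))"

definition Qhat :: "nat \<Rightarrow> 'a \<Rightarrow> real ^ 'd \<Rightarrow> real" where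
  "Qhat n \<omega> \<theta> = (\<Sum>t=1..n. qf (X (int t) \<omega>) (vol \<theta> (laghat t \<omega>)))"

lemma vol_hat_ge: "\<theta> \<in> \<Theta> \<Longrightarrow> t \<ge> 1 \<Longrightarrow> vol \<theta> (laghat t \<omega>) \<ge> b"
  by (rule vol_bounds(1)[OF _ laghat_summable])

lemma qf_square: "m > 0 \<Longrightarrow> x\<^sup>2 / m\<^sup>2 + ln (m\<^sup>2) = qf x m"
  by (simp add: qf_def ln_realpow)

lemma L_hat_eq: "\<theta> \<in> \<Theta> \<Longrightarrow> L_hat b0 bp bm u X n \<omega> \<theta> = - (1 / 2) * Qhat n \<omega> \<theta>"
  unfolding L_hat_def Qhat_def H_hat_eq_vol
  using vol_hat_ge b_pos by (intro arg_cong2[where f="(*)"] sum.cong refl qf_square) (auto intro: less_le_trans)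

lemma AE_good: "AE \<omega> in M. \<forall>t. summable (\<lambda>j. \<beta> j * \<bar>lag X t \<omega> j\<bar>)"
  by (rule wsum_lag_props(1)[OF \<beta>_nonneg \<beta>_summable])

text \<open>Each term of the contrast changes by at most a multiple of
  \<open>(1 + X^2) * \<Delta> \<beta> t\<close>, a bound free of \<theta>. Averages of
  \<open>1 + X^2\<close> converge while \<open>\<Delta> \<beta> t\<close> tends to 0, so the
  weighted averages vanish.\<close>

lemma Qhat_uniform: "AE \<omega> in M. \<exists>e::nat \<Rightarrow> real. e \<longlonglongrightarrow> 0 \<and> (\<forall>n. \<forall>\<theta>\<in>\<Theta>. \<bar>Qhat n \<omega> \<theta> - Qn n \<omega> \<theta>\<bar> \<le> real n * e n)"
proof -
  have "AE \<omega> in M. (\<lambda>n. (\<Sum>t=1..n. 1 + (X (int t) \<omega>)\<^sup>2) / n) \<longlonglongrightarrow> expectation (\<lambda>\<omega>. 1 + (X 0 \<omega>)\<^sup>2)"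
    using ergodic_lag[of "\<lambda>z. 1 + (fst z)\<^sup>2"] int_X2[of 0] by simp
  then show ?thesis using \<Delta>_\<beta>_tendsto_0 AE_good
  proof eventually_elim
    case (elim \<omega>)
    define K where "K = 2 / b ^ 3 + 2 / b"
    define e where "e = (\<lambda>n. K * ((\<Sum>t=1..n. (1 + (X (int t) \<omega>)\<^sup>2) * \<Delta> \<beta> t \<omega>) / real n))"
    have "(\<lambda>n. (\<Sum>t=1..n. (1 + (X (int t) \<omega>)\<^sup>2) * \<Delta> \<beta> t \<omega>) / real n) \<longlonglongrightarrow> 0"
      by (rule cesaro_weighted_null[OF _ elim(1,2)]) (simp add: add_nonneg_nonneg)
    then have "e \<longlonglongrightarrow> 0" unfolding e_def by (rule tendsto_mult_right_zero)
    moreover have "\<bar>Qhat n \<omega> \<theta> - Qn n \<omega> \<theta>\<bar> \<le> n * e n" if \<theta>: "\<theta> \<in> \<Theta>" for n \<theta>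
    proof -
      have "\<bar>Qhat n \<omega> \<theta> - Qn n \<omega> \<theta>\<bar> \<le> (\<Sum>t=1..n. \<bar>qf (X (int t) \<omega>) (vol \<theta> (laghat t \<omega>)) - qf (X (int t) \<omega>) (vol \<theta> (lag X (int t) \<omega>))\<bar>)"
        unfolding Qhat_def Qn_def sum_subtractf[symmetric] by (rule sum_abs)
      also have "\<dots> \<le> (\<Sum>t=1..n. K * ((1 + (X (int t) \<omega>)\<^sup>2) * \<Delta> \<beta> t \<omega>))"
      proof (rule sum_mono)
        fix t assume t: "t \<in> {1..n}"
        then have t1: "t \<ge> 1" by simp
        have s: "summable (\<lambda>j. \<beta> j * \<bar>lag X (int t) \<omega> j\<bar>)" using elim(3) by blast
        have v: "vol \<theta> (laghat t \<omega>) \<ge> b" "vol \<theta> (lag X (int t) \<omega>) \<ge> b"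
          by (rule vol_hat_ge[OF \<theta> t1], rule vol_bounds(1)[OF \<theta> s])
        have "\<bar>qf (X (int t) \<omega>) (vol \<theta> (laghat t \<omega>)) - qf (X (int t) \<omega>) (vol \<theta> (lag X (int t) \<omega>))\<bar>
           \<le> K * ((1 + (X (int t) \<omega>)\<^sup>2) * \<bar>vol \<theta> (laghat t \<omega>) - vol \<theta> (lag X (int t) \<omega>)\<bar>)"
          unfolding K_def by (rule qf_diff(1)[OF b_pos v])
        also have "\<dots> \<le> K * ((1 + (X (int t) \<omega>)\<^sup>2) * \<Delta> \<beta> t \<omega>)"
        proof (intro mult_left_mono)
          show "\<bar>vol \<theta> (laghat t \<omega>) - vol \<theta> (lag X (int t) \<omega>)\<bar> \<le> \<Delta> \<beta> t \<omega>"
            unfolding \<Delta>_def using vol_diff_seq[OF \<theta> s laghat_summable[OF t1]] by (simp add: abs_minus_commute)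
        qed (use b_pos in \<open>auto simp: K_def add_nonneg_nonneg\<close>)
        finally show "\<bar>qf (X (int t) \<omega>) (vol \<theta> (laghat t \<omega>)) - qf (X (int t) \<omega>) (vol \<theta> (lag X (int t) \<omega>))\<bar>
           \<le> K * ((1 + (X (int t) \<omega>)\<^sup>2) * \<Delta> \<beta> t \<omega>)" .
      qed
      also have "\<dots> = n * e n" by (cases "n = 0") (simp_all add: e_def sum_distrib_left[symmetric])
      finally show ?thesis .
    qed
    ultimately show ?case by blast
  qed
qed


section \<open>Moduli of continuity in the parameter\<close>

definition mod_b0 :: "real ^ 'd \<Rightarrow> nat \<Rightarrow> real" where
  "mod_b0 \<theta>1 = lsup (\<lambda>\<theta>. \<bar>b0 \<theta> - b0 \<theta>1\<bar>) \<Theta> \<theta>1"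

definition mod_b :: "real ^ 'd \<Rightarrow> nat \<Rightarrow> nat \<Rightarrow> real" where
  "mod_b \<theta>1 j = lsup (\<lambda>\<theta>. max \<bar>bp (Suc j) \<theta> - bp (Suc j) \<theta>1\<bar> \<bar>bm (Suc j) \<theta> - bm (Suc j) \<theta>1\<bar>) \<Theta> \<theta>1"

text \<open>The supremum over nearby parameters is taken inside each coefficient. The result
  dominates the supremum of the random volatility difference and is visibly measurable in
  \<open>y\<close>.\<close>

definition mod_vol :: "real ^ 'd \<Rightarrow> nat \<Rightarrow> (nat \<Rightarrow> real) \<Rightarrow> real" where
  "mod_vol \<theta>1 k y = mod_b0 \<theta>1 k + wsum (\<lambda>j. mod_b \<theta>1 j k) y"

lemma mod_vol_measurable [measurable]:
  assumes [measurable]: "\<And>j. (\<lambda>\<omega>. f \<omega> j) \<in> borel_measurable N"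
  shows "(\<lambda>\<omega>. mod_vol \<theta>1 k (f \<omega>)) \<in> borel_measurable N"
  unfolding mod_vol_def by measurable

lemma continuous_on_imp_abs_diff_tendsto_0:
  fixes f :: "real ^ 'd \<Rightarrow> real"
  assumes "continuous_on \<Theta> f" "\<theta>1 \<in> \<Theta>"
  shows "((\<lambda>\<theta>. \<bar>f \<theta> - f \<theta>1\<bar>) \<longlongrightarrow> 0) (at \<theta>1 within \<Theta>)"
proof -
  have "(f \<longlongrightarrow> f \<theta>1) (at \<theta>1 within \<Theta>)" using assms by (auto simp: continuous_on_def)
  from tendsto_rabs_zero[OF LIM_zero[OF this]] show ?thesis .
qed

lemma mod_b0_props:
  assumes \<theta>1: "\<theta>1 \<in> \<Theta>"
  shows "\<And>\<theta> k. \<theta> \<in> \<Theta> \<Longrightarrow> dist \<theta>1 \<theta> \<le> inverse (real (Suc k)) \<Longrightarrow> \<bar>b0 \<theta> - b0 \<theta>1\<bar> \<le> mod_b0 \<theta>1 k"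
    and "\<And>k. mod_b0 \<theta>1 k \<ge> 0" and "mod_b0 \<theta>1 \<longlonglongrightarrow> 0"
    and "\<exists>B. \<forall>k. mod_b0 \<theta>1 k \<le> B"
proof -
  have "continuous_on \<Theta> (\<lambda>\<theta>. \<bar>b0 \<theta> - b0 \<theta>1\<bar>)" by (intro continuous_intros cont_b0)
  from continuous_on_compact_bdd(1)[OF compact_\<Theta> this] obtain B where B: "\<And>\<theta>. \<theta> \<in> \<Theta> \<Longrightarrow> \<bar>b0 \<theta> - b0 \<theta>1\<bar> \<le> B"
    unfolding bdd_above_def by auto
  note l = lsup_props[of \<theta>1 \<Theta> "\<lambda>\<theta>. \<bar>b0 \<theta> - b0 \<theta>1\<bar>" B, OF \<theta>1 _ B, folded mod_b0_def, simplified]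
  show "\<And>\<theta> k. \<theta> \<in> \<Theta> \<Longrightarrow> dist \<theta>1 \<theta> \<le> inverse (real (Suc k)) \<Longrightarrow> \<bar>b0 \<theta> - b0 \<theta>1\<bar> \<le> mod_b0 \<theta>1 k"
    using l(1) by simp
  show "\<And>k. mod_b0 \<theta>1 k \<ge> 0" using l(2) by simp
  show "mod_b0 \<theta>1 \<longlonglongrightarrow> 0" using l(4) continuous_on_imp_abs_diff_tendsto_0[OF cont_b0 \<theta>1] by simp
  show "\<exists>B. \<forall>k. mod_b0 \<theta>1 k \<le> B" using l(3) by blast
qed

text \<open>Coefficients at both parameters lie between 0 and \<open>\<beta> j\<close>, so their
  difference is at most \<open>\<beta> j\<close> with no factor 2; this is the summable majorant
  uniform in \<open>k\<close>.\<close>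

lemma mod_b_props:
  assumes \<theta>1: "\<theta>1 \<in> \<Theta>"
  shows "\<And>\<theta> k. \<theta> \<in> \<Theta> \<Longrightarrow> dist \<theta>1 \<theta> \<le> inverse (real (Suc k)) \<Longrightarrow> \<bar>bp (Suc j) \<theta> - bp (Suc j) \<theta>1\<bar> \<le> mod_b \<theta>1 j k"
    and "\<And>\<theta> k. \<theta> \<in> \<Theta> \<Longrightarrow> dist \<theta>1 \<theta> \<le> inverse (real (Suc k)) \<Longrightarrow> \<bar>bm (Suc j) \<theta> - bm (Suc j) \<theta>1\<bar> \<le> mod_b \<theta>1 j k"
    and "\<And>k. mod_b \<theta>1 j k \<ge> 0" and "mod_b \<theta>1 j \<longlonglongrightarrow> 0" and "\<And>k. mod_b \<theta>1 j k \<le> \<beta> j"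
proof -
  let ?f = "\<lambda>\<theta>. max \<bar>bp (Suc j) \<theta> - bp (Suc j) \<theta>1\<bar> \<bar>bm (Suc j) \<theta> - bm (Suc j) \<theta>1\<bar>"
  have B: "?f \<theta> \<le> \<beta> j" if "\<theta> \<in> \<Theta>" for \<theta>
    using b_le_\<beta>[OF that, of j] b_le_\<beta>[OF \<theta>1, of j] bp_nonneg[of "Suc j" \<theta>] bm_nonneg[of "Suc j" \<theta>]
      bp_nonneg[of "Suc j" \<theta>1] bm_nonneg[of "Suc j" \<theta>1] by auto
  note l = lsup_props[of \<theta>1 \<Theta> ?f "\<beta> j", OF \<theta>1 _ B, folded mod_b_def]
  have l1: "?f \<theta> \<le> mod_b \<theta>1 j k" if "\<theta> \<in> \<Theta>" "dist \<theta>1 \<theta> \<le> inverse (real (Suc k))" for \<theta> k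
    by (rule l(1)) (use that in auto)
  show "\<And>\<theta> k. \<theta> \<in> \<Theta> \<Longrightarrow> dist \<theta>1 \<theta> \<le> inverse (real (Suc k)) \<Longrightarrow> \<bar>bp (Suc j) \<theta> - bp (Suc j) \<theta>1\<bar> \<le> mod_b \<theta>1 j k"
    and "\<And>\<theta> k. \<theta> \<in> \<Theta> \<Longrightarrow> dist \<theta>1 \<theta> \<le> inverse (real (Suc k)) \<Longrightarrow> \<bar>bm (Suc j) \<theta> - bm (Suc j) \<theta>1\<bar> \<le> mod_b \<theta>1 j k"
    using l1 by auto
  show "\<And>k. mod_b \<theta>1 j k \<ge> 0" by (rule l(2)) auto
  show "\<And>k. mod_b \<theta>1 j k \<le> \<beta> j" by (rule l(3)) auto
  have "(?f \<longlongrightarrow> max 0 0) (at \<theta>1 within \<Theta>)"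
    by (intro tendsto_max continuous_on_imp_abs_diff_tendsto_0 cont_bp cont_bm \<theta>1) auto
  then show "mod_b \<theta>1 j \<longlonglongrightarrow> 0" by (intro l(4)) auto
qed

lemma vol_modulus:
  assumes \<theta>1: "\<theta>1 \<in> \<Theta>" and \<theta>: "\<theta> \<in> \<Theta>" and d: "dist \<theta>1 \<theta> \<le> inverse (real (Suc k))"
    and s: "summable (\<lambda>j. \<beta> j * \<bar>y j\<bar>)"
  shows "\<bar>vol \<theta> y - vol \<theta>1 y\<bar> \<le> mod_vol \<theta>1 k y"
proof -
  have s': "summable (\<lambda>j. mod_b \<theta>1 j k * \<bar>y j\<bar>)"
    by (rule summable_comparison_test'[OF s, of 0])
      (use mod_b_props(3,5)[OF \<theta>1] in \<open>auto simp: abs_mult intro!: mult_right_mono\<close>)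
  have "tser (\<lambda>j. bp (Suc j) \<theta>) (\<lambda>j. bm (Suc j) \<theta>) y - tser (\<lambda>j. bp (Suc j) \<theta>1) (\<lambda>j. bm (Suc j) \<theta>1) y
     = tser (\<lambda>j. bp (Suc j) \<theta> - bp (Suc j) \<theta>1) (\<lambda>j. bm (Suc j) \<theta> - bm (Suc j) \<theta>1) y"
    by (rule tser_diff_coeff[OF tser_bound(1)[OF b_le_\<beta>[OF \<theta>] s] tser_bound(1)[OF b_le_\<beta>[OF \<theta>1] s]])
  moreover have "norm (tser (\<lambda>j. bp (Suc j) \<theta> - bp (Suc j) \<theta>1) (\<lambda>j. bm (Suc j) \<theta> - bm (Suc j) \<theta>1) y) \<le> wsum (\<lambda>j. mod_b \<theta>1 j k) y"
    unfolding wsum_def by (rule tser_bound(2)[OF _ _ s']) (use mod_b_props(1,2)[OF \<theta>1 \<theta> d] in auto)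
  ultimately show ?thesis
    using mod_b0_props(1)[OF \<theta>1 \<theta> d] unfolding vol_def mod_vol_def by (simp add: abs_le_iff)
qed

lemma mod_vol_props:
  assumes \<theta>1: "\<theta>1 \<in> \<Theta>" and s: "summable (\<lambda>j. \<beta> j * \<bar>y j\<bar>)"
  shows "mod_vol \<theta>1 k y \<ge> 0" "(\<lambda>k. mod_vol \<theta>1 k y) \<longlonglongrightarrow> 0" "mod_vol \<theta>1 k y \<le> mod_b0 \<theta>1 k + wsum \<beta> y"
proof -
  have le: "\<bar>mod_b \<theta>1 j k * \<bar>y j\<bar>\<bar> \<le> \<beta> j * \<bar>y j\<bar>" for j k
    using mod_b_props(3,5)[OF \<theta>1] by (auto simp: abs_mult intro!: mult_right_mono)
  have s': "summable (\<lambda>j. mod_b \<theta>1 j k * \<bar>y j\<bar>)" for k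
    by (rule summable_comparison_test'[OF s, of 0]) (use le in auto)
  show "mod_vol \<theta>1 k y \<ge> 0"
    unfolding mod_vol_def using mod_b0_props(2)[OF \<theta>1] wsum_nonneg[OF mod_b_props(3)[OF \<theta>1] s'] by (simp add: add_nonneg_nonneg)
  have "(\<lambda>k. wsum (\<lambda>j. mod_b \<theta>1 j k) y) \<longlonglongrightarrow> 0"
    unfolding wsum_def by (rule tannery_null[OF _ le s]) (intro tendsto_mult_left_zero mod_b_props(4)[OF \<theta>1])
  then show "(\<lambda>k. mod_vol \<theta>1 k y) \<longlonglongrightarrow> 0"
    unfolding mod_vol_def using mod_b0_props(3)[OF \<theta>1] by (intro tendsto_add_zero)
  show "mod_vol \<theta>1 k y \<le> mod_b0 \<theta>1 k + wsum \<beta> y"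
    unfolding mod_vol_def wsum_def by (intro add_left_mono suminf_le[OF abs_le_D1[OF le] s' s])
qed

section \<open>The limiting contrast and its minimum\<close>

lemma lag_component_measurable [measurable]: "(\<lambda>\<omega>. lag X t \<omega> j) \<in> borel_measurable M"
  unfolding lag_def by measurable

lemma integrable_vol_square:
  assumes \<theta>: "\<theta> \<in> \<Theta>"
  shows "integrable M (\<lambda>\<omega>. (vol \<theta> (lag X t \<omega>))\<^sup>2)"
proof (rule Bochner_Integration.integrable_bound)
  show "integrable M (\<lambda>\<omega>. 2 * (b0 \<theta>)\<^sup>2 + 2 * (wsum \<beta> (lag X t \<omega>))\<^sup>2)"
    using wsum_lag_props(3)[OF \<beta>_nonneg \<beta>_summable] by simp
  show "AE \<omega> in M. norm ((vol \<theta> (lag X t \<omega>))\<^sup>2) \<le> norm (2 * (b0 \<theta>)\<^sup>2 + 2 * (wsum \<beta> (lag X t \<omega>))\<^sup>2)"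
    using AE_good
  proof eventually_elim
    case (elim \<omega>)
    then have s: "summable (\<lambda>j. \<beta> j * \<bar>lag X t \<omega> j\<bar>)" by blast
    note v = vol_bounds[OF \<theta> s]
    have "(vol \<theta> (lag X t \<omega>))\<^sup>2 \<le> (b0 \<theta> + wsum \<beta> (lag X t \<omega>))\<^sup>2"
      using v b_pos by (intro power_mono) auto
    also have "\<dots> \<le> 2 * (b0 \<theta>)\<^sup>2 + 2 * (wsum \<beta> (lag X t \<omega>))\<^sup>2"
      using sum_squares_bound[of "b0 \<theta>" "wsum \<beta> (lag X t \<omega>)"] by (simp add: power2_sum)
    finally show ?case by simp
  qed
qed measurable

lemma qf_measurable [measurable]:
  assumes [measurable]: "f \<in> borel_measurable N" "g \<in> borel_measurable N"
  shows "(\<lambda>\<omega>. qf (f \<omega>) (g \<omega>)) \<in> borel_measurable N"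
  unfolding qf_def by measurable

text \<open>The lower bound \<open>b\<close> controls the logarithm from below,
  \<open>ln m \<le> m - 1\<close> from above.\<close>

lemma integrable_ln_vol:
  assumes \<theta>: "\<theta> \<in> \<Theta>"
  shows "integrable M (\<lambda>\<omega>. ln (vol \<theta> (lag X t \<omega>)))"
proof (rule Bochner_Integration.integrable_bound)
  show "integrable M (\<lambda>\<omega>. \<bar>ln b\<bar> + 1 + (vol \<theta> (lag X t \<omega>))\<^sup>2)" using integrable_vol_square[OF \<theta>] by simp
  show "AE \<omega> in M. norm (ln (vol \<theta> (lag X t \<omega>))) \<le> norm (\<bar>ln b\<bar> + 1 + (vol \<theta> (lag X t \<omega>))\<^sup>2)"
    using AE_good
  proof eventually_elim
    case (elim \<omega>)
    define m where "m = vol \<theta> (lag X t \<omega>)"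
    have s: "summable (\<lambda>j. \<beta> j * \<bar>lag X t \<omega> j\<bar>)" using elim by blast
    have m: "m \<ge> b" "m > 0" using vol_bounds(1)[OF \<theta> s] b_pos by (auto simp: m_def)
    have "ln m \<le> m - 1" using m by (intro ln_le_minus_one)
    moreover have "ln b \<le> ln m" using m b_pos by simp
    moreover have "m \<le> 1 + m\<^sup>2"
    proof -
      have "0 \<le> (m - 1)\<^sup>2" by simp
      then show ?thesis using m by (simp add: power2_eq_square algebra_simps)
    qed
    moreover have "0 \<le> m\<^sup>2" by simp
    ultimately show ?case unfolding m_def[symmetric] real_norm_def by linarith
  qed
qed measurable

lemma square_div_vol_le:
  assumes \<theta>: "\<theta> \<in> \<Theta>" and s: "summable (\<lambda>j. \<beta> j * \<bar>y j\<bar>)"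
  shows "x\<^sup>2 / (vol \<theta> y)\<^sup>2 \<le> x\<^sup>2 / b\<^sup>2"
  using vol_bounds(1)[OF \<theta> s] b_pos by (intro divide_left_mono power_mono) auto

lemma integrable_qf:
  assumes \<theta>: "\<theta> \<in> \<Theta>"
  shows "integrable M (\<lambda>\<omega>. (X t \<omega>)\<^sup>2 / (vol \<theta> (lag X t \<omega>))\<^sup>2)"
    and "integrable M (\<lambda>\<omega>. qf (X t \<omega>) (vol \<theta> (lag X t \<omega>)))"
proof -
  show i: "integrable M (\<lambda>\<omega>. (X t \<omega>)\<^sup>2 / (vol \<theta> (lag X t \<omega>))\<^sup>2)"
  proof (rule Bochner_Integration.integrable_bound)
    show "integrable M (\<lambda>\<omega>. (X t \<omega>)\<^sup>2 / b\<^sup>2)" using int_X2 by simp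
    show "AE \<omega> in M. norm ((X t \<omega>)\<^sup>2 / (vol \<theta> (lag X t \<omega>))\<^sup>2) \<le> norm ((X t \<omega>)\<^sup>2 / b\<^sup>2)"
      using AE_good by eventually_elim (simp add: square_div_vol_le[OF \<theta>])
  qed measurable
  show "integrable M (\<lambda>\<omega>. qf (X t \<omega>) (vol \<theta> (lag X t \<omega>)))"
    unfolding qf_def using i integrable_ln_vol[OF \<theta>] by simp
qed

definition Q :: "real ^ 'd \<Rightarrow> real" where "Q \<theta> = expectation (\<lambda>\<omega>. qf (X 0 \<omega>) (vol \<theta> (lag X 0 \<omega>)))"

lemma X_eq_vol: "AE \<omega> in M. X t \<omega> = vol \<theta>0 (lag X t \<omega>) * \<xi> t \<omega>"
  using X_eq[of t] by (simp add: tarch_M_eq_vol past_Suc)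

text \<open>Substituting \<open>X = vol * \<xi>\<close> and using independence of
  \<open>\<xi> 0\<close> from the past, the factor \<open>\<xi>^2\<close> integrates to 1 and only
  the ratio of the two volatilities remains.\<close>

lemma Q_eq:
  assumes \<theta>: "\<theta> \<in> \<Theta>"
  defines "r \<equiv> \<lambda>\<omega>. (vol \<theta>0 (lag X 0 \<omega>))\<^sup>2 / (vol \<theta> (lag X 0 \<omega>))\<^sup>2"
  shows "integrable M r" "Q \<theta> = expectation r + 2 * expectation (\<lambda>\<omega>. ln (vol \<theta> (lag X 0 \<omega>)))"
proof -
  have rb: "integrable M r"
  proof (rule Bochner_Integration.integrable_bound)
    show "integrable M (\<lambda>\<omega>. (vol \<theta>0 (lag X 0 \<omega>))\<^sup>2 / b\<^sup>2)" using integrable_vol_square[OF \<theta>0] by simp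
    show "AE \<omega> in M. norm (r \<omega>) \<le> norm ((vol \<theta>0 (lag X 0 \<omega>))\<^sup>2 / b\<^sup>2)"
      unfolding r_def using AE_good by eventually_elim (simp add: square_div_vol_le[OF \<theta>])
  qed (simp add: r_def)
  then show "integrable M r" .
  define g where "g = (\<lambda>y. (vol \<theta>0 y)\<^sup>2 / (vol \<theta> y)\<^sup>2)"
  have g: "g \<in> borel_measurable lag_space" unfolding g_def by measurable
  have "expectation (\<lambda>\<omega>. g (lag X 0 \<omega>) * (\<xi> 0 \<omega>)\<^sup>2) = expectation (\<lambda>\<omega>. g (lag X 0 \<omega>)) * expectation (\<lambda>\<omega>. (\<xi> 0 \<omega>)\<^sup>2)"
    by (rule lag_independent[OF g]) (use rb int_\<xi>2 in \<open>auto simp: g_def r_def\<close>)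
  then have "expectation (\<lambda>\<omega>. r \<omega> * (\<xi> 0 \<omega>)\<^sup>2) = expectation r" by (simp add: mean_\<xi>2 g_def r_def)
  moreover have "expectation (\<lambda>\<omega>. (X 0 \<omega>)\<^sup>2 / (vol \<theta> (lag X 0 \<omega>))\<^sup>2) = expectation (\<lambda>\<omega>. r \<omega> * (\<xi> 0 \<omega>)\<^sup>2)"
  proof (rule integral_cong_AE)
    show "AE \<omega> in M. (X 0 \<omega>)\<^sup>2 / (vol \<theta> (lag X 0 \<omega>))\<^sup>2 = r \<omega> * (\<xi> 0 \<omega>)\<^sup>2"
      using X_eq_vol[of 0] by eventually_elim (simp add: r_def power_mult_distrib)
  qed (simp_all add: r_def)
  ultimately show "Q \<theta> = expectation r + 2 * expectation (\<lambda>\<omega>. ln (vol \<theta> (lag X 0 \<omega>)))"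
    unfolding Q_def qf_def using integrable_qf(1)[OF \<theta>] integrable_ln_vol[OF \<theta>] by simp
qed

lemma Q_minimum:
  assumes \<theta>: "\<theta> \<in> \<Theta>" and ne: "\<theta> \<noteq> \<theta>0"
  shows "Q \<theta>0 < Q \<theta>"
proof (rule ccontr)
  assume not: "\<not> Q \<theta>0 < Q \<theta>"
  define r where "r = (\<lambda>\<omega>. (vol \<theta>0 (lag X 0 \<omega>))\<^sup>2 / (vol \<theta> (lag X 0 \<omega>))\<^sup>2)"
  \<comment> \<open>This is \<open>r - 1 - ln r\<close> with the logarithm split, so that each
    summand is integrable on its own.\<close>
  define h where "h = (\<lambda>\<omega>. r \<omega> - 1 - (2 * ln (vol \<theta>0 (lag X 0 \<omega>)) - 2 * ln (vol \<theta> (lag X 0 \<omega>))))"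
  have good: "AE \<omega> in M. vol \<theta>0 (lag X 0 \<omega>) > 0 \<and> vol \<theta> (lag X 0 \<omega>) > 0"
    using AE_good
  proof eventually_elim
    case (elim \<omega>)
    then have s: "summable (\<lambda>j. \<beta> j * \<bar>lag X 0 \<omega> j\<bar>)" by blast
    show ?case using vol_bounds(1)[OF \<theta> s] vol_bounds(1)[OF \<theta>0 s] b_pos by auto
  qed
  have ln_r: "h \<omega> = r \<omega> - 1 - ln (r \<omega>)" "r \<omega> > 0" if "vol \<theta>0 (lag X 0 \<omega>) > 0 \<and> vol \<theta> (lag X 0 \<omega>) > 0" for \<omega>
    using that by (auto simp: h_def r_def ln_div ln_realpow)
  have h0: "AE \<omega> in M. h \<omega> \<ge> 0"
    using good by eventually_elim (use ln_r ln_le_minus_one in fastforce)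
  have ih: "integrable M h"
    unfolding h_def using Q_eq(1)[OF \<theta>] integrable_ln_vol[OF \<theta>] integrable_ln_vol[OF \<theta>0] by (simp add: r_def)
  have one: "expectation (\<lambda>\<omega>. (vol \<theta>0 (lag X 0 \<omega>))\<^sup>2 / (vol \<theta>0 (lag X 0 \<omega>))\<^sup>2) = 1"
  proof -
    have "expectation (\<lambda>\<omega>. (vol \<theta>0 (lag X 0 \<omega>))\<^sup>2 / (vol \<theta>0 (lag X 0 \<omega>))\<^sup>2) = expectation (\<lambda>\<omega>. 1)"
      by (rule integral_cong_AE) (use good in auto)
    then show ?thesis by (simp add: prob_space)
  qed
  have "expectation h = expectation r - 1 - (2 * expectation (\<lambda>\<omega>. ln (vol \<theta>0 (lag X 0 \<omega>))) - 2 * expectation (\<lambda>\<omega>. ln (vol \<theta> (lag X 0 \<omega>))))"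
    unfolding h_def using Q_eq(1)[OF \<theta>] integrable_ln_vol[OF \<theta>] integrable_ln_vol[OF \<theta>0]
    by (simp add: r_def prob_space)
  also have "\<dots> = Q \<theta> - Q \<theta>0"
    using Q_eq(2)[OF \<theta>] Q_eq(2)[OF \<theta>0] one by (simp add: r_def)
  finally have "expectation h \<le> 0" using not by simp
  moreover have "expectation h \<ge> 0" using h0 by (rule integral_nonneg_AE)
  ultimately have "expectation h = 0" by simp
  then have "AE \<omega> in M. h \<omega> = 0" using integral_nonneg_eq_0_iff_AE[OF ih h0] by simp
  then have "AE \<omega> in M. H_proc b0 bp bm X 0 \<omega> \<theta> = H_proc b0 bp bm X 0 \<omega> \<theta>0"
    using good
  proof eventually_elim
    case (elim \<omega>)
    note lr = ln_r[OF elim(2)]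
    have "ln (r \<omega>) = r \<omega> - 1" using lr elim(1) by simp
    then have "r \<omega> = 1" using ln_eq_minus_one lr(2) by blast
    then show ?case using elim(2) by (simp add: H_proc_eq_vol r_def divide_eq_eq split: if_splits)
  qed
  then show False using identifiable[OF \<theta>] ne by blast
qed

section \<open>Separation from the true parameter\<close>

definition qmod :: "real ^ 'd \<Rightarrow> nat \<Rightarrow> real \<times> (nat \<Rightarrow> real) \<Rightarrow> real" where
  "qmod \<theta>1 k z = (2 / b ^ 3 + 1 / b\<^sup>2) * ((fst z)\<^sup>2 * min 1 (mod_vol \<theta>1 k (snd z))) + 2 / b * mod_vol \<theta>1 k (snd z)"

lemma qmod_measurable [measurable]: "qmod \<theta>1 k \<in> borel_measurable (borel \<Otimes>\<^sub>M lag_space)"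
  unfolding qmod_def[abs_def] by measurable

lemma qmod_bound:
  assumes "\<theta>1 \<in> \<Theta>" "\<theta> \<in> \<Theta>" "dist \<theta>1 \<theta> \<le> inverse (real (Suc k))" "summable (\<lambda>j. \<beta> j * \<bar>y j\<bar>)"
  shows "\<bar>qf x (vol \<theta> y) - qf x (vol \<theta>1 y)\<bar> \<le> qmod \<theta>1 k (x, y)"
  unfolding qmod_def fst_conv snd_conv
  by (rule qf_diff(2)[OF b_pos vol_bounds(1) vol_bounds(1) vol_modulus]) (use assms in auto)

text \<open>Because of the cap at 1, \<open>X^2\<close> and the weighted past enter the majorant
  \<open>W\<close> as a sum and never as a product, so second moments suffice for dominated
  convergence.\<close>

lemma qmod_expectation:
  assumes \<theta>1: "\<theta>1 \<in> \<Theta>"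
  shows "integrable M (\<lambda>\<omega>. qmod \<theta>1 k (X 0 \<omega>, lag X 0 \<omega>))"
    and "(\<lambda>k. expectation (\<lambda>\<omega>. qmod \<theta>1 k (X 0 \<omega>, lag X 0 \<omega>))) \<longlonglongrightarrow> 0"
proof -
  obtain B where B: "\<And>k. mod_b0 \<theta>1 k \<le> B" using mod_b0_props(4)[OF \<theta>1] by blast
  define K where "K = 2 / b ^ 3 + 1 / b\<^sup>2"
  have K: "K \<ge> 0" "2 / b \<ge> 0" using b_pos by (auto simp: K_def)
  define W where "W = (\<lambda>\<omega>. K * (X 0 \<omega>)\<^sup>2 + 2 / b * (B + wsum \<beta> (lag X 0 \<omega>)))"
  have iW: "integrable M W"
    unfolding W_def using int_X2 wsum_lag_props(2)[OF \<beta>_nonneg \<beta>_summable] by simp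
  have dom: "AE \<omega> in M. norm (qmod \<theta>1 k (X 0 \<omega>, lag X 0 \<omega>)) \<le> W \<omega>" for k
    using AE_good
  proof eventually_elim
    case (elim \<omega>)
    then have s: "summable (\<lambda>j. \<beta> j * \<bar>lag X 0 \<omega> j\<bar>)" by blast
    define e where "e = mod_vol \<theta>1 k (lag X 0 \<omega>)"
    have e: "e \<ge> 0" "e \<le> B + wsum \<beta> (lag X 0 \<omega>)"
      using mod_vol_props(1,3)[OF \<theta>1 s, of k] B[of k] by (auto simp: e_def)
    have "0 \<le> K * ((X 0 \<omega>)\<^sup>2 * min 1 e) + 2 / b * e" using K e by (intro add_nonneg_nonneg mult_nonneg_nonneg) auto
    moreover have "K * ((X 0 \<omega>)\<^sup>2 * min 1 e) + 2 / b * e \<le> K * ((X 0 \<omega>)\<^sup>2 * 1) + 2 / b * (B + wsum \<beta> (lag X 0 \<omega>))"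
      using K e by (intro add_mono mult_left_mono) auto
    ultimately show ?case by (simp add: qmod_def W_def K_def e_def)
  qed
  have m: "(\<lambda>\<omega>. qmod \<theta>1 k (X 0 \<omega>, lag X 0 \<omega>)) \<in> borel_measurable M" for k
    unfolding qmod_def fst_conv snd_conv by measurable
  show "integrable M (\<lambda>\<omega>. qmod \<theta>1 k (X 0 \<omega>, lag X 0 \<omega>))"
  proof (rule Bochner_Integration.integrable_bound[OF iW m])
    show "AE \<omega> in M. norm (qmod \<theta>1 k (X 0 \<omega>, lag X 0 \<omega>)) \<le> norm (W \<omega>)"
      using dom[of k] by eventually_elim auto
  qed
  have "(\<lambda>k. expectation (\<lambda>\<omega>. qmod \<theta>1 k (X 0 \<omega>, lag X 0 \<omega>))) \<longlonglongrightarrow> expectation (\<lambda>\<omega>. 0)"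
  proof (rule integral_dominated_convergence[OF _ m iW _ dom])
    show "AE \<omega> in M. (\<lambda>k. qmod \<theta>1 k (X 0 \<omega>, lag X 0 \<omega>)) \<longlonglongrightarrow> 0"
      using AE_good
    proof eventually_elim
      case (elim \<omega>)
      then have s: "summable (\<lambda>j. \<beta> j * \<bar>lag X 0 \<omega> j\<bar>)" by blast
      note l = mod_vol_props(2)[OF \<theta>1 s]
      have "(\<lambda>k. qmod \<theta>1 k (X 0 \<omega>, lag X 0 \<omega>)) \<longlonglongrightarrow> K * ((X 0 \<omega>)\<^sup>2 * min 1 0) + 2 / b * 0"
        unfolding qmod_def fst_conv snd_conv K_def by (intro tendsto_intros l)
      then show ?case by simp
    qed
  qed simp
  then show "(\<lambda>k. expectation (\<lambda>\<omega>. qmod \<theta>1 k (X 0 \<omega>, lag X 0 \<omega>))) \<longlonglongrightarrow> 0" by simp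
qed

text \<open>The radius is chosen so that the expected modulus stays below the gap
  \<open>Q \<theta>1 - Q \<theta>0\<close>. The function \<open>g\<close>, a lower envelope of the
  contrast differences over the whole ball, then has positive mean \<open>c\<close>, and one
  application of the ergodic theorem covers all \<theta> in the ball.\<close>

lemma local_separation:
  assumes \<theta>1: "\<theta>1 \<in> \<Theta>" and ne: "\<theta>1 \<noteq> \<theta>0"
  shows "\<exists>\<delta>>0. AE \<omega> in M. \<forall>\<^sub>F n in sequentially. \<forall>\<theta>\<in>\<Theta>. dist \<theta>1 \<theta> < \<delta> \<longrightarrow> Qhat n \<omega> \<theta>0 < Qhat n \<omega> \<theta>"
proof -
  define gap where "gap = Q \<theta>1 - Q \<theta>0"
  have gap: "gap > 0" using Q_minimum[OF \<theta>1 ne] by (simp add: gap_def)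
  have "\<forall>\<^sub>F k in sequentially. expectation (\<lambda>\<omega>. qmod \<theta>1 k (X 0 \<omega>, lag X 0 \<omega>)) < gap"
    using order_tendstoD(2)[OF qmod_expectation(2)[OF \<theta>1] gap] .
  then obtain k where k: "expectation (\<lambda>\<omega>. qmod \<theta>1 k (X 0 \<omega>, lag X 0 \<omega>)) < gap"
    unfolding eventually_sequentially by blast
  define g where "g = (\<lambda>z. qf (fst z) (vol \<theta>1 (snd z)) - qf (fst z) (vol \<theta>0 (snd z)) - qmod \<theta>1 k z)"
  have gm: "g \<in> borel_measurable (borel \<Otimes>\<^sub>M lag_space)" unfolding g_def by measurable
  have gi: "integrable M (\<lambda>\<omega>. g (X 0 \<omega>, lag X 0 \<omega>))"
    unfolding g_def using integrable_qf(2)[OF \<theta>1] integrable_qf(2)[OF \<theta>0] qmod_expectation(1)[OF \<theta>1] by simp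
  define c where "c = expectation (\<lambda>\<omega>. g (X 0 \<omega>, lag X 0 \<omega>))"
  have c: "c > 0"
    unfolding c_def g_def using k integrable_qf(2)[OF \<theta>1] integrable_qf(2)[OF \<theta>0] qmod_expectation(1)[OF \<theta>1]
    by (simp add: gap_def Q_def)
  have "AE \<omega> in M. \<forall>\<^sub>F n in sequentially. \<forall>\<theta>\<in>\<Theta>. dist \<theta>1 \<theta> < inverse (real (Suc k)) \<longrightarrow> Qhat n \<omega> \<theta>0 < Qhat n \<omega> \<theta>"
    using ergodic_lag[OF gm gi, folded c_def] Qhat_uniform AE_good
  proof eventually_elim
    case (elim \<omega>)
    obtain e :: "nat \<Rightarrow> real" where e: "e \<longlonglongrightarrow> 0" "\<And>n \<theta>. \<theta> \<in> \<Theta> \<Longrightarrow> \<bar>Qhat n \<omega> \<theta> - Qn n \<omega> \<theta>\<bar> \<le> real n * e n"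
      using elim(2) by blast
    have ev1: "\<forall>\<^sub>F n in sequentially. (\<Sum>t=1..n. g (X (int t) \<omega>, lag X (int t) \<omega>)) / n > c / 2"
      by (rule order_tendstoD(1)[OF elim(1)]) (use c in simp)
    \<comment> \<open>The truncation error is paid twice, at \<theta> and at \<theta>0; two quarters
      of \<open>c\<close> are compensated by the average exceeding \<open>c / 2\<close>.\<close>
    have ev2: "\<forall>\<^sub>F n in sequentially. e n < c / 4"
      by (rule order_tendstoD(2)[OF e(1)]) (use c in simp)
    show ?case using ev1 ev2 eventually_gt_at_top[of 0]
    proof eventually_elim
      case (elim n)
      show ?case
      proof (intro ballI impI)
        fix \<theta> assume \<theta>: "\<theta> \<in> \<Theta>" and d: "dist \<theta>1 \<theta> < inverse (real (Suc k))"
        have "(\<Sum>t=1..n. g (X (int t) \<omega>, lag X (int t) \<omega>)) \<le> Qn n \<omega> \<theta> - Qn n \<omega> \<theta>0"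
          unfolding Qn_def sum_subtractf[symmetric]
        proof (rule sum_mono)
          fix t
          have "\<bar>qf (X (int t) \<omega>) (vol \<theta> (lag X (int t) \<omega>)) - qf (X (int t) \<omega>) (vol \<theta>1 (lag X (int t) \<omega>))\<bar> \<le> qmod \<theta>1 k (X (int t) \<omega>, lag X (int t) \<omega>)"
            by (rule qmod_bound[OF \<theta>1 \<theta>]) (use d \<open>\<forall>t. summable (\<lambda>j. \<beta> j * \<bar>lag X t \<omega> j\<bar>)\<close> in auto)
          then show "g (X (int t) \<omega>, lag X (int t) \<omega>) \<le> qf (X (int t) \<omega>) (vol \<theta> (lag X (int t) \<omega>)) - qf (X (int t) \<omega>) (vol \<theta>0 (lag X (int t) \<omega>))"
            unfolding g_def by simp
        qed
        moreover have "(\<Sum>t=1..n. g (X (int t) \<omega>, lag X (int t) \<omega>)) > n * (c / 2)"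
          using elim(1,3) by (simp add: field_simps)
        moreover have "real n * e n < n * (c / 4)" using elim(2,3) by simp
        ultimately show "Qhat n \<omega> \<theta>0 < Qhat n \<omega> \<theta>"
          using e(2)[OF \<theta>, of n] e(2)[OF \<theta>0, of n] by (simp add: abs_le_iff)
      qed
    qed
  qed
  then show ?thesis by (intro exI[of _ "inverse (real (Suc k))"]) simp
qed

text \<open>The parameters at distance at least \<open>1 / (k + 1)\<close> from \<theta>0 form a
  compact set, covered by finitely many balls of local separation; finitely many null sets for each
  \<open>k\<close> and countably many \<open>k\<close> leave one null set.\<close>

lemma separation:
  "AE \<omega> in M. \<forall>k::nat. \<forall>\<^sub>F n in sequentially. \<forall>\<theta>\<in>\<Theta>. dist \<theta>0 \<theta> \<ge> inverse (real (Suc k)) \<longrightarrow> Qhat n \<omega> \<theta>0 < Qhat n \<omega> \<theta>"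
  unfolding AE_all_countable
proof
  fix k :: nat
  define r where "r = inverse (real (Suc k))"
  have r: "r > 0" by (simp add: r_def)
  define K where "K = \<Theta> - ball \<theta>0 r"
  have K: "compact K" unfolding K_def using compact_\<Theta> by (rule compact_diff) simp
  have "\<forall>\<theta>1\<in>K. \<exists>\<delta>>0. AE \<omega> in M. \<forall>\<^sub>F n in sequentially. \<forall>\<theta>\<in>\<Theta>. dist \<theta>1 \<theta> < \<delta> \<longrightarrow> Qhat n \<omega> \<theta>0 < Qhat n \<omega> \<theta>"
  proof
    fix \<theta>1 assume "\<theta>1 \<in> K"
    then have "\<theta>1 \<in> \<Theta>" "\<theta>1 \<noteq> \<theta>0" using r by (auto simp: K_def)
    then show "\<exists>\<delta>>0. AE \<omega> in M. \<forall>\<^sub>F n in sequentially. \<forall>\<theta>\<in>\<Theta>. dist \<theta>1 \<theta> < \<delta> \<longrightarrow> Qhat n \<omega> \<theta>0 < Qhat n \<omega> \<theta>"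
      by (rule local_separation)
  qed
  from bchoice[OF this] obtain \<delta> where "\<forall>\<theta>1\<in>K. \<delta> \<theta>1 > 0 \<and> (AE \<omega> in M. \<forall>\<^sub>F n in sequentially. \<forall>\<theta>\<in>\<Theta>. dist \<theta>1 \<theta> < \<delta> \<theta>1 \<longrightarrow> Qhat n \<omega> \<theta>0 < Qhat n \<omega> \<theta>)" ..
  then have \<delta>: "\<And>\<theta>1. \<theta>1 \<in> K \<Longrightarrow> \<delta> \<theta>1 > 0"
    "\<And>\<theta>1. \<theta>1 \<in> K \<Longrightarrow> AE \<omega> in M. \<forall>\<^sub>F n in sequentially. \<forall>\<theta>\<in>\<Theta>. dist \<theta>1 \<theta> < \<delta> \<theta>1 \<longrightarrow> Qhat n \<omega> \<theta>0 < Qhat n \<omega> \<theta>"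
    by auto
  obtain C where C: "C \<subseteq> K" "finite C" "K \<subseteq> (\<Union>c\<in>C. ball c (\<delta> c))"
    by (rule compactE_image[OF K, of K "\<lambda>c. ball c (\<delta> c)"]) (use \<delta>(1) in auto)
  have "AE \<omega> in M. \<forall>c\<in>C. \<forall>\<^sub>F n in sequentially. \<forall>\<theta>\<in>\<Theta>. dist c \<theta> < \<delta> c \<longrightarrow> Qhat n \<omega> \<theta>0 < Qhat n \<omega> \<theta>"
    by (rule AE_finite_allI[OF C(2)]) (use C \<delta>(2) in blast)
  then show "AE \<omega> in M. \<forall>\<^sub>F n in sequentially. \<forall>\<theta>\<in>\<Theta>. dist \<theta>0 \<theta> \<ge> inverse (real (Suc k)) \<longrightarrow> Qhat n \<omega> \<theta>0 < Qhat n \<omega> \<theta>"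
  proof eventually_elim
    case (elim \<omega>)
    then have "\<forall>\<^sub>F n in sequentially. \<forall>c\<in>C. \<forall>\<theta>\<in>\<Theta>. dist c \<theta> < \<delta> c \<longrightarrow> Qhat n \<omega> \<theta>0 < Qhat n \<omega> \<theta>"
      by (rule eventually_ball_finite[OF C(2)])
    then show ?case
    proof eventually_elim
      case (elim n)
      show ?case
      proof (intro ballI impI)
        fix \<theta> assume \<theta>: "\<theta> \<in> \<Theta>" "inverse (real (Suc k)) \<le> dist \<theta>0 \<theta>"
        then have "\<theta> \<in> K" by (simp add: K_def r_def)
        then show "Qhat n \<omega> \<theta>0 < Qhat n \<omega> \<theta>" using C(3) elim \<theta>(1) by (auto simp: subset_eq)
      qed
    qed
  qed
qed

lemma QMLE_minimises_Qhat:
  assumes "is_QMLE M b0 bp bm u X \<Theta> \<theta>hat" "\<omega> \<in> space M" "n \<ge> 1"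
  shows "\<theta>hat n \<omega> \<in> \<Theta>" "\<theta> \<in> \<Theta> \<Longrightarrow> Qhat n \<omega> (\<theta>hat n \<omega>) \<le> Qhat n \<omega> \<theta>"
proof -
  have *: "is_arg_max (L_hat b0 bp bm u X n \<omega>) (\<lambda>\<theta>. \<theta> \<in> \<Theta>) (\<theta>hat n \<omega>)"
    using assms by (simp add: is_QMLE_def)
  then show 1: "\<theta>hat n \<omega> \<in> \<Theta>" by (simp add: is_arg_max_def)
  assume \<theta>: "\<theta> \<in> \<Theta>"
  then have "\<not> L_hat b0 bp bm u X n \<omega> (\<theta>hat n \<omega>) < L_hat b0 bp bm u X n \<omega> \<theta>"
    using * by (auto simp: is_arg_max_def)
  then show "Qhat n \<omega> (\<theta>hat n \<omega>) \<le> Qhat n \<omega> \<theta>" by (simp add: L_hat_eq[OF \<theta>] L_hat_eq[OF 1])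
qed

theorem strong_consistency:
  assumes "is_QMLE M b0 bp bm u X \<Theta> \<theta>hat"
  shows "AE \<omega> in M. (\<lambda>n. \<theta>hat n \<omega>) \<longlonglongrightarrow> \<theta>0"
  using separation AE_space
proof eventually_elim
  case (elim \<omega>)
  show ?case
  proof (rule tendstoI)
    fix e :: real assume "e > 0"
    then obtain k where k: "inverse (real (Suc k)) < e" using reals_Archimedean by blast
    show "\<forall>\<^sub>F n in sequentially. dist (\<theta>hat n \<omega>) \<theta>0 < e"
      using elim(1)[rule_format, of k] eventually_ge_at_top[of 1]
    proof eventually_elim
      case (elim n)
      note q = QMLE_minimises_Qhat[OF assms \<open>\<omega> \<in> space M\<close> elim(2)]
      have "\<not> inverse (real (Suc k)) \<le> dist \<theta>0 (\<theta>hat n \<omega>)"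
        using elim(1) q(1) q(2)[OF \<theta>0] by force
      then show ?case using k by (simp add: dist_commute)
    qed
  qed
qed

end

section \<open>Second order expansions\<close>

lemma norm_matrix_vector_le:
  fixes A :: "real ^ 'd::finite ^ 'd"
  assumes "\<And>k k'. \<bar>A $ k $ k'\<bar> \<le> c k k'"
  shows "norm (A *v v) \<le> (\<Sum>k\<in>UNIV. \<Sum>k'\<in>UNIV. c k k') * norm v"
proof -
  have "norm (A *v v) \<le> (\<Sum>k\<in>UNIV. \<bar>(A *v v) $ k\<bar>)" by (rule norm_le_l1_cart)
  also have "\<dots> \<le> (\<Sum>k\<in>UNIV. \<Sum>k'\<in>UNIV. c k k' * norm v)"
  proof (rule sum_mono)
    fix k
    have "\<bar>(A *v v) $ k\<bar> \<le> (\<Sum>k'\<in>UNIV. \<bar>A $ k $ k' * v $ k'\<bar>)"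
      by (simp add: matrix_vector_mult_def sum_abs)
    also have "\<dots> \<le> (\<Sum>k'\<in>UNIV. c k k' * norm v)"
      unfolding abs_mult using assms component_le_norm_cart
      by (intro sum_mono mult_mono) (auto intro: order_trans[OF abs_ge_zero])
    finally show "\<bar>(A *v v) $ k\<bar> \<le> (\<Sum>k'\<in>UNIV. c k k' * norm v)" .
  qed
  finally show ?thesis by (simp add: sum_distrib_right)
qed

text \<open>The remainder quotient of differentiability. At \<open>y = x\<close> it is 0 by the
  convention for division by 0, as \<open>lsup_props\<close> demands of its function at the
  centre.\<close>

definition rem_ratio :: "('b::real_normed_vector \<Rightarrow> 'c::real_normed_vector) \<Rightarrow> ('b \<Rightarrow> 'c) \<Rightarrow> 'b \<Rightarrow> 'b \<Rightarrow> real" where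
  "rem_ratio f f' x y = norm (f y - f x - f' (y - x)) / norm (y - x)"

lemma rem_ratio_tendsto:
  assumes "(f has_derivative f') (at x within S)"
  shows "(rem_ratio f f' x \<longlongrightarrow> 0) (at x within S)"
proof -
  have "((\<lambda>y. (1 / norm (y - x)) *\<^sub>R (f y - (f x + f' (y - x)))) \<longlongrightarrow> 0) (at x within S)"
    using assms by (simp add: has_derivative_within)
  moreover have "norm ((1 / norm (y - x)) *\<^sub>R (f y - (f x + f' (y - x)))) = rem_ratio f f' x y" for y
    by (simp add: rem_ratio_def diff_diff_eq)
  ultimately show ?thesis using tendsto_norm_zero by fastforce
qed

lemma norm_le_rem_ratio: "norm (f y - f x - f' (y - x)) \<le> rem_ratio f f' x y * norm (y - x)"
  if "f' 0 = 0"
  using that by (cases "y = x") (auto simp: rem_ratio_def)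

text \<open>Estimates for one scalar coefficient with explicit constants. In the applications to
  \<open>bp (Suc j)\<close> and \<open>bm (Suc j)\<close> the constants \<open>G\<close> and
  \<open>K\<close> become summable sequences in \<open>j\<close>, so the estimates can be added up
  over all lags.\<close>

locale C2_ball =
  fixes U :: "(real ^ 'd::finite) set" and f g h and G K :: real
  assumes convex_U: "convex U" and open_U: "open U"
    and df: "\<And>x. x \<in> U \<Longrightarrow> (f has_derivative (\<lambda>v. g x \<bullet> v)) (at x)"
    and dg: "\<And>x. x \<in> U \<Longrightarrow> (g has_derivative (\<lambda>v. (h x :: real ^ 'd ^ 'd) *v v)) (at x)"
    and G: "\<And>x. x \<in> U \<Longrightarrow> norm (g x) \<le> G"
    and K: "\<And>x v. x \<in> U \<Longrightarrow> norm (h x *v v) \<le> K * norm v"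
begin

lemma f_lipschitz:
  assumes "x \<in> U" "y \<in> U"
  shows "\<bar>f y - f x\<bar> \<le> G * norm (y - x)"
proof -
  have "norm (f y - f x) \<le> G * norm (y - x)"
  proof (rule differentiable_bound[OF convex_U _ _ assms(2,1)])
    fix z assume z: "z \<in> U"
    show "(f has_derivative (\<lambda>v. g z \<bullet> v)) (at z within U)" using df[OF z] by (rule has_derivative_at_withinI)
    show "onorm (\<lambda>v. g z \<bullet> v) \<le> G"
    proof (rule onorm_bound)
      show "G \<ge> 0" using G[OF z] norm_ge_zero order_trans by blast
      fix v show "norm (g z \<bullet> v) \<le> G * norm v"
        using Cauchy_Schwarz_ineq2[of "g z" v] mult_right_mono[OF G[OF z], of "norm v"] by simp
    qed
  qed
  then show ?thesis by simp
qed

lemma K_nonneg: "x \<in> U \<Longrightarrow> K \<ge> 0"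
proof -
  assume "x \<in> U"
  from K[OF this, of "axis undefined 1"] have "0 \<le> K * norm (axis undefined 1 :: real ^ 'd)"
    using norm_ge_zero order_trans by blast
  then show ?thesis by (simp add: norm_axis_1)
qed

lemma g_lipschitz:
  assumes "x \<in> U" "y \<in> U"
  shows "norm (g y - g x) \<le> K * norm (y - x)"
proof (rule differentiable_bound[OF convex_U _ _ assms(2,1)])
  fix z assume z: "z \<in> U"
  show "(g has_derivative (\<lambda>v. h z *v v)) (at z within U)" using dg[OF z] by (rule has_derivative_at_withinI)
  show "onorm (\<lambda>v. h z *v v) \<le> K" by (rule onorm_bound[OF K_nonneg[OF z] K[OF z]])
qed

text \<open>The mean value inequality is applied to \<open>f\<close> minus its linear part at
  \<open>x\<close> on the segment, where the gradient differs from \<open>g x\<close> by at most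
  \<open>K * norm (y - x)\<close>; hence the constant \<open>K\<close> and not
  \<open>K / 2\<close>.\<close>

lemma f_taylor:
  assumes x: "x \<in> U" and y: "y \<in> U"
  shows "\<bar>f y - f x - g x \<bullet> (y - x)\<bar> \<le> K * norm (y - x) * norm (y - x)"
proof -
  let ?S = "closed_segment x y"
  have S: "?S \<subseteq> U" using closed_segment_subset[OF x y convex_U] .
  have "norm ((f y - g x \<bullet> y) - (f x - g x \<bullet> x)) \<le> (K * norm (y - x)) * norm (y - x)"
  proof (rule differentiable_bound[of ?S "\<lambda>z. f z - g x \<bullet> z" "\<lambda>z v. g z \<bullet> v - g x \<bullet> v"])
    fix z assume z: "z \<in> ?S"
    then have zU: "z \<in> U" using S by blast
    show "((\<lambda>z. f z - g x \<bullet> z) has_derivative (\<lambda>v. g z \<bullet> v - g x \<bullet> v)) (at z within ?S)"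
      by (intro has_derivative_diff has_derivative_at_withinI[OF df[OF zU]] has_derivative_inner_right has_derivative_ident)
    show "onorm (\<lambda>v. g z \<bullet> v - g x \<bullet> v) \<le> K * norm (y - x)"
    proof (rule onorm_bound)
      show "0 \<le> K * norm (y - x)" using K_nonneg[OF x] by simp
      fix v
      have "norm (g z \<bullet> v - g x \<bullet> v) \<le> norm (g z - g x) * norm v"
        unfolding inner_diff_left[symmetric] by (simp add: Cauchy_Schwarz_ineq2)
      also have "\<dots> \<le> (K * norm (z - x)) * norm v"
        by (intro mult_right_mono g_lipschitz x zU) simp
      also have "\<dots> \<le> (K * norm (y - x)) * norm v"
      proof (intro mult_right_mono mult_left_mono)
        have "z - x \<in> closed_segment 0 (y - x)"
          using z closed_segment_translation_eq[of "-x" z x y] by (simp add: algebra_simps)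
        then show "norm (z - x) \<le> norm (y - x)" using segment_bound(1)[of z x y] z by (simp add: norm_minus_commute)
      qed (use K_nonneg[OF x] in auto)
      finally show "norm (g z \<bullet> v - g x \<bullet> v) \<le> K * norm (y - x) * norm v" .
    qed
  qed auto
  then show ?thesis by (simp add: inner_diff_right algebra_simps)
qed

text \<open>One \<open>K\<close> bounds the increment of \<open>g\<close>, the other its
  linearisation. This is the majorant when remainders are summed over lags.\<close>

lemma g_rem_ratio_le:
  assumes x: "x \<in> U" and y: "y \<in> U"
  shows "rem_ratio g (\<lambda>v. h x *v v) x y \<le> 2 * K"
proof (cases "y = x")
  case False
  have "norm (g y - g x - h x *v (y - x)) \<le> norm (g y - g x) + norm (h x *v (y - x))"
    by (rule norm_triangle_ineq4)
  also have "\<dots> \<le> K * norm (y - x) + K * norm (y - x)" by (intro add_mono g_lipschitz K x y)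
  finally show ?thesis using False by (simp add: rem_ratio_def field_simps)
qed (use K_nonneg[OF x] in \<open>simp add: rem_ratio_def\<close>)

lemma lsup_g_props:
  assumes x: "x \<in> U"
  shows "\<And>y k. y \<in> U \<Longrightarrow> dist x y \<le> inverse (real (Suc k)) \<Longrightarrow>
      norm (g y - g x - h x *v (y - x)) \<le> lsup (rem_ratio g (\<lambda>v. h x *v v) x) U x k * norm (y - x)"
    and "\<And>k. lsup (rem_ratio g (\<lambda>v. h x *v v) x) U x k \<ge> 0"
    and "\<And>k. lsup (rem_ratio g (\<lambda>v. h x *v v) x) U x k \<le> 2 * K"
    and "lsup (rem_ratio g (\<lambda>v. h x *v v) x) U x \<longlonglongrightarrow> 0"
proof -
  note l = lsup_props[of x U "rem_ratio g (\<lambda>v. h x *v v) x" "2 * K", OF x _ g_rem_ratio_le[OF x]]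
  show "\<And>k. lsup (rem_ratio g (\<lambda>v. h x *v v) x) U x k \<ge> 0" by (rule l(2)) (auto simp: rem_ratio_def)
  show "\<And>k. lsup (rem_ratio g (\<lambda>v. h x *v v) x) U x k \<le> 2 * K" by (rule l(3)) (auto simp: rem_ratio_def)
  show "lsup (rem_ratio g (\<lambda>v. h x *v v) x) U x \<longlonglongrightarrow> 0"
    by (rule l(4)) (auto simp: rem_ratio_def[of _ _ x x] intro!: rem_ratio_tendsto has_derivative_at_withinI dg x, auto simp: rem_ratio_def)
  fix y k assume y: "y \<in> U" "dist x y \<le> inverse (real (Suc k))"
  have "norm (g y - g x - h x *v (y - x)) \<le> rem_ratio g (\<lambda>v. h x *v v) x y * norm (y - x)"
    by (rule norm_le_rem_ratio) simp
  also have "\<dots> \<le> lsup (rem_ratio g (\<lambda>v. h x *v v) x) U x k * norm (y - x)"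
    by (intro mult_right_mono l(1) y) (auto simp: rem_ratio_def)
  finally show "norm (g y - g x - h x *v (y - x)) \<le> lsup (rem_ratio g (\<lambda>v. h x *v v) x) U x k * norm (y - x)" .
qed

end

section \<open>Derivatives of the contrast with respect to the volatility\<close>

definition qf1 :: "real \<Rightarrow> real \<Rightarrow> real" where "qf1 x m = 2 / m - 2 * x\<^sup>2 / m ^ 3"
definition qf2 :: "real \<Rightarrow> real \<Rightarrow> real" where "qf2 x m = 6 * x\<^sup>2 / m ^ 4 - 2 / m ^ 2"

lemma qf_has_derivative: "m > 0 \<Longrightarrow> (qf x has_real_derivative qf1 x m) (at m)"
  unfolding qf_def[abs_def] qf1_def
  by (auto intro!: derivative_eq_intros simp: field_simps power2_eq_square power3_eq_cube)

lemma qf1_has_derivative: "m > 0 \<Longrightarrow> (qf1 x has_real_derivative qf2 x m) (at m)"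
  unfolding qf1_def[abs_def] qf2_def
  by (auto intro!: derivative_eq_intros simp: field_simps power2_eq_square power3_eq_cube power4_eq_xxxx)

lemma qf2_has_derivative: "m > 0 \<Longrightarrow> (qf2 x has_real_derivative (4 / m ^ 3 - 24 * x\<^sup>2 / m ^ 5)) (at m)"
  unfolding qf2_def[abs_def]
  by (auto intro!: derivative_eq_intros simp: field_simps eval_nat_numeral)

lemma power_inverse_bound:
  fixes m b :: real
  assumes "b > 0" "m \<ge> b"
  shows "1 / m ^ n \<le> 1 / b ^ n" "0 \<le> 1 / m ^ n"
  using assms by (auto intro!: frac_le power_mono)

lemma qf12_bounds:
  fixes b m :: real
  assumes b: "b > 0" "m \<ge> b"
  shows "\<bar>qf1 x m\<bar> \<le> (2 / b + 2 / b ^ 3) * (1 + x\<^sup>2)"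
    and "\<bar>qf2 x m\<bar> \<le> (2 / b ^ 2 + 6 / b ^ 4) * (1 + x\<^sup>2)"
    and "\<bar>4 / m ^ 3 - 24 * x\<^sup>2 / m ^ 5\<bar> \<le> (4 / b ^ 3 + 24 / b ^ 5) * (1 + x\<^sup>2)"
proof -
  have gen: "\<bar>p * (1 / m ^ i) - q * x\<^sup>2 * (1 / m ^ j)\<bar> \<le> (p / b ^ i + q / b ^ j) * (1 + x\<^sup>2)"
    if "p \<ge> 0" "q \<ge> 0" for p q i j
  proof -
    have "\<bar>p * (1 / m ^ i) - q * x\<^sup>2 * (1 / m ^ j)\<bar> \<le> p * (1 / m ^ i) + q * x\<^sup>2 * (1 / m ^ j)"
      using that power_inverse_bound(2)[OF b] by (intro abs_leI) (simp_all add: mult_nonneg_nonneg)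
    also have "\<dots> \<le> p * (1 / b ^ i) + q * x\<^sup>2 * (1 / b ^ j)"
      using that by (intro add_mono mult_left_mono power_inverse_bound b) auto
    also have "\<dots> \<le> (p / b ^ i + q / b ^ j) * (1 + x\<^sup>2)"
    proof -
      have "0 \<le> p / b ^ i * x\<^sup>2 + q / b ^ j" using that b by simp
      then show ?thesis by (simp add: algebra_simps)
    qed
    finally show ?thesis .
  qed
  show "\<bar>qf1 x m\<bar> \<le> (2 / b + 2 / b ^ 3) * (1 + x\<^sup>2)" using gen[of 2 2 1 3] by (simp add: qf1_def)
  show "\<bar>qf2 x m\<bar> \<le> (2 / b ^ 2 + 6 / b ^ 4) * (1 + x\<^sup>2)" using gen[of 2 6 2 4] by (simp add: qf2_def abs_minus_commute)
  show "\<bar>4 / m ^ 3 - 24 * x\<^sup>2 / m ^ 5\<bar> \<le> (4 / b ^ 3 + 24 / b ^ 5) * (1 + x\<^sup>2)" using gen[of 4 24 3 5] by simp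
qed

lemma real_mean_value_bound:
  fixes f f' :: "real \<Rightarrow> real"
  assumes "\<And>z. z \<ge> b \<Longrightarrow> (f has_real_derivative f' z) (at z)" "\<And>z. z \<ge> b \<Longrightarrow> \<bar>f' z\<bar> \<le> B" "x \<ge> b" "y \<ge> b"
  shows "\<bar>f x - f y\<bar> \<le> B * \<bar>x - y\<bar>"
proof -
  have "norm (f x - f y) \<le> B * norm (x - y)"
    by (rule field_differentiable_bound[of "{b..}" f f'])
      (use assms in \<open>auto intro: has_field_derivative_at_within\<close>)
  then show ?thesis by simp
qed

text \<open>The bounds of the first three derivatives added into one constant. The second one is
  doubled because, for distant arguments, an increment of \<open>qf1\<close> and its linearisation
  are bounded separately.\<close>

definition Kqf :: "real \<Rightarrow> real" where
  "Kqf b = (2 / b + 2 / b ^ 3) + 2 * (2 / b ^ 2 + 6 / b ^ 4) + (4 / b ^ 3 + 24 / b ^ 5)"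

text \<open>In the last estimate, arguments at distance at most 1 use that \<open>qf2\<close> is
  Lipschitz and give a quadratic error; for distant ones the increment and its linear part are
  bounded separately and linearly. The minimum unites both cases and keeps the growth linear, which
  saves a moment later.\<close>

lemma qf1_estimates:
  fixes b m m0 x :: real
  assumes b: "b > 0" "m \<ge> b" "m0 \<ge> b"
  defines "C \<equiv> Kqf b * (1 + x\<^sup>2)"
  shows "\<bar>qf1 x m\<bar> \<le> C" "\<bar>qf2 x m\<bar> \<le> C" "\<bar>qf1 x m - qf1 x m0\<bar> \<le> C * \<bar>m - m0\<bar>"
    and "\<bar>qf1 x m - qf1 x m0 - qf2 x m0 * (m - m0)\<bar> \<le> C * (min 1 \<bar>m - m0\<bar> * \<bar>m - m0\<bar>)"
proof -
  define A where "A = (2 / b + 2 / b ^ 3) * (1 + x\<^sup>2)"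
  define B where "B = (2 / b ^ 2 + 6 / b ^ 4) * (1 + x\<^sup>2)"
  define D where "D = (4 / b ^ 3 + 24 / b ^ 5) * (1 + x\<^sup>2)"
  have nn: "A \<ge> 0" "B \<ge> 0" "D \<ge> 0" using b by (auto simp: A_def B_def D_def)
  have C: "C = A + 2 * B + D" unfolding C_def Kqf_def A_def B_def D_def by (simp only: distrib_right mult.assoc)
  have q2: "\<bar>qf2 x z\<bar> \<le> B" if "z \<ge> b" for z using qf12_bounds(2)[OF b(1) that, of x] by (simp add: B_def)
  have q1d: "\<bar>qf1 x z - qf1 x m0\<bar> \<le> B * \<bar>z - m0\<bar>" if "z \<ge> b" for z
    by (rule real_mean_value_bound[of b _ "qf2 x"]) (use b q2 that qf1_has_derivative in auto)
  show "\<bar>qf1 x m\<bar> \<le> C" using qf12_bounds(1)[OF b(1,2), of x] nn by (simp add: C A_def[symmetric])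
  show "\<bar>qf2 x m\<bar> \<le> C" using q2[OF b(2)] nn by (simp add: C)
  have "B * \<bar>m - m0\<bar> \<le> C * \<bar>m - m0\<bar>" using nn by (intro mult_right_mono) (auto simp: C)
  then show "\<bar>qf1 x m - qf1 x m0\<bar> \<le> C * \<bar>m - m0\<bar>" using q1d[OF b(2)] by linarith
  show "\<bar>qf1 x m - qf1 x m0 - qf2 x m0 * (m - m0)\<bar> \<le> C * (min 1 \<bar>m - m0\<bar> * \<bar>m - m0\<bar>)"
  proof (cases "\<bar>m - m0\<bar> \<le> 1")
    case False
    have "\<bar>qf1 x m - qf1 x m0 - qf2 x m0 * (m - m0)\<bar> \<le> \<bar>qf1 x m - qf1 x m0\<bar> + \<bar>qf2 x m0\<bar> * \<bar>m - m0\<bar>"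
      unfolding abs_mult[symmetric] by (rule abs_triangle_ineq4)
    also have "\<dots> \<le> B * \<bar>m - m0\<bar> + B * \<bar>m - m0\<bar>" by (intro add_mono mult_right_mono q1d q2 b) auto
    also have "\<dots> = (2 * B) * \<bar>m - m0\<bar>" by simp
    also have "\<dots> \<le> C * \<bar>m - m0\<bar>" using nn by (intro mult_right_mono) (auto simp: C)
    finally show ?thesis using False by simp
  next
    case True
    have q2d: "\<bar>qf2 x z - qf2 x m0\<bar> \<le> D * \<bar>z - m0\<bar>" if "z \<ge> b" for z
      by (rule real_mean_value_bound[of b _ "\<lambda>z. 4 / z ^ 3 - 24 * x\<^sup>2 / z ^ 5"])
        (use b that qf2_has_derivative qf12_bounds(3)[OF b(1)] in \<open>auto simp: D_def\<close>)
    define lo where "lo = min m m0"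
    define hi where "hi = max m m0"
    have "norm ((qf1 x m - qf2 x m0 * m) - (qf1 x m0 - qf2 x m0 * m0)) \<le> (D * \<bar>m - m0\<bar>) * norm (m - m0)"
    proof (rule field_differentiable_bound[of "{lo..hi}" "\<lambda>z. qf1 x z - qf2 x m0 * z" "\<lambda>z. qf2 x z - qf2 x m0"])
      fix z assume z: "z \<in> {lo..hi}"
      then have zb: "z \<ge> b" using b by (auto simp: lo_def)
      have "(qf1 x has_real_derivative qf2 x z) (at z)" using zb b by (intro qf1_has_derivative) auto
      then show "((\<lambda>z. qf1 x z - qf2 x m0 * z) has_real_derivative qf2 x z - qf2 x m0) (at z within {lo..hi})"
        by (rule has_field_derivative_at_within[OF DERIV_diff[OF _ DERIV_cmult_Id]])
      have "norm (qf2 x z - qf2 x m0) \<le> D * \<bar>z - m0\<bar>" using q2d[OF zb] by simp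
      also have "\<dots> \<le> D * \<bar>m - m0\<bar>" using z nn by (intro mult_left_mono) (auto simp: lo_def hi_def)
      finally show "norm (qf2 x z - qf2 x m0) \<le> D * \<bar>m - m0\<bar>" .
    qed (auto simp: lo_def hi_def)
    then have "\<bar>qf1 x m - qf1 x m0 - qf2 x m0 * (m - m0)\<bar> \<le> D * (\<bar>m - m0\<bar> * \<bar>m - m0\<bar>)"
      by (simp add: algebra_simps)
    also have "\<dots> \<le> C * (\<bar>m - m0\<bar> * \<bar>m - m0\<bar>)" using nn by (intro mult_right_mono) (auto simp: C)
    finally show ?thesis using True by simp
  qed
qed

section \<open>Score and information matrix\<close>

text \<open>\<open>solution4\<close> is about the same process \<open>X\<close> as
  \<open>solution\<close> and supplies its fourth moment; gradients and Hessians of the coefficients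
  are explicit parameters.\<close>

locale tarch_normal = tarch_setting M \<xi> X b0 bp bm \<Theta> \<theta>0 u
  for M :: "'a measure" and \<xi> X :: "int \<Rightarrow> 'a \<Rightarrow> real"
    and b0 :: "real ^ 'd::finite \<Rightarrow> real" and bp bm :: "nat \<Rightarrow> real ^ 'd \<Rightarrow> real"
    and \<Theta> :: "(real ^ 'd) set" and \<theta>0 :: "real ^ 'd" and u :: "nat \<Rightarrow> real" +
  fixes g0 :: "real ^ 'd \<Rightarrow> real ^ 'd" and h0 :: "real ^ 'd \<Rightarrow> real ^ 'd ^ 'd"
    and gp gm :: "nat \<Rightarrow> real ^ 'd \<Rightarrow> real ^ 'd" and hp hm :: "nat \<Rightarrow> real ^ 'd \<Rightarrow> real ^ 'd ^ 'd"
  assumes \<theta>0_interior: "\<theta>0 \<in> interior \<Theta>"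
    and int_\<xi>4: "integrable M (\<lambda>\<omega>. \<bar>\<xi> 0 \<omega>\<bar> powr 4)"
    and solution4: "stationary_solution M \<xi> b0 bp bm \<theta>0 4 X"
    and C2_b0: "C2_on \<Theta> b0 g0 h0"
    and C2_bp: "\<And>j. j \<ge> 1 \<Longrightarrow> C2_on \<Theta> (bp j) (gp j) (hp j)"
    and C2_bm: "\<And>j. j \<ge> 1 \<Longrightarrow> C2_on \<Theta> (bm j) (gm j) (hm j)"
    and grad_decay: "\<And>k. \<exists>l'>3/2. (\<lambda>j. SUP \<theta>\<in>\<Theta>. max \<bar>gp j \<theta> $ k\<bar> \<bar>gm j \<theta> $ k\<bar>) \<in> O(\<lambda>j. real j powr (- l'))"
    and hess_summable: "\<And>k k'. summable (\<lambda>j. SUP \<theta>\<in>\<Theta>. max \<bar>hp (Suc j) \<theta> $ k $ k'\<bar> \<bar>hm (Suc j) \<theta> $ k $ k'\<bar>)"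
    and lin_indep: "\<And>t c. (AE \<omega> in M. (\<Sum>i\<in>UNIV. c $ i * partial_deriv i (H_proc b0 bp bm X t \<omega>) \<theta>0) = 0) \<Longrightarrow> c = 0"
begin

section \<open>Bounds on gradients and Hessians of the coefficients\<close>

lemma C2_on_bounded:
  assumes "C2_on \<Theta> f g h"
  shows "bdd_above ((\<lambda>\<theta>. \<bar>g \<theta> $ k\<bar>) ` \<Theta>)" "bdd_above ((\<lambda>\<theta>. \<bar>h \<theta> $ k $ k'\<bar>) ` \<Theta>)"
proof -
  have cg: "continuous_on \<Theta> g"
    unfolding continuous_on_eq_continuous_within using assms by (auto simp: C2_on_def intro: has_derivative_continuous)
  have ch: "continuous_on \<Theta> h" using assms by (simp add: C2_on_def)
  show "bdd_above ((\<lambda>\<theta>. \<bar>g \<theta> $ k\<bar>) ` \<Theta>)"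
    by (rule continuous_on_compact_bdd[OF compact_\<Theta>]) (intro continuous_intros cg)
  show "bdd_above ((\<lambda>\<theta>. \<bar>h \<theta> $ k $ k'\<bar>) ` \<Theta>)"
    by (rule continuous_on_compact_bdd[OF compact_\<Theta>]) (intro continuous_intros ch)
qed

lemma bdd_above_max:
  fixes f g :: "'z \<Rightarrow> real"
  assumes "bdd_above (f ` S)" "bdd_above (g ` S)"
  shows "bdd_above ((\<lambda>x. max (f x) (g x)) ` S)"
proof -
  obtain A B where "\<And>x. x \<in> S \<Longrightarrow> f x \<le> A" "\<And>x. x \<in> S \<Longrightarrow> g x \<le> B"
    using assms unfolding bdd_above_def by auto
  then show ?thesis by (intro bdd_aboveI2[of _ _ "max A B"] max.mono) auto
qed

definition \<gamma> :: "nat \<Rightarrow> real" where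
  "\<gamma> j = (\<Sum>k\<in>UNIV. SUP \<theta>\<in>\<Theta>. max \<bar>gp (Suc j) \<theta> $ k\<bar> \<bar>gm (Suc j) \<theta> $ k\<bar>)"

definition \<kappa> :: "nat \<Rightarrow> real" where
  "\<kappa> j = (\<Sum>k\<in>UNIV. \<Sum>k'\<in>UNIV. SUP \<theta>\<in>\<Theta>. max \<bar>hp (Suc j) \<theta> $ k $ k'\<bar> \<bar>hm (Suc j) \<theta> $ k $ k'\<bar>)"

lemma grad_sup:
  assumes "\<theta> \<in> \<Theta>"
  shows "max \<bar>gp (Suc j) \<theta> $ k\<bar> \<bar>gm (Suc j) \<theta> $ k\<bar> \<le> (SUP \<theta>\<in>\<Theta>. max \<bar>gp (Suc j) \<theta> $ k\<bar> \<bar>gm (Suc j) \<theta> $ k\<bar>)"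
  by (rule cSUP_upper[OF assms], rule bdd_above_max[OF C2_on_bounded(1)[OF C2_bp] C2_on_bounded(1)[OF C2_bm]]) auto

lemma hess_sup:
  assumes "\<theta> \<in> \<Theta>"
  shows "max \<bar>hp (Suc j) \<theta> $ k $ k'\<bar> \<bar>hm (Suc j) \<theta> $ k $ k'\<bar> \<le> (SUP \<theta>\<in>\<Theta>. max \<bar>hp (Suc j) \<theta> $ k $ k'\<bar> \<bar>hm (Suc j) \<theta> $ k $ k'\<bar>)"
  by (rule cSUP_upper[OF assms], rule bdd_above_max[OF C2_on_bounded(2)[OF C2_bp] C2_on_bounded(2)[OF C2_bm]]) auto

lemma norm_grad_le:
  assumes "\<theta> \<in> \<Theta>"
  shows "norm (gp (Suc j) \<theta>) \<le> \<gamma> j" "norm (gm (Suc j) \<theta>) \<le> \<gamma> j"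
  unfolding \<gamma>_def
  by (rule order_trans[OF norm_le_l1_cart], rule sum_mono, use grad_sup[OF assms] in auto)+

lemma norm_hess_le:
  assumes "\<theta> \<in> \<Theta>"
  shows "norm (hp (Suc j) \<theta> *v v) \<le> \<kappa> j * norm v" "norm (hm (Suc j) \<theta> *v v) \<le> \<kappa> j * norm v"
  unfolding \<kappa>_def
  by (rule norm_matrix_vector_le, use hess_sup[OF assms] in auto)+

lemma \<gamma>_nonneg: "\<gamma> j \<ge> 0" using norm_grad_le(1)[OF \<theta>0] norm_ge_zero order_trans by blast

lemma \<kappa>_nonneg: "\<kappa> j \<ge> 0"
  unfolding \<kappa>_def by (intro sum_nonneg) (use hess_sup[OF \<theta>0] in \<open>meson abs_ge_zero max.coboundedI1 order_trans\<close>)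

lemma \<kappa>_summable: "summable \<kappa>"
  unfolding \<kappa>_def[abs_def] by (intro summable_sum hess_summable)

lemma \<gamma>_sqrt_summable: "summable (\<lambda>j. sqrt (real (Suc j)) * \<gamma> j)" and \<gamma>_summable: "summable \<gamma>"
proof -
  let ?s = "\<lambda>k j. SUP \<theta>\<in>\<Theta>. max \<bar>gp (Suc j) \<theta> $ k\<bar> \<bar>gm (Suc j) \<theta> $ k\<bar>"
  have *: "summable (?s k) \<and> summable (\<lambda>j. sqrt (real (Suc j)) * ?s k j)" for k
  proof -
    obtain l where l: "l > 3 / 2" "(\<lambda>j. SUP \<theta>\<in>\<Theta>. max \<bar>gp j \<theta> $ k\<bar> \<bar>gm j \<theta> $ k\<bar>) \<in> O(\<lambda>j. real j powr (- l))"
      using grad_decay by blast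
    from bigo_powr_bound[OF this(2)] obtain C where C:
      "\<And>j. j \<ge> 1 \<Longrightarrow> \<bar>SUP \<theta>\<in>\<Theta>. max \<bar>gp j \<theta> $ k\<bar> \<bar>gm j \<theta> $ k\<bar>\<bar> \<le> C * real j powr (- l)" by blast
    have "?s k j \<le> C * real (Suc j) powr (- l)" for j using C[of "Suc j"] by simp
    moreover have "?s k j \<ge> 0" for j
      using grad_sup[OF \<theta>0, of j k] by (meson abs_ge_zero max.coboundedI1 order_trans)
    ultimately show ?thesis using summable_powr_decay[of "?s k" C l] l by blast
  qed
  show "summable \<gamma>" unfolding \<gamma>_def[abs_def] by (intro summable_sum) (use * in blast)
  show "summable (\<lambda>j. sqrt (real (Suc j)) * \<gamma> j)"
    unfolding \<gamma>_def sum_distrib_left by (intro summable_sum) (use * in blast)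
qed

definition wt :: "nat \<Rightarrow> real" where "wt j = \<beta> j + \<gamma> j + \<kappa> j"

lemma wt_nonneg: "wt j \<ge> 0" using \<beta>_nonneg \<gamma>_nonneg \<kappa>_nonneg by (simp add: wt_def add_nonneg_nonneg)

lemma wt_summable: "summable wt"
  unfolding wt_def[abs_def] by (intro summable_add \<beta>_summable \<gamma>_summable \<kappa>_summable)

lemma wt_ge: "\<beta> j \<le> wt j" "\<gamma> j \<le> wt j" "\<kappa> j \<le> wt j"
  using \<beta>_nonneg[of j] \<gamma>_nonneg[of j] \<kappa>_nonneg[of j] by (auto simp: wt_def)

text \<open>A condition on a single deterministic sequence. On almost every path it holds for the
  lags at all times, and it holds for every \<open>laghat t\<close> with \<open>t \<ge> 1\<close>;
  the calculus below can therefore be deterministic.\<close>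

definition good :: "(nat \<Rightarrow> real) \<Rightarrow> bool" where "good y \<longleftrightarrow> summable (\<lambda>j. wt j * \<bar>y j\<bar>)"

lemma good_summable:
  assumes "good y" "\<And>j. c j \<ge> 0" "\<And>j. c j \<le> K * wt j"
  shows "summable (\<lambda>j. c j * \<bar>y j\<bar>)" "wsum c y \<le> K * wsum wt y"
proof -
  have s: "summable (\<lambda>j. K * (wt j * \<bar>y j\<bar>))" using assms(1) by (intro summable_mult) (simp add: good_def)
  have le: "c j * \<bar>y j\<bar> \<le> K * (wt j * \<bar>y j\<bar>)" for j
    unfolding mult.assoc[symmetric] by (intro mult_right_mono assms) simp
  show s': "summable (\<lambda>j. c j * \<bar>y j\<bar>)"
    by (rule summable_comparison_test'[OF s, of 0]) (use le assms(2) in \<open>auto simp: abs_mult\<close>)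
  show "wsum c y \<le> K * wsum wt y"
    unfolding wsum_def using suminf_le[OF le s' s] assms(1) by (simp add: suminf_mult good_def)
qed

lemma good_\<beta>: "good y \<Longrightarrow> summable (\<lambda>j. \<beta> j * \<bar>y j\<bar>)" "good y \<Longrightarrow> wsum \<beta> y \<le> wsum wt y"
  using good_summable[of y \<beta> 1] \<beta>_nonneg wt_ge by auto
lemma good_\<gamma>: "good y \<Longrightarrow> summable (\<lambda>j. \<gamma> j * \<bar>y j\<bar>)" "good y \<Longrightarrow> wsum \<gamma> y \<le> wsum wt y"
  using good_summable[of y \<gamma> 1] \<gamma>_nonneg wt_ge by auto
lemma good_\<kappa>: "good y \<Longrightarrow> summable (\<lambda>j. \<kappa> j * \<bar>y j\<bar>)" "good y \<Longrightarrow> wsum \<kappa> y \<le> wsum wt y"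
  using good_summable[of y \<kappa> 1] \<kappa>_nonneg wt_ge by auto

lemma wsum_wt_nonneg: "good y \<Longrightarrow> wsum wt y \<ge> 0"
  by (rule wsum_nonneg[OF wt_nonneg]) (simp add: good_def)

text \<open>A ball, hence convex as the mean value inequalities require, and open so that
  derivatives within \<open>\<Theta>\<close> are ordinary derivatives on it.\<close>

definition U :: "(real ^ 'd) set" where
  "U = ball \<theta>0 (SOME r. r > 0 \<and> ball \<theta>0 r \<subseteq> \<Theta>)"

lemma U_props: "open U" "convex U" "\<theta>0 \<in> U" "U \<subseteq> \<Theta>"
proof -
  obtain r where "r > 0 \<and> ball \<theta>0 r \<subseteq> \<Theta>" using \<theta>0_interior by (auto simp: mem_interior)
  then have "(SOME r. r > 0 \<and> ball \<theta>0 r \<subseteq> \<Theta>) > 0 \<and> ball \<theta>0 (SOME r. r > 0 \<and> ball \<theta>0 r \<subseteq> \<Theta>) \<subseteq> \<Theta>"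
    by (rule someI)
  then show "open U" "convex U" "\<theta>0 \<in> U" "U \<subseteq> \<Theta>" by (auto simp: U_def)
qed

definition G0 :: real where "G0 = (\<Sum>k\<in>UNIV. SUP \<theta>\<in>\<Theta>. \<bar>g0 \<theta> $ k\<bar>)"
definition K0 :: real where "K0 = (\<Sum>k\<in>UNIV. \<Sum>k'\<in>UNIV. SUP \<theta>\<in>\<Theta>. \<bar>h0 \<theta> $ k $ k'\<bar>)"

lemma C2_ball_U:
  assumes "C2_on \<Theta> f g h"
    and "\<And>\<theta>. \<theta> \<in> \<Theta> \<Longrightarrow> norm (g \<theta>) \<le> G" "\<And>\<theta> v. \<theta> \<in> \<Theta> \<Longrightarrow> norm (h \<theta> *v v) \<le> K * norm v"
  shows "C2_ball U f g h G K"
proof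
  fix x assume x: "x \<in> U"
  then have "x \<in> interior \<Theta>" using U_props interior_maximal by blast
  then have "at x within \<Theta> = at x" by (rule at_within_interior)
  moreover have "x \<in> \<Theta>" using x U_props by blast
  ultimately show "(f has_derivative (\<lambda>v. g x \<bullet> v)) (at x)" "(g has_derivative (\<lambda>v. h x *v v)) (at x)"
    using assms(1) unfolding C2_on_def by force+
qed (use U_props assms in auto)

lemma norm_g0_h0:
  assumes "\<theta> \<in> \<Theta>"
  shows "norm (g0 \<theta>) \<le> G0" "norm (h0 \<theta> *v v) \<le> K0 * norm v"
  unfolding G0_def K0_def
   apply (rule order_trans[OF norm_le_l1_cart], rule sum_mono, rule cSUP_upper[OF assms], rule C2_on_bounded(1)[OF C2_b0])
  apply (rule norm_matrix_vector_le, rule cSUP_upper[OF assms], rule C2_on_bounded(2)[OF C2_b0])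
  done

sublocale c0: C2_ball U b0 g0 h0 G0 K0
  by (rule C2_ball_U[OF C2_b0 norm_g0_h0])

sublocale cp: C2_ball U "bp (Suc j)" "gp (Suc j)" "hp (Suc j)" "\<gamma> j" "\<kappa> j" for j
  by (rule C2_ball_U[OF C2_bp norm_grad_le(1) norm_hess_le(1)]) auto

sublocale cm: C2_ball U "bm (Suc j)" "gm (Suc j)" "hm (Suc j)" "\<gamma> j" "\<kappa> j" for j
  by (rule C2_ball_U[OF C2_bm norm_grad_le(2) norm_hess_le(2)]) auto

lemma G0_nonneg: "G0 \<ge> 0" using norm_g0_h0(1)[OF \<theta>0] norm_ge_zero order_trans by blast
lemma K0_nonneg: "K0 \<ge> 0" using c0.K_nonneg[OF U_props(3)] .

text \<open>One envelope for the Lipschitz constant of the volatility in \<theta>, its gradient and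
  its Hessian. The summand 1 gives \<open>B y \<le> (B y)^2\<close>, so that all error terms can be
  compared with the square.\<close>

definition B :: "(nat \<Rightarrow> real) \<Rightarrow> real" where "B y = 1 + G0 + K0 + wsum wt y"

lemma B_ge_1: "good y \<Longrightarrow> B y \<ge> 1"
  using wsum_wt_nonneg[of y] G0_nonneg K0_nonneg by (simp add: B_def)

section \<open>Gradient and Hessian of the volatility\<close>

definition grad :: "real ^ 'd \<Rightarrow> (nat \<Rightarrow> real) \<Rightarrow> real ^ 'd" where
  "grad \<theta> y = g0 \<theta> + tser (\<lambda>j. gp (Suc j) \<theta>) (\<lambda>j. gm (Suc j) \<theta>) y"

text \<open>The Hessian at \<theta>0 as a map on directions: for fixed \<open>v\<close> it is again
  a series with vector coefficients, to which the general estimates apply.\<close>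

definition hess :: "(nat \<Rightarrow> real) \<Rightarrow> real ^ 'd \<Rightarrow> real ^ 'd" where
  "hess y v = h0 \<theta>0 *v v + tser (\<lambda>j. hp (Suc j) \<theta>0 *v v) (\<lambda>j. hm (Suc j) \<theta>0 *v v) y"

lemma grad_tser_bound:
  assumes "\<theta> \<in> \<Theta>" "good y"
  shows "summable (\<lambda>j. tterm (gp (Suc j) \<theta>) (gm (Suc j) \<theta>) (y j))"
    "norm (tser (\<lambda>j. gp (Suc j) \<theta>) (\<lambda>j. gm (Suc j) \<theta>) y) \<le> wsum \<gamma> y"
  unfolding wsum_def by (rule tser_bound[OF norm_grad_le[OF assms(1)] good_\<gamma>(1)[OF assms(2)]])+

lemma norm_grad: "\<theta> \<in> \<Theta> \<Longrightarrow> good y \<Longrightarrow> norm (grad \<theta> y) \<le> B y"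
  unfolding grad_def B_def
  using norm_triangle_ineq[of "g0 \<theta>"] norm_g0_h0(1)[of \<theta>] grad_tser_bound(2)[of \<theta> y] good_\<gamma>(2)[of y] K0_nonneg
  by (smt (verit))

lemma grad_diff_seq:
  assumes "\<theta> \<in> \<Theta>" "summable (\<lambda>j. \<gamma> j * \<bar>y j\<bar>)" "summable (\<lambda>j. \<gamma> j * \<bar>y' j\<bar>)"
  shows "norm (grad \<theta> y - grad \<theta> y') \<le> wsum \<gamma> (\<lambda>j. y j - y' j)"
  using tser_diff_seq[OF norm_grad_le[OF assms(1)] assms(2,3)] by (simp add: grad_def wsum_def)

lemma hess_tser_bound:
  assumes "good y"
  shows "summable (\<lambda>j. tterm (hp (Suc j) \<theta>0 *v v) (hm (Suc j) \<theta>0 *v v) (y j))"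
    "norm (tser (\<lambda>j. hp (Suc j) \<theta>0 *v v) (\<lambda>j. hm (Suc j) \<theta>0 *v v) y) \<le> wsum \<kappa> y * norm v"
proof -
  have s: "summable (\<lambda>j. \<kappa> j * norm v * \<bar>y j\<bar>)"
    using summable_mult[OF good_\<kappa>(1)[OF assms], of "norm v"] by (simp add: mult_ac)
  note t = tser_bound[of "\<lambda>j. hp (Suc j) \<theta>0 *v v" "\<lambda>j. \<kappa> j * norm v" "\<lambda>j. hm (Suc j) \<theta>0 *v v" y, OF norm_hess_le[OF \<theta>0] s]
  show "summable (\<lambda>j. tterm (hp (Suc j) \<theta>0 *v v) (hm (Suc j) \<theta>0 *v v) (y j))" by (rule t(1))
  have "(\<Sum>j. \<kappa> j * norm v * \<bar>y j\<bar>) = wsum \<kappa> y * norm v"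
    using suminf_mult2[OF good_\<kappa>(1)[OF assms], of "norm v"] by (simp add: wsum_def mult_ac)
  then show "norm (tser (\<lambda>j. hp (Suc j) \<theta>0 *v v) (\<lambda>j. hm (Suc j) \<theta>0 *v v) y) \<le> wsum \<kappa> y * norm v"
    using t(2) by simp
qed

lemma norm_hess: "good y \<Longrightarrow> norm (hess y v) \<le> B y * norm v"
proof -
  assume g: "good y"
  have "norm (hess y v) \<le> norm (h0 \<theta>0 *v v) + norm (tser (\<lambda>j. hp (Suc j) \<theta>0 *v v) (\<lambda>j. hm (Suc j) \<theta>0 *v v) y)"
    unfolding hess_def by (rule norm_triangle_ineq)
  also have "\<dots> \<le> K0 * norm v + wsum \<kappa> y * norm v"
    by (intro add_mono norm_g0_h0 \<theta>0 hess_tser_bound g)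
  also have "\<dots> = (K0 + wsum \<kappa> y) * norm v" by (simp add: algebra_simps)
  also have "\<dots> \<le> B y * norm v"
    using good_\<kappa>(2)[OF g] G0_nonneg by (intro mult_right_mono) (auto simp: B_def)
  finally show ?thesis .
qed

lemma vol_tser_summable:
  assumes "\<theta> \<in> \<Theta>" "good y"
  shows "summable (\<lambda>j. tterm (bp (Suc j) \<theta>) (bm (Suc j) \<theta>) (y j))"
  by (rule tser_bound(1)[OF b_le_\<beta>[OF assms(1)] good_\<beta>(1)[OF assms(2)]])

lemma vol_lipschitz:
  assumes "\<theta> \<in> U" "\<theta>' \<in> U" "good y"
  shows "\<bar>vol \<theta>' y - vol \<theta> y\<bar> \<le> B y * norm (\<theta>' - \<theta>)"
proof -
  have \<Theta>: "\<theta> \<in> \<Theta>" "\<theta>' \<in> \<Theta>" using assms U_props by auto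
  have s: "summable (\<lambda>j. \<gamma> j * norm (\<theta>' - \<theta>) * \<bar>y j\<bar>)"
    using summable_mult[OF good_\<gamma>(1)[OF assms(3)], of "norm (\<theta>' - \<theta>)"] by (simp add: mult_ac)
  have "vol \<theta>' y - vol \<theta> y = (b0 \<theta>' - b0 \<theta>) + tser (\<lambda>j. bp (Suc j) \<theta>' - bp (Suc j) \<theta>) (\<lambda>j. bm (Suc j) \<theta>' - bm (Suc j) \<theta>) y"
    unfolding vol_def by (simp flip: tser_diff_coeff[OF vol_tser_summable[OF \<Theta>(2) assms(3)] vol_tser_summable[OF \<Theta>(1) assms(3)]])
  then have "\<bar>vol \<theta>' y - vol \<theta> y\<bar> \<le> \<bar>b0 \<theta>' - b0 \<theta>\<bar> + norm (tser (\<lambda>j. bp (Suc j) \<theta>' - bp (Suc j) \<theta>) (\<lambda>j. bm (Suc j) \<theta>' - bm (Suc j) \<theta>) y)"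
    by simp
  also have "\<dots> \<le> G0 * norm (\<theta>' - \<theta>) + (\<Sum>j. \<gamma> j * norm (\<theta>' - \<theta>) * \<bar>y j\<bar>)"
    by (intro add_mono c0.f_lipschitz assms tser_bound(2)[OF _ _ s])
      (use cp.f_lipschitz[OF assms(1,2)] cm.f_lipschitz[OF assms(1,2)] in auto)
  also have "(\<Sum>j. \<gamma> j * norm (\<theta>' - \<theta>) * \<bar>y j\<bar>) = wsum \<gamma> y * norm (\<theta>' - \<theta>)"
    using suminf_mult2[OF good_\<gamma>(1)[OF assms(3)], of "norm (\<theta>' - \<theta>)"] by (simp add: wsum_def mult_ac)
  also have "G0 * norm (\<theta>' - \<theta>) + \<dots> = (G0 + wsum \<gamma> y) * norm (\<theta>' - \<theta>)" by (simp add: algebra_simps)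
  also have "\<dots> \<le> B y * norm (\<theta>' - \<theta>)"
    using good_\<gamma>(2)[OF assms(3)] K0_nonneg by (intro mult_right_mono) (auto simp: B_def)
  finally show ?thesis .
qed

lemma tterm_inner: "tterm p m x \<bullet> v = tterm (p \<bullet> v) (m \<bullet> v) x"
  by (simp add: tterm_def inner_diff_left)

lemma grad_inner:
  assumes "\<theta> \<in> \<Theta>" "good y"
  shows "grad \<theta> y \<bullet> v = g0 \<theta> \<bullet> v + tser (\<lambda>j. gp (Suc j) \<theta> \<bullet> v) (\<lambda>j. gm (Suc j) \<theta> \<bullet> v) y"
    and "summable (\<lambda>j. tterm (gp (Suc j) \<theta> \<bullet> v) (gm (Suc j) \<theta> \<bullet> v) (y j))"
  unfolding grad_def tser_def inner_add_left tterm_inner[symmetric]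
  using bounded_linear.suminf[OF bounded_linear_inner_left grad_tser_bound(1)[OF assms]]
    bounded_linear.summable[OF bounded_linear_inner_left grad_tser_bound(1)[OF assms]] by auto

text \<open>The Taylor bounds of the individual coefficients are summed over the lags, with
  \<open>\<kappa> j\<close> as weights.\<close>

lemma vol_taylor:
  assumes "\<theta> \<in> U" "\<theta>' \<in> U" "good y"
  shows "\<bar>vol \<theta>' y - vol \<theta> y - grad \<theta> y \<bullet> (\<theta>' - \<theta>)\<bar> \<le> B y * (norm (\<theta>' - \<theta>) * norm (\<theta>' - \<theta>))"
proof -
  have \<Theta>: "\<theta> \<in> \<Theta>" "\<theta>' \<in> \<Theta>" using assms U_props by auto
  let ?n = "norm (\<theta>' - \<theta>)" and ?v = "\<theta>' - \<theta>"
  have s: "summable (\<lambda>j. \<kappa> j * ?n * ?n * \<bar>y j\<bar>)"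
    using summable_mult[OF good_\<kappa>(1)[OF assms(3)], of "?n * ?n"] by (simp add: mult_ac)
  note sv = vol_tser_summable[OF \<Theta>(2) assms(3)] vol_tser_summable[OF \<Theta>(1) assms(3)]
  note sd = summable_diff[OF sv, folded tterm_diff]
  have "vol \<theta>' y - vol \<theta> y - grad \<theta> y \<bullet> ?v = (b0 \<theta>' - b0 \<theta> - g0 \<theta> \<bullet> ?v)
    + tser (\<lambda>j. bp (Suc j) \<theta>' - bp (Suc j) \<theta> - gp (Suc j) \<theta> \<bullet> ?v) (\<lambda>j. bm (Suc j) \<theta>' - bm (Suc j) \<theta> - gm (Suc j) \<theta> \<bullet> ?v) y"
    unfolding vol_def grad_inner(1)[OF \<Theta>(1) assms(3)] tser_diff_coeff[OF sd grad_inner(2)[OF \<Theta>(1) assms(3)], symmetric]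
      tser_diff_coeff[OF sv, symmetric] by simp
  then have "\<bar>vol \<theta>' y - vol \<theta> y - grad \<theta> y \<bullet> ?v\<bar> \<le> \<bar>b0 \<theta>' - b0 \<theta> - g0 \<theta> \<bullet> ?v\<bar>
    + norm (tser (\<lambda>j. bp (Suc j) \<theta>' - bp (Suc j) \<theta> - gp (Suc j) \<theta> \<bullet> ?v) (\<lambda>j. bm (Suc j) \<theta>' - bm (Suc j) \<theta> - gm (Suc j) \<theta> \<bullet> ?v) y)"
    by simp
  also have "\<dots> \<le> K0 * ?n * ?n + (\<Sum>j. \<kappa> j * ?n * ?n * \<bar>y j\<bar>)"
    by (intro add_mono c0.f_taylor assms tser_bound(2)[OF _ _ s])
      (use cp.f_taylor[OF assms(1,2)] cm.f_taylor[OF assms(1,2)] in auto)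
  also have "(\<Sum>j. \<kappa> j * ?n * ?n * \<bar>y j\<bar>) = wsum \<kappa> y * (?n * ?n)"
    using suminf_mult2[OF good_\<kappa>(1)[OF assms(3)], of "?n * ?n"] by (simp add: wsum_def mult_ac)
  also have "K0 * ?n * ?n + \<dots> = (K0 + wsum \<kappa> y) * (?n * ?n)" by (simp add: algebra_simps)
  also have "\<dots> \<le> B y * (?n * ?n)"
    using good_\<kappa>(2)[OF assms(3)] G0_nonneg by (intro mult_right_mono) (auto simp: B_def)
  finally show ?thesis .
qed

definition rem0 :: "nat \<Rightarrow> real" where "rem0 = lsup (rem_ratio g0 (\<lambda>v. h0 \<theta>0 *v v) \<theta>0) U \<theta>0"

definition remj :: "nat \<Rightarrow> nat \<Rightarrow> real" where
  "remj j k = lsup (rem_ratio (gp (Suc j)) (\<lambda>v. hp (Suc j) \<theta>0 *v v) \<theta>0) U \<theta>0 k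
    + lsup (rem_ratio (gm (Suc j)) (\<lambda>v. hm (Suc j) \<theta>0 *v v) \<theta>0) U \<theta>0 k"

lemma remj_props: "remj j k \<ge> 0" "remj j k \<le> 4 * \<kappa> j" "remj j \<longlonglongrightarrow> 0" "rem0 k \<ge> 0" "rem0 k \<le> 2 * K0" "rem0 \<longlonglongrightarrow> 0"
proof -
  note p = cp.lsup_g_props[where j=j, OF U_props(3)] and m = cm.lsup_g_props[where j=j, OF U_props(3)]
  show "remj j k \<ge> 0" "remj j k \<le> 4 * \<kappa> j" using p(2,3)[of k] m(2,3)[of k] by (auto simp: remj_def)
  show "remj j \<longlonglongrightarrow> 0" unfolding remj_def[abs_def] using tendsto_add[OF p(4) m(4)] by simp
  show "rem0 k \<ge> 0" "rem0 k \<le> 2 * K0" "rem0 \<longlonglongrightarrow> 0"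
    unfolding rem0_def using c0.lsup_g_props[OF U_props(3)] by auto
qed

definition rem :: "nat \<Rightarrow> (nat \<Rightarrow> real) \<Rightarrow> real" where "rem k y = rem0 k + wsum (\<lambda>j. remj j k) y"

lemma remj_summable: "good y \<Longrightarrow> summable (\<lambda>j. remj j k * \<bar>y j\<bar>)" "good y \<Longrightarrow> wsum (\<lambda>j. remj j k) y \<le> 4 * wsum wt y"
proof -
  have "remj j k \<le> 4 * wt j" for j using remj_props(2)[of j k] wt_ge(3)[of j] by linarith
  then show "good y \<Longrightarrow> summable (\<lambda>j. remj j k * \<bar>y j\<bar>)" "good y \<Longrightarrow> wsum (\<lambda>j. remj j k) y \<le> 4 * wsum wt y"
    using good_summable[of y "\<lambda>j. remj j k" 4] remj_props(1) by auto
qed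

lemma rem_props:
  assumes "good y"
  shows "rem k y \<ge> 0" "rem k y \<le> 4 * B y" "(\<lambda>k. rem k y) \<longlonglongrightarrow> 0"
proof -
  show "rem k y \<ge> 0" unfolding rem_def
    using remj_props wsum_nonneg[OF remj_props(1) remj_summable(1)[OF assms]] by (simp add: add_nonneg_nonneg)
  have "r + w \<le> 4 * (1 + G + K + s)" if "r \<le> 2 * K" "w \<le> 4 * s" "0 \<le> K" "0 \<le> G" for r w K G s :: real
    using that by simp
  then show "rem k y \<le> 4 * B y" unfolding rem_def B_def
    using remj_props(5)[of k] remj_summable(2)[OF assms, of k] K0_nonneg G0_nonneg by blast
  have "(\<lambda>k. wsum (\<lambda>j. remj j k) y) \<longlonglongrightarrow> 0"
    unfolding wsum_def
  proof (rule tannery_null)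
    show "summable (\<lambda>j. 4 * (\<kappa> j * \<bar>y j\<bar>))" using good_\<kappa>(1)[OF assms] by (rule summable_mult)
    fix j k
    have "remj j k * \<bar>y j\<bar> \<le> (4 * \<kappa> j) * \<bar>y j\<bar>" by (intro mult_right_mono remj_props) simp
    then show "\<bar>remj j k * \<bar>y j\<bar>\<bar> \<le> 4 * (\<kappa> j * \<bar>y j\<bar>)" using remj_props(1)[of j k] by (simp add: abs_mult)
    show "(\<lambda>k. remj j k * \<bar>y j\<bar>) \<longlonglongrightarrow> 0" by (intro tendsto_mult_left_zero remj_props)
  qed
  then show "(\<lambda>k. rem k y) \<longlonglongrightarrow> 0" unfolding rem_def using remj_props(6) by (intro tendsto_add_zero)
qed

text \<open>Continuity of the second derivatives gives no rate, so the remainder is measured by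
  moduli at \<theta>0. Each tends to 0 with \<open>k\<close> and is at most a multiple of
  \<open>\<kappa> j\<close>, so their weighted sum \<open>rem k y\<close> tends to 0 as
  well.\<close>

lemma grad_expansion:
  assumes \<theta>: "\<theta> \<in> U" "dist \<theta>0 \<theta> \<le> inverse (real (Suc k))" and y: "good y"
  shows "norm (grad \<theta> y - grad \<theta>0 y - hess y (\<theta> - \<theta>0)) \<le> rem k y * norm (\<theta> - \<theta>0)"
proof -
  have \<Theta>: "\<theta> \<in> \<Theta>" "\<theta>0 \<in> \<Theta>" using \<theta> U_props by auto
  let ?v = "\<theta> - \<theta>0"
  let ?D = "\<lambda>g h. g \<theta> - g \<theta>0 - h \<theta>0 *v ?v"
  note sg = grad_tser_bound(1)[OF \<Theta>(1) y] grad_tser_bound(1)[OF \<Theta>(2) y]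
  note sd = summable_diff[OF sg, folded tterm_diff]
  have s: "summable (\<lambda>j. remj j k * norm ?v * \<bar>y j\<bar>)"
    using summable_mult[OF remj_summable(1)[OF y, of k], of "norm ?v"] by (simp add: mult_ac)
  have "grad \<theta> y - grad \<theta>0 y - hess y ?v = ?D g0 h0 + tser (\<lambda>j. ?D (gp (Suc j)) (hp (Suc j))) (\<lambda>j. ?D (gm (Suc j)) (hm (Suc j))) y"
    unfolding grad_def hess_def tser_diff_coeff[OF sd hess_tser_bound(1)[OF y], symmetric] tser_diff_coeff[OF sg, symmetric]
    by simp
  then have "norm (grad \<theta> y - grad \<theta>0 y - hess y ?v) \<le> norm (?D g0 h0) + norm (tser (\<lambda>j. ?D (gp (Suc j)) (hp (Suc j))) (\<lambda>j. ?D (gm (Suc j)) (hm (Suc j))) y)"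
    by (simp only:) (rule norm_triangle_ineq)
  also have "\<dots> \<le> rem0 k * norm ?v + (\<Sum>j. remj j k * norm ?v * \<bar>y j\<bar>)"
  proof (intro add_mono tser_bound(2)[OF _ _ s])
    show "norm (?D g0 h0) \<le> rem0 k * norm ?v" unfolding rem0_def by (rule c0.lsup_g_props(1)[OF U_props(3) \<theta>])
    fix j
    have "norm (?D (gp (Suc j)) (hp (Suc j))) \<le> lsup (rem_ratio (gp (Suc j)) (\<lambda>v. hp (Suc j) \<theta>0 *v v) \<theta>0) U \<theta>0 k * norm ?v"
      by (rule cp.lsup_g_props(1)[OF U_props(3) \<theta>])
    also have "\<dots> \<le> remj j k * norm ?v"
      unfolding remj_def using cm.lsup_g_props(2)[where j=j and k=k, OF U_props(3)] by (intro mult_right_mono) auto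
    finally show "norm (?D (gp (Suc j)) (hp (Suc j))) \<le> remj j k * norm ?v" .
    have "norm (?D (gm (Suc j)) (hm (Suc j))) \<le> lsup (rem_ratio (gm (Suc j)) (\<lambda>v. hm (Suc j) \<theta>0 *v v) \<theta>0) U \<theta>0 k * norm ?v"
      by (rule cm.lsup_g_props(1)[OF U_props(3) \<theta>])
    also have "\<dots> \<le> remj j k * norm ?v"
      unfolding remj_def using cp.lsup_g_props(2)[where j=j and k=k, OF U_props(3)] by (intro mult_right_mono) auto
    finally show "norm (?D (gm (Suc j)) (hm (Suc j))) \<le> remj j k * norm ?v" .
  qed
  also have "(\<Sum>j. remj j k * norm ?v * \<bar>y j\<bar>) = wsum (\<lambda>j. remj j k) y * norm ?v"
    using suminf_mult2[OF remj_summable(1)[OF y, of k], of "norm ?v"] by (simp add: wsum_def mult_ac)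
  finally show ?thesis by (simp add: rem_def algebra_simps)
qed

section \<open>The score, its Jacobian at the true parameter and the remainder\<close>

definition score :: "real \<Rightarrow> real ^ 'd \<Rightarrow> (nat \<Rightarrow> real) \<Rightarrow> real ^ 'd" where
  "score x \<theta> y = qf1 x (vol \<theta> y) *\<^sub>R grad \<theta> y"

definition jac :: "real \<Rightarrow> (nat \<Rightarrow> real) \<Rightarrow> real ^ 'd \<Rightarrow> real ^ 'd" where
  "jac x y v = qf1 x (vol \<theta>0 y) *\<^sub>R hess y v + (qf2 x (vol \<theta>0 y) * (grad \<theta>0 y \<bullet> v)) *\<^sub>R grad \<theta>0 y"

text \<open>Bounds the score remainder per unit of \<open>norm (\<theta> - \<theta>0)\<close> inside
  the ball of radius \<open>1 / (k + 1)\<close>. Every summand is at most a multiple of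
  \<open>(1 + x^2) * (B y)^2\<close>; without the minimum a third power of \<open>B\<close> would
  appear and fourth moments would not suffice.\<close>

definition smod :: "nat \<Rightarrow> real \<times> (nat \<Rightarrow> real) \<Rightarrow> real" where
  "smod k z = Kqf b * (1 + (fst z)\<^sup>2) * (rem k (snd z) + 2 * (inverse (real (Suc k)) * (B (snd z))\<^sup>2)
     + (B (snd z))\<^sup>2 * min 1 (inverse (real (Suc k)) * B (snd z)))"

lemma Kqf_nonneg: "Kqf b \<ge> 0" using b_pos by (simp add: Kqf_def)

lemma vol_ge: "\<theta> \<in> \<Theta> \<Longrightarrow> good y \<Longrightarrow> vol \<theta> y \<ge> b"
  by (rule vol_bounds(1)[OF _ good_\<beta>(1)])

lemma vol_has_derivative:
  assumes \<theta>: "\<theta> \<in> U" and y: "good y"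
  shows "((\<lambda>\<theta>. vol \<theta> y) has_derivative (\<lambda>v. grad \<theta> y \<bullet> v)) (at \<theta>)"
  unfolding has_derivative_within
proof
  show "bounded_linear (\<lambda>v. grad \<theta> y \<bullet> v)" by (rule bounded_linear_inner_right)
  show "((\<lambda>\<theta>'. (1 / norm (\<theta>' - \<theta>)) *\<^sub>R (vol \<theta>' y - (vol \<theta> y + grad \<theta> y \<bullet> (\<theta>' - \<theta>)))) \<longlongrightarrow> 0) (at \<theta>)"
  proof (rule Lim_null_comparison)
    show "((\<lambda>\<theta>'. B y * norm (\<theta>' - \<theta>)) \<longlongrightarrow> 0) (at \<theta>)"
      by (intro tendsto_mult_right_zero tendsto_norm_zero LIM_zero tendsto_ident_at)
    have "eventually (\<lambda>\<theta>'. \<theta>' \<in> U) (at \<theta>)" using U_props(1) \<theta> by (rule eventually_at_in_open')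
    then show "eventually (\<lambda>\<theta>'. norm ((1 / norm (\<theta>' - \<theta>)) *\<^sub>R (vol \<theta>' y - (vol \<theta> y + grad \<theta> y \<bullet> (\<theta>' - \<theta>)))) \<le> B y * norm (\<theta>' - \<theta>)) (at \<theta>)"
    proof eventually_elim
      case (elim \<theta>')
      show ?case
      proof (cases "\<theta>' = \<theta>")
        case False
        have "\<bar>vol \<theta>' y - (vol \<theta> y + grad \<theta> y \<bullet> (\<theta>' - \<theta>))\<bar> \<le> B y * (norm (\<theta>' - \<theta>) * norm (\<theta>' - \<theta>))"
          using vol_taylor[OF \<theta> elim y] by (simp add: diff_diff_eq)
        then show ?thesis using False by (simp add: divide_le_eq mult.assoc)
      qed simp
    qed
  qed
qed

lemma qf_vol_has_derivative:
  assumes \<theta>: "\<theta> \<in> U" and y: "good y"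
  shows "((\<lambda>\<theta>. qf x (vol \<theta> y)) has_derivative (\<lambda>v. score x \<theta> y \<bullet> v)) (at \<theta>)"
proof -
  have "vol \<theta> y > 0" using vol_ge[of \<theta> y] \<theta> y U_props b_pos by (auto intro: less_le_trans)
  from qf_has_derivative[OF this, of x]
  have "(qf x has_derivative (\<lambda>z. z * qf1 x (vol \<theta> y))) (at (vol \<theta> y))"
    by (simp add: has_field_derivative_def mult_commute_abs)
  from has_derivative_compose[OF vol_has_derivative[OF assms] this] show ?thesis
    by (simp add: score_def mult.commute)
qed

text \<open>Both factors of the score move with the past: the gradient by the discrepancy weighted
  with \<open>\<gamma>\<close>, \<open>qf1\<close> through the volatility by the one weighted with
  \<open>\<beta>\<close>.\<close>

lemma score_diff_seq:
  assumes \<theta>: "\<theta> \<in> \<Theta>" and y: "good y" "good y'"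
  shows "norm (score x \<theta> y' - score x \<theta> y) \<le> Kqf b * (1 + x\<^sup>2) * (wsum \<gamma> (\<lambda>j. y j - y' j) + wsum \<beta> (\<lambda>j. y j - y' j) * B y)"
proof -
  define m where "m = vol \<theta> y" define m' where "m' = vol \<theta> y'"
  have m: "m \<ge> b" "m' \<ge> b" using vol_ge[OF \<theta>] y by (auto simp: m_def m'_def)
  let ?C = "Kqf b * (1 + x\<^sup>2)"
  have C: "?C \<ge> 0" using Kqf_nonneg by simp
  have "score x \<theta> y' - score x \<theta> y = qf1 x m' *\<^sub>R (grad \<theta> y' - grad \<theta> y) + (qf1 x m' - qf1 x m) *\<^sub>R grad \<theta> y"
    by (simp add: score_def m_def m'_def algebra_simps)
  then have "norm (score x \<theta> y' - score x \<theta> y) \<le> \<bar>qf1 x m'\<bar> * norm (grad \<theta> y' - grad \<theta> y) + \<bar>qf1 x m' - qf1 x m\<bar> * norm (grad \<theta> y)"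
    using norm_triangle_ineq[of "qf1 x m' *\<^sub>R (grad \<theta> y' - grad \<theta> y)" "(qf1 x m' - qf1 x m) *\<^sub>R grad \<theta> y"] by simp
  also have "\<dots> \<le> ?C * wsum \<gamma> (\<lambda>j. y j - y' j) + (?C * wsum \<beta> (\<lambda>j. y j - y' j)) * B y"
  proof (intro add_mono mult_mono)
    show "\<bar>qf1 x m'\<bar> \<le> ?C" by (rule qf1_estimates(1)[OF b_pos m(2) m(2)])
    show "norm (grad \<theta> y' - grad \<theta> y) \<le> wsum \<gamma> (\<lambda>j. y j - y' j)"
      using grad_diff_seq[OF \<theta> good_\<gamma>(1)[OF y(1)] good_\<gamma>(1)[OF y(2)]] by (simp add: norm_minus_commute)
    have "\<bar>qf1 x m' - qf1 x m\<bar> \<le> ?C * \<bar>m' - m\<bar>" by (rule qf1_estimates(3)[OF b_pos m(2,1)])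
    also have "\<dots> \<le> ?C * wsum \<beta> (\<lambda>j. y j - y' j)"
      using vol_diff_seq[OF \<theta> good_\<beta>(1)[OF y(1)] good_\<beta>(1)[OF y(2)]] C
      by (intro mult_left_mono) (auto simp: m_def m'_def abs_minus_commute)
    finally show "\<bar>qf1 x m' - qf1 x m\<bar> \<le> ?C * wsum \<beta> (\<lambda>j. y j - y' j)" .
    show "norm (grad \<theta> y) \<le> B y" by (rule norm_grad[OF \<theta> y(1)])
    have "wsum \<beta> (\<lambda>j. y j - y' j) \<ge> 0"
      using vol_diff_seq[OF \<theta> good_\<beta>(1)[OF y(1)] good_\<beta>(1)[OF y(2)]] by linarith
    then show "0 \<le> ?C * wsum \<beta> (\<lambda>j. y j - y' j)" using C by simp
  qed (use C in auto)
  also have "\<dots> = ?C * (wsum \<gamma> (\<lambda>j. y j - y' j) + wsum \<beta> (\<lambda>j. y j - y' j) * B y)" by (simp add: distrib_left mult.assoc)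
  finally show ?thesis .
qed

lemma score_expansion:
  assumes \<theta>: "\<theta> \<in> U" "dist \<theta>0 \<theta> \<le> inverse (real (Suc k))" and y: "good y"
  shows "norm (score x \<theta> y - score x \<theta>0 y - jac x y (\<theta> - \<theta>0)) \<le> norm (\<theta> - \<theta>0) * smod k (x, y)"
proof -
  define v where "v = \<theta> - \<theta>0"
  define m where "m = vol \<theta> y" define m0 where "m0 = vol \<theta>0 y"
  define \<epsilon> where "\<epsilon> = inverse (real (Suc k))"
  have \<Theta>: "\<theta> \<in> \<Theta>" "\<theta>0 \<in> \<Theta>" using \<theta> U_props by auto
  have m: "m \<ge> b" "m0 \<ge> b" using vol_ge \<Theta> y by (auto simp: m_def m0_def)
  define C where "C = Kqf b * (1 + x\<^sup>2)"
  have C: "C \<ge> 0" using Kqf_nonneg by (simp add: C_def)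
  note q = qf1_estimates[OF b_pos m, of x, folded C_def]
  have B1: "B y \<ge> 1" by (rule B_ge_1[OF y])
  have v\<epsilon>: "norm v \<le> \<epsilon>" using \<theta>(2) by (simp add: v_def \<epsilon>_def dist_norm norm_minus_commute)
  have \<epsilon>0: "\<epsilon> \<ge> 0" by (simp add: \<epsilon>_def)
  have lip: "\<bar>m - m0\<bar> \<le> B y * norm v" unfolding m_def m0_def v_def by (rule vol_lipschitz[OF U_props(3) \<theta>(1) y])
  define R where "R = qf1 x m - qf1 x m0 - qf2 x m0 * (grad \<theta>0 y \<bullet> v)"
  \<comment> \<open>The product of \<open>qf1\<close> and the gradient is differenced one factor at
    a time; \<open>R\<close> is the error of linearising \<open>qf1\<close> of the volatility in
    \<theta>.\<close>
  have "score x \<theta> y - score x \<theta>0 y - jac x y v =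
      qf1 x m *\<^sub>R (grad \<theta> y - grad \<theta>0 y - hess y v) + (qf1 x m - qf1 x m0) *\<^sub>R hess y v + R *\<^sub>R grad \<theta>0 y"
    by (simp add: score_def jac_def R_def m_def m0_def algebra_simps)
  then have "norm (score x \<theta> y - score x \<theta>0 y - jac x y v) \<le>
     \<bar>qf1 x m\<bar> * norm (grad \<theta> y - grad \<theta>0 y - hess y v) + \<bar>qf1 x m - qf1 x m0\<bar> * norm (hess y v) + \<bar>R\<bar> * norm (grad \<theta>0 y)"
    by (simp only:) (intro order_trans[OF norm_triangle_ineq] add_mono order_trans[OF norm_triangle_ineq], auto)
  also have "\<dots> \<le> C * (rem k y * norm v) + (C * (B y * norm v)) * (B y * \<epsilon>)
      + (C * (min 1 (\<epsilon> * B y) * (B y * norm v)) + C * (B y * (\<epsilon> * norm v))) * B y"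
  proof (intro add_mono mult_mono)
    show "norm (grad \<theta> y - grad \<theta>0 y - hess y v) \<le> rem k y * norm v"
      unfolding v_def by (rule grad_expansion[OF \<theta> y])
    have "\<bar>qf1 x m - qf1 x m0\<bar> \<le> C * \<bar>m - m0\<bar>" by (rule q(3))
    also have "\<dots> \<le> C * (B y * norm v)" by (intro mult_left_mono lip C)
    finally show "\<bar>qf1 x m - qf1 x m0\<bar> \<le> C * (B y * norm v)" .
    show "norm (hess y v) \<le> B y * \<epsilon>"
      using norm_hess[OF y, of v] mult_left_mono[OF v\<epsilon>, of "B y"] B1 by linarith
    \<comment> \<open>\<open>R\<close> separates into the curvature of \<open>qf1\<close> in the
      volatility and the curvature of the volatility in \<theta>.\<close>
    have "R = (qf1 x m - qf1 x m0 - qf2 x m0 * (m - m0)) + qf2 x m0 * (m - m0 - grad \<theta>0 y \<bullet> v)"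
      by (simp add: R_def algebra_simps)
    then have "\<bar>R\<bar> \<le> \<bar>qf1 x m - qf1 x m0 - qf2 x m0 * (m - m0)\<bar> + \<bar>qf2 x m0\<bar> * \<bar>m - m0 - grad \<theta>0 y \<bullet> v\<bar>"
      by (simp only: abs_mult[symmetric] abs_triangle_ineq)
    also have "\<dots> \<le> C * (min 1 (\<epsilon> * B y) * (B y * norm v)) + C * (B y * (\<epsilon> * norm v))"
    proof (intro add_mono)
      have "B y * norm v \<le> \<epsilon> * B y" using mult_left_mono[OF v\<epsilon>, of "B y"] B1 by (simp add: mult.commute)
      then have "\<bar>m - m0\<bar> \<le> \<epsilon> * B y" using lip by linarith
      then have "min 1 \<bar>m - m0\<bar> * \<bar>m - m0\<bar> \<le> min 1 (\<epsilon> * B y) * (B y * norm v)"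
        using lip by (intro mult_mono) auto
      from mult_left_mono[OF this C] q(4)
      show "\<bar>qf1 x m - qf1 x m0 - qf2 x m0 * (m - m0)\<bar> \<le> C * (min 1 (\<epsilon> * B y) * (B y * norm v))" by linarith
      have "\<bar>m - m0 - grad \<theta>0 y \<bullet> v\<bar> \<le> B y * (norm v * norm v)"
        unfolding m_def m0_def v_def by (rule vol_taylor[OF U_props(3) \<theta>(1) y])
      also have "\<dots> \<le> B y * (\<epsilon> * norm v)" using B1 v\<epsilon> by (intro mult_left_mono mult_right_mono) auto
      finally show "\<bar>qf2 x m0\<bar> * \<bar>m - m0 - grad \<theta>0 y \<bullet> v\<bar> \<le> C * (B y * (\<epsilon> * norm v))"
        using qf1_estimates(2)[OF b_pos m(2) m(2), of x, folded C_def] C by (intro mult_mono) auto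
    qed
    finally show "\<bar>R\<bar> \<le> C * (min 1 (\<epsilon> * B y) * (B y * norm v)) + C * (B y * (\<epsilon> * norm v))" .
    show "norm (grad \<theta>0 y) \<le> B y" by (rule norm_grad[OF \<Theta>(2) y])
  qed (use q(1) C B1 \<epsilon>0 in \<open>auto intro!: add_nonneg_nonneg mult_nonneg_nonneg\<close>)
  also have "\<dots> = norm v * smod k (x, y)"
    unfolding smod_def fst_conv snd_conv C_def[symmetric] \<epsilon>_def[symmetric]
    by (simp add: power2_eq_square algebra_simps)
  finally show ?thesis unfolding v_def .
qed

end

text \<open>A function that equals a measurable one almost everywhere is measurable for the
  completion. This evaluates the entries of \<open>F\<close> and \<open>G\<close> although the
  formal derivatives are uncontrolled on a null set.\<close>

lemma integral_completion_cong_AE: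
  fixes f g :: "'a \<Rightarrow> real"
  assumes g[measurable]: "g \<in> borel_measurable M" and ae: "AE x in M. f x = g x"
  shows "(\<integral>x. f x \<partial>completion M) = (\<integral>x. g x \<partial>M)"
proof -
  have gc: "g \<in> borel_measurable (completion M)" by (rule measurable_completion[OF g])
  have aec: "AE x in completion M. f x = g x" using ae by (rule AE_completion)
  have fc: "f \<in> borel_measurable (completion M)"
  proof (rule measurableI)
    fix A :: "real set" assume A: "A \<in> sets borel"
    show "f -` A \<inter> space (completion M) \<in> sets (completion M)"
    proof (rule completion.in_sets_AE)
      show "AE x in completion M. (x \<in> g -` A \<inter> space (completion M)) = (x \<in> f -` A \<inter> space (completion M))"
        using aec by eventually_elim auto
      show "g -` A \<inter> space (completion M) \<in> sets (completion M)" using gc A by (rule measurable_sets)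
    qed auto
  qed auto
  have "(\<integral>x. f x \<partial>completion M) = (\<integral>x. g x \<partial>completion M)" by (rule integral_cong_AE[OF fc gc aec])
  also have "\<dots> = (\<integral>x. g x \<partial>M)" by (rule integral_completion[OF g])
  finally show ?thesis .
qed

lemma partial_deriv_eq:
  assumes "(f has_derivative f') (at \<theta>)"
  shows "partial_deriv j f \<theta> = f' (axis j 1)"
proof -
  have 1: "((\<lambda>s. \<theta> + s *\<^sub>R axis j 1) has_derivative (\<lambda>s. s *\<^sub>R axis j 1)) (at 0)"
    by (auto intro!: derivative_eq_intros)
  have "(f has_derivative f') (at (\<theta> + 0 *\<^sub>R axis j 1))" using assms by simp
  from has_derivative_compose[OF 1 this]
  have "((\<lambda>s. f (\<theta> + s *\<^sub>R axis j 1)) has_derivative (\<lambda>s. f' (s *\<^sub>R axis j 1))) (at 0)" .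
  moreover have "(\<lambda>s. f' (s *\<^sub>R axis j 1)) = (\<lambda>s. f' (axis j 1) * s)"
    using linear_cmul[OF has_derivative_linear[OF assms]] by (simp add: mult.commute)
  ultimately have "((\<lambda>s. f (\<theta> + s *\<^sub>R axis j 1)) has_real_derivative f' (axis j 1)) (at 0)"
    by (simp add: has_field_derivative_def)
  then show ?thesis unfolding partial_deriv_def by (rule DERIV_imp_deriv)
qed

lemma borel_measurable_vec_component [measurable]:
  fixes f :: "'a \<Rightarrow> real ^ 'd::finite"
  assumes "f \<in> borel_measurable N"
  shows "(\<lambda>x. f x $ i) \<in> borel_measurable N"
  using borel_measurable_continuous_on[OF continuous_on_component[of _ "\<lambda>x. x" for i] assms, of i] by (simp add: continuous_on_id)

context tarch_normal
begin

section \<open>Fourth moments and integrable envelopes\<close>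

lemma int_X4: "integrable M (\<lambda>\<omega>. (X t \<omega>) ^ 4)"
proof -
  have "integrable M (\<lambda>\<omega>. (X 0 \<omega>) ^ 4)"
    using solution4 by (simp add: stationary_solution_def powr_numeral cong: integrable_cong)
  then show ?thesis using lag_stationary(1)[of "\<lambda>z. (fst z) ^ 4" t] by simp
qed

lemma int_\<xi>4': "integrable M (\<lambda>\<omega>. (\<xi> 0 \<omega>) ^ 4)"
  using int_\<xi>4 by (simp add: powr_numeral)

lemma AE_good': "AE \<omega> in M. \<forall>t. good (lag X t \<omega>)"
  unfolding good_def by (rule wsum_lag_props(1)[OF wt_nonneg wt_summable])

text \<open>Two applications of Cauchy-Schwarz: the square of the weighted sum is bounded by a
  weighted sum of squares, whose own square is integrable because \<open>X\<close> has a uniform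
  fourth moment.\<close>

lemma wsum_lag_4: "integrable M (\<lambda>\<omega>. (wsum wt (lag X t \<omega>)) ^ 4)"
proof -
  have st: "expectation (\<lambda>\<omega>. (X s \<omega>) ^ 4) \<le> expectation (\<lambda>\<omega>. (X 0 \<omega>) ^ 4)"
    "expectation (\<lambda>\<omega>. (X s \<omega>)\<^sup>2) \<le> expectation (\<lambda>\<omega>. (X 0 \<omega>)\<^sup>2)" for s
    using lag_stationary(2)[of "\<lambda>z. (fst z) ^ 4" s] lag_stationary(2)[of "\<lambda>z. (fst z)\<^sup>2" s] by auto
  have sq: "((X s \<omega>)\<^sup>2)\<^sup>2 = (X s \<omega>) ^ 4" for s \<omega> by (simp flip: power_mult)
  have le: "AE \<omega> in M. (wsum wt (lag X t \<omega>))\<^sup>2 \<le> (\<Sum>j. wt j) * (\<Sum>j. wt j * \<bar>lag X t \<omega> j\<bar>\<^sup>2)"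
    unfolding wsum_def lag_def
    by (rule integrable_weighted_sum_square(1)[where K="expectation (\<lambda>\<omega>. (X 0 \<omega>)\<^sup>2)"])
       (use int_X2 st wt_nonneg wt_summable in auto)
  have int: "integrable M (\<lambda>\<omega>. (\<Sum>j. wt j * \<bar>lag X t \<omega> j\<bar>\<^sup>2)\<^sup>2)"
    unfolding lag_def
    by (rule integrable_weighted_sum_square(2)[where K="expectation (\<lambda>\<omega>. (X 0 \<omega>) ^ 4)"])
       (use int_X4 st wt_nonneg wt_summable sq in auto)
  show ?thesis
  proof (rule Bochner_Integration.integrable_bound)
    show "integrable M (\<lambda>\<omega>. (\<Sum>j. wt j)\<^sup>2 * (\<Sum>j. wt j * \<bar>lag X t \<omega> j\<bar>\<^sup>2)\<^sup>2)" using int by simp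
    show "AE \<omega> in M. norm ((wsum wt (lag X t \<omega>)) ^ 4) \<le> norm ((\<Sum>j. wt j)\<^sup>2 * (\<Sum>j. wt j * \<bar>lag X t \<omega> j\<bar>\<^sup>2)\<^sup>2)"
      using le
    proof eventually_elim
      case (elim \<omega>)
      have "((wsum wt (lag X t \<omega>))\<^sup>2)\<^sup>2 \<le> ((\<Sum>j. wt j) * (\<Sum>j. wt j * \<bar>lag X t \<omega> j\<bar>\<^sup>2))\<^sup>2"
        by (rule power_mono[OF elim]) simp
      then show ?case by (simp add: power_mult_distrib flip: power_mult)
    qed
  qed measurable
qed

lemma B_measurable [measurable]:
  assumes [measurable]: "\<And>j. (\<lambda>\<omega>. f \<omega> j) \<in> borel_measurable N"
  shows "(\<lambda>\<omega>. B (f \<omega>)) \<in> borel_measurable N"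
  unfolding B_def by measurable

lemma grad_measurable [measurable]:
  assumes [measurable]: "\<And>j. (\<lambda>\<omega>. f \<omega> j) \<in> borel_measurable N"
  shows "(\<lambda>\<omega>. grad \<theta> (f \<omega>)) \<in> borel_measurable N"
  unfolding grad_def by measurable

lemma hess_measurable [measurable]:
  assumes [measurable]: "\<And>j. (\<lambda>\<omega>. f \<omega> j) \<in> borel_measurable N"
  shows "(\<lambda>\<omega>. hess (f \<omega>) v) \<in> borel_measurable N"
  unfolding hess_def by measurable

lemma rem_measurable [measurable]:
  assumes [measurable]: "\<And>j. (\<lambda>\<omega>. f \<omega> j) \<in> borel_measurable N"
  shows "(\<lambda>\<omega>. rem k (f \<omega>)) \<in> borel_measurable N"
  unfolding rem_def by measurable

lemma qf12_measurable [measurable]: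
  assumes [measurable]: "f \<in> borel_measurable N" "g \<in> borel_measurable N"
  shows "(\<lambda>\<omega>. qf1 (f \<omega>) (g \<omega>)) \<in> borel_measurable N" "(\<lambda>\<omega>. qf2 (f \<omega>) (g \<omega>)) \<in> borel_measurable N"
  unfolding qf1_def qf2_def by measurable

lemma smod_measurable [measurable]: "smod k \<in> borel_measurable (borel \<Otimes>\<^sub>M lag_space)"
  unfolding smod_def[abs_def] by measurable

text \<open>By Young's inequality this sum dominates \<open>(1 + x^2) * (B y)^2\<close>, so
  integrability is reduced to separate fourth moments of the present and of the past.\<close>

definition env :: "real \<times> (nat \<Rightarrow> real) \<Rightarrow> real" where
  "env z = (1 + (fst z)\<^sup>2)\<^sup>2 + (B (snd z)) ^ 4"

lemma env_measurable [measurable]: "env \<in> borel_measurable (borel \<Otimes>\<^sub>M lag_space)"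
  unfolding env_def[abs_def] by measurable

lemma env_nonneg: "env z \<ge> 0" by (simp add: env_def)

lemma add_power4_le: "(a + c) ^ 4 \<le> 8 * a ^ 4 + 8 * c ^ 4" for a c :: real
proof -
  have 1: "(a + c)\<^sup>2 \<le> 2 * a\<^sup>2 + 2 * c\<^sup>2" using sum_squares_bound[of a c] by (simp add: power2_sum)
  have "((a + c)\<^sup>2)\<^sup>2 \<le> (2 * a\<^sup>2 + 2 * c\<^sup>2)\<^sup>2" by (rule power_mono[OF 1]) simp
  also have "\<dots> \<le> 8 * a ^ 4 + 8 * c ^ 4"
    using sum_squares_bound[of "a\<^sup>2" "c\<^sup>2"] by (simp add: power2_sum power_mult_distrib flip: power_mult)
  finally show ?thesis by (simp flip: power_mult)
qed

lemma integrable_B4: "integrable M (\<lambda>\<omega>. (B (lag X t \<omega>)) ^ 4)"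
proof (rule Bochner_Integration.integrable_bound)
  show "integrable M (\<lambda>\<omega>. 8 * (1 + G0 + K0) ^ 4 + 8 * (wsum wt (lag X t \<omega>)) ^ 4)" using wsum_lag_4 by simp
  show "AE \<omega> in M. norm ((B (lag X t \<omega>)) ^ 4) \<le> norm (8 * (1 + G0 + K0) ^ 4 + 8 * (wsum wt (lag X t \<omega>)) ^ 4)"
  proof (rule AE_I2)
    fix \<omega>
    have "(B (lag X t \<omega>)) ^ 4 \<le> 8 * (1 + G0 + K0) ^ 4 + 8 * (wsum wt (lag X t \<omega>)) ^ 4"
      unfolding B_def by (rule add_power4_le)
    moreover have "0 \<le> (B (lag X t \<omega>)) ^ 4" by simp
    ultimately show "norm ((B (lag X t \<omega>)) ^ 4) \<le> norm (8 * (1 + G0 + K0) ^ 4 + 8 * (wsum wt (lag X t \<omega>)) ^ 4)" by simp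
  qed
qed measurable

lemma integrable_env: "integrable M (\<lambda>\<omega>. env (X t \<omega>, lag X t \<omega>))"
proof -
  have "(1 + (X t \<omega>)\<^sup>2)\<^sup>2 = 1 + 2 * (X t \<omega>)\<^sup>2 + (X t \<omega>) ^ 4" for \<omega>
    by (simp add: power2_sum flip: power_mult)
  then show ?thesis unfolding env_def using int_X2 int_X4 integrable_B4 by simp
qed

lemma env_ge: "(1 + x\<^sup>2) * (B y)\<^sup>2 \<le> env (x, y)"
proof -
  have "0 \<le> ((1 + x\<^sup>2) - (B y)\<^sup>2)\<^sup>2" by simp
  then have "2 * ((1 + x\<^sup>2) * (B y)\<^sup>2) \<le> (1 + x\<^sup>2)\<^sup>2 + ((B y)\<^sup>2)\<^sup>2"
    by (simp only: power2_diff mult.assoc)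
  also have "\<dots> = env (x, y)" by (simp add: env_def flip: power_mult)
  finally have "2 * ((1 + x\<^sup>2) * (B y)\<^sup>2) \<le> env (x, y)" .
  moreover have "0 \<le> (1 + x\<^sup>2) * (B y)\<^sup>2" by (intro mult_nonneg_nonneg add_nonneg_nonneg) auto
  ultimately show ?thesis by linarith
qed

lemma B_le_square: "good y \<Longrightarrow> B y \<le> (B y)\<^sup>2"
  using B_ge_1[of y] by (simp add: power2_eq_square)

lemma integrable_le_env:
  assumes "f \<in> borel_measurable (borel \<Otimes>\<^sub>M lag_space)"
    and "\<And>x y. good y \<Longrightarrow> \<bar>f (x, y)\<bar> \<le> K * ((1 + x\<^sup>2) * (B y)\<^sup>2)" and K: "K \<ge> 0"
  shows "integrable M (\<lambda>\<omega>. f (X t \<omega>, lag X t \<omega>))"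
proof (rule Bochner_Integration.integrable_bound)
  note assms(1)[measurable]
  show "integrable M (\<lambda>\<omega>. K * env (X t \<omega>, lag X t \<omega>))" using integrable_env by simp
  have "(\<lambda>\<omega>. (X t \<omega>, lag X t \<omega>)) \<in> M \<rightarrow>\<^sub>M borel \<Otimes>\<^sub>M lag_space"
    by (intro measurable_Pair lag_X_measurable) simp
  from measurable_compose[OF this assms(1)] show "(\<lambda>\<omega>. f (X t \<omega>, lag X t \<omega>)) \<in> borel_measurable M" .
  show "AE \<omega> in M. norm (f (X t \<omega>, lag X t \<omega>)) \<le> norm (K * env (X t \<omega>, lag X t \<omega>))"
    using AE_good'
  proof eventually_elim
    case (elim \<omega>)
    have "\<bar>f (X t \<omega>, lag X t \<omega>)\<bar> \<le> K * ((1 + (X t \<omega>)\<^sup>2) * (B (lag X t \<omega>))\<^sup>2)" using elim assms(2) by blast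
    also have "\<dots> \<le> K * env (X t \<omega>, lag X t \<omega>)" by (intro mult_left_mono env_ge K)
    finally show ?case using env_nonneg K by simp
  qed
qed

lemma smod_bounds:
  assumes "good y"
  shows "smod k (x, y) \<ge> 0" "smod k (x, y) \<le> 7 * Kqf b * ((1 + x\<^sup>2) * (B y)\<^sup>2)" "(\<lambda>k. smod k (x, y)) \<longlonglongrightarrow> 0"
proof -
  have B1: "B y \<ge> 1" by (rule B_ge_1[OF assms])
  have BB: "B y \<le> (B y)\<^sup>2" by (rule B_le_square[OF assms])
  have C: "Kqf b * (1 + x\<^sup>2) \<ge> 0" using Kqf_nonneg by simp
  let ?\<epsilon> = "inverse (real (Suc k))"
  have \<epsilon>: "0 \<le> ?\<epsilon>" "?\<epsilon> \<le> 1" by (auto simp: inverse_le_1_iff)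
  note r = rem_props[OF assms]
  show "smod k (x, y) \<ge> 0"
    unfolding smod_def fst_conv snd_conv using Kqf_nonneg r(1)[of k] B1 by (intro mult_nonneg_nonneg add_nonneg_nonneg) auto
  \<comment> \<open>The constant 7 is 4 from \<open>rem\<close>, 2 from the two quadratic terms and
    1 from the capped term.\<close>
  have "rem k y + 2 * (?\<epsilon> * (B y)\<^sup>2) + (B y)\<^sup>2 * min 1 (?\<epsilon> * B y) \<le> 4 * (B y)\<^sup>2 + 2 * (1 * (B y)\<^sup>2) + (B y)\<^sup>2 * 1"
    using r(2)[of k] BB \<epsilon> by (intro add_mono mult_left_mono mult_right_mono) auto
  then have "smod k (x, y) \<le> Kqf b * (1 + x\<^sup>2) * (7 * (B y)\<^sup>2)"
    unfolding smod_def fst_conv snd_conv by (intro mult_left_mono C) simp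
  then show "smod k (x, y) \<le> 7 * Kqf b * ((1 + x\<^sup>2) * (B y)\<^sup>2)" by (simp add: mult_ac)
  have "(\<lambda>k. smod k (x, y)) \<longlonglongrightarrow> Kqf b * (1 + x\<^sup>2) * (0 + 2 * (0 * (B y)\<^sup>2) + (B y)\<^sup>2 * min 1 (0 * B y))"
    unfolding smod_def fst_conv snd_conv by (intro tendsto_intros r(3) LIMSEQ_inverse_real_of_nat)
  then show "(\<lambda>k. smod k (x, y)) \<longlonglongrightarrow> 0" by simp
qed

text \<open>With the ergodic theorem this makes the averaged remainder factor eventually smaller
  than any \<open>e\<close>, once \<open>k\<close> is large.\<close>

lemma smod_expectation:
  "integrable M (\<lambda>\<omega>. smod k (X 0 \<omega>, lag X 0 \<omega>))"
  "(\<lambda>k. expectation (\<lambda>\<omega>. smod k (X 0 \<omega>, lag X 0 \<omega>))) \<longlonglongrightarrow> 0"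
proof -
  have K7: "7 * Kqf b \<ge> 0" using Kqf_nonneg by simp
  show int: "integrable M (\<lambda>\<omega>. smod k (X 0 \<omega>, lag X 0 \<omega>))" for k
    by (rule integrable_le_env[OF smod_measurable _ K7]) (use smod_bounds in auto)
  have "(\<lambda>k. expectation (\<lambda>\<omega>. smod k (X 0 \<omega>, lag X 0 \<omega>))) \<longlonglongrightarrow> expectation (\<lambda>\<omega>. 0)"
  proof (rule integral_dominated_convergence[where w="\<lambda>\<omega>. 7 * Kqf b * env (X 0 \<omega>, lag X 0 \<omega>)"])
    show "integrable M (\<lambda>\<omega>. 7 * Kqf b * env (X 0 \<omega>, lag X 0 \<omega>))" using integrable_env by simp
    show "AE \<omega> in M. (\<lambda>k. smod k (X 0 \<omega>, lag X 0 \<omega>)) \<longlonglongrightarrow> 0"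
      using AE_good' by eventually_elim (use smod_bounds(3) in blast)
    fix k
    show "(\<lambda>\<omega>. smod k (X 0 \<omega>, lag X 0 \<omega>)) \<in> borel_measurable M" using int[of k] by auto
    show "AE \<omega> in M. norm (smod k (X 0 \<omega>, lag X 0 \<omega>)) \<le> 7 * Kqf b * env (X 0 \<omega>, lag X 0 \<omega>)"
      using AE_good'
    proof eventually_elim
      case (elim \<omega>)
      then have g: "good (lag X 0 \<omega>)" by blast
      have "7 * Kqf b * ((1 + (X 0 \<omega>)\<^sup>2) * (B (lag X 0 \<omega>))\<^sup>2) \<le> 7 * Kqf b * env (X 0 \<omega>, lag X 0 \<omega>)"
        by (intro mult_left_mono env_ge K7)
      then show ?case using smod_bounds(1,2)[OF g, of k "X 0 \<omega>"] by simp
    qed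
  qed simp
  then show "(\<lambda>k. expectation (\<lambda>\<omega>. smod k (X 0 \<omega>, lag X 0 \<omega>))) \<longlonglongrightarrow> 0" by simp
qed

lemma tterm_add: "tterm (p + p') (m + m') x = tterm p m x + tterm p' m' x"
  by (simp add: tterm_def algebra_simps)

lemma tterm_scaleR: "tterm (c *\<^sub>R p) (c *\<^sub>R m) x = c *\<^sub>R tterm p m x"
  by (simp add: tterm_def algebra_simps)

lemma linear_hess: "good y \<Longrightarrow> linear (hess y)"
proof (rule linearI)
  assume y: "good y"
  note s = hess_tser_bound(1)[OF y]
  show "hess y (v + v') = hess y v + hess y v'" for v v'
    unfolding hess_def tser_def matrix_vector_right_distrib tterm_add using suminf_add[OF s s, of v v'] by (simp add: algebra_simps)
  show "hess y (c *\<^sub>R v) = c *\<^sub>R hess y v" for c v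
    unfolding hess_def tser_def matrix_vector_mult_scaleR tterm_scaleR
    using suminf_scaleR_right[OF s, of c v] by (simp add: scaleR_right_distrib)
qed

lemma linear_jac: "good y \<Longrightarrow> linear (jac x y)"
  unfolding jac_def using linear_hess[of y]
  by (intro linearI) (auto simp: linear_add linear_scale algebra_simps inner_add_right)

lemma jac_entry_bound:
  assumes y: "good y"
  shows "\<bar>jac x y (axis j 1) $ i\<bar> \<le> 2 * Kqf b * ((1 + x\<^sup>2) * (B y)\<^sup>2)"
proof -
  define C where "C = Kqf b * (1 + x\<^sup>2)"
  have C: "C \<ge> 0" using Kqf_nonneg by (simp add: C_def)
  have v: "vol \<theta>0 y \<ge> b" by (rule vol_ge[OF \<theta>0 y])
  note q = qf1_estimates(1,2)[OF b_pos v v, of x, folded C_def]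
  have B1: "B y \<ge> 1" by (rule B_ge_1[OF y])
  let ?e = "axis j 1 :: real ^ 'd"
  have n1: "norm ?e = 1" by (rule norm_axis_1)
  have ge: "\<bar>grad \<theta>0 y \<bullet> ?e\<bar> \<le> B y"
    using Cauchy_Schwarz_ineq2[of "grad \<theta>0 y" ?e] norm_grad[OF \<theta>0 y] n1 by simp
  have "\<bar>jac x y ?e $ i\<bar> \<le> norm (jac x y ?e)" by (rule component_le_norm_cart)
  also have "\<dots> \<le> \<bar>qf1 x (vol \<theta>0 y)\<bar> * norm (hess y ?e) + (\<bar>qf2 x (vol \<theta>0 y)\<bar> * \<bar>grad \<theta>0 y \<bullet> ?e\<bar>) * norm (grad \<theta>0 y)"
    unfolding jac_def by (rule order_trans[OF norm_triangle_ineq]) (simp add: abs_mult)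
  also have "\<dots> \<le> C * (B y * 1) + (C * B y) * B y"
    using norm_hess[OF y, of ?e] n1 q ge norm_grad[OF \<theta>0 y] C B1 by (intro add_mono mult_mono) auto
  also have "\<dots> \<le> C * (B y)\<^sup>2 + C * (B y)\<^sup>2"
    using mult_left_mono[OF B_le_square[OF y] C] by (simp add: power2_eq_square mult_ac)
  finally show ?thesis by (simp add: C_def mult_ac)
qed

lemma jac_entry_measurable [measurable]: "(\<lambda>z. jac (fst z) (snd z) v $ i) \<in> borel_measurable (borel \<Otimes>\<^sub>M lag_space)"
  unfolding jac_def by measurable

lemma integrable_jac_entry: "integrable M (\<lambda>\<omega>. jac (X t \<omega>) (lag X t \<omega>) (axis j 1) $ i)"
  using integrable_le_env[of "\<lambda>z. jac (fst z) (snd z) (axis j 1) $ i" "2 * Kqf b" t]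
    jac_entry_measurable jac_entry_bound Kqf_nonneg by simp

text \<open>Since \<open>smod k (x, y)\<close> tends to 0 with \<open>k\<close>, the expansion gives
  differentiability at \<theta>0, the point where \<open>F\<close> evaluates second
  derivatives.\<close>

lemma score_has_derivative:
  assumes y: "good y"
  shows "((\<lambda>\<theta>. score x \<theta> y) has_derivative jac x y) (at \<theta>0)"
  unfolding has_derivative_at_alt
proof (intro conjI allI impI)
  show "bounded_linear (jac x y)" using linear_jac[OF y] by (simp add: linear_conv_bounded_linear)
  fix e :: real assume e: "e > 0"
  obtain k where k: "smod k (x, y) < e"
    using order_tendstoD(2)[OF smod_bounds(3)[OF y] e, of x] unfolding eventually_sequentially by blast
  obtain r where r: "r > 0" "ball \<theta>0 r \<subseteq> U" using U_props openE by metis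
  show "\<exists>d>0. \<forall>\<theta>. norm (\<theta> - \<theta>0) < d \<longrightarrow> norm (score x \<theta> y - score x \<theta>0 y - jac x y (\<theta> - \<theta>0)) \<le> e * norm (\<theta> - \<theta>0)"
  proof (intro exI[of _ "min r (inverse (real (Suc k)))"] conjI allI impI)
    show "min r (inverse (real (Suc k))) > 0" using r by simp
    fix \<theta> assume d: "norm (\<theta> - \<theta>0) < min r (inverse (real (Suc k)))"
    have "norm (score x \<theta> y - score x \<theta>0 y - jac x y (\<theta> - \<theta>0)) \<le> norm (\<theta> - \<theta>0) * smod k (x, y)"
      by (rule score_expansion[OF _ _ y]) (use d r in \<open>auto simp: dist_norm norm_minus_commute\<close>)
    also have "\<dots> \<le> norm (\<theta> - \<theta>0) * e" using k by (intro mult_left_mono) auto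
    finally show "norm (score x \<theta> y - score x \<theta>0 y - jac x y (\<theta> - \<theta>0)) \<le> e * norm (\<theta> - \<theta>0)" by (simp add: mult.commute)
  qed
qed

lemma q_proc_eq:
  assumes "good (lag X t \<omega>)" "\<theta> \<in> \<Theta>"
  shows "q_proc b0 bp bm X t \<omega> \<theta> = qf (X t \<omega>) (vol \<theta> (lag X t \<omega>))"
proof -
  have "vol \<theta> (lag X t \<omega>) > 0" using vol_ge[OF assms(2,1)] b_pos by simp
  then show ?thesis unfolding q_proc_def H_proc_eq_vol by (rule qf_square)
qed

text \<open>First partials are identified on all of \<open>U\<close> because the second partial at
  \<theta>0 differentiates them along a neighbourhood.\<close>

lemma q_proc_partial:
  assumes g: "good (lag X t \<omega>)"
  shows "\<theta> \<in> U \<Longrightarrow> partial_deriv j (q_proc b0 bp bm X t \<omega>) \<theta> = score (X t \<omega>) \<theta> (lag X t \<omega>) $ j"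
    and "partial_deriv i (partial_deriv j (q_proc b0 bp bm X t \<omega>)) \<theta>0 = jac (X t \<omega>) (lag X t \<omega>) (axis i 1) $ j"
proof -
  show 1: "partial_deriv j (q_proc b0 bp bm X t \<omega>) \<theta> = score (X t \<omega>) \<theta> (lag X t \<omega>) $ j" if \<theta>: "\<theta> \<in> U" for \<theta>
  proof -
    have "(q_proc b0 bp bm X t \<omega> has_derivative (\<lambda>v. score (X t \<omega>) \<theta> (lag X t \<omega>) \<bullet> v)) (at \<theta>)"
      by (rule has_derivative_transform_within_open[OF qf_vol_has_derivative[OF \<theta> g] U_props(1) \<theta>])
        (use q_proc_eq[OF g] U_props in auto)
    from partial_deriv_eq[OF this] show ?thesis by (simp add: inner_axis)
  qed
  have "((\<lambda>\<theta>. score (X t \<omega>) \<theta> (lag X t \<omega>) $ j) has_derivative (\<lambda>v. jac (X t \<omega>) (lag X t \<omega>) v $ j)) (at \<theta>0)"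
    by (rule bounded_linear.has_derivative[OF bounded_linear_vec_nth score_has_derivative[OF g]])
  then have "(partial_deriv j (q_proc b0 bp bm X t \<omega>) has_derivative (\<lambda>v. jac (X t \<omega>) (lag X t \<omega>) v $ j)) (at \<theta>0)"
    by (rule has_derivative_transform_within_open[OF _ U_props(1,3)]) (simp add: 1)
  from partial_deriv_eq[OF this]
  show "partial_deriv i (partial_deriv j (q_proc b0 bp bm X t \<omega>)) \<theta>0 = jac (X t \<omega>) (lag X t \<omega>) (axis i 1) $ j" .
qed

text \<open>The logarithmic gradient of \<open>H\<close> at \<theta>0, that is
  \<open>grad H / H\<close>, written with \<open>H = vol^2\<close>.\<close>

definition D :: "(nat \<Rightarrow> real) \<Rightarrow> real ^ 'd" where "D y = (2 / vol \<theta>0 y) *\<^sub>R grad \<theta>0 y"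

lemma D_measurable [measurable]:
  assumes [measurable]: "\<And>j. (\<lambda>\<omega>. f \<omega> j) \<in> borel_measurable N"
  shows "(\<lambda>\<omega>. D (f \<omega>)) \<in> borel_measurable N"
  unfolding D_def by measurable

lemma score_at_\<theta>0: "AE \<omega> in M. score (X t \<omega>) \<theta>0 (lag X t \<omega>) = (1 - (\<xi> t \<omega>)\<^sup>2) *\<^sub>R D (lag X t \<omega>)"
  using X_eq_vol[of t] AE_good'
proof eventually_elim
  case (elim \<omega>)
  have v: "vol \<theta>0 (lag X t \<omega>) > 0" using vol_ge[OF \<theta>0, of "lag X t \<omega>"] elim b_pos by (auto intro: less_le_trans)
  have "qf1 (X t \<omega>) (vol \<theta>0 (lag X t \<omega>)) = (1 - (\<xi> t \<omega>)\<^sup>2) * (2 / vol \<theta>0 (lag X t \<omega>))"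
    unfolding elim(1) qf1_def using v by (simp add: field_simps power2_eq_square power3_eq_cube)
  then show ?case by (simp add: score_def D_def)
qed

lemma norm_D: "good y \<Longrightarrow> norm (D y) \<le> 2 / b * B y"
proof -
  assume y: "good y"
  have v: "vol \<theta>0 y \<ge> b" by (rule vol_ge[OF \<theta>0 y])
  then have "2 / vol \<theta>0 y \<le> 2 / b" "0 \<le> 2 / vol \<theta>0 y" using b_pos by (auto intro: frac_le)
  then show ?thesis unfolding D_def using norm_grad[OF \<theta>0 y] b_pos by (simp only: norm_scaleR) (intro mult_mono, auto)
qed

lemma integrable_B2: "integrable M (\<lambda>\<omega>. (B (lag X t \<omega>))\<^sup>2)"
proof (rule Bochner_Integration.integrable_bound)
  show "integrable M (\<lambda>\<omega>. 1 + (B (lag X t \<omega>)) ^ 4)" using integrable_B4 by simp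
  have "x\<^sup>2 \<le> 1 + x ^ 4" for x :: real
  proof -
    have "0 \<le> (x\<^sup>2 - 1)\<^sup>2" by simp
    then have "2 * x\<^sup>2 \<le> 1 + x ^ 4" by (simp add: power2_diff flip: power_mult)
    then show ?thesis using zero_le_power2[of x] by linarith
  qed
  moreover have "0 \<le> x ^ 4" for x :: real by simp
  ultimately show "AE \<omega> in M. norm ((B (lag X t \<omega>))\<^sup>2) \<le> norm (1 + (B (lag X t \<omega>)) ^ 4)"
    by (intro AE_I2) (simp add: add_nonneg_nonneg)
qed measurable

lemma integrable_D2: "integrable M (\<lambda>\<omega>. (a \<bullet> D (lag X t \<omega>))\<^sup>2)"
  and integrable_DD: "integrable M (\<lambda>\<omega>. D (lag X t \<omega>) $ i * D (lag X t \<omega>) $ j)"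
proof -
  have b2: "\<bar>a \<bullet> D y\<bar> \<le> norm a * (2 / b * B y)" if "good y" for a y
    using Cauchy_Schwarz_ineq2[of a "D y"] mult_left_mono[OF norm_D[OF that], of "norm a"] by simp
  show "integrable M (\<lambda>\<omega>. (a \<bullet> D (lag X t \<omega>))\<^sup>2)"
  proof (rule Bochner_Integration.integrable_bound)
    show "integrable M (\<lambda>\<omega>. (norm a * (2 / b))\<^sup>2 * (B (lag X t \<omega>))\<^sup>2)" using integrable_B2 by simp
    show "AE \<omega> in M. norm ((a \<bullet> D (lag X t \<omega>))\<^sup>2) \<le> norm ((norm a * (2 / b))\<^sup>2 * (B (lag X t \<omega>))\<^sup>2)"
      using AE_good'
    proof eventually_elim
      case (elim \<omega>)
      then have "\<bar>a \<bullet> D (lag X t \<omega>)\<bar>\<^sup>2 \<le> (norm a * (2 / b * B (lag X t \<omega>)))\<^sup>2" by (intro power_mono b2) auto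
      also have "\<dots> = (norm a * (2 / b))\<^sup>2 * (B (lag X t \<omega>))\<^sup>2" by (simp only: power_mult_distrib mult.assoc)
      finally show ?case by simp
    qed
  qed measurable
  show "integrable M (\<lambda>\<omega>. D (lag X t \<omega>) $ i * D (lag X t \<omega>) $ j)"
  proof (rule Bochner_Integration.integrable_bound)
    show "integrable M (\<lambda>\<omega>. (2 / b)\<^sup>2 * (B (lag X t \<omega>))\<^sup>2)" using integrable_B2 by simp
    show "AE \<omega> in M. norm (D (lag X t \<omega>) $ i * D (lag X t \<omega>) $ j) \<le> norm ((2 / b)\<^sup>2 * (B (lag X t \<omega>))\<^sup>2)"
      using AE_good'
    proof eventually_elim
      case (elim \<omega>)
      then have g: "good (lag X t \<omega>)" by blast
      have "\<bar>D (lag X t \<omega>) $ i\<bar> * \<bar>D (lag X t \<omega>) $ j\<bar> \<le> (2 / b * B (lag X t \<omega>)) * (2 / b * B (lag X t \<omega>))"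
        using component_le_norm_cart[of "D (lag X t \<omega>)"] norm_D[OF g] B_ge_1[OF g] b_pos
        by (intro mult_mono) (auto intro: order_trans)
      then show ?case by (simp add: abs_mult power2_eq_square mult_ac)
    qed
  qed measurable
qed

definition Fm :: "real ^ 'd ^ 'd" where
  "Fm = (\<chi> i j. expectation (\<lambda>\<omega>. D (lag X 0 \<omega>) $ i * D (lag X 0 \<omega>) $ j))"

definition v\<eta> :: real where "v\<eta> = expectation (\<lambda>\<omega>. (1 - (\<xi> 0 \<omega>)\<^sup>2)\<^sup>2)"

lemma integrable_\<eta>2: "integrable M (\<lambda>\<omega>. (1 - (\<xi> 0 \<omega>)\<^sup>2)\<^sup>2)"
proof -
  have "(1 - x\<^sup>2)\<^sup>2 = 1 - 2 * x\<^sup>2 + x ^ 4" for x :: real by (simp add: power2_diff flip: power_mult)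
  then show ?thesis using int_\<xi>2 int_\<xi>4' by simp
qed

text \<open>With \<open>X = vol * \<xi>\<close> the entry splits into a past term times
  \<open>1 - \<xi>^2\<close>, of mean 0, and the product of two components of \<open>D\<close> times
  \<open>(6 * \<xi>^2 - 2) / 4\<close>, of mean 1. Second derivatives of the volatility thus average
  out.\<close>

lemma expectation_jac: "expectation (\<lambda>\<omega>. jac (X 0 \<omega>) (lag X 0 \<omega>) (axis j 1) $ i) = Fm $ i $ j"
proof -
  define p where "p = (\<lambda>y. 2 / vol \<theta>0 y * (hess y (axis j 1) $ i))"
  define q where "q = (\<lambda>y. D y $ i * D y $ j)"
  have pm[measurable]: "p \<in> borel_measurable lag_space" and qm[measurable]: "q \<in> borel_measurable lag_space"
    unfolding p_def q_def by measurable
  have ip: "integrable M (\<lambda>\<omega>. p (lag X 0 \<omega>))"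
  proof (rule Bochner_Integration.integrable_bound)
    show "integrable M (\<lambda>\<omega>. 2 / b * (B (lag X 0 \<omega>))\<^sup>2)" using integrable_B2 by simp
    show "AE \<omega> in M. norm (p (lag X 0 \<omega>)) \<le> norm (2 / b * (B (lag X 0 \<omega>))\<^sup>2)"
      using AE_good'
    proof eventually_elim
      case (elim \<omega>)
      define y where "y = lag X 0 \<omega>"
      have y: "good y" using elim by (simp add: y_def)
      have v: "vol \<theta>0 y \<ge> b" by (rule vol_ge[OF \<theta>0 y])
      have "\<bar>hess y (axis j 1) $ i\<bar> \<le> (B y)\<^sup>2"
        using component_le_norm_cart[of "hess y (axis j 1)" i] norm_hess[OF y, of "axis j 1"] B_le_square[OF y]
        by (simp add: norm_axis_1)
      moreover have "\<bar>2 / vol \<theta>0 y\<bar> \<le> 2 / b" using v b_pos by (auto intro: frac_le)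
      ultimately have "\<bar>2 / vol \<theta>0 y\<bar> * \<bar>hess y (axis j 1) $ i\<bar> \<le> 2 / b * (B y)\<^sup>2"
        using b_pos by (intro mult_mono) auto
      then show ?case unfolding p_def y_def[symmetric] real_norm_def abs_mult using b_pos by simp
    qed
  qed (use measurable_compose[OF lag_X_measurable pm] in auto)
  have iq: "integrable M (\<lambda>\<omega>. q (lag X 0 \<omega>))" unfolding q_def by (rule integrable_DD)
  have i1: "integrable M (\<lambda>\<omega>. 1 - (\<xi> 0 \<omega>)\<^sup>2)" and i2: "integrable M (\<lambda>\<omega>. (6 * (\<xi> 0 \<omega>)\<^sup>2 - 2) / 4)"
    using int_\<xi>2 by auto
  note P = lag_independent[where t=0 and k="\<lambda>x. 1 - x\<^sup>2", OF pm _ ip i1] and R = lag_independent[where t=0 and k="\<lambda>x. (6 * x\<^sup>2 - 2) / 4", OF qm _ iq i2]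
  have e1: "expectation (\<lambda>\<omega>. 1 - (\<xi> 0 \<omega>)\<^sup>2) = 0" using int_\<xi>2 mean_\<xi>2 by (simp add: prob_space)
  have e2: "expectation (\<lambda>\<omega>. (6 * (\<xi> 0 \<omega>)\<^sup>2 - 2) / 4) = 1" using int_\<xi>2 mean_\<xi>2 by (simp add: prob_space)
  have "AE \<omega> in M. jac (X 0 \<omega>) (lag X 0 \<omega>) (axis j 1) $ i = p (lag X 0 \<omega>) * (1 - (\<xi> 0 \<omega>)\<^sup>2) + q (lag X 0 \<omega>) * ((6 * (\<xi> 0 \<omega>)\<^sup>2 - 2) / 4)"
    using X_eq_vol[of 0] AE_good'
  proof eventually_elim
    case (elim \<omega>)
    define y where "y = lag X 0 \<omega>"
    have y: "good y" using elim by (simp add: y_def)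
    have v: "vol \<theta>0 y > 0" using vol_ge[OF \<theta>0 y] b_pos by simp
    have x: "X 0 \<omega> = vol \<theta>0 y * \<xi> 0 \<omega>" using elim(1) by (simp add: y_def)
    have 1: "qf1 (X 0 \<omega>) (vol \<theta>0 y) = 2 / vol \<theta>0 y * (1 - (\<xi> 0 \<omega>)\<^sup>2)"
      unfolding x qf1_def using v by (simp add: field_simps power2_eq_square power3_eq_cube)
    have 2: "qf2 (X 0 \<omega>) (vol \<theta>0 y) = (2 / vol \<theta>0 y) * (2 / vol \<theta>0 y) * ((6 * (\<xi> 0 \<omega>)\<^sup>2 - 2) / 4)"
      unfolding x qf2_def using v by (simp add: field_simps power2_eq_square power4_eq_xxxx)
    have "jac (X 0 \<omega>) y (axis j 1) $ i = qf1 (X 0 \<omega>) (vol \<theta>0 y) * (hess y (axis j 1) $ i) + qf2 (X 0 \<omega>) (vol \<theta>0 y) * (grad \<theta>0 y $ j) * (grad \<theta>0 y $ i)"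
      by (simp add: jac_def inner_axis)
    then show ?case unfolding 1 2 y_def[symmetric] p_def q_def D_def by (simp only: vector_scaleR_component real_scaleR_def mult_ac)
  qed
  then have "expectation (\<lambda>\<omega>. jac (X 0 \<omega>) (lag X 0 \<omega>) (axis j 1) $ i)
     = expectation (\<lambda>\<omega>. p (lag X 0 \<omega>) * (1 - (\<xi> 0 \<omega>)\<^sup>2) + q (lag X 0 \<omega>) * ((6 * (\<xi> 0 \<omega>)\<^sup>2 - 2) / 4))"
    by (intro integral_cong_AE) (use integrable_jac_entry[of 0 j i] P(2) R(2) in auto)
  also have "\<dots> = expectation (\<lambda>\<omega>. q (lag X 0 \<omega>))"
    using P R e1 e2 by simp
  finally show ?thesis by (simp add: q_def Fm_def)
qed

lemma Fm_sym: "Fm $ i $ j = Fm $ j $ i" by (simp add: Fm_def mult.commute)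

lemma F_matrix_eq: "F_matrix M b0 bp bm X \<theta>0 = Fm"
proof -
  have "(\<integral>\<omega>. partial_deriv i (partial_deriv j (q_proc b0 bp bm X 0 \<omega>)) \<theta>0 \<partial>completion M) = Fm $ i $ j" for i j
  proof -
    have "(\<integral>\<omega>. partial_deriv i (partial_deriv j (q_proc b0 bp bm X 0 \<omega>)) \<theta>0 \<partial>completion M)
      = expectation (\<lambda>\<omega>. jac (X 0 \<omega>) (lag X 0 \<omega>) (axis i 1) $ j)"
    proof (rule integral_completion_cong_AE)
      show "AE \<omega> in M. partial_deriv i (partial_deriv j (q_proc b0 bp bm X 0 \<omega>)) \<theta>0 = jac (X 0 \<omega>) (lag X 0 \<omega>) (axis i 1) $ j"
        using AE_good' by eventually_elim (simp add: q_proc_partial(2))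
    qed (use integrable_jac_entry[of 0 i j] in auto)
    then show ?thesis using expectation_jac[of i j] Fm_sym[of i j] by simp
  qed
  then show ?thesis unfolding F_matrix_def by (simp add: vec_eq_iff)
qed

lemma G_matrix_eq: "G_matrix M b0 bp bm X \<theta>0 = v\<eta> *\<^sub>R Fm"
proof -
  have "(\<integral>\<omega>. partial_deriv i (q_proc b0 bp bm X 0 \<omega>) \<theta>0 * partial_deriv j (q_proc b0 bp bm X 0 \<omega>) \<theta>0 \<partial>completion M) = v\<eta> * Fm $ i $ j" for i j
  proof -
    define q where "q = (\<lambda>y. D y $ i * D y $ j)"
    have qm: "q \<in> borel_measurable lag_space" unfolding q_def by measurable
    have iq: "integrable M (\<lambda>\<omega>. q (lag X 0 \<omega>))" unfolding q_def by (rule integrable_DD)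
    note R = lag_independent[where t=0 and k="\<lambda>x. (1 - x\<^sup>2)\<^sup>2", OF qm _ iq integrable_\<eta>2]
    have "(\<integral>\<omega>. partial_deriv i (q_proc b0 bp bm X 0 \<omega>) \<theta>0 * partial_deriv j (q_proc b0 bp bm X 0 \<omega>) \<theta>0 \<partial>completion M)
      = expectation (\<lambda>\<omega>. q (lag X 0 \<omega>) * (1 - (\<xi> 0 \<omega>)\<^sup>2)\<^sup>2)"
    proof (rule integral_completion_cong_AE)
      show "AE \<omega> in M. partial_deriv i (q_proc b0 bp bm X 0 \<omega>) \<theta>0 * partial_deriv j (q_proc b0 bp bm X 0 \<omega>) \<theta>0
         = q (lag X 0 \<omega>) * (1 - (\<xi> 0 \<omega>)\<^sup>2)\<^sup>2"
        using AE_good' score_at_\<theta>0[of 0]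
        by eventually_elim (simp add: q_proc_partial(1) U_props q_def power2_eq_square mult_ac)
    qed (use R(2) in auto)
    also have "\<dots> = v\<eta> * Fm $ i $ j" using R(1) by (simp add: v\<eta>_def q_def Fm_def mult.commute)
    finally show ?thesis .
  qed
  then show ?thesis unfolding G_matrix_def by (simp add: vec_eq_iff)
qed

lemma Fm_quadratic: "a \<bullet> (Fm *v a) = expectation (\<lambda>\<omega>. (a \<bullet> D (lag X 0 \<omega>))\<^sup>2)"
proof -
  have "(a \<bullet> D (lag X 0 \<omega>))\<^sup>2 = (\<Sum>i\<in>UNIV. \<Sum>j\<in>UNIV. (a $ i * a $ j) * (D (lag X 0 \<omega>) $ i * D (lag X 0 \<omega>) $ j))" for \<omega>
    by (simp add: inner_vec_def power2_eq_square sum_product mult_ac)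
  then have "expectation (\<lambda>\<omega>. (a \<bullet> D (lag X 0 \<omega>))\<^sup>2) = (\<Sum>i\<in>UNIV. \<Sum>j\<in>UNIV. (a $ i * a $ j) * Fm $ i $ j)"
    using integrable_DD by (simp add: Fm_def)
  also have "\<dots> = a \<bullet> (Fm *v a)"
    by (simp add: inner_vec_def matrix_vector_mult_def sum_distrib_left mult_ac)
  finally show ?thesis by simp
qed

lemma H_proc_partial:
  assumes g: "good (lag X t \<omega>)"
  shows "partial_deriv i (H_proc b0 bp bm X t \<omega>) \<theta>0 = (vol \<theta>0 (lag X t \<omega>))\<^sup>2 * D (lag X t \<omega>) $ i"
proof -
  have v: "vol \<theta>0 (lag X t \<omega>) \<noteq> 0" using vol_ge[OF \<theta>0 g] b_pos by simp
  have "((\<lambda>\<theta>. (vol \<theta> (lag X t \<omega>))\<^sup>2) has_derivative (\<lambda>w. 2 * (grad \<theta>0 (lag X t \<omega>) \<bullet> w) * vol \<theta>0 (lag X t \<omega>))) (at \<theta>0)"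
    using has_derivative_power[OF vol_has_derivative[OF U_props(3) g], of 2] by (simp add: mult_ac)
  then have "(H_proc b0 bp bm X t \<omega> has_derivative (\<lambda>w. 2 * (grad \<theta>0 (lag X t \<omega>) \<bullet> w) * vol \<theta>0 (lag X t \<omega>))) (at \<theta>0)"
    by (simp add: H_proc_eq_vol[abs_def])
  from partial_deriv_eq[OF this] show ?thesis using v
    by (simp add: inner_axis D_def power2_eq_square field_simps)
qed

text \<open>A vector in the kernel has vanishing quadratic form, so \<open>a \<bullet> D\<close> is
  0 almost surely; multiplied by \<open>H\<close> this is a linear relation between the partial
  derivatives of \<open>H\<close> at time 0, excluded by linear independence.\<close>

lemma Fm_definite: "Fm *v a = 0 \<Longrightarrow> a = 0"
proof -
  assume "Fm *v a = 0"
  then have "expectation (\<lambda>\<omega>. (a \<bullet> D (lag X 0 \<omega>))\<^sup>2) = 0" using Fm_quadratic[of a] by simp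
  then have "AE \<omega> in M. (a \<bullet> D (lag X 0 \<omega>))\<^sup>2 = 0"
    using integral_nonneg_eq_0_iff_AE[OF integrable_D2[of a 0]] by simp
  then have "AE \<omega> in M. (\<Sum>i\<in>UNIV. a $ i * partial_deriv i (H_proc b0 bp bm X 0 \<omega>) \<theta>0) = 0"
    using AE_good'
  proof eventually_elim
    case (elim \<omega>)
    have "(\<Sum>i\<in>UNIV. a $ i * partial_deriv i (H_proc b0 bp bm X 0 \<omega>) \<theta>0) = (vol \<theta>0 (lag X 0 \<omega>))\<^sup>2 * (a \<bullet> D (lag X 0 \<omega>))"
      using elim(2) by (simp add: H_proc_partial inner_vec_def sum_distrib_left mult_ac)
    then show ?case using elim(1) by simp
  qed
  then show "a = 0" by (rule lin_indep)
qed

lemma Fm_invertible: "invertible Fm"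
proof -
  have "\<exists>A. A ** Fm = mat 1" unfolding matrix_left_invertible_ker using Fm_definite by blast
  then show ?thesis using invertible_left_inverse by blast
qed

end

section \<open>Asymptotic normality\<close>

context tarch_normal
begin

section \<open>The normalised score as a martingale\<close>

definition Tn :: "nat \<Rightarrow> 'a \<Rightarrow> real ^ 'd" where
  "Tn n \<omega> = (1 / sqrt (real n)) *\<^sub>R (\<Sum>t=1..n. score (X (int t) \<omega>) \<theta>0 (lag X (int t) \<omega>))"

lemma Tn_measurable [measurable]: "Tn n \<in> borel_measurable M"
  unfolding Tn_def score_def by measurable

lemma v\<eta>_nonneg: "v\<eta> \<ge> 0" unfolding v\<eta>_def by (intro integral_nonneg_AE) auto

lemma Fm_psd: "a \<bullet> (Fm *v a) \<ge> 0" unfolding Fm_quadratic by (intro integral_nonneg_AE) auto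

text \<open>The lags of \<open>X'\<close> make the factors measurable for the past everywhere and
  not just almost everywhere. Index \<open>n\<close> stands for time \<open>n + 1\<close> because
  score sums start at time 1. The averages of squares converge by the ergodic theorem, to the
  quadratic form of \<open>Fm\<close>.\<close>

lemma score_martingale:
  "martingale_difference M (\<lambda>n. past_algebra (int (Suc n))) (\<lambda>n \<omega>. a \<bullet> D (lag X' (int (Suc n)) \<omega>))
     (\<lambda>n \<omega>. 1 - (\<xi> (int (Suc n)) \<omega>)\<^sup>2) v\<eta> (a \<bullet> (Fm *v a))"
proof -
  define g where "g = (\<lambda>y. a \<bullet> D y)"
  have gm: "g \<in> borel_measurable lag_space" unfolding g_def by measurable
  have eqAE: "AE \<omega> in M. \<forall>t. lag X t \<omega> = lag X' t \<omega>"
    using X_eq_X' by eventually_elim (simp add: lag_def)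
  have gF: "(\<lambda>\<omega>. g (lag X' t \<omega>)) \<in> borel_measurable (past_algebra t)" for t
    by (rule measurable_compose[OF lag_X'_past_algebra gm])
  have gM[measurable]: "(\<lambda>\<omega>. g (lag X' t \<omega>)) \<in> borel_measurable M" for t
    using measurable_larger_algebra[OF gF space_past_algebra sets_past_algebra] .
  have gM'[measurable]: "(\<lambda>\<omega>. g (lag X t \<omega>)) \<in> borel_measurable M" for t
    by (rule measurable_compose[OF lag_X_measurable gm])
  have dg: "distr M borel (\<lambda>\<omega>. g (lag X' t \<omega>)) = distr M borel (\<lambda>\<omega>. g (lag X t \<omega>))" for t
    by (rule distr_cong_AE) (use eqAE in \<open>auto elim: eventually_mono\<close>)
  have st: "distr M borel (\<lambda>\<omega>. g (lag X t \<omega>)) = distr M borel (\<lambda>\<omega>. g (lag X 0 \<omega>))" for t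
    using lag_stationary(3)[OF measurable_compose[OF measurable_snd gm], of t] by simp
  have d\<xi>: "distr M borel (\<lambda>\<omega>. 1 - (\<xi> t \<omega>)\<^sup>2) = distr (distr M borel (\<xi> 0)) borel (\<lambda>x. 1 - x\<^sup>2)" for t
    by (subst distr_\<xi>[of t, symmetric], subst distr_distr) (auto simp: comp_def)
  have ei: "integrable M (\<lambda>\<omega>. k (\<xi> t \<omega>)) \<longleftrightarrow> integrable M (\<lambda>\<omega>. k (\<xi> 0 \<omega>))"
    and ee: "expectation (\<lambda>\<omega>. k (\<xi> t \<omega>)) = expectation (\<lambda>\<omega>. k (\<xi> 0 \<omega>))"
    if "k \<in> borel_measurable borel" for t and k :: "real \<Rightarrow> real"
    using integrable_distr_eq[OF \<xi>_measurable that, of t] integrable_distr_eq[OF \<xi>_measurable that, of 0]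
      integral_distr[OF \<xi>_measurable that, of t] integral_distr[OF \<xi>_measurable that, of 0] distr_\<xi>[of t] by auto
  show ?thesis
  proof
    fix n
    show "space (past_algebra (int (Suc n))) = space M" by (rule space_past_algebra)
    show "sets (past_algebra (int (Suc n))) \<subseteq> sets M" by (rule sets_past_algebra)
    show "sets (past_algebra (int (Suc m))) \<subseteq> sets (past_algebra (int (Suc n)))" if "m \<le> n" for m n
      by (rule past_algebra_mono) (use that in simp)
    show "(\<lambda>\<omega>. a \<bullet> D (lag X' (int (Suc n)) \<omega>)) \<in> borel_measurable (past_algebra (int (Suc n)))"
      using gF[of "int (Suc n)"] by (simp add: g_def)
    have [measurable]: "\<xi> (int (Suc n)) \<in> borel_measurable (past_algebra (int (Suc (Suc n))))"
      by (rule \<xi>_past_algebra) simp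
    show "(\<lambda>\<omega>. 1 - (\<xi> (int (Suc n)) \<omega>)\<^sup>2) \<in> borel_measurable (past_algebra (int (Suc (Suc n))))"
      by measurable
    show "indep_pair M (past_algebra (int (Suc n))) (\<lambda>\<omega>. \<omega>) borel (\<lambda>\<omega>. 1 - (\<xi> (int (Suc n)) \<omega>)\<^sup>2)"
      by (rule indep_pair_compose[OF past_algebra_indep]) auto
    show "distr M borel (\<lambda>\<omega>. 1 - (\<xi> (int (Suc n)) \<omega>)\<^sup>2) = distr M borel (\<lambda>\<omega>. 1 - (\<xi> (int (Suc 0)) \<omega>)\<^sup>2)"
      unfolding d\<xi> ..
    show "distr M borel (\<lambda>\<omega>. a \<bullet> D (lag X' (int (Suc n)) \<omega>)) = distr M borel (\<lambda>\<omega>. a \<bullet> D (lag X' (int (Suc 0)) \<omega>))"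
      using dg[of "int (Suc n)"] dg[of "int (Suc 0)"] st[of "int (Suc n)"] st[of "int (Suc 0)"] by (simp add: g_def)
    show "integrable M (\<lambda>\<omega>. (1 - (\<xi> (int (Suc 0)) \<omega>)\<^sup>2)\<^sup>2)"
      using ei[of "\<lambda>x. (1 - x\<^sup>2)\<^sup>2" "int (Suc 0)"] integrable_\<eta>2 by simp
    show "expectation (\<lambda>\<omega>. 1 - (\<xi> (int (Suc 0)) \<omega>)\<^sup>2) = 0"
      using ee[of "\<lambda>x. 1 - x\<^sup>2" "int (Suc 0)"] int_\<xi>2 mean_\<xi>2 by (simp add: prob_space)
    show "expectation (\<lambda>\<omega>. (1 - (\<xi> (int (Suc 0)) \<omega>)\<^sup>2)\<^sup>2) = v\<eta>"
      using ee[of "\<lambda>x. (1 - x\<^sup>2)\<^sup>2" "int (Suc 0)"] by (simp add: v\<eta>_def)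
    show "integrable M (\<lambda>\<omega>. (a \<bullet> D (lag X' (int (Suc 0)) \<omega>))\<^sup>2)"
    proof (rule iffD1[OF integrable_cong_AE integrable_D2])
      show "AE \<omega> in M. (a \<bullet> D (lag X (int (Suc 0)) \<omega>))\<^sup>2 = (a \<bullet> D (lag X' (int (Suc 0)) \<omega>))\<^sup>2"
        using eqAE by eventually_elim simp
      show "(\<lambda>\<omega>. (a \<bullet> D (lag X (int (Suc 0)) \<omega>))\<^sup>2) \<in> borel_measurable M"
        by (rule borel_measurable_power[OF gM'[unfolded g_def]])
      show "(\<lambda>\<omega>. (a \<bullet> D (lag X' (int (Suc 0)) \<omega>))\<^sup>2) \<in> borel_measurable M"
        by (rule borel_measurable_power[OF gM[unfolded g_def]])
    qed
    have gm2: "(\<lambda>z. (g (snd z))\<^sup>2) \<in> borel_measurable (borel \<Otimes>\<^sub>M lag_space)"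
      by (rule borel_measurable_power[OF measurable_compose[OF measurable_snd gm]])
    have "AE \<omega> in M. (\<lambda>n. (\<Sum>t=1..n. (g (lag X (int t) \<omega>))\<^sup>2) / n) \<longlonglongrightarrow> a \<bullet> (Fm *v a)"
      using ergodic_lag[OF gm2] integrable_D2[of a 0] by (simp add: Fm_quadratic g_def)
    then show "AE \<omega> in M. (\<lambda>n. (\<Sum>t<n. (a \<bullet> D (lag X' (int (Suc t)) \<omega>))\<^sup>2) / n) \<longlonglongrightarrow> a \<bullet> (Fm *v a)"
      using eqAE
    proof eventually_elim
      case (elim \<omega>)
      then show ?case by (simp only: g_def One_nat_def sum.atLeast1_atMost_eq)
    qed
  qed
qed

lemma Tn_AE_eq: "AE \<omega> in M. \<forall>n. a \<bullet> Tn n \<omega> = (\<Sum>t<n. (1 - (\<xi> (int (Suc t)) \<omega>)\<^sup>2) * (a \<bullet> D (lag X' (int (Suc t)) \<omega>))) / sqrt (real n)"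
proof -
  have "AE \<omega> in M. \<forall>t. score (X t \<omega>) \<theta>0 (lag X t \<omega>) = (1 - (\<xi> t \<omega>)\<^sup>2) *\<^sub>R D (lag X t \<omega>)"
    using score_at_\<theta>0 by (simp add: AE_all_countable)
  then show ?thesis using X_eq_X'
  proof eventually_elim
    case (elim \<omega>)
    have l: "lag X t \<omega> = lag X' t \<omega>" for t using elim(2) by (simp add: lag_def)
    show ?case
    proof
      fix n
      have "a \<bullet> Tn n \<omega> = (\<Sum>t=1..n. a \<bullet> score (X (int t) \<omega>) \<theta>0 (lag X (int t) \<omega>)) / sqrt (real n)"
        by (simp add: Tn_def inner_sum_right)
      also have "(\<Sum>t=1..n. a \<bullet> score (X (int t) \<omega>) \<theta>0 (lag X (int t) \<omega>))
         = (\<Sum>t=1..n. (1 - (\<xi> (int t) \<omega>)\<^sup>2) * (a \<bullet> D (lag X' (int t) \<omega>)))"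
        using elim(1) by (simp add: l)
      finally show "a \<bullet> Tn n \<omega> = (\<Sum>t<n. (1 - (\<xi> (int (Suc t)) \<omega>)\<^sup>2) * (a \<bullet> D (lag X' (int (Suc t)) \<omega>))) / sqrt (real n)"
        by (simp only: One_nat_def sum.atLeast1_atMost_eq)
    qed
  qed
qed

text \<open>Fixing a direction \<open>a\<close>, in the manner of Cramer and Wold, reduces the
  vector statement to the scalar limit theorem.\<close>

lemma Tn_char: "(\<lambda>n. CLINT \<omega>|M. iexp (a \<bullet> Tn n \<omega>)) \<longlonglongrightarrow> complex_of_real (exp (- (v\<eta> * (a \<bullet> (Fm *v a)) / 2)))"
proof -
  interpret m: martingale_difference M "\<lambda>n. past_algebra (int (Suc n))" "\<lambda>n \<omega>. a \<bullet> D (lag X' (int (Suc n)) \<omega>)"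
    "\<lambda>n \<omega>. 1 - (\<xi> (int (Suc n)) \<omega>)\<^sup>2" v\<eta> "a \<bullet> (Fm *v a)" by (rule score_martingale)
  have [measurable]: "(\<lambda>\<omega>. a \<bullet> D (lag X' (int (Suc t)) \<omega>)) \<in> borel_measurable M" for t by (rule m.d_M)
  have "(CLINT \<omega>|M. iexp (a \<bullet> Tn n \<omega>)) = (CLINT \<omega>|M. iexp ((\<Sum>t<n. (1 - (\<xi> (int (Suc t)) \<omega>)\<^sup>2) * (a \<bullet> D (lag X' (int (Suc t)) \<omega>))) / sqrt (real n)))" for n
  proof (rule integral_cong_AE)
    show "AE \<omega> in M. iexp (a \<bullet> Tn n \<omega>) = iexp ((\<Sum>t<n. (1 - (\<xi> (int (Suc t)) \<omega>)\<^sup>2) * (a \<bullet> D (lag X' (int (Suc t)) \<omega>))) / sqrt (real n))"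
      using Tn_AE_eq[of a] by eventually_elim simp
  qed measurable
  then show ?thesis using m.martingale_clt by simp
qed

lemma Tn_second_moment: "integrable M (\<lambda>\<omega>. (a \<bullet> Tn n \<omega>)\<^sup>2)" "expectation (\<lambda>\<omega>. (a \<bullet> Tn n \<omega>)\<^sup>2) \<le> v\<eta> * (a \<bullet> (Fm *v a))"
proof -
  interpret m: martingale_difference M "\<lambda>n. past_algebra (int (Suc n))" "\<lambda>n \<omega>. a \<bullet> D (lag X' (int (Suc n)) \<omega>)"
    "\<lambda>n \<omega>. 1 - (\<xi> (int (Suc n)) \<omega>)\<^sup>2" v\<eta> "a \<bullet> (Fm *v a)" by (rule score_martingale)
  have [measurable]: "(\<lambda>\<omega>. a \<bullet> D (lag X' (int (Suc t)) \<omega>)) \<in> borel_measurable M" for t by (rule m.d_M)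
  define S where "S = (\<lambda>\<omega>. \<Sum>t<n. (1 - (\<xi> (int (Suc t)) \<omega>)\<^sup>2) * (a \<bullet> D (lag X' (int (Suc t)) \<omega>)))"
  have [measurable]: "S \<in> borel_measurable M" unfolding S_def by measurable
  have ae: "AE \<omega> in M. (a \<bullet> Tn n \<omega>)\<^sup>2 = (S \<omega>)\<^sup>2 / real n"
    using Tn_AE_eq[of a] by eventually_elim (simp add: S_def power_divide)
  have e1: "expectation (\<lambda>\<omega>. (a \<bullet> D (lag X' (int (Suc 0)) \<omega>))\<^sup>2) = a \<bullet> (Fm *v a)"
  proof -
    have "expectation (\<lambda>\<omega>. (a \<bullet> D (lag X' (int (Suc 0)) \<omega>))\<^sup>2) = expectation (\<lambda>\<omega>. (a \<bullet> D (lag X (int (Suc 0)) \<omega>))\<^sup>2)"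
    proof (rule integral_cong_AE)
      show "AE \<omega> in M. (a \<bullet> D (lag X' (int (Suc 0)) \<omega>))\<^sup>2 = (a \<bullet> D (lag X (int (Suc 0)) \<omega>))\<^sup>2"
        using X_eq_X' by eventually_elim (simp add: lag_def)
    qed measurable
    also have "\<dots> = expectation (\<lambda>\<omega>. (a \<bullet> D (lag X 0 \<omega>))\<^sup>2)"
      using lag_stationary(2)[of "\<lambda>z. (a \<bullet> D (snd z))\<^sup>2" "int (Suc 0)"] by simp
    finally show ?thesis by (simp add: Fm_quadratic)
  qed
  have i: "integrable M (\<lambda>\<omega>. (S \<omega>)\<^sup>2)" using m.martingale_second_moment(1)[of n] by (simp add: S_def)
  have e: "expectation (\<lambda>\<omega>. (S \<omega>)\<^sup>2) = real n * (v\<eta> * (a \<bullet> (Fm *v a)))"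
    using m.martingale_second_moment(2)[of n] e1 by (simp add: S_def)
  show "integrable M (\<lambda>\<omega>. (a \<bullet> Tn n \<omega>)\<^sup>2)"
    by (subst integrable_cong_AE[OF _ _ ae]) (use i in auto)
  have "expectation (\<lambda>\<omega>. (a \<bullet> Tn n \<omega>)\<^sup>2) = expectation (\<lambda>\<omega>. (S \<omega>)\<^sup>2 / real n)"
    by (rule integral_cong_AE[OF _ _ ae]) measurable
  \<comment> \<open>For \<open>n = 0\<close> the left side is 0 by the convention for division by
    0.\<close>
  also have "\<dots> \<le> v\<eta> * (a \<bullet> (Fm *v a))"
    using e v\<eta>_nonneg Fm_psd[of a] by (cases "n = 0") auto
  finally show "expectation (\<lambda>\<omega>. (a \<bullet> Tn n \<omega>)\<^sup>2) \<le> v\<eta> * (a \<bullet> (Fm *v a))" .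
qed

end

text \<open>Tightness of \<open>Z\<close> is not needed: on the event \<open>norm (T n) \<le> K\<close> the equation itself bounds
  \<open>Z n\<close>.\<close>

lemma perturbed_linear_equation:
  fixes T Z :: "nat \<Rightarrow> real ^ 'd::finite" and A :: "nat \<Rightarrow> real ^ 'd \<Rightarrow> real ^ 'd" and F :: "real ^ 'd ^ 'd"
  assumes c: "c > 0" "\<And>z. c * norm z \<le> norm (F *v z)"
    and A: "\<And>e. e > 0 \<Longrightarrow> \<forall>\<^sub>F n in sequentially. \<forall>z. norm (A n z - F *v z) \<le> e * norm z"
    and R: "R \<longlonglongrightarrow> 0"
    and main: "\<And>e. e > 0 \<Longrightarrow> \<forall>\<^sub>F n in sequentially. norm (T n + A n (Z n)) \<le> R n + e * norm (Z n)"
  shows "(\<lambda>n. if norm (T n) \<le> K then norm (F *v Z n + T n) else 0) \<longlonglongrightarrow> 0"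
proof (rule tendstoI)
  fix \<epsilon> :: real assume \<epsilon>: "\<epsilon> > 0"
  define K' where "K' = \<bar>K\<bar> + 1"
  have K': "K' > 0" by (simp add: K'_def)
  \<comment> \<open>The first bound lets the term \<open>2 * e * z\<close> be absorbed by half of
    \<open>c * z\<close>, which gives \<open>z \<le> 2 * K' / c\<close>; the second then makes the
    final error \<open>2 * e * z\<close> at most \<open>\<epsilon> / 4\<close>.\<close>
  define e where "e = min (c / 4) (\<epsilon> * c / (16 * K'))"
  have e: "e > 0" "e \<le> c / 4" "e \<le> \<epsilon> * c / (16 * K')" using \<epsilon> c K' by (auto simp: e_def)
  have R1: "\<forall>\<^sub>F n in sequentially. R n < min 1 (\<epsilon> / 4)"
    by (rule order_tendstoD(2)[OF R]) (use \<epsilon> in simp)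
  show "\<forall>\<^sub>F n in sequentially. dist (if norm (T n) \<le> K then norm (F *v Z n + T n) else 0) 0 < \<epsilon>"
    using A[OF e(1)] main[OF e(1)] R1
  proof eventually_elim
    case (elim n)
    show ?case
    proof (cases "norm (T n) \<le> K")
      case True
      define z where "z = norm (Z n)"
      have z0: "z \<ge> 0" by (simp add: z_def)
      have "F *v Z n + T n = (T n + A n (Z n)) - (A n (Z n) - F *v Z n)" by simp
      then have "norm (F *v Z n + T n) \<le> norm (T n + A n (Z n)) + norm (A n (Z n) - F *v Z n)"
        by (simp only: norm_triangle_ineq4)
      also have "\<dots> \<le> (R n + e * z) + e * z" using elim(1,2) by (intro add_mono) (auto simp: z_def)
      finally have 1: "norm (F *v Z n + T n) \<le> R n + 2 * (e * z)" by simp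
      have "c * z \<le> norm (F *v Z n)" unfolding z_def by (rule c(2))
      also have "\<dots> \<le> norm (F *v Z n + T n) + norm (T n)" using norm_triangle_ineq4[of "F *v Z n + T n" "T n"] by simp
      finally have 2: "c * z \<le> R n + 2 * (e * z) + K" using 1 True by linarith
      have "e * z \<le> c / 4 * z" by (intro mult_right_mono e z0)
      then have "c * z \<le> 2 * K'" using 2 elim(3) by (simp add: K'_def abs_if split: if_splits)
      then have zb: "z \<le> 2 * K' / c" using c by (simp add: field_simps)
      have "e * z \<le> (\<epsilon> * c / (16 * K')) * (2 * K' / c)" using e zb z0 \<epsilon> c K' by (intro mult_mono) auto
      also have "\<dots> = \<epsilon> / 8" using c K' by (simp add: field_simps)
      finally have "norm (F *v Z n + T n) < \<epsilon>" using 1 elim(3) \<epsilon> by linarith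
      then show ?thesis using True by simp
    qed (use \<epsilon> in simp)
  qed
qed

text \<open>In finite dimension entrywise convergence controls the operator norm, here through the
  sum of the absolute entries. Uniformity in \<open>z\<close> matters because the estimator error is
  inserted for \<open>z\<close> at each \<open>n\<close>.\<close>

lemma linear_averages_uniform:
  fixes A :: "nat \<Rightarrow> real ^ 'd::finite \<Rightarrow> real ^ 'd" and F :: "real ^ 'd ^ 'd"
  assumes lin: "\<And>n. linear (A n)"
    and entries: "\<And>i j. (\<lambda>n. A n (axis j 1) $ i) \<longlonglongrightarrow> F $ i $ j" and e: "e > 0"
  shows "\<forall>\<^sub>F n in sequentially. \<forall>z. norm (A n z - F *v z) \<le> e * norm z"
proof -
  define c where "c = (\<lambda>n. \<Sum>i\<in>UNIV. \<Sum>j\<in>UNIV. \<bar>A n (axis j 1) $ i - F $ i $ j\<bar>)"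
  have "c \<longlonglongrightarrow> (\<Sum>i\<in>UNIV. \<Sum>j\<in>UNIV. \<bar>F $ i $ j - F $ i $ j\<bar>)"
    unfolding c_def by (intro tendsto_sum tendsto_rabs tendsto_diff tendsto_const entries)
  then have "c \<longlonglongrightarrow> 0" by simp
  from order_tendstoD(2)[OF this e] show ?thesis
  proof eventually_elim
    case (elim n)
    show ?case
    proof
      fix z
      have "A n z - F *v z = (matrix (A n) - F) *v z"
        using matrix_works[of "A n" z] lin[of n] by (simp add: matrix_vector_mult_diff_rdistrib)
      also have "norm \<dots> \<le> c n * norm z"
        unfolding c_def by (rule norm_matrix_vector_le) (simp add: matrix_def)
      also have "\<dots> \<le> e * norm z" using elim by (intro mult_right_mono) auto
      finally show "norm (A n z - F *v z) \<le> e * norm z" .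
    qed
  qed
qed

context tarch_normal
begin

text \<open>The price of replacing the unobserved past by \<open>u\<close>. Decay rates above \<open>3/2\<close> are what
  makes it summable against \<open>1 / sqrt n\<close>.\<close>

definition trunc_err :: "nat \<Rightarrow> 'a \<Rightarrow> real" where
  "trunc_err n \<omega> = Kqf b * (1 + (X (int (Suc n)) \<omega>)\<^sup>2)
     * (\<Delta> \<gamma> (Suc n) \<omega> + \<Delta> \<beta> (Suc n) \<omega> * B (lag X (int (Suc n)) \<omega>))"

lemma lag_diff_summable:
  assumes "\<And>j. w j \<ge> 0" "summable (\<lambda>j. w j * \<bar>lag X (int (Suc n)) \<omega> j\<bar>)"
  shows "\<Delta> w (Suc n) \<omega> \<ge> 0"
proof -
  have "summable (\<lambda>j. w j * \<bar>lag X (int (Suc n)) \<omega> j - laghat (Suc n) \<omega> j\<bar>)"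
  proof (rule summable_comparison_test'[OF summable_add[OF assms(2) laghat_summable[of "Suc n" w \<omega>]], of 0])
    fix j
    have "w j * \<bar>lag X (int (Suc n)) \<omega> j - laghat (Suc n) \<omega> j\<bar> \<le> w j * (\<bar>lag X (int (Suc n)) \<omega> j\<bar> + \<bar>laghat (Suc n) \<omega> j\<bar>)"
      using assms(1) by (intro mult_left_mono) auto
    then show "norm (w j * \<bar>lag X (int (Suc n)) \<omega> j - laghat (Suc n) \<omega> j\<bar>) \<le> w j * \<bar>lag X (int (Suc n)) \<omega> j\<bar> + w j * \<bar>laghat (Suc n) \<omega> j\<bar>"
      using assms(1)[of j] by (simp add: distrib_left)
  qed simp
  then show ?thesis unfolding \<Delta>_def by (intro wsum_nonneg assms(1))
qed

lemma trunc_err_bound: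
  assumes "good (lag X (int (Suc n)) \<omega>)"
  shows "trunc_err n \<omega> \<ge> 0"
    and "\<theta> \<in> \<Theta> \<Longrightarrow> norm (score (X (int (Suc n)) \<omega>) \<theta> (laghat (Suc n) \<omega>) - score (X (int (Suc n)) \<omega>) \<theta> (lag X (int (Suc n)) \<omega>)) \<le> trunc_err n \<omega>"
proof -
  have "B (lag X (int (Suc n)) \<omega>) \<ge> 0" using B_ge_1[OF assms] by simp
  then show "trunc_err n \<omega> \<ge> 0"
    unfolding trunc_err_def
    using lag_diff_summable[OF \<gamma>_nonneg good_\<gamma>(1)[OF assms]] lag_diff_summable[OF \<beta>_nonneg good_\<beta>(1)[OF assms]] Kqf_nonneg
    by (intro mult_nonneg_nonneg add_nonneg_nonneg) auto
  have "good (laghat (Suc n) \<omega>)" unfolding good_def by (rule laghat_summable) simp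
  then show "\<theta> \<in> \<Theta> \<Longrightarrow> norm (score (X (int (Suc n)) \<omega>) \<theta> (laghat (Suc n) \<omega>) - score (X (int (Suc n)) \<omega>) \<theta> (lag X (int (Suc n)) \<omega>)) \<le> trunc_err n \<omega>"
    unfolding trunc_err_def \<Delta>_def by (intro score_diff_seq assms)
qed

lemma laghat_measurable [measurable]: "(\<lambda>\<omega>. laghat t \<omega> j) \<in> borel_measurable M"
  unfolding laghat_def past_hat_def by measurable

lemma trunc_err_measurable [measurable]: "trunc_err n \<in> borel_measurable M"
  unfolding trunc_err_def \<Delta>_def by measurable

lemma dev_fourth_moment: "\<exists>K. \<forall>i. integrable M (\<lambda>\<omega>. dev i \<omega> ^ 4) \<and> expectation (\<lambda>\<omega>. dev i \<omega> ^ 4) \<le> K"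
proof -
  obtain V where V: "V \<ge> 0" "\<And>i. \<bar>u i\<bar> \<le> V" using u_bounded by blast
  have st: "expectation (\<lambda>\<omega>. (X s \<omega>) ^ 4) = expectation (\<lambda>\<omega>. (X 0 \<omega>) ^ 4)" for s
    using lag_stationary(2)[of "\<lambda>z. (fst z) ^ 4" s] by simp
  have le: "dev i \<omega> ^ 4 \<le> 8 * (X (- int i) \<omega>) ^ 4 + 8 * V ^ 4" for i \<omega>
  proof -
    have "dev i \<omega> ^ 4 = (X (- int i) \<omega> + - u (Suc i)) ^ 4" by (simp add: dev_def)
    also have "\<dots> \<le> 8 * (X (- int i) \<omega>) ^ 4 + 8 * (- u (Suc i)) ^ 4" by (rule add_power4_le)
    also have "(- u (Suc i)) ^ 4 = \<bar>u (Suc i)\<bar> ^ 4" by simp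
    also have "\<dots> \<le> V ^ 4" by (intro power_mono V) simp
    finally show ?thesis by simp
  qed
  have int: "integrable M (\<lambda>\<omega>. dev i \<omega> ^ 4)" for i
  proof (rule Bochner_Integration.integrable_bound)
    show "integrable M (\<lambda>\<omega>. 8 * (X (- int i) \<omega>) ^ 4 + 8 * V ^ 4)" using int_X4 by simp
    show "AE \<omega> in M. norm (dev i \<omega> ^ 4) \<le> norm (8 * (X (- int i) \<omega>) ^ 4 + 8 * V ^ 4)"
      by (rule AE_I2) (use le[of i] in \<open>auto simp: dev_def intro: order_trans[OF _ abs_ge_self]\<close>)
  qed measurable
  have "expectation (\<lambda>\<omega>. dev i \<omega> ^ 4) \<le> 8 * expectation (\<lambda>\<omega>. (X 0 \<omega>) ^ 4) + 8 * V ^ 4" for i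
  proof -
    have "expectation (\<lambda>\<omega>. dev i \<omega> ^ 4) \<le> expectation (\<lambda>\<omega>. 8 * (X (- int i) \<omega>) ^ 4 + 8 * V ^ 4)"
      by (rule integral_mono) (use int int_X4 le in auto)
    also have "\<dots> = 8 * expectation (\<lambda>\<omega>. (X 0 \<omega>) ^ 4) + 8 * V ^ 4"
      using int_X4 st by (simp add: prob_space)
    finally show ?thesis .
  qed
  then show ?thesis using int by blast
qed

text \<open>Young's inequality twice: the three factors may be dependent, so the product is replaced
  by a sum of quantities with known fourth moments.\<close>

lemma product_le_env: "(1 + x\<^sup>2) * (B y * d) \<le> env (x, y) + d ^ 4"
proof -
  have 1: "p * q \<le> p\<^sup>2 + q\<^sup>2" for p q :: real
    using sum_squares_bound[of p q] zero_le_power2[of p] zero_le_power2[of q] by linarith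
  have "(1 + x\<^sup>2) * (B y * d) \<le> (1 + x\<^sup>2)\<^sup>2 + (B y * d)\<^sup>2" by (rule 1)
  also have "(B y * d)\<^sup>2 = (B y)\<^sup>2 * d\<^sup>2" by (rule power_mult_distrib)
  also have "\<dots> \<le> ((B y)\<^sup>2)\<^sup>2 + (d\<^sup>2)\<^sup>2" by (rule 1)
  finally show ?thesis by (simp add: env_def flip: power_mult)
qed

text \<open>The expectation of the whole series is finite. By \<open>\<Delta>_eq\<close> the error
  at step \<open>n\<close> is a series with weights \<open>w (i + n)\<close>, its terms have
  uniformly bounded expectation, and the tail sums of \<open>w\<close> divided by
  \<open>sqrt n\<close> are summable.\<close>

lemma trunc_err_summable: "AE \<omega> in M. summable (\<lambda>n. trunc_err n \<omega> / sqrt (real (Suc n)))"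
proof -
  define w where "w = (\<lambda>j. \<beta> j + \<gamma> j)"
  have w: "w j \<ge> 0" for j using \<beta>_nonneg \<gamma>_nonneg by (simp add: w_def add_nonneg_nonneg)
  have ws: "summable w" unfolding w_def by (intro summable_add \<beta>_summable \<gamma>_summable)
  have wss: "summable (\<lambda>j. sqrt (real (Suc j)) * w j)"
    using summable_add[OF \<beta>_sqrt_summable \<gamma>_sqrt_summable] by (simp add: w_def distrib_left)
  obtain K0 where K0: "\<And>i. integrable M (\<lambda>\<omega>. dev i \<omega> ^ 4)" "\<And>i. expectation (\<lambda>\<omega>. dev i \<omega> ^ 4) \<le> K0"
    using dev_fourth_moment by blast
  define e where "e = expectation (\<lambda>\<omega>. env (X 0 \<omega>, lag X 0 \<omega>))"
  have ee: "expectation (\<lambda>\<omega>. env (X t \<omega>, lag X t \<omega>)) = e" for t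
    unfolding e_def by (rule lag_stationary(2)[OF env_measurable])
  define K where "K = e + K0"
  have Ki: "expectation (\<lambda>\<omega>. env (X t \<omega>, lag X t \<omega>) + dev i \<omega> ^ 4) \<le> K" for t i
    using K0 integrable_env[of t] ee[of t] by (simp add: K_def)
  have nn: "env (X t \<omega>, lag X t \<omega>) + dev i \<omega> ^ 4 \<ge> 0" for t i \<omega>
    using env_nonneg by (simp add: add_nonneg_nonneg)
  have K: "K \<ge> 0" by (rule order_trans[OF _ Ki[of 0 0]]) (intro integral_nonneg_AE, use nn in auto)
  have [measurable]: "(\<lambda>\<omega>. env (X t \<omega>, lag X t \<omega>)) \<in> borel_measurable M" for t
    using integrable_env[of t] by (rule borel_measurable_integrable)
  have sd: "AE \<omega> in M. \<forall>n. summable (\<lambda>i. \<beta> (i + n) * dev i \<omega>) \<and> summable (\<lambda>i. \<gamma> (i + n) * dev i \<omega>)"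
    unfolding AE_all_countable
    using AE_summable_dev[of "\<lambda>i. \<beta> (i + n)" for n] AE_summable_dev[of "\<lambda>i. \<gamma> (i + n)" for n]
      summable_ignore_initial_segment[OF \<beta>_summable] summable_ignore_initial_segment[OF \<gamma>_summable] \<beta>_nonneg \<gamma>_nonneg
    by (intro allI AE_conjI) auto
  have step: "(\<integral>\<^sup>+\<omega>. ennreal (trunc_err n \<omega> / sqrt (real (Suc n))) \<partial>M) \<le> ennreal (Kqf b * K) * ennreal ((\<Sum>i. w (i + n)) / sqrt (real (Suc n)))" for n
  proof -
    let ?s = "sqrt (real (Suc n))"
    let ?q = "\<lambda>i \<omega>. env (X (int (Suc n)) \<omega>, lag X (int (Suc n)) \<omega>) + dev i \<omega> ^ 4"
    have "(\<integral>\<^sup>+\<omega>. ennreal (trunc_err n \<omega> / ?s) \<partial>M) \<le> (\<integral>\<^sup>+\<omega>. (\<Sum>i. ennreal (Kqf b / ?s * w (i + n) * ?q i \<omega>)) \<partial>M)"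
    proof (rule nn_integral_mono_AE)
      show "AE \<omega> in M. ennreal (trunc_err n \<omega> / ?s) \<le> (\<Sum>i. ennreal (Kqf b / ?s * w (i + n) * ?q i \<omega>))"
        using sd AE_good'
      proof eventually_elim
        case (elim \<omega>)
        define x where "x = X (int (Suc n)) \<omega>"
        define y where "y = lag X (int (Suc n)) \<omega>"
        have y: "B y \<ge> 1" using B_ge_1 elim(2) by (simp add: y_def)
        have d0: "dev i \<omega> \<ge> 0" for i by (simp add: dev_def)
        have sb: "summable (\<lambda>i. \<beta> (i + n) * dev i \<omega>)" and sg: "summable (\<lambda>i. \<gamma> (i + n) * dev i \<omega>)" using elim(1) by blast+
        have sw: "summable (\<lambda>i. w (i + n) * dev i \<omega>)"
          using summable_add[OF sb sg] by (simp add: w_def distrib_right)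
        have D\<gamma>: "\<Delta> \<gamma> (Suc n) \<omega> \<ge> 0" unfolding \<Delta>_eq[OF sg] by (intro suminf_nonneg sg mult_nonneg_nonneg \<gamma>_nonneg d0)
        have eqw: "\<Delta> \<gamma> (Suc n) \<omega> + \<Delta> \<beta> (Suc n) \<omega> = (\<Sum>i. w (i + n) * dev i \<omega>)"
          unfolding \<Delta>_eq[OF sg] \<Delta>_eq[OF sb] suminf_add[OF sg sb] by (simp add: w_def distrib_right add.commute)
        \<comment> \<open>As \<open>B y \<ge> 1\<close>, the gradient discrepancy may also be
          multiplied by \<open>B y\<close>; both discrepancies then merge into a single series with
          weights \<open>w\<close>.\<close>
        have "trunc_err n \<omega> \<le> Kqf b * (1 + x\<^sup>2) * (\<Delta> \<gamma> (Suc n) \<omega> * B y + \<Delta> \<beta> (Suc n) \<omega> * B y)"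
          unfolding trunc_err_def x_def[symmetric] y_def[symmetric]
          using mult_left_mono[OF y D\<gamma>] Kqf_nonneg by (intro mult_left_mono add_mono order_refl) auto
        also have "\<dots> = Kqf b * (1 + x\<^sup>2) * B y * (\<Sum>i. w (i + n) * dev i \<omega>)"
          unfolding eqw[symmetric] by (simp add: algebra_simps)
        finally have "trunc_err n \<omega> / ?s \<le> Kqf b * (1 + x\<^sup>2) * B y * (\<Sum>i. w (i + n) * dev i \<omega>) / ?s"
          by (rule divide_right_mono) simp
        also have "\<dots> = Kqf b * (1 + x\<^sup>2) * B y / ?s * (\<Sum>i. w (i + n) * dev i \<omega>)" by simp
        also have "\<dots> = (\<Sum>i. Kqf b * (1 + x\<^sup>2) * B y / ?s * (w (i + n) * dev i \<omega>))"
          by (rule suminf_mult[OF sw, symmetric])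
        finally have "ennreal (trunc_err n \<omega> / ?s) \<le> ennreal (\<Sum>i. Kqf b * (1 + x\<^sup>2) * B y / ?s * (w (i + n) * dev i \<omega>))"
          by (rule ennreal_leI)
        also have "\<dots> = (\<Sum>i. ennreal (Kqf b * (1 + x\<^sup>2) * B y / ?s * (w (i + n) * dev i \<omega>)))"
          by (rule suminf_ennreal2[symmetric, OF _ summable_mult[OF sw]])
             (use Kqf_nonneg y w d0 in \<open>auto intro!: mult_nonneg_nonneg divide_nonneg_nonneg\<close>)
        also have "\<dots> \<le> (\<Sum>i. ennreal (Kqf b / ?s * w (i + n) * ?q i \<omega>))"
        proof (intro suminf_le ennreal_leI)
          fix i
          have "Kqf b / ?s * w (i + n) * ((1 + x\<^sup>2) * (B y * dev i \<omega>)) \<le> Kqf b / ?s * w (i + n) * ?q i \<omega>"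
            unfolding x_def y_def by (intro mult_left_mono product_le_env mult_nonneg_nonneg divide_nonneg_nonneg w Kqf_nonneg) auto
          then show "Kqf b * (1 + x\<^sup>2) * B y / ?s * (w (i + n) * dev i \<omega>) \<le> Kqf b / ?s * w (i + n) * ?q i \<omega>"
            by (simp add: mult_ac)
        qed auto
        finally show ?case .
      qed
    qed
    also have "\<dots> = (\<Sum>i. \<integral>\<^sup>+\<omega>. ennreal (Kqf b / ?s * w (i + n) * ?q i \<omega>) \<partial>M)"
      by (rule nn_integral_suminf) measurable
    also have "\<dots> \<le> (\<Sum>i. ennreal (Kqf b * K / ?s * w (i + n)))"
    proof (intro suminf_le)
      fix i
      have c: "Kqf b / ?s * w (i + n) \<ge> 0" by (intro mult_nonneg_nonneg divide_nonneg_nonneg w Kqf_nonneg) auto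
      have "(\<integral>\<^sup>+\<omega>. ennreal (Kqf b / ?s * w (i + n) * ?q i \<omega>) \<partial>M) = ennreal (expectation (\<lambda>\<omega>. Kqf b / ?s * w (i + n) * ?q i \<omega>))"
        by (rule nn_integral_eq_integral[OF _ AE_I2[OF mult_nonneg_nonneg[OF c nn]]]) (use integrable_env K0 in simp)
      also have "\<dots> \<le> ennreal (Kqf b * K / ?s * w (i + n))"
        using mult_left_mono[OF Ki[of "int (Suc n)" i] c] by (intro ennreal_leI) (simp add: mult_ac)
      finally show "(\<integral>\<^sup>+\<omega>. ennreal (Kqf b / ?s * w (i + n) * ?q i \<omega>) \<partial>M) \<le> ennreal (Kqf b * K / ?s * w (i + n))" .
    qed auto
    also have "\<dots> = ennreal (\<Sum>i. Kqf b * K / ?s * w (i + n))"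
      by (rule suminf_ennreal2)
         (use w K Kqf_nonneg in \<open>simp\<close>, rule summable_mult[OF summable_ignore_initial_segment[OF ws]])
    also have "(\<Sum>i. Kqf b * K / ?s * w (i + n)) = Kqf b * K * ((\<Sum>i. w (i + n)) / ?s)"
      using suminf_mult[OF summable_ignore_initial_segment[OF ws, of n], of "Kqf b * K / ?s"] by simp
    also have "ennreal \<dots> = ennreal (Kqf b * K) * ennreal ((\<Sum>i. w (i + n)) / ?s)"
      by (rule ennreal_mult) (use K Kqf_nonneg w summable_ignore_initial_segment[OF ws] in \<open>auto intro!: divide_nonneg_nonneg suminf_nonneg\<close>)
    finally show ?thesis .
  qed
  have "(\<integral>\<^sup>+\<omega>. (\<Sum>n. ennreal (trunc_err n \<omega> / sqrt (real (Suc n)))) \<partial>M) = (\<Sum>n. \<integral>\<^sup>+\<omega>. ennreal (trunc_err n \<omega> / sqrt (real (Suc n))) \<partial>M)"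
    by (rule nn_integral_suminf) measurable
  also have "\<dots> \<le> (\<Sum>n. ennreal (Kqf b * K) * ennreal ((\<Sum>i. w (i + n)) / sqrt (real (Suc n))))"
    by (intro suminf_le step) auto
  also have "\<dots> = ennreal (Kqf b * K) * (\<Sum>n. ennreal ((\<Sum>i. w (i + n)) / sqrt (real (Suc n))))"
    by (rule ennreal_suminf_cmult)
  also have "\<dots> < \<infinity>" using tail_sums_weighted[OF w ws wss] by (simp add: ennreal_mult_less_top)
  finally have "AE \<omega> in M. (\<Sum>n. ennreal (trunc_err n \<omega> / sqrt (real (Suc n)))) \<noteq> \<infinity>"
    by (intro nn_integral_PInf_AE) auto
  then show ?thesis using AE_good'
  proof eventually_elim
    case (elim \<omega>)
    show ?case
      by (rule summable_suminf_not_top) (use elim trunc_err_bound(1) in auto)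
  qed
qed

text \<open>A minimiser over \<open>\<Theta>\<close> that lies in the open set \<open>U\<close> is a
  local minimiser, so the gradient of the truncated contrast vanishes there.\<close>

lemma score_hat_zero:
  assumes q: "is_QMLE M b0 bp bm u X \<Theta> \<theta>hat" and \<omega>: "\<omega> \<in> space M" and n: "n \<ge> 1" and U: "\<theta>hat n \<omega> \<in> U"
  shows "(\<Sum>t=1..n. score (X (int t) \<omega>) (\<theta>hat n \<omega>) (laghat t \<omega>)) = 0"
proof -
  let ?s = "\<Sum>t=1..n. score (X (int t) \<omega>) (\<theta>hat n \<omega>) (laghat t \<omega>)"
  have "(Qhat n \<omega> has_derivative (\<lambda>v. \<Sum>t=1..n. score (X (int t) \<omega>) (\<theta>hat n \<omega>) (laghat t \<omega>) \<bullet> v)) (at (\<theta>hat n \<omega>))"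
    unfolding Qhat_def[abs_def]
  proof (intro has_derivative_sum qf_vol_has_derivative U)
    fix t assume "t \<in> {1..n}"
    then show "good (laghat t \<omega>)" unfolding good_def by (intro laghat_summable) simp
  qed
  then have "(Qhat n \<omega> has_derivative (\<lambda>v. ?s \<bullet> v)) (at (\<theta>hat n \<omega>))" by (simp add: inner_sum_left)
  then have "(\<lambda>v. ?s \<bullet> v) = (\<lambda>v. 0)"
    by (rule differential_zero_maxmin[OF U U_props(1)])
       (use QMLE_minimises_Qhat(2)[OF q \<omega> n] U_props in blast)
  then have "?s \<bullet> ?s = 0" by meson
  then show ?thesis by simp
qed

text \<open>The exact zero of the truncated score is rewritten as a linear equation for the scaled
  error; what remains is the truncation error and the expansion error, the latter proportional to
  the scaled error itself.\<close>

lemma score_equation: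
  assumes q: "is_QMLE M b0 bp bm u X \<Theta> \<theta>hat" and \<omega>: "\<omega> \<in> space M" and n: "n \<ge> 1" and U: "\<theta>hat n \<omega> \<in> U"
    and k: "dist \<theta>0 (\<theta>hat n \<omega>) \<le> inverse (real (Suc k))" and good: "\<And>t. good (lag X t \<omega>)"
  shows "norm (Tn n \<omega> + (1 / real n) *\<^sub>R (\<Sum>t=1..n. jac (X (int t) \<omega>) (lag X (int t) \<omega>) (sqrt (real n) *\<^sub>R (\<theta>hat n \<omega> - \<theta>0))))
    \<le> (\<Sum>m<n. trunc_err m \<omega>) / sqrt (real n)
      + (\<Sum>t=1..n. smod k (X (int t) \<omega>, lag X (int t) \<omega>)) / real n * norm (sqrt (real n) *\<^sub>R (\<theta>hat n \<omega> - \<theta>0))"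
proof -
  define \<theta> where "\<theta> = \<theta>hat n \<omega>"
  define x where "x = (\<lambda>t. X (int t) \<omega>)"
  define y where "y = (\<lambda>t. lag X (int t) \<omega>)"
  define S where "S = (\<Sum>t=1..n. score (x t) \<theta>0 (y t) + jac (x t) (y t) (\<theta> - \<theta>0))"
  have s: "sqrt (real n) > 0" using n by simp
  \<comment> \<open>\<open>trunc_err m\<close> belongs to time \<open>m + 1\<close>.\<close>
  have tr: "(\<Sum>t=1..n. trunc_err (t - 1) \<omega>) = (\<Sum>m<n. trunc_err m \<omega>)"
    unfolding One_nat_def sum.atLeast1_atMost_eq by (rule sum.cong) auto
  have gy: "good (y t)" for t using good by (simp add: y_def)
  have U\<Theta>: "\<theta> \<in> \<Theta>" using U U_props by (auto simp: \<theta>_def)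
  have z: "(\<Sum>t=1..n. score (x t) \<theta> (laghat t \<omega>)) = 0"
    unfolding x_def \<theta>_def by (rule score_hat_zero[OF q \<omega> n U])
  \<comment> \<open>The truncated score sum, which is zero, is inserted so that the rest consists of
    truncation differences and expansion remainders only.\<close>
  have Seq: "S = (\<Sum>t=1..n. (score (x t) \<theta> (y t) - score (x t) \<theta> (laghat t \<omega>)) - (score (x t) \<theta> (y t) - score (x t) \<theta>0 (y t) - jac (x t) (y t) (\<theta> - \<theta>0)))
      + (\<Sum>t=1..n. score (x t) \<theta> (laghat t \<omega>))"
    unfolding S_def sum.distrib[symmetric] by (rule sum.cong) auto
  have "norm S \<le> (\<Sum>t=1..n. trunc_err (t - 1) \<omega> + norm (\<theta> - \<theta>0) * smod k (x t, y t))"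
    unfolding Seq z add_0_right
  proof (rule sum_norm_le)
    fix t assume t: "t \<in> {1..n}"
    then have St: "Suc (t - 1) = t" by simp
    have "norm (score (x t) \<theta> (y t) - score (x t) \<theta> (laghat t \<omega>)) \<le> trunc_err (t - 1) \<omega>"
      using trunc_err_bound(2)[of "t - 1" \<omega> \<theta>, OF good U\<Theta>] unfolding St x_def y_def by (subst norm_minus_commute)
    moreover have "norm (score (x t) \<theta> (y t) - score (x t) \<theta>0 (y t) - jac (x t) (y t) (\<theta> - \<theta>0)) \<le> norm (\<theta> - \<theta>0) * smod k (x t, y t)"
      by (rule score_expansion[OF _ _ gy]) (use U k in \<open>auto simp: \<theta>_def\<close>)
    ultimately show "norm ((score (x t) \<theta> (y t) - score (x t) \<theta> (laghat t \<omega>)) - (score (x t) \<theta> (y t) - score (x t) \<theta>0 (y t) - jac (x t) (y t) (\<theta> - \<theta>0)))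
       \<le> trunc_err (t - 1) \<omega> + norm (\<theta> - \<theta>0) * smod k (x t, y t)"
      by (rule order_trans[OF norm_triangle_ineq4 add_mono])
  qed
  also have "\<dots> = (\<Sum>m<n. trunc_err m \<omega>) + norm (\<theta> - \<theta>0) * (\<Sum>t=1..n. smod k (x t, y t))"
    using tr by (simp only: sum.distrib sum_distrib_left)
  finally have S: "norm S \<le> (\<Sum>m<n. trunc_err m \<omega>) + norm (\<theta> - \<theta>0) * (\<Sum>t=1..n. smod k (x t, y t))" .
  have c: "1 / real n * sqrt (real n) = 1 / sqrt (real n)"
    using sqrt_divide_self_eq[of "real n"] by (simp add: inverse_eq_divide)
  have j: "jac (x t) (y t) (sqrt (real n) *\<^sub>R (\<theta> - \<theta>0)) = sqrt (real n) *\<^sub>R jac (x t) (y t) (\<theta> - \<theta>0)" for t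
    by (rule linear_scale[OF linear_jac[OF gy]])
  have "Tn n \<omega> + (1 / real n) *\<^sub>R (\<Sum>t=1..n. jac (x t) (y t) (sqrt (real n) *\<^sub>R (\<theta> - \<theta>0))) = (1 / sqrt (real n)) *\<^sub>R S"
  proof -
    show ?thesis
      unfolding j Tn_def S_def sum.distrib scaleR_add_right scaleR_sum_right[symmetric] scaleR_scaleR c by (simp add: x_def y_def)
  qed
  moreover have "norm ((1 / sqrt (real n)) *\<^sub>R S) \<le> ((\<Sum>m<n. trunc_err m \<omega>) + norm (\<theta> - \<theta>0) * (\<Sum>t=1..n. smod k (x t, y t))) / sqrt (real n)"
    using divide_right_mono[OF S, of "sqrt (real n)"] s by simp
  moreover have "norm (\<theta> - \<theta>0) * sm / sqrt (real n) = sm / real n * norm (sqrt (real n) *\<^sub>R (\<theta> - \<theta>0))" for sm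
  proof -
    have "sm / real n * norm (sqrt (real n) *\<^sub>R (\<theta> - \<theta>0)) = (1 / real n * sqrt (real n)) * (norm (\<theta> - \<theta>0) * sm)" by simp
    then show ?thesis unfolding c by simp
  qed
  ultimately show ?thesis unfolding \<theta>_def x_def y_def by (simp add: add_divide_distrib)
qed

text \<open>\<open>Fm\<close> is injective, hence bounded below by some \<open>c > 0\<close>. All
  averages involved converge outside one null set, since only finitely many matrix entries and
  countably many radii occur; after that the argument is deterministic on each path.\<close>

lemma linearised_equation:
  assumes q: "is_QMLE M b0 bp bm u X \<Theta> \<theta>hat"
  shows "AE \<omega> in M. \<forall>K. (\<lambda>n. if norm (Tn n \<omega>) \<le> K then norm (Fm *v (sqrt (real n) *\<^sub>R (\<theta>hat n \<omega> - \<theta>0)) + Tn n \<omega>) else 0) \<longlonglongrightarrow> 0"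
proof -
  have inj: "inj ((*v) Fm)"
    unfolding linear_injective_0[OF matrix_vector_mul_linear] using Fm_definite by blast
  obtain c where c: "c > 0" "\<And>z. c * norm z \<le> norm (Fm *v z)"
    using linear_inj_bounded_below_pos[OF matrix_vector_mul_linear inj] by metis
  have ja: "AE \<omega> in M. \<forall>i j. (\<lambda>n. (\<Sum>t=1..n. jac (X (int t) \<omega>) (lag X (int t) \<omega>) (axis j 1) $ i) / real n) \<longlonglongrightarrow> Fm $ i $ j"
    unfolding AE_all_countable
    using ergodic_lag[OF jac_entry_measurable[of "axis j 1" i for i j]] integrable_jac_entry[of 0] expectation_jac by simp
  have sa: "AE \<omega> in M. \<forall>k. (\<lambda>n. (\<Sum>t=1..n. smod k (X (int t) \<omega>, lag X (int t) \<omega>)) / real n) \<longlonglongrightarrow> expectation (\<lambda>\<omega>. smod k (X 0 \<omega>, lag X 0 \<omega>))"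
    unfolding AE_all_countable using ergodic_lag[OF smod_measurable smod_expectation(1)] by blast
  show ?thesis using strong_consistency[OF q] AE_space AE_good' ja sa trunc_err_summable
  proof eventually_elim
    case (elim \<omega>)
    note cons = elim(1) and \<omega> = elim(2) and good = elim(3)[rule_format] and ja = elim(4)[rule_format] and sa = elim(5)[rule_format]
    define A where "A = (\<lambda>n z. (1 / real n) *\<^sub>R (\<Sum>t=1..n. jac (X (int t) \<omega>) (lag X (int t) \<omega>) z))"
    define R where "R = (\<lambda>n. (\<Sum>m<n. trunc_err m \<omega>) / sqrt (real n))"
    have "R \<longlonglongrightarrow> 0" unfolding R_def by (rule kronecker_sqrt[OF trunc_err_bound(1)[OF good] elim(6)])
    show ?case
    proof (intro allI perturbed_linear_equation[OF c _ \<open>R \<longlonglongrightarrow> 0\<close>, of A])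
      fix e :: real assume e: "e > 0"
      show "\<forall>\<^sub>F n in sequentially. \<forall>z. norm (A n z - Fm *v z) \<le> e * norm z"
      proof (rule linear_averages_uniform[OF _ _ e])
        show "linear (A n)" for n
          unfolding A_def by (intro linear_compose_scale_right linear_compose_sum ballI linear_jac good)
        show "(\<lambda>n. A n (axis j 1) $ i) \<longlonglongrightarrow> Fm $ i $ j" for i j using ja[of j i] by (simp add: A_def)
      qed
      \<comment> \<open>For each \<open>e\<close> a radius with mean remainder below
        \<open>e\<close> is fixed; consistency puts the estimator inside it eventually.\<close>
      obtain k where k: "expectation (\<lambda>\<omega>. smod k (X 0 \<omega>, lag X 0 \<omega>)) < e"
        using order_tendstoD(2)[OF smod_expectation(2) e] unfolding eventually_sequentially by blast
      have "\<forall>\<^sub>F n in sequentially. dist (\<theta>hat n \<omega>) \<theta>0 < inverse (real (Suc k))" by (rule tendstoD[OF cons]) simp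
      then show "\<forall>\<^sub>F n in sequentially. norm (Tn n \<omega> + A n (sqrt (real n) *\<^sub>R (\<theta>hat n \<omega> - \<theta>0))) \<le> R n + e * norm (sqrt (real n) *\<^sub>R (\<theta>hat n \<omega> - \<theta>0))"
        using topological_tendstoD[OF cons U_props(1,3)] eventually_ge_at_top[of 1] order_tendstoD(2)[OF sa k]
      proof eventually_elim
        case (elim n)
        have "dist \<theta>0 (\<theta>hat n \<omega>) \<le> inverse (real (Suc k))" using elim(1) by (simp add: dist_commute)
        from score_equation[OF q \<omega> elim(3,2) this good]
        show ?case unfolding A_def R_def
          by (rule order_trans) (intro add_left_mono mult_right_mono less_imp_le[OF elim(4)] norm_ge_zero)
      qed
    qed
  qed
qed

text \<open>The limit is carried by \<open>W = - N Tn\<close> with \<open>N\<close> the inverse of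
  \<open>Fm\<close>. Since \<open>G\<close> is \<open>v\<eta>\<close> times \<open>Fm\<close>, the
  sandwich matrix acts as \<open>v\<eta>\<close> times \<open>N\<close>. The scaled error differs
  from \<open>W\<close> by \<open>N\<close> applied to the left side of the linearised
  equation.\<close>

theorem asymptotic_normality:
  assumes q: "is_QMLE M b0 bp bm u X \<Theta> \<theta>hat" and meas: "\<And>n. \<theta>hat n \<in> borel_measurable M"
  shows "\<exists>\<nu>. mvnormal_law 0 (matrix_inv Fm ** (v\<eta> *\<^sub>R Fm) ** matrix_inv Fm) \<nu> \<and>
    converges_in_law M (\<lambda>n \<omega>. sqrt (real n) *\<^sub>R (\<theta>hat n \<omega> - \<theta>0)) \<nu>"
proof -
  define N where "N = matrix_inv Fm"
  define S where "S = N ** (v\<eta> *\<^sub>R Fm) ** N"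
  define W where "W = (\<lambda>n \<omega>. - (N *v Tn n \<omega>))"
  have inv: "Fm ** N = mat 1" "N ** Fm = mat 1"
    using someI_ex[OF Fm_invertible[unfolded invertible_def], folded matrix_inv_def] unfolding N_def by blast+
  have Ft: "transpose Fm = Fm" by (simp add: transpose_def vec_eq_iff Fm_sym)
  have Fsym: "x \<bullet> (Fm *v y) = (Fm *v x) \<bullet> y" for x y
    using dot_lmul_matrix[of x Fm y] Ft by (metis transpose_matrix_vector)
  have FN: "Fm *v (N *v x) = x" and NF: "N *v (Fm *v x) = x" for x
    by (simp_all add: matrix_vector_mul_assoc inv)
  have Fneg: "Fm *v (- x) = - (Fm *v x)" for x by (rule linear_neg[OF matrix_vector_mul_linear])
  have Nsym: "x \<bullet> (N *v y) = (N *v x) \<bullet> y" for x y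
    using Fsym[of "N *v x" "N *v y"] FN by simp
  have Sv: "S *v x = v\<eta> *\<^sub>R (N *v x)" for x
  proof -
    have "S *v x = N *v ((v\<eta> *\<^sub>R Fm) *v (N *v x))" by (simp only: S_def flip: matrix_vector_mul_assoc)
    also have "(v\<eta> *\<^sub>R Fm) *v (N *v x) = v\<eta> *\<^sub>R (Fm *v (N *v x))" by (rule scaleR_matrix_vector_assoc[symmetric])
    also have "\<dots> = v\<eta> *\<^sub>R x" by (simp only: FN)
    finally show ?thesis by (simp add: matrix_vector_mult_scaleR)
  qed
  have Squad: "x \<bullet> (S *v x) = v\<eta> * ((N *v x) \<bullet> (Fm *v (N *v x)))" for x
    by (simp add: Sv FN inner_commute)
  have psd: "x \<bullet> (S *v x) \<ge> 0" for x unfolding Squad by (intro mult_nonneg_nonneg v\<eta>_nonneg Fm_psd)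
  have "x \<bullet> (S *v y) = (S *v x) \<bullet> y" for x y by (simp add: Sv Nsym)
  from ex_mvnormal_law[OF this psd] obtain \<nu> where \<nu>: "mvnormal_law 0 S \<nu>" by blast
  have \<nu>p: "prob_space \<nu>" "sets \<nu> = sets borel" using \<nu> by (auto simp: mvnormal_law_def)
  have vW: "v \<bullet> W n \<omega> = (- (N *v v)) \<bullet> Tn n \<omega>" for v n \<omega> by (simp add: W_def Nsym)
  have Wm[measurable]: "W n \<in> borel_measurable M" for n
    unfolding W_def by (intro borel_measurable_uminus
        borel_measurable_continuous_on[OF linear_continuous_on[OF matrix_vector_mul_bounded_linear] Tn_measurable])
  have ch: "(\<lambda>n. CLINT \<omega>|M. iexp (v \<bullet> W n \<omega>)) \<longlonglongrightarrow> (CLINT x|\<nu>. iexp (v \<bullet> x))" for v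
  proof -
    have "(- (N *v v)) \<bullet> (Fm *v (- (N *v v))) = (N *v v) \<bullet> (Fm *v (N *v v))"
      by (simp add: FN Fneg)
    then show ?thesis unfolding vW mvnormal_law_char[OF \<nu> psd] Squad using Tn_char[of "- (N *v v)"] by simp
  qed
  have tight: "uniformly_tight M W"
  proof (rule uniformly_tight_second_moment[OF prob_space_axioms Wm])
    fix n i
    have c: "W n \<omega> $ i = (- (N *v axis i 1)) \<bullet> Tn n \<omega>" for \<omega>
      using vW[of "axis i 1"] by (simp add: inner_axis')
    show "integrable M (\<lambda>\<omega>. (W n \<omega> $ i)\<^sup>2)" unfolding c by (rule Tn_second_moment(1))
    show "expectation (\<lambda>\<omega>. (W n \<omega> $ i)\<^sup>2) \<le> v\<eta> * ((- (N *v axis i 1)) \<bullet> (Fm *v (- (N *v axis i 1))))"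
      unfolding c by (rule Tn_second_moment(2))
  qed
  have law: "converges_in_law M W \<nu>" by (rule char_convergence_imp_law[OF prob_space_axioms Wm \<nu>p ch tight])
  obtain k where k: "k > 0" "\<And>x. norm (N *v x) \<le> norm x * k"
    using bounded_linear.pos_bounded[OF matrix_vector_mul_bounded_linear[of N]] by blast
  obtain k' where k': "k' > 0" "\<And>x. norm (Fm *v x) \<le> norm x * k'"
    using bounded_linear.pos_bounded[OF matrix_vector_mul_bounded_linear[of Fm]] by blast
  have "converges_in_law M (\<lambda>n \<omega>. sqrt (real n) *\<^sub>R (\<theta>hat n \<omega> - \<theta>0)) \<nu>"
  proof (rule converges_in_law_perturbation[OF prob_space_axioms Wm _ law tight])
    note meas[measurable]
    show "(\<lambda>\<omega>. sqrt (real n) *\<^sub>R (\<theta>hat n \<omega> - \<theta>0)) \<in> borel_measurable M" for n by measurable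
    show "AE \<omega> in M. \<forall>K>0. (\<lambda>n. if norm (W n \<omega>) \<le> K then norm (sqrt (real n) *\<^sub>R (\<theta>hat n \<omega> - \<theta>0) - W n \<omega>) else 0) \<longlonglongrightarrow> 0"
      using linearised_equation[OF q]
    proof eventually_elim
      case (elim \<omega>)
      show ?case
      proof (intro allI impI)
        fix K :: real
        let ?Z = "\<lambda>n. sqrt (real n) *\<^sub>R (\<theta>hat n \<omega> - \<theta>0)"
        let ?f = "\<lambda>n. if norm (Tn n \<omega>) \<le> K * k' then norm (Fm *v ?Z n + Tn n \<omega>) else 0"
        have "(\<lambda>n. ?f n * k) \<longlonglongrightarrow> 0" using elim[rule_format, of "K * k'"] by (rule tendsto_mult_left_zero)
        then show "(\<lambda>n. if norm (W n \<omega>) \<le> K then norm (?Z n - W n \<omega>) else 0) \<longlonglongrightarrow> 0"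
        proof (rule Lim_null_comparison[rotated], intro always_eventually allI)
          fix n
          have 1: "?Z n - W n \<omega> = N *v (Fm *v ?Z n + Tn n \<omega>)"
            unfolding W_def matrix_vector_right_distrib NF by simp
          \<comment> \<open>\<open>Tn\<close> is \<open>- Fm\<close> applied to \<open>W\<close>, so
            the event that \<open>W\<close> is bounded by \<open>K\<close> lies inside the event
            treated by \<open>linearised_equation\<close> with bound \<open>K * k'\<close>.\<close>
          have 2: "norm (Tn n \<omega>) \<le> K * k'" if "norm (W n \<omega>) \<le> K"
          proof -
            have "Tn n \<omega> = - (Fm *v W n \<omega>)" by (simp add: W_def FN Fneg)
            then have "norm (Tn n \<omega>) \<le> norm (W n \<omega>) * k'" using k'(2)[of "W n \<omega>"] by simp
            also have "\<dots> \<le> K * k'" using that k'(1) by (intro mult_right_mono) auto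
            finally show ?thesis .
          qed
          show "norm (if norm (W n \<omega>) \<le> K then norm (?Z n - W n \<omega>) else 0) \<le> ?f n * k"
            using k(2)[of "Fm *v ?Z n + Tn n \<omega>"] 2 k(1) unfolding 1 by auto
        qed
      qed
    qed
  qed
  then show ?thesis using \<nu> unfolding S_def N_def by blast
qed

end

theorem proposition5:
  fixes M :: "'a measure"
    and \<xi> X :: "int \<Rightarrow> 'a \<Rightarrow> real"
    and b0 :: "real ^ 'd::finite \<Rightarrow> real"
    and bp bm :: "nat \<Rightarrow> real ^ 'd \<Rightarrow> real"
    and \<Theta> :: "(real ^ 'd) set"
    and \<theta>0 :: "real ^ 'd"
    and u :: "nat \<Rightarrow> real"
    and \<theta>hat :: "nat \<Rightarrow> 'a \<Rightarrow> real ^ 'd"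
  assumes "prob_space M"
    and "iid_process M \<xi>"
    and "integrable M (\<lambda>\<omega>. (\<xi> 0 \<omega>)\<^sup>2)"
    and "prob_space.expectation M (\<lambda>\<omega>. (\<xi> 0 \<omega>)\<^sup>2) = 1"
    and "prob_space.variance M (\<xi> 0) = 1"
    and "\<And>\<theta>. b0 \<theta> \<ge> 0"
    and "\<And>j \<theta>. j \<ge> 1 \<Longrightarrow> bp j \<theta> \<ge> 0"
    and "\<And>j \<theta>. j \<ge> 1 \<Longrightarrow> bm j \<theta> \<ge> 0"
    and "continuous_on \<Theta> b0"
    and "\<And>j. j \<ge> 1 \<Longrightarrow> continuous_on \<Theta> (bp j)"
    and "\<And>j. j \<ge> 1 \<Longrightarrow> continuous_on \<Theta> (bm j)"
    and "compact \<Theta>"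
    and "\<Theta> \<subseteq> Theta_r M \<xi> bp bm 2"
    and "\<theta>0 \<in> \<Theta>"
    and "stationary_solution M \<xi> b0 bp bm \<theta>0 2 X"
    and "\<And>\<theta> t. \<theta> \<in> \<Theta> \<Longrightarrow>
           (AE \<omega> in M. H_proc b0 bp bm X t \<omega> \<theta> = H_proc b0 bp bm X t \<omega> \<theta>0) \<Longrightarrow> \<theta> = \<theta>0"
    and "(INF \<theta>\<in>\<Theta>. b0 \<theta>) > 0"
    and "\<exists>l>3/2. (\<lambda>j. SUP \<theta>\<in>\<Theta>. max (bm j \<theta>) (bp j \<theta>)) \<in> O(\<lambda>j. real j powr (- l))"
    and "finite {j. u j \<noteq> 0}"
    and "is_QMLE M b0 bp bm u X \<Theta> \<theta>hat"
  shows "(AE \<omega> in M. (\<lambda>n. \<theta>hat n \<omega>) \<longlonglongrightarrow> \<theta>0) \<and>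
    (\<forall>g0 h0 gp hp gm hm.
       \<theta>0 \<in> interior \<Theta> \<longrightarrow>
       integrable M (\<lambda>\<omega>. \<bar>\<xi> 0 \<omega>\<bar> powr 4) \<longrightarrow>
       interior \<Theta> \<subseteq> Theta_r M \<xi> bp bm 4 \<longrightarrow>
       stationary_solution M \<xi> b0 bp bm \<theta>0 4 X \<longrightarrow>
       C2_on \<Theta> b0 g0 h0 \<longrightarrow>
       (\<forall>j\<ge>1. C2_on \<Theta> (bp j) (gp j) (hp j)) \<longrightarrow>
       (\<forall>j\<ge>1. C2_on \<Theta> (bm j) (gm j) (hm j)) \<longrightarrow>
       (\<forall>k. \<exists>l'>3/2. (\<lambda>j. SUP \<theta>\<in>\<Theta>. max \<bar>gp j \<theta> $ k\<bar> \<bar>gm j \<theta> $ k\<bar>)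
                        \<in> O(\<lambda>j. real j powr (- l'))) \<longrightarrow>
       (\<forall>k k'. summable (\<lambda>j. SUP \<theta>\<in>\<Theta>. max \<bar>hp (Suc j) \<theta> $ k $ k'\<bar> \<bar>hm (Suc j) \<theta> $ k $ k'\<bar>)) \<longrightarrow>
       (\<forall>t. \<forall>c::real ^ 'd.
          (AE \<omega> in M. (\<Sum>i\<in>UNIV. c $ i * partial_deriv i (H_proc b0 bp bm X t \<omega>) \<theta>0) = 0) \<longrightarrow> c = 0) \<longrightarrow>
       (\<forall>n. \<theta>hat n \<in> borel_measurable M) \<longrightarrow>
       invertible (F_matrix M b0 bp bm X \<theta>0) \<and>
       (\<exists>\<nu>. mvnormal_law 0
              (matrix_inv (F_matrix M b0 bp bm X \<theta>0) ** G_matrix M b0 bp bm X \<theta>0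
                 ** matrix_inv (F_matrix M b0 bp bm X \<theta>0)) \<nu> \<and>
            converges_in_law M (\<lambda>n \<omega>. sqrt (real n) *\<^sub>R (\<theta>hat n \<omega> - \<theta>0)) \<nu>))"
proof -
  interpret tarch_setting M \<xi> X b0 bp bm \<Theta> \<theta>0 u
    by (rule tarch_setting.intro[OF assms(1) tarch_setting_axioms.intro]) (fact assms)+
  show ?thesis
  proof (intro conjI allI impI)
    show "AE \<omega> in M. (\<lambda>n. \<theta>hat n \<omega>) \<longlonglongrightarrow> \<theta>0"
      by (rule strong_consistency[OF assms(20)])
  next
    fix g0 h0 gp hp gm hm
    assume h: "\<theta>0 \<in> interior \<Theta>" "integrable M (\<lambda>\<omega>. \<bar>\<xi> 0 \<omega>\<bar> powr 4)"
      "stationary_solution M \<xi> b0 bp bm \<theta>0 4 X" "C2_on \<Theta> b0 g0 h0"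
      "\<forall>j\<ge>1. C2_on \<Theta> (bp j) (gp j) (hp j)" "\<forall>j\<ge>1. C2_on \<Theta> (bm j) (gm j) (hm j)"
      "\<forall>k. \<exists>l'>3/2. (\<lambda>j. SUP \<theta>\<in>\<Theta>. max \<bar>gp j \<theta> $ k\<bar> \<bar>gm j \<theta> $ k\<bar>) \<in> O(\<lambda>j. real j powr (- l'))"
      "\<forall>k k'. summable (\<lambda>j. SUP \<theta>\<in>\<Theta>. max \<bar>hp (Suc j) \<theta> $ k $ k'\<bar> \<bar>hm (Suc j) \<theta> $ k $ k'\<bar>)"
      "\<forall>t. \<forall>c. (AE \<omega> in M. (\<Sum>i\<in>UNIV. c $ i * partial_deriv i (H_proc b0 bp bm X t \<omega>) \<theta>0) = 0) \<longrightarrow> c = 0"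
      "\<forall>n. \<theta>hat n \<in> borel_measurable M"
    interpret tarch_normal M \<xi> X b0 bp bm \<Theta> \<theta>0 u g0 h0 gp gm hp hm
      by (rule tarch_normal.intro[OF tarch_setting_axioms tarch_normal_axioms.intro]) (fact h[rule_format])+
    show "invertible (F_matrix M b0 bp bm X \<theta>0)" unfolding F_matrix_eq by (rule Fm_invertible)
    show "\<exists>\<nu>. mvnormal_law 0
              (matrix_inv (F_matrix M b0 bp bm X \<theta>0) ** G_matrix M b0 bp bm X \<theta>0
                 ** matrix_inv (F_matrix M b0 bp bm X \<theta>0)) \<nu> \<and>
            converges_in_law M (\<lambda>n \<omega>. sqrt (real n) *\<^sub>R (\<theta>hat n \<omega> - \<theta>0)) \<nu>"
      unfolding F_matrix_eq G_matrix_eq by (rule asymptotic_normality[OF assms(20) h(10)[rule_format]])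
  qed
qed

end
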